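(* Assume $H$ is twice continuously differentiable in a neighborhood of $\beta^*$, with $\mathcal H=\nabla^2H(\beta^* )$. Suppose all buyers exhaust their budgets, i.e. $I_{=>}=\emptyset$, and let $\epsilon_t>0$ satisfy $\epsilon_t=o(1)$ and $\sqrt t\,\epsilon_t\to\infty$. (1) Let $$\beta^{\mathrm{boot}}_{\mathrm{nu}}=\operatorname*{argmin}_{\beta\in(0,1]^n}\ \frac1t\sum_{\tau=1}^t\big(1+\epsilon_t\sqrt t\,(W_\tau-1)\big)F(\theta^\tau,\beta).$$ Then the conditional distribution of $\epsilon_t^{-1}(\beta^{\mathrm{boot}}_{\mathrm{nu}}-\beta^\gamma)$ consistently estimates $\mathcal J_{\mathrm{FPPE}}$. (2) Let $$\beta^{\mathrm{boot}}_{\mathrm{pr}}=\operatorname*{argmin}_{\beta\in[0,1]^n}\ \epsilon_t\,(G^{\mathrm{boot}})^{\top}(\beta-\beta^\gamma)+\tfrac12\|\beta-\beta^\gamma\|_{\widehat{\mathcal H}}^2 .$$ If $\widehat{\mathcal H}\to\mathcal H$ in probability, then the conditional distribution of $\epsilon_t^{-1}(\beta^{\mathrm{boot}}_{\mathrm{pr}}-\beta^\gamma)$ consistently estimates $\mathcal J_{\mathrm{FPPE}}$.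
   Context: Setting. There are $n$ buyers with budgets $b_i>0$, a measurable item space $\Theta$ with integrating measure $d\theta$, nonnegative integrable valuations $v_i:\Theta\to[0,\infty)$ with $\max_i\sup_\theta v_i(\theta)<\infty$, and a bounded supply function $s\ge 0$ with $\int_\Theta s\,d\theta=1$. Write $\mathbb E[g]=\int g\,s\,d\theta$. Let $\theta^1,\theta^2,\dots$ be i.i.d. draws from the density $s$ and $P_tf=\frac1t\sum_{\tau=1}^tf(\theta^\tau)$. For $\beta\in(0,\infty)^n$ put $$F(\theta,\beta)=\max_{i}\beta_iv_i(\theta)-\sum_{i=1}^nb_i\log\beta_i,\quad H(\beta)=\mathbb E[F(\cdot,\beta)],\quad H_t(\beta)=P_tF(\cdot,\beta).$$ The limit FPPE (first-price pacing equilibrium) pacing multiplier is $\beta^*=\operatorname{argmin}_{(0,1]^n}H$ and the finite (observed) one is $\beta^\gamma=\operatorname{argmin}_{(0,1]^n}H_t$. Leftover budgets: $\delta^*=-\nabla H(\beta^* )$ (equivalently $\delta_i^*$ is $b_i$ minus buyer $i$'s equilibrium payment; $\delta_i^*\ge 0$). $I_{=>}=\{i:\beta_i^*=1,\delta_i^*>0\}$ and $I_{==}=\{i:\beta_i^*=1,\delta_i^*=0\}$. $\mathcal J_{\mathrm{FPPE}}$ denotes the limit distribution of $\sqrt t(\beta^\gamma-\beta^* )$, which is the law of $\operatorname{argmin}\{\|h+\mathcal H^{-1}G\|_{\mathcal H}^2: h_i=0\ (i\in I_{=>}),\ h_i\le0\ (i\in I_{==})\}$ with $G\sim\mathcal N(0,\operatorname{Cov}[\nabla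 F(\cdot,\beta^* )])$ and $\|a\|_A^2=a^{\top}Aa$; $\mathcal H$ is positive definite and $\nabla F(\theta,\beta^* )$ exists for almost every $\theta$. Bootstrap objects. $W=(W_1,\dots,W_t)$ is multinomial with $t$ trials and probabilities $(1/t,\dots,1/t)$, independent of the data; $P_t^{\mathrm{boot}}f=\frac1t\sum_\tau W_\tau f(\theta^\tau)$. $D_F(\theta,\beta)$ is a deterministic selection from the subdifferential $\partial_\beta F(\theta,\beta)$, and $G^{\mathrm{boot}}=\sqrt t\,(P_t^{\mathrm{boot}}-P_t)D_F(\cdot,\beta^\gamma)$. $\widehat{\mathcal H}$ is the numerical-difference Hessian estimate with entries $\widehat{\mathcal H}_{k\ell}=(\widehat\nabla^2_{k\ell,\eta_t}H_t)(\beta^\gamma)$ for a stepsize $\eta_t>0$, where $(\widehat\nabla^2_{k\ell,\eta}g)(\beta)=[g(\beta+\eta e_k+\eta e_\ell)-g(\beta-\eta e_k+\eta e_\ell)-g(\beta+\eta e_k-\eta e_\ell)+g(\beta-\eta e_k-\eta e_\ell)]/(4\eta^2)$ and $e_k$ are the unit vectors. Consistency: for random vectors $X_t\in\mathbb R^n$ that are functions of $(\theta^\tau)_{\tau\le t}$ and $W$, the conditional distribution of $X_t$ consistently estimates a law $L$ if $$\sup_{f\in\mathrm{BL}_1}\big|\mathbb E[f(X_t)\mid\theta^1,\dots,\theta^t]-\mathbb E_{X\sim L}[f(X)]\big|\to0\text{ in probability},$$ where $\mathrm{BL}_1$ is the set of $f:\mathbb R^n\to\mathbb R$ with $\sup|f|\le1$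 and $|f(x)-f(y)|\le\|x-y\|_2$. *)

theory Defs
  imports "HOL-Probability.Probability"
begin

section \<open>Calculus\<close>

definition grad :: "(real^'n \<Rightarrow> real) \<Rightarrow> real^'n \<Rightarrow> real^'n" where
  "grad f x = (THE D. GDERIV f x :> D)"

definition hessian :: "(real^'n \<Rightarrow> real) \<Rightarrow> real^'n \<Rightarrow> real^'n^'n" where
  "hessian f x = matrix (frechet_derivative (grad f) (at x))"

definition twice_cont_diff_on :: "(real^'n \<Rightarrow> real) \<Rightarrow> (real^'n) set \<Rightarrow> bool" where
  "twice_cont_diff_on f U \<longleftrightarrow>
     (\<forall>x\<in>U. f differentiable (at x)) \<and> (\<forall>x\<in>U. grad f differentiable (at x)) \<and>
     continuous_on U (hessian f)"

definition subdifferential_on ::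
    "(real^'n) set \<Rightarrow> (real^'n \<Rightarrow> real) \<Rightarrow> real^'n \<Rightarrow> (real^'n) set" where
  "subdifferential_on S f x = {g. \<forall>y\<in>S. f y \<ge> f x + g \<bullet> (y - x)}"

definition num_diff2 :: "real \<Rightarrow> (real^'n \<Rightarrow> real) \<Rightarrow> real^'n \<Rightarrow> real^'n^'n" where
  "num_diff2 \<eta> g \<beta> = (\<chi> k l.
     (g (\<beta> + \<eta> *\<^sub>R axis k 1 + \<eta> *\<^sub>R axis l 1)
      - g (\<beta> - \<eta> *\<^sub>R axis k 1 + \<eta> *\<^sub>R axis l 1)
      - g (\<beta> + \<eta> *\<^sub>R axis k 1 - \<eta> *\<^sub>R axis l 1)
      + g (\<beta> - \<eta> *\<^sub>R axis k 1 - \<eta> *\<^sub>R axis l 1)) / (4 * \<eta>\<^sup>2))"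

text \<open>The squared norm \<open>\<parallel>a\<parallel>\<^sub>A\<^sup>2\<close>.\<close>

definition sqnorm :: "real^'n^'n \<Rightarrow> real^'n \<Rightarrow> real" where
  "sqnorm A a = a \<bullet> (A *v a)"

section \<open>Probability\<close>

definition normal_law :: "real \<Rightarrow> real \<Rightarrow> real measure" where
  "normal_law m var =
     (if var = 0 then return borel m else density lborel (normal_density m (sqrt var)))"

text \<open>The covariance matrix may be singular, so normality is defined through the
  one-dimensional projections, which may be degenerate.\<close>

definition multivariate_normal :: "real^'n \<Rightarrow> real^'n^'n \<Rightarrow> (real^'n) measure \<Rightarrow> bool" where
  "multivariate_normal \<mu> S N \<longleftrightarrow>
     prob_space N \<and> sets N = sets borel \<and>
     (\<forall>c. distr N borel (\<lambda>x. c \<bullet> x) = normal_law (c \<bullet> \<mu>) (c \<bullet> (S *v c)))"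

text \<open>The numbers of occurrences of each category in \<open>m\<close> independent trials with law \<open>p\<close>.\<close>

definition multinomial_pmf :: "nat \<Rightarrow> 'c pmf \<Rightarrow> ('c \<Rightarrow> nat) pmf" where
  "multinomial_pmf m p =
     map_pmf (\<lambda>d c. card {j\<in>{..<m}. d j = c}) (Pi_pmf {..<m} undefined (\<lambda>_. p))"

definition boot_weights :: "nat \<Rightarrow> (nat \<Rightarrow> nat) pmf" where
  "boot_weights t = multinomial_pmf t (pmf_of_set {..<t})"

text \<open>The outer measure makes the notion meaningful without a separate measurability proof; on
  measurable events it is the usual convergence in probability.\<close>

definition tendsto_in_prob :: "'w measure \<Rightarrow> (nat \<Rightarrow> 'w \<Rightarrow> 'b::metric_space) \<Rightarrow> 'b \<Rightarrow> bool" where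
  "tendsto_in_prob M X c \<longleftrightarrow>
     (\<forall>e>0. (\<lambda>t. outer_measure_of M {\<omega>\<in>space M. dist (X t \<omega>) c > e}) \<longlonglongrightarrow> 0)"

definition regular_cond_distr ::
    "'w measure \<Rightarrow> 'w measure \<Rightarrow> ('w \<Rightarrow> real^'n) \<Rightarrow> ('w \<Rightarrow> (real^'n) measure) \<Rightarrow> bool" where
  "regular_cond_distr M F X K \<longleftrightarrow>
     subalgebra M F \<and> X \<in> borel_measurable M \<and> K \<in> measurable F (prob_algebra borel) \<and>
     (\<forall>A\<in>sets borel. AE \<omega> in M.
        measure (K \<omega>) A = real_cond_exp M F (\<lambda>\<omega>'. indicator A (X \<omega>')) \<omega>)"

definition BL1 :: "(real^'n \<Rightarrow> real) set" where
  "BL1 = {f. (\<forall>x. \<bar>f x\<bar> \<le> 1) \<and> (\<forall>x y. \<bar>f x - f y\<bar> \<le> norm (x - y))}"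

text \<open>A conditional expectation is determined only almost surely, for each \<open>f\<close> separately; the
  supremum over the uncountable class \<open>BL1\<close> therefore refers to a regular conditional distribution
  of \<open>X t\<close> given \<open>F t\<close>, which is almost surely unique.\<close>

definition consistently_estimates ::
    "'w measure \<Rightarrow> (nat \<Rightarrow> 'w measure) \<Rightarrow> (nat \<Rightarrow> 'w \<Rightarrow> real^'n) \<Rightarrow> (real^'n) measure \<Rightarrow> bool" where
  "consistently_estimates M F X L \<longleftrightarrow>
     (\<exists>K. (\<forall>t>0. regular_cond_distr M (F t) (X t) (K t)) \<and>
        tendsto_in_prob M
          (\<lambda>t \<omega>. SUP f\<in>BL1. \<bar>(\<integral>x. f x \<partial>K t \<omega>) - (\<integral>x. f x \<partial>L)\<bar>) 0)"

section \<open>The market\<close>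

definition pos_orthant :: "(real^'n) set" where
  "pos_orthant = {\<beta>. \<forall>i. 0 < \<beta> $ i}"

definition pacing_box :: "(real^'n) set" where
  "pacing_box = {\<beta>. \<forall>i. 0 < \<beta> $ i \<and> \<beta> $ i \<le> 1}"

definition closed_box :: "(real^'n) set" where
  "closed_box = {\<beta>. \<forall>i. 0 \<le> \<beta> $ i \<and> \<beta> $ i \<le> 1}"

definition F_obj :: "('n::finite \<Rightarrow> 'a \<Rightarrow> real) \<Rightarrow> real^'n \<Rightarrow> 'a \<Rightarrow> real^'n \<Rightarrow> real" where
  "F_obj v b x \<beta> = Max (range (\<lambda>i. \<beta> $ i * v i x)) - (\<Sum>i\<in>UNIV. b $ i * ln (\<beta> $ i))"

definition E_supply :: "'a measure \<Rightarrow> ('a \<Rightarrow> real) \<Rightarrow> ('a \<Rightarrow> real) \<Rightarrow> real" where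
  "E_supply \<Theta> s g = (\<integral>x. g x * s x \<partial>\<Theta>)"

definition H_obj ::
    "'a measure \<Rightarrow> ('a \<Rightarrow> real) \<Rightarrow> ('n::finite \<Rightarrow> 'a \<Rightarrow> real) \<Rightarrow> real^'n \<Rightarrow> real^'n \<Rightarrow> real" where
  "H_obj \<Theta> s v b \<beta> = E_supply \<Theta> s (\<lambda>x. F_obj v b x \<beta>)"

definition beta_star ::
    "'a measure \<Rightarrow> ('a \<Rightarrow> real) \<Rightarrow> ('n::finite \<Rightarrow> 'a \<Rightarrow> real) \<Rightarrow> real^'n \<Rightarrow> real^'n" where
  "beta_star \<Theta> s v b = arg_min_on (H_obj \<Theta> s v b) pacing_box"

definition leftover ::
    "'a measure \<Rightarrow> ('a \<Rightarrow> real) \<Rightarrow> ('n::finite \<Rightarrow> 'a \<Rightarrow> real) \<Rightarrow> real^'n \<Rightarrow> real^'n" where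
  "leftover \<Theta> s v b = - grad (H_obj \<Theta> s v b) (beta_star \<Theta> s v b)"

definition I_gt ::
    "'a measure \<Rightarrow> ('a \<Rightarrow> real) \<Rightarrow> ('n::finite \<Rightarrow> 'a \<Rightarrow> real) \<Rightarrow> real^'n \<Rightarrow> 'n set" where
  "I_gt \<Theta> s v b = {i. beta_star \<Theta> s v b $ i = 1 \<and> leftover \<Theta> s v b $ i > 0}"

definition I_eq ::
    "'a measure \<Rightarrow> ('a \<Rightarrow> real) \<Rightarrow> ('n::finite \<Rightarrow> 'a \<Rightarrow> real) \<Rightarrow> real^'n \<Rightarrow> 'n set" where
  "I_eq \<Theta> s v b = {i. beta_star \<Theta> s v b $ i = 1 \<and> leftover \<Theta> s v b $ i = 0}"

definition hess_star ::
    "'a measure \<Rightarrow> ('a \<Rightarrow> real) \<Rightarrow> ('n::finite \<Rightarrow> 'a \<Rightarrow> real) \<Rightarrow> real^'n \<Rightarrow> real^'n^'n" where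
  "hess_star \<Theta> s v b = hessian (H_obj \<Theta> s v b) (beta_star \<Theta> s v b)"

definition grad_cov ::
    "'a measure \<Rightarrow> ('a \<Rightarrow> real) \<Rightarrow> ('n::finite \<Rightarrow> 'a \<Rightarrow> real) \<Rightarrow> real^'n \<Rightarrow> real^'n^'n" where
  "grad_cov \<Theta> s v b =
     (let D = (\<lambda>x. grad (F_obj v b x) (beta_star \<Theta> s v b));
          m = (\<lambda>i. E_supply \<Theta> s (\<lambda>x. D x $ i))
      in \<chi> i j. E_supply \<Theta> s (\<lambda>x. (D x $ i - m i) * (D x $ j - m j)))"

definition limit_cone ::
    "'a measure \<Rightarrow> ('a \<Rightarrow> real) \<Rightarrow> ('n::finite \<Rightarrow> 'a \<Rightarrow> real) \<Rightarrow> real^'n \<Rightarrow> (real^'n) set" where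
  "limit_cone \<Theta> s v b =
     {h. (\<forall>i\<in>I_gt \<Theta> s v b. h $ i = 0) \<and> (\<forall>i\<in>I_eq \<Theta> s v b. h $ i \<le> 0)}"

text \<open>\<open>N\<close> is the law of the Gaussian vector \<open>G\<close>.\<close>

definition J_FPPE ::
    "'a measure \<Rightarrow> ('a \<Rightarrow> real) \<Rightarrow> ('n::finite \<Rightarrow> 'a \<Rightarrow> real) \<Rightarrow> real^'n
      \<Rightarrow> (real^'n) measure \<Rightarrow> (real^'n) measure" where
  "J_FPPE \<Theta> s v b N = distr N borel (\<lambda>g.
     arg_min_on (\<lambda>h. sqnorm (hess_star \<Theta> s v b) (h + matrix_inv (hess_star \<Theta> s v b) *v g))
       (limit_cone \<Theta> s v b))"

section \<open>Data and bootstrap\<close>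

text \<open>Observations are indexed from \<open>0\<close>: a sample \<open>x\<close> of size \<open>t\<close> and its weights \<open>w\<close> are used
  on \<open>{..<t}\<close> only.\<close>

definition emp :: "nat \<Rightarrow> (nat \<Rightarrow> 'a) \<Rightarrow> ('a \<Rightarrow> 'b::real_vector) \<Rightarrow> 'b" where
  "emp t x f = (1 / real t) *\<^sub>R (\<Sum>\<tau><t. f (x \<tau>))"

definition emp_boot :: "nat \<Rightarrow> (nat \<Rightarrow> 'a) \<Rightarrow> (nat \<Rightarrow> nat) \<Rightarrow> ('a \<Rightarrow> 'b::real_vector) \<Rightarrow> 'b" where
  "emp_boot t x w f = (1 / real t) *\<^sub>R (\<Sum>\<tau><t. real (w \<tau>) *\<^sub>R f (x \<tau>))"

definition Ht_obj ::
    "('n::finite \<Rightarrow> 'a \<Rightarrow> real) \<Rightarrow> real^'n \<Rightarrow> nat \<Rightarrow> (nat \<Rightarrow> 'a) \<Rightarrow> real^'n \<Rightarrow> real" where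
  "Ht_obj v b t x \<beta> = emp t x (\<lambda>y. F_obj v b y \<beta>)"

definition beta_gamma ::
    "('n::finite \<Rightarrow> 'a \<Rightarrow> real) \<Rightarrow> real^'n \<Rightarrow> nat \<Rightarrow> (nat \<Rightarrow> 'a) \<Rightarrow> real^'n" where
  "beta_gamma v b t x = arg_min_on (Ht_obj v b t x) pacing_box"

definition hess_hat ::
    "('n::finite \<Rightarrow> 'a \<Rightarrow> real) \<Rightarrow> real^'n \<Rightarrow> nat \<Rightarrow> real \<Rightarrow> (nat \<Rightarrow> 'a) \<Rightarrow> real^'n^'n" where
  "hess_hat v b t \<eta> x = num_diff2 \<eta> (Ht_obj v b t x) (beta_gamma v b t x)"

definition G_boot ::
    "('n::finite \<Rightarrow> 'a \<Rightarrow> real) \<Rightarrow> real^'n \<Rightarrow> ('a \<Rightarrow> real^'n \<Rightarrow> real^'n)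
      \<Rightarrow> nat \<Rightarrow> (nat \<Rightarrow> 'a) \<Rightarrow> (nat \<Rightarrow> nat) \<Rightarrow> real^'n" where
  "G_boot v b D t x w = sqrt (real t) *\<^sub>R
     (emp_boot t x w (\<lambda>y. D y (beta_gamma v b t x)) - emp t x (\<lambda>y. D y (beta_gamma v b t x)))"

definition nu_obj ::
    "('n::finite \<Rightarrow> 'a \<Rightarrow> real) \<Rightarrow> real^'n \<Rightarrow> real
      \<Rightarrow> nat \<Rightarrow> (nat \<Rightarrow> 'a) \<Rightarrow> (nat \<Rightarrow> nat) \<Rightarrow> real^'n \<Rightarrow> real" where
  "nu_obj v b \<epsilon> t x w \<beta> = (1 / real t) *
     (\<Sum>\<tau><t. (1 + \<epsilon> * sqrt (real t) * (real (w \<tau>) - 1)) * F_obj v b (x \<tau>) \<beta>)"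

definition pr_obj ::
    "('n::finite \<Rightarrow> 'a \<Rightarrow> real) \<Rightarrow> real^'n \<Rightarrow> ('a \<Rightarrow> real^'n \<Rightarrow> real^'n) \<Rightarrow> real \<Rightarrow> real
      \<Rightarrow> nat \<Rightarrow> (nat \<Rightarrow> 'a) \<Rightarrow> (nat \<Rightarrow> nat) \<Rightarrow> real^'n \<Rightarrow> real" where
  "pr_obj v b D \<eta> \<epsilon> t x w \<beta> =
     \<epsilon> * (G_boot v b D t x w \<bullet> (\<beta> - beta_gamma v b t x))
     + 1 / 2 * sqnorm (hess_hat v b t \<eta> x) (\<beta> - beta_gamma v b t x)"

text \<open>Some weights in \<open>nu_obj\<close> may be negative and the matrix in \<open>pr_obj\<close> may fail to be positive
  definite, so minimizers need not be unique: \<open>B\<close> is any measurable choice of a minimizer as a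
  function of the sample and of the weights.\<close>

definition argmin_selection ::
    "'a measure \<Rightarrow> (nat \<Rightarrow> (nat \<Rightarrow> 'a) \<Rightarrow> (nat \<Rightarrow> nat) \<Rightarrow> real^'n \<Rightarrow> real) \<Rightarrow> (real^'n) set
      \<Rightarrow> (nat \<Rightarrow> (nat \<Rightarrow> 'a) \<Rightarrow> (nat \<Rightarrow> nat) \<Rightarrow> real^'n) \<Rightarrow> bool" where
  "argmin_selection \<Theta> obj S B \<longleftrightarrow> (\<forall>t>0.
     case_prod (B t) \<in> borel_measurable (Pi\<^sub>M {..<t} (\<lambda>_. \<Theta>) \<Otimes>\<^sub>M count_space UNIV) \<and>
     (\<forall>x\<in>space (Pi\<^sub>M {..<t} (\<lambda>_. \<Theta>)). \<forall>w\<in>set_pmf (boot_weights t).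
        is_arg_min (obj t x w) (\<lambda>\<beta>. \<beta> \<in> S) (B t x w)))"

definition subgrad_selection ::
    "'a measure \<Rightarrow> ('n::finite \<Rightarrow> 'a \<Rightarrow> real) \<Rightarrow> real^'n \<Rightarrow> ('a \<Rightarrow> real^'n \<Rightarrow> real^'n) \<Rightarrow> bool" where
  "subgrad_selection \<Theta> v b D \<longleftrightarrow>
     (\<forall>x\<in>space \<Theta>. \<forall>\<beta>\<in>pos_orthant. D x \<beta> \<in> subdifferential_on pos_orthant (F_obj v b x) \<beta>)"

definition sample :: "(nat \<Rightarrow> 'w \<Rightarrow> 'a) \<Rightarrow> nat \<Rightarrow> 'w \<Rightarrow> nat \<Rightarrow> 'a" where
  "sample \<theta> t \<omega> = (\<lambda>\<tau>\<in>{..<t}. \<theta> \<tau> \<omega>)"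

definition data_algebra ::
    "'w measure \<Rightarrow> 'a measure \<Rightarrow> (nat \<Rightarrow> 'w \<Rightarrow> 'a) \<Rightarrow> nat \<Rightarrow> 'w measure" where
  "data_algebra M \<Theta> \<theta> t = vimage_algebra (space M) (sample \<theta> t) (Pi\<^sub>M {..<t} (\<lambda>_. \<Theta>))"

end

theory Submission
  imports Defs
begin

text \<open>Put \<open>\<beta> = \<beta>\<^sup>* + \<epsilon>\<^sub>t u\<close>. Since every buyer exhausts the budget,
  \<open>\<nabla>H(\<beta>\<^sup>*) = 0\<close>, so \<open>H\<close> grows like \<open>\<epsilon>\<^sub>t\<^sup>2 u\<^sup>T\<H>u / 2\<close> around \<open>\<beta>\<^sup>*\<close>. Over this range \<open>H\<^sub>t - H\<close> varies by
  \<open>O(\<epsilon>\<^sub>t t\<^sup>-\<^sup>1\<^sup>/\<^sup>2)\<close>, which is \<open>o(\<epsilon>\<^sub>t\<^sup>2)\<close> because \<open>\<epsilon>\<^sub>t\<close> shrinks more slowly than \<open>t\<^sup>-\<^sup>1\<^sup>/\<^sup>2\<close>: at this scale the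
  observed objective has the same quadratic shape, and \<open>\<beta>\<^sup>\<gamma> - \<beta>\<^sup>* = o(\<epsilon>\<^sub>t)\<close>. Resampling adds
  \<open>\<epsilon>\<^sub>t\<^sup>2 \<Gamma>\<^sup>T u\<close> up to \<open>o(\<epsilon>\<^sub>t\<^sup>2)\<close>, where \<open>\<Gamma>\<close> is the resampling fluctuation of the gradient of the highest
  paced bid at \<open>\<beta>\<^sup>*\<close>, and the box looks like the cone of the limit law. Hence both rescaled estimators
  are close to the minimizer \<open>sol \<Gamma>\<close> of \<open>\<Gamma>\<^sup>T u + u\<^sup>T\<H>u / 2\<close> over this cone. Given the data, \<open>\<Gamma>\<close> is nearly
  Gaussian with the covariance of the gradient, and \<open>sol\<close> is Lipschitz, so bounded Lipschitz test
  functions of \<open>sol \<Gamma>\<close> are, up to a factor, bounded Lipschitz test functions of \<open>\<Gamma>\<close>.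

  The randomness of the data is separated from that of the weights. Countably many properties, each
  failing with vanishing outer probability, describe a \<open>typical_sample\<close>, and \<open>tendsto_in_prob_by_sequences\<close> turns
  convergence in probability into a statement about deterministic sequences of typical samples. Along
  such a sequence only the multinomial weights are random. By independence the law of an estimator
  under the weights, with the data held fixed, is a regular conditional distribution
  (\<open>regular_cond_distr_of_independent\<close>).

  The objective of the numerical bootstrap is not convex, since its weights may be negative, so
  pointwise limits do not suffice. Uniform bounds come from \<open>chaining_maximal_inequality\<close>, fed with
  Hoeffding tails. The logarithmic barrier makes \<open>H\<^sub>t\<close> grow quadratically from its minimizer over the
  whole box; weighing this growth against the fluctuations on dyadic shells shows that the estimator is
  within \<open>O(\<epsilon>\<^sub>t)\<close> of \<open>\<beta>\<^sup>\<gamma>\<close> (\<open>nu_obj_localized\<close>). In that range the highest paced bid is exactly linear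
  in \<open>\<beta>\<close> except for items on which the two leading bids nearly tie. Ties are null because \<open>H\<close> is
  differentiable (\<open>AE_clear_win\<close>); so the linearization error has a small second moment, and
  interpolating this with the Hoeffding tail makes it uniformly small (\<open>fluct_linearized\<close>).

  The conditional central limit theorem is obtained for characteristic functions. Smoothing with a
  Gaussian kernel turns their pointwise convergence into convergence of densities in \<open>L\<^sup>1\<close>, which
  bounds all test functions at once (\<open>char_convergence_imp_uniform_BL\<close>).\<close>

section \<open>Convergence in outer probability\<close>

lemma outer_measure_of_Un_le:
  assumes "A \<subseteq> space M" "B \<subseteq> space M"
  shows "outer_measure_of M (A \<union> B) \<le> outer_measure_of M A + outer_measure_of M B"
proof -
  obtain E where E: "E \<in> sets M" "A \<subseteq> E" "outer_measure_of M A = emeasure M E"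
    using outer_measure_of_attain[OF assms(1)] by blast
  obtain D where D: "D \<in> sets M" "B \<subseteq> D" "outer_measure_of M B = emeasure M D"
    using outer_measure_of_attain[OF assms(2)] by blast
  have "outer_measure_of M (A \<union> B) \<le> outer_measure_of M (E \<union> D)"
    using E D by (intro outer_measure_of_mono) auto
  also have "\<dots> = emeasure M (E \<union> D)" using E D by simp
  also have "\<dots> \<le> emeasure M E + emeasure M D" using E D by (intro emeasure_subadditive)
  finally show ?thesis using E D by simp
qed

text \<open>Outer measure, because the events involve selections and suprema that need not be measurable.\<close>

definition outer_vanishing :: "'w measure \<Rightarrow> (nat \<Rightarrow> 'w \<Rightarrow> bool) \<Rightarrow> bool" where
  "outer_vanishing M Q \<longleftrightarrow> (\<lambda>t. outer_measure_of M {\<omega>\<in>space M. Q t \<omega>}) \<longlonglongrightarrow> 0"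

lemma outer_vanishing_mono:
  assumes "outer_vanishing M Q"
    and "eventually (\<lambda>t. \<forall>\<omega>\<in>space M. P t \<omega> \<longrightarrow> Q t \<omega>) sequentially"
  shows "outer_vanishing M P"
  unfolding outer_vanishing_def
proof (rule tendsto_sandwich[OF _ _ tendsto_const assms(1)[unfolded outer_vanishing_def]])
  show "\<forall>\<^sub>F t in sequentially. outer_measure_of M {\<omega>\<in>space M. P t \<omega>}
      \<le> outer_measure_of M {\<omega>\<in>space M. Q t \<omega>}"
    using assms(2) by eventually_elim (auto intro!: outer_measure_of_mono)
qed auto

lemma outer_vanishing_disj:
  assumes "outer_vanishing M P" "outer_vanishing M Q"
  shows "outer_vanishing M (\<lambda>t \<omega>. P t \<omega> \<or> Q t \<omega>)"
  unfolding outer_vanishing_def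
proof (rule tendsto_sandwich[of "\<lambda>_. 0"])
  show "(\<lambda>t. outer_measure_of M {\<omega>\<in>space M. P t \<omega>} + outer_measure_of M {\<omega>\<in>space M. Q t \<omega>}) \<longlonglongrightarrow> 0"
    using tendsto_add[OF assms[unfolded outer_vanishing_def]] by simp
  show "\<forall>\<^sub>F t in sequentially. outer_measure_of M {\<omega>\<in>space M. P t \<omega> \<or> Q t \<omega>}
     \<le> outer_measure_of M {\<omega>\<in>space M. P t \<omega>} + outer_measure_of M {\<omega>\<in>space M. Q t \<omega>}"
  proof (intro always_eventually allI)
    fix t
    have "{\<omega>\<in>space M. P t \<omega> \<or> Q t \<omega>} = {\<omega>\<in>space M. P t \<omega>} \<union> {\<omega>\<in>space M. Q t \<omega>}" by auto
    then show "outer_measure_of M {\<omega>\<in>space M. P t \<omega> \<or> Q t \<omega>}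
     \<le> outer_measure_of M {\<omega>\<in>space M. P t \<omega>} + outer_measure_of M {\<omega>\<in>space M. Q t \<omega>}"
      using outer_measure_of_Un_le[of "{\<omega>\<in>space M. P t \<omega>}" M "{\<omega>\<in>space M. Q t \<omega>}"] by auto
  qed
qed auto

lemma outer_vanishing_False: "outer_vanishing M (\<lambda>_ _. False)"
  by (simp add: outer_vanishing_def)

lemma outer_vanishing_bex:
  assumes "finite I" "\<And>i. i \<in> I \<Longrightarrow> outer_vanishing M (Q i)"
  shows "outer_vanishing M (\<lambda>t \<omega>. \<exists>i\<in>I. Q i t \<omega>)"
  using assms by (induction I rule: finite_induct)
    (auto simp: outer_vanishing_False intro: outer_vanishing_disj)

lemma outer_vanishing_prob_le:
  assumes M: "prob_space M" and g: "g \<longlonglongrightarrow> (0::real)"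
    and ev: "\<forall>\<^sub>F t in sequentially. \<exists>E\<in>sets M. (\<forall>\<omega>\<in>space M. Q t \<omega> \<longrightarrow> \<omega> \<in> E) \<and> measure M E \<le> g t"
  shows "outer_vanishing M Q"
  unfolding outer_vanishing_def
proof (rule tendsto_sandwich[of "\<lambda>_. 0"])
  interpret prob_space M by fact
  show "(\<lambda>t. ennreal (g t)) \<longlonglongrightarrow> 0" using tendsto_ennrealI[OF g] by simp
  show "\<forall>\<^sub>F t in sequentially. outer_measure_of M {\<omega>\<in>space M. Q t \<omega>} \<le> ennreal (g t)"
    using ev
  proof eventually_elim
    case (elim t)
    then obtain E where E: "E \<in> sets M" "\<forall>\<omega>\<in>space M. Q t \<omega> \<longrightarrow> \<omega> \<in> E" "measure M E \<le> g t" by blast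
    have "outer_measure_of M {\<omega>\<in>space M. Q t \<omega>} \<le> outer_measure_of M E"
      using E by (intro outer_measure_of_mono) auto
    also have "\<dots> = emeasure M E" using E by simp
    also have "\<dots> = ennreal (measure M E)" by (simp add: emeasure_eq_measure)
    also have "\<dots> \<le> ennreal (g t)" using E by (intro ennreal_leI)
    finally show ?case .
  qed
qed auto

lemma tendsto_in_prob_iff_outer_vanishing:
  "tendsto_in_prob M X c \<longleftrightarrow> (\<forall>e>0. outer_vanishing M (\<lambda>t \<omega>. dist (X t \<omega>) c > e))"
  by (simp add: tendsto_in_prob_def outer_vanishing_def)

text \<open>If convergence in outer probability fails, then at infinitely many times the bad event has outer
  measure bounded below, so it is not covered by the exceptional sets of the first \<open>k\<close> properties \<open>p\<close>.
  Choosing such times and such points \<open>\<omega> k\<close> diagonally gives a sequence along which every \<open>p m\<close>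
  eventually holds but \<open>Y\<close> stays away from the limit. All probabilistic information about the data thus
  enters through the properties \<open>p\<close>, and the rest of the argument is deterministic.\<close>

lemma tendsto_in_prob_by_sequences:
  fixes p :: "'i::countable \<Rightarrow> nat \<Rightarrow> 'w \<Rightarrow> bool" and Y :: "nat \<Rightarrow> 'w \<Rightarrow> 'b::metric_space"
  assumes p: "\<And>m. outer_vanishing M (\<lambda>t \<omega>. \<not> p m t \<omega>)"
    and det: "\<And>r \<omega>. strict_mono r \<Longrightarrow> (\<And>k. \<omega> k \<in> space M) \<Longrightarrow>
        (\<And>m. \<forall>\<^sub>F k in sequentially. p m (r k) (\<omega> k)) \<Longrightarrow> (\<lambda>k. Y (r k) (\<omega> k)) \<longlonglongrightarrow> c"
  shows "tendsto_in_prob M Y c"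
proof (rule ccontr)
  assume "\<not> tendsto_in_prob M Y c"
  then obtain e where e: "e > 0" and "\<not> (\<lambda>t. outer_measure_of M {\<omega>\<in>space M. dist (Y t \<omega>) c > e}) \<longlonglongrightarrow> 0"
    unfolding tendsto_in_prob_def by blast
  then obtain \<alpha> :: ennreal where \<alpha>: "\<alpha> > 0"
    and freq: "\<not> eventually (\<lambda>t. outer_measure_of M {\<omega>\<in>space M. dist (Y t \<omega>) c > e} < \<alpha>) sequentially"
    unfolding order_tendsto_iff by auto
  have "\<exists>t>T. \<exists>\<omega>\<in>space M. dist (Y t \<omega>) c > e \<and> (\<forall>m\<in>{..<N}. p (from_nat m) t \<omega>)" for N T
  proof -
    have "outer_vanishing M (\<lambda>t \<omega>. \<exists>m\<in>{..<N}. \<not> p (from_nat m) t \<omega>)"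
      by (rule outer_vanishing_bex) (use p in auto)
    then have "eventually (\<lambda>t. outer_measure_of M {\<omega>\<in>space M. \<exists>m\<in>{..<N}. \<not> p (from_nat m) t \<omega>} < \<alpha>) sequentially"
      unfolding outer_vanishing_def order_tendsto_iff using \<alpha> by auto
    note small = this
    obtain t where t: "\<not> outer_measure_of M {\<omega>\<in>space M. dist (Y t \<omega>) c > e} < \<alpha>"
        "outer_measure_of M {\<omega>\<in>space M. \<exists>m\<in>{..<N}. \<not> p (from_nat m) t \<omega>} < \<alpha>" "t > T"
    proof (rule ccontr)
      assume no: "\<not> thesis"
      have "eventually (\<lambda>t. outer_measure_of M {\<omega>\<in>space M. dist (Y t \<omega>) c > e} < \<alpha>) sequentially"
        using small eventually_gt_at_top[of T] by eventually_elim (use no that in blast)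
      with freq show False by blast
    qed
    have "\<not> {\<omega>\<in>space M. dist (Y t \<omega>) c > e} \<subseteq> {\<omega>\<in>space M. \<exists>m\<in>{..<N}. \<not> p (from_nat m) t \<omega>}"
      using t(1,2) outer_measure_of_mono by (metis (no_types, lifting) order.strict_trans1)
    then show ?thesis using t(3) by blast
  qed
  note step = this
  have "\<exists>r. \<forall>k. (\<exists>\<omega>\<in>space M. dist (Y (r k) \<omega>) c > e \<and> (\<forall>m\<in>{..<k}. p (from_nat m) (r k) \<omega>)) \<and> r k < r (Suc k)"
  proof (rule dependent_nat_choice)
    show "\<exists>t. \<exists>\<omega>\<in>space M. dist (Y t \<omega>) c > e \<and> (\<forall>m\<in>{..<0}. p (from_nat m) t \<omega>)"
      using step[of 0 0] by blast
    show "\<exists>t. (\<exists>\<omega>\<in>space M. dist (Y t \<omega>) c > e \<and> (\<forall>m\<in>{..<Suc k}. p (from_nat m) t \<omega>)) \<and> s < t" for s k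
      using step[of s "Suc k"] by blast
  qed
  then obtain r where r: "\<And>k. \<exists>\<omega>\<in>space M. dist (Y (r k) \<omega>) c > e \<and> (\<forall>m\<in>{..<k}. p (from_nat m) (r k) \<omega>)"
      and sm: "\<And>k. r k < r (Suc k)" by blast
  then obtain \<omega> where \<omega>: "\<And>k. \<omega> k \<in> space M" "\<And>k. dist (Y (r k) (\<omega> k)) c > e"
      "\<And>k m. m < k \<Longrightarrow> p (from_nat m) (r k) (\<omega> k)" by (metis lessThan_iff)
  have "(\<lambda>k. Y (r k) (\<omega> k)) \<longlonglongrightarrow> c"
  proof (rule det)
    show "strict_mono r" using sm by (simp add: strict_mono_Suc_iff)
    fix m :: 'i
    show "\<forall>\<^sub>F k in sequentially. p m (r k) (\<omega> k)"
      using eventually_gt_at_top[of "to_nat m"]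
      by eventually_elim (use \<omega>(3)[of "to_nat m"] in auto)
  qed (use \<omega> in auto)
  then have "eventually (\<lambda>k. dist (Y (r k) (\<omega> k)) c < e) sequentially" using e by (rule tendstoD)
  then show False using \<omega>(2) by (metis (no_types, lifting) eventually_sequentially le_refl less_asym)
qed

section \<open>A maximal inequality by chaining\<close>

text \<open>The cube is exhausted by dyadic grids, and \<open>Z\<close> is compared along the chain from a grid point to its
  ancestors on the coarser grids. A tail of order \<open>4 * n\<close> beats the number of grid points, which grows
  like the \<open>n\<close>-th power of the mesh, so that
  the union bounds over the levels are summable. The dependence on \<open>B\<close> is kept explicit, since a small \<open>B\<close> makes the
  whole process small.\<close>

lemma (in prob_space) chaining_maximal_inequality:
  fixes Z :: "real^'n \<Rightarrow> 'a \<Rightarrow> real" and a :: "real^'n" and R B \<kappa> :: real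
  defines "n \<equiv> CARD('n)"
  assumes R: "R > 0" and \<kappa>: "\<kappa> > 0"
    and meas[measurable]: "\<And>u. Z u \<in> borel_measurable M"
    and cont: "\<And>\<omega>. \<omega> \<in> space M \<Longrightarrow> continuous_on UNIV (\<lambda>u. Z u \<omega>)"
    and tail: "\<And>u u' l. \<lbrakk>\<And>i. \<bar>u $ i - a $ i\<bar> \<le> R; \<And>i. \<bar>u' $ i - a $ i\<bar> \<le> R; l > 0\<rbrakk> \<Longrightarrow>
         prob {\<omega>\<in>space M. \<bar>Z u \<omega> - Z u' \<omega>\<bar> > l * norm (u - u')} \<le> B / l ^ (4 * n)"
  obtains E where "E \<in> events" "prob E \<le> (3 * n) ^ (4 * n) * B / \<kappa> ^ (4 * n)"
    "\<And>\<omega> u. \<omega> \<in> space M - E \<Longrightarrow> (\<And>i. \<bar>u $ i - a $ i\<bar> \<le> R) \<Longrightarrow> \<bar>Z u \<omega> - Z a \<omega>\<bar> \<le> 4 * \<kappa> * R"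
proof -
  have n: "n \<ge> 1" by (simp add: n_def Suc_le_eq)
  define o' where "o' = (\<chi> i. a $ i - R)"
  define L where "L = 2 * R"
  have L: "L > 0" using R by (simp add: L_def)
  define G where "G k = {z :: 'n \<Rightarrow> nat. \<forall>i. z i \<in> {..<2^k}}" for k :: nat
  define pt where "pt k z = (\<chi> i. o' $ i + L / 2^k * real (z i))" for k :: nat and z :: "'n \<Rightarrow> nat"
  define hf where "hf z = (\<lambda>i. z i div 2)" for z :: "'n \<Rightarrow> nat"
  \<comment> \<open>the steps of the chain: at level \<open>k\<close> the mesh is proportional to \<open>2 ^ - Suc k\<close>, and an increment of
     \<open>(3/4) ^ Suc k\<close>, which is still summable, exceeds the mesh by the factor \<open>(3/2) ^ Suc k\<close>\<close>
  define lam where "lam k = \<kappa> * L * (3/4)^(Suc k) / 3" for k :: nat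
  have G_PiE: "G k = (\<Pi>\<^sub>E i\<in>UNIV. {..<2^k})" for k by (auto simp: G_def PiE_def Pi_def extensional_def)
  have fin: "finite (G k)" for k unfolding G_PiE by (intro finite_PiE) auto
  have card: "card (G k) = (2^k)^n" for k unfolding G_PiE n_def by (subst card_PiE) auto
  have hfG: "hf z \<in> G k" if "z \<in> G (Suc k)" for z k
    using that by (auto simp: G_def hf_def intro!: less_mult_imp_div_less simp: mult.commute)
  have in_cube: "\<bar>pt k z $ i - a $ i\<bar> \<le> R" if "z \<in> G k" for k z i
  proof -
    have "real (z i) \<le> 2^k" using that unfolding G_def 
      by (metis (mono_tags, lifting) lessThan_iff less_imp_le mem_Collect_eq of_nat_le_numeral_power_cancel_iff)
    then have "L * real (z i) \<le> L * 2^k" using L by (intro mult_left_mono) auto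
    then have "L / 2^k * real (z i) \<le> L" "0 \<le> L / 2^k * real (z i)" using L by (auto simp: field_simps)
    then show ?thesis unfolding pt_def o'_def L_def by auto
  qed
  have close: "norm (pt (Suc k) z - pt k (hf z)) \<le> L / 2^Suc k * n" for k z
  proof -
    have "norm (pt (Suc k) z - pt k (hf z)) \<le> (\<Sum>i\<in>UNIV. \<bar>(pt (Suc k) z - pt k (hf z)) $ i\<bar>)"
      by (rule norm_le_l1_cart)
    also have "\<dots> \<le> (\<Sum>i\<in>(UNIV::'n set). L / 2^Suc k)"
    proof (rule sum_mono)
      fix i
      have "real (z i) = 2 * real (z i div 2) + real (z i mod 2)"
        by (metis mult_div_mod_eq of_nat_add of_nat_mult of_nat_numeral)
      then have "(pt (Suc k) z - pt k (hf z)) $ i = L / 2^Suc k * real (z i mod 2)"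
        by (simp add: pt_def hf_def field_simps)
      also have "\<bar>\<dots>\<bar> \<le> L / 2^Suc k * 1" unfolding abs_mult using L by (intro mult_mono) auto
      finally show "\<bar>(pt (Suc k) z - pt k (hf z)) $ i\<bar> \<le> L / 2^Suc k" by simp
    qed
    also have "\<dots> = L / 2^Suc k * n" by (simp add: n_def)
    finally show ?thesis .
  qed
  define E where "E k = {\<omega>\<in>space M. \<exists>z\<in>G (Suc k). \<bar>Z (pt (Suc k) z) \<omega> - Z (pt k (hf z)) \<omega>\<bar> > lam k}" for k
  have E_meas[measurable]: "E k \<in> events" for k
  proof -
    have "E k = (\<Union>z\<in>G (Suc k). {\<omega>\<in>space M. \<bar>Z (pt (Suc k) z) \<omega> - Z (pt k (hf z)) \<omega>\<bar> > lam k})"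
      by (auto simp: E_def)
    also have "\<dots> \<in> events" using fin by (intro sets.finite_UN) auto
    finally show ?thesis .
  qed
  define D where "D = (3 * n) ^ (4 * n) * B / \<kappa> ^ (4 * n)"
  have B: "B \<ge> 0"
    using tail[of a a 1] R by (auto intro: order_trans[OF measure_nonneg])
  have D: "D \<ge> 0" using \<kappa> B by (simp add: D_def)
  have PE: "prob (E k) \<le> D * (1/2)^(Suc k)" for k
  proof -
    define l where "l = \<kappa> * (3/2)^Suc k / (3 * n)"
    have l: "l > 0" using \<kappa> n by (simp add: l_def)
    have "E k = (\<Union>z\<in>G (Suc k). {\<omega>\<in>space M. \<bar>Z (pt (Suc k) z) \<omega> - Z (pt k (hf z)) \<omega>\<bar> > lam k})"
      by (auto simp: E_def)
    also have "prob \<dots> \<le> (\<Sum>z\<in>G (Suc k). prob {\<omega>\<in>space M. \<bar>Z (pt (Suc k) z) \<omega> - Z (pt k (hf z)) \<omega>\<bar> > lam k})"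
      using fin by (intro finite_measure_subadditive_finite) auto
    also have "\<dots> \<le> (\<Sum>z\<in>G (Suc k). B / l ^ (4 * n))"
    proof (rule sum_mono)
      fix z assume z: "z \<in> G (Suc k)"
      have "l * norm (pt (Suc k) z - pt k (hf z)) \<le> l * (L / 2^Suc k * n)"
        using close l by (intro mult_left_mono) auto
      also have "\<dots> = lam k"
      proof -
        have "(3/2::real)^Suc k / 2^Suc k = (3/4)^Suc k" by (simp add: power_divide flip: power_mult_distrib)
        then show ?thesis using n by (simp add: l_def lam_def field_simps)
      qed
      finally have le: "l * norm (pt (Suc k) z - pt k (hf z)) \<le> lam k" .
      have "prob {\<omega>\<in>space M. \<bar>Z (pt (Suc k) z) \<omega> - Z (pt k (hf z)) \<omega>\<bar> > lam k}
        \<le> prob {\<omega>\<in>space M. \<bar>Z (pt (Suc k) z) \<omega> - Z (pt k (hf z)) \<omega>\<bar> > l * norm (pt (Suc k) z - pt k (hf z))}"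
        using le by (intro finite_measure_mono) auto
      also have "\<dots> \<le> B / l ^ (4 * n)"
        using in_cube[OF z] in_cube[OF hfG[OF z]] l by (intro tail)
      finally show "prob {\<omega>\<in>space M. \<bar>Z (pt (Suc k) z) \<omega> - Z (pt k (hf z)) \<omega>\<bar> > lam k} \<le> B / l ^ (4 * n)" .
    qed
    also have "\<dots> = (2^n)^Suc k * (B / l ^ (4 * n))"
      by (simp add: card power_mult[symmetric] mult.commute)
    also have "l ^ (4 * n) = \<kappa>^(4*n) / (3 * n) ^ (4*n) * ((81/16)^n)^Suc k"
    proof -
      have "((3/2::real)^Suc k)^(4*n) = (((3/2)^4)^n)^Suc k"
        by (simp only: power_mult[symmetric] mult.commute mult.left_commute)
      also have "(3/2::real)^4 = 81/16" by (simp add: power4_eq_xxxx)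
      finally have p: "((3/2::real)^Suc k)^(4*n) = ((81/16)^n)^Suc k" .
      have "l = \<kappa> / (3 * n) * (3/2)^Suc k" by (simp add: l_def)
      then have "l ^ (4 * n) = (\<kappa> / (3 * n)) ^ (4 * n) * ((3/2)^Suc k)^(4*n)"
        by (simp only: power_mult_distrib)
      then have "l ^ (4 * n) = (\<kappa> / (3 * n)) ^ (4 * n) * ((81/16)^n)^Suc k" unfolding p .
      then show ?thesis by (simp add: power_divide)
    qed
    \<comment> \<open>\<open>2 ^ n\<close> grid points per point of the previous level against \<open>(3/2) ^ (4 * n)\<close> from the tail: the ratio
       is \<open>(32/81) ^ n\<close>\<close>
    also have "(2^n)^Suc k * (B / (\<kappa>^(4*n) / (3 * n) ^ (4*n) * ((81/16)^n)^Suc k))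
       = (3 * n) ^ (4*n) * B / \<kappa>^(4*n) * ((32/81)^n)^Suc k"
    proof -
      have "(32/81::real) = 2 / (81/16)" by simp
      then have "((32/81::real)^n)^Suc k = (2^n)^Suc k / ((81/16)^n)^Suc k" by (simp only: power_divide)
      then show ?thesis by (simp only:) (simp add: field_simps)
    qed
    also have "\<dots> \<le> D * (1/2)^Suc k"
    proof (intro mult_mono)
      show "(3 * n) ^ (4*n) * B / \<kappa>^(4*n) \<le> D" by (simp add: D_def)
      have "(32/81::real)^n \<le> (1/2)^n" by (intro power_mono) auto
      also have "\<dots> \<le> (1/2)^1" using n by (intro power_decreasing) auto
      finally show "((32/81::real)^n)^Suc k \<le> (1/2)^Suc k" by (intro power_mono) auto
    qed (use D in auto)
    finally show ?thesis .
  qed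
  have geo: "(\<lambda>k. D * (1/2)^(Suc k)) sums D"
    using sums_mult[OF power_half_series, of D] by simp
  have summ: "summable (\<lambda>k. prob (E k))"
    by (rule summable_comparison_test'[OF sums_summable[OF geo], of 0]) (use PE in auto)
  show thesis
  proof (rule that[of "\<Union>k. E k"], goal_cases)
    case 1
    show ?case by auto
  next
    case 2
    have "prob (\<Union>k. E k) \<le> (\<Sum>k. prob (E k))"
      using summ by (intro finite_measure_subadditive_countably) auto
    also have "\<dots> \<le> (\<Sum>k. D * (1/2)^(Suc k))"
      using summ PE sums_summable[OF geo] by (intro suminf_le) auto
    also have "\<dots> = D" using geo by (simp add: sums_iff)
    finally show ?case by (simp add: D_def)
  next
    case (3 \<omega> u)
    note \<omega> = 3(1) and u = 3(2)
    have grid: "\<bar>Z (pt k z) \<omega> - Z o' \<omega>\<bar> \<le> (\<Sum>j<k. lam j)" if "z \<in> G k" for k z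
      using that
    proof (induction k arbitrary: z)
      case 0
      then have "pt 0 z = o'" by (auto simp: G_def pt_def vec_eq_iff)
      then show ?case by simp
    next
      case (Suc k)
      have "\<bar>Z (pt (Suc k) z) \<omega> - Z (pt k (hf z)) \<omega>\<bar> \<le> lam k"
        using \<omega> Suc.prems by (force simp: E_def)
      moreover have "\<bar>Z (pt k (hf z)) \<omega> - Z o' \<omega>\<bar> \<le> (\<Sum>j<k. lam j)" using Suc.IH hfG[OF Suc.prems] by blast
      ultimately show ?case by simp
    qed
    have lamsum: "(\<Sum>j<k. lam j) \<le> \<kappa> * L" for k
    proof -
      have "(\<Sum>j<k. (3/4::real)^Suc j) = 3 - 3 * (3/4)^k" by (induction k) (auto simp: field_simps)
      then have "(\<Sum>j<k. (3/4::real)^Suc j) \<le> 3" by simp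
      then have "\<kappa> * L / 3 * (\<Sum>j<k. (3/4::real)^Suc j) \<le> \<kappa> * L / 3 * 3" using \<kappa> L by (intro mult_left_mono) auto
      moreover have "(\<Sum>j<k. lam j) = \<kappa> * L / 3 * (\<Sum>j<k. (3/4::real)^Suc j)"
        unfolding lam_def sum_distrib_left by (intro sum.cong) (simp_all add: field_simps)
      ultimately show ?thesis by simp
    qed
    have main: "\<bar>Z u \<omega> - Z o' \<omega>\<bar> \<le> \<kappa> * L" if u: "\<And>i. \<bar>u $ i - a $ i\<bar> \<le> R" for u
    proof -
      define y where "y i = (u $ i - o' $ i) / L" for i
      have y: "0 \<le> y i" "y i \<le> 1" for i
        using u[of i] R by (auto simp: y_def o'_def L_def field_simps)
      define z where "z k i = min (2^k - 1) (nat \<lfloor>y i * 2^k\<rfloor>)" for k i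
      have zG: "z k \<in> G k" for k by (auto simp: z_def G_def min_less_iff_disj)
      have zb: "\<bar>real (z k i) - y i * 2^k\<bar> \<le> 1" for k i
      proof -
        have fl: "real (nat \<lfloor>y i * 2^k\<rfloor>) = of_int \<lfloor>y i * 2^k\<rfloor>" using y[of i] by simp
        have "y i * 2^k \<le> 1 * 2^k" using y[of i] by (intro mult_right_mono) auto
        moreover have "real (2^k - 1 :: nat) = 2^k - 1" by (simp add: of_nat_diff)
        moreover have "of_int \<lfloor>y i * 2^k\<rfloor> \<le> y i * 2^k" "y i * 2^k < of_int \<lfloor>y i * 2^k\<rfloor> + 1"
          by linarith+
        ultimately show ?thesis unfolding z_def of_nat_min fl by linarith
      qed
      have "(\<lambda>k. pt k (z k)) \<longlonglongrightarrow> u"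
      proof (rule vec_tendstoI)
        fix i
        have lim: "(\<lambda>k. L / 2^k) \<longlonglongrightarrow> 0"
          using tendsto_mult_right_zero[OF LIMSEQ_power_zero[of "1/2::real"], of L] by (simp add: power_divide)
        have "(\<lambda>k. pt k (z k) $ i - u $ i) \<longlonglongrightarrow> 0"
        proof (rule Lim_null_comparison[OF _ lim], intro always_eventually allI)
          fix k
          have "pt k (z k) $ i - u $ i = L / 2^k * (real (z k i) - y i * 2^k)"
            using L by (simp add: pt_def y_def field_simps)
          also have "\<bar>\<dots>\<bar> \<le> L / 2^k * 1" unfolding abs_mult using zb L by (intro mult_mono) auto
          finally show "norm (pt k (z k) $ i - u $ i) \<le> L / 2^k" by simp
        qed
        then show "(\<lambda>k. pt k (z k) $ i) \<longlonglongrightarrow> u $ i" by (simp add: LIM_zero_iff)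
      qed
      moreover have "isCont (\<lambda>u. Z u \<omega>) u"
        using cont[of \<omega>] \<omega> by (auto simp: continuous_on_eq_continuous_at)
      ultimately have "(\<lambda>k. Z (pt k (z k)) \<omega>) \<longlonglongrightarrow> Z u \<omega>" using isCont_tendsto_compose by fast
      then have "(\<lambda>k. \<bar>Z (pt k (z k)) \<omega> - Z o' \<omega>\<bar>) \<longlonglongrightarrow> \<bar>Z u \<omega> - Z o' \<omega>\<bar>"
        by (intro tendsto_intros)
      then show ?thesis
        by (rule tendsto_upperbound) (auto intro!: always_eventually order_trans[OF grid[OF zG] lamsum])
    qed
    have m: "\<bar>Z a \<omega> - Z o' \<omega>\<bar> \<le> \<kappa> * L" using main[of a] R by simp
    have "\<bar>Z u \<omega> - Z a \<omega>\<bar> \<le> \<kappa> * L + \<kappa> * L"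
      using main[OF u] m by linarith
    then show ?case unfolding L_def by argo
  qed
qed

section \<open>From characteristic functions to the bounded Lipschitz distance\<close>

definition gauss_kernel :: "real \<Rightarrow> real^'n \<Rightarrow> real" where
  "gauss_kernel a z = exp (- a * (norm z)\<^sup>2)"

lemma gauss_kernel_measurable[measurable]: "gauss_kernel a \<in> borel_measurable borel"
  unfolding gauss_kernel_def by measurable

lemma gauss_kernel_nonneg[simp]: "0 \<le> gauss_kernel a z"
  by (simp add: gauss_kernel_def)

lemma gauss_kernel_integrable[simp]:
  assumes a: "a > 0"
  shows "integrable lborel (gauss_kernel a :: real^'n \<Rightarrow> real)"
proof (rule integrableI_bounded)
  define \<sigma> where "\<sigma> = 1 / sqrt (2 * a)"
  have \<sigma>: "\<sigma> > 0" "2 * \<sigma>\<^sup>2 = 1 / a" using a by (auto simp: \<sigma>_def power_divide)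
  have one: "(\<integral>\<^sup>+x. ennreal (exp (- a * (x::real)\<^sup>2)) \<partial>lborel) < \<infinity>"
  proof -
    have "exp (- a * x\<^sup>2) = sqrt (2 * pi * \<sigma>\<^sup>2) * normal_density 0 \<sigma> x" for x
      using \<sigma> a by (simp add: normal_density_def field_simps)
    moreover have "integrable lborel (\<lambda>x. sqrt (2 * pi * \<sigma>\<^sup>2) * normal_density 0 \<sigma> x)"
      using \<sigma>(1) by simp
    ultimately have "integrable lborel (\<lambda>x::real. exp (- a * x\<^sup>2))" by presburger
    then show ?thesis by (simp add: integrable_iff_bounded)
  qed
  have "gauss_kernel a z = (\<Prod>b\<in>Basis. exp (- a * (z \<bullet> b)\<^sup>2))" for z :: "real^'n"
    unfolding gauss_kernel_def power2_norm_eq_inner euclidean_inner[of z z]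
    by (simp add: sum_distrib_left exp_sum power2_eq_square flip: sum_negf)
  then have "(\<integral>\<^sup>+z. ennreal (norm (gauss_kernel a (z::real^'n))) \<partial>lborel)
      = (\<integral>\<^sup>+z. (\<Prod>b\<in>Basis. ennreal (exp (- a * ((z::real^'n) \<bullet> b)\<^sup>2))) \<partial>lborel)"
    by (intro nn_integral_cong) (simp add: prod_ennreal prod_nonneg)
  also have "\<dots> = (\<Prod>b\<in>(Basis :: (real^'n) set). (\<integral>\<^sup>+x. ennreal (exp (- a * x\<^sup>2)) \<partial>lborel))"
    by (rule nn_integral_lborel_prod) auto
  also have "\<dots> < \<infinity>" using one by (simp add: power_less_top_ennreal)
  finally show "(\<integral>\<^sup>+z. ennreal (norm (gauss_kernel a (z::real^'n))) \<partial>lborel) < \<infinity>" .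
qed simp

lemma norm_gauss_kernel_integrable[simp]:
  assumes a: "a > 0"
  shows "integrable lborel (\<lambda>z::real^'n. norm z * gauss_kernel a z)"
proof (rule Bochner_Integration.integrable_bound)
  show "integrable lborel (\<lambda>z::real^'n. (1 / sqrt a + 1) * gauss_kernel (a/2) z)"
    using gauss_kernel_integrable[of "a/2"] a by simp
  show "AE z::real^'n in lborel. norm (norm z * gauss_kernel a z) \<le> norm ((1 / sqrt a + 1) * gauss_kernel (a / 2) z)"
  proof (intro AE_I2)
    fix z :: "real^'n"
    define r where "r = norm z"
    have "sqrt a * r \<le> 1 + (sqrt a * r)\<^sup>2 / 2" using zero_le_power2[of "sqrt a * r - 1"]
      by (simp add: power2_eq_square algebra_simps)
    also have "\<dots> \<le> exp ((sqrt a * r)\<^sup>2 / 2)" by (rule exp_ge_add_one_self)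
    also have "(sqrt a * r)\<^sup>2 / 2 = a / 2 * r\<^sup>2" using a by (simp add: power_mult_distrib)
    finally have "r \<le> 1 / sqrt a * exp (a / 2 * r\<^sup>2)" using a by (simp add: field_simps)
    also have "\<dots> \<le> (1 / sqrt a + 1) * exp (a / 2 * r\<^sup>2)" by (simp add: algebra_simps)
    finally have "r * exp (- a * r\<^sup>2) \<le> (1 / sqrt a + 1) * exp (a / 2 * r\<^sup>2) * exp (- a * r\<^sup>2)"
      by (intro mult_right_mono) auto
    also have "\<dots> = (1 / sqrt a + 1) * exp (- (a / 2) * r\<^sup>2)"
      by (simp add: mult.assoc flip: exp_add)
    finally show "norm (norm z * gauss_kernel a z) \<le> norm ((1 / sqrt a + 1) * gauss_kernel (a / 2) z)"
      using a by (simp add: gauss_kernel_def r_def abs_mult)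
  qed
qed simp

lemma lborel_translate:
  fixes h :: "real^'n \<Rightarrow> real"
  assumes [measurable]: "h \<in> borel_measurable borel"
  shows "(\<integral>y. h (y - x) \<partial>lborel) = (\<integral>y. h y \<partial>lborel)"
    and "(\<integral>\<^sup>+y. h (y - x) \<partial>lborel) = (\<integral>\<^sup>+y. h y \<partial>lborel)"
    and "integrable lborel h \<Longrightarrow> integrable lborel (\<lambda>y. h (y - x))"
proof -
  have "(\<integral>y. h (y - x) \<partial>lborel) = (\<integral>y. h (y - x) \<partial>distr lborel borel ((+) x))"
    by (simp add: lborel_distr_plus)
  also have "\<dots> = (\<integral>y. h y \<partial>lborel)" by (subst integral_distr) auto
  finally show "(\<integral>y. h (y - x) \<partial>lborel) = (\<integral>y. h y \<partial>lborel)" .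
  have "(\<integral>\<^sup>+y. h (y - x) \<partial>lborel) = (\<integral>\<^sup>+y. h (y - x) \<partial>distr lborel borel ((+) x))"
    by (simp add: lborel_distr_plus)
  also have "\<dots> = (\<integral>\<^sup>+y. h y \<partial>lborel)" by (subst nn_integral_distr) auto
  finally show "(\<integral>\<^sup>+y. h (y - x) \<partial>lborel) = (\<integral>\<^sup>+y. h y \<partial>lborel)" .
  assume "integrable lborel h"
  then have "integrable (distr lborel borel ((+) x)) (\<lambda>y. h (y - x))"
    by (subst integrable_distr_eq) auto
  then show "integrable lborel (\<lambda>y. h (y - x))" by (simp add: lborel_distr_plus)
qed

lemma gauss_kernel_mass_pos:
  assumes "a > 0" shows "(\<integral>z. gauss_kernel a (z::real^'n) \<partial>lborel) > 0"
proof -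
  have "(\<integral>z. gauss_kernel a (z::real^'n) \<partial>lborel) \<noteq> 0"
  proof
    assume "(\<integral>z. gauss_kernel a (z::real^'n) \<partial>lborel) = 0"
    then have "AE z::real^'n in lborel. gauss_kernel a z = 0"
      using assms by (subst (asm) integral_nonneg_eq_0_iff_AE) auto
    then have "AE z::real^'n in lborel. False"
      by eventually_elim (simp add: gauss_kernel_def)
    then have "UNIV \<in> null_sets (lborel :: (real^'n) measure)"
      by (subst AE_iff_null_sets) auto
    then show False by (simp add: null_sets_def)
  qed
  moreover have "(\<integral>z. gauss_kernel a (z::real^'n) \<partial>lborel) \<ge> 0" by (intro Bochner_Integration.integral_nonneg) simp
  ultimately show ?thesis by linarith
qed

text \<open>Scaling the argument by \<open>c\<close> multiplies the ratio of the two integrals by \<open>c\<close>.\<close>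

lemma gauss_kernel_concentrates:
  assumes e: "e > 0"
  obtains a where "a > 0" "(\<integral>z. norm z * gauss_kernel a (z::real^'n) \<partial>lborel)
    \<le> e * (\<integral>z. gauss_kernel a (z::real^'n) \<partial>lborel)"
proof -
  have sc: "(\<integral>z. h z \<partial>lborel) = c ^ CARD('n) * (\<integral>z. h (c *\<^sub>R z) \<partial>lborel)"
    if c: "c > 0" and [measurable]: "h \<in> borel_measurable borel" for c and h :: "real^'n \<Rightarrow> real"
  proof -
    have "(\<integral>z. h z \<partial>lborel) = (\<integral>z. h z \<partial>(density (distr lborel borel (\<lambda>x. 0 + c *\<^sub>R x)) (\<lambda>_. \<bar>c\<bar>^DIM(real^'n))))"
      using c by (subst lborel_affine[of c 0]) auto
    also have "\<dots> = (\<integral>z. \<bar>c\<bar>^DIM(real^'n) * h (c *\<^sub>R z) \<partial>lborel)"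
      using c by (subst integral_density, simp, simp, simp) (subst integral_distr, auto)
    finally show ?thesis using c by simp
  qed
  define V m where "V = (\<integral>z. gauss_kernel 1 (z::real^'n) \<partial>lborel)"
    and "m = (\<integral>z. norm z * gauss_kernel 1 (z::real^'n) \<partial>lborel)"
  have V: "V > 0" unfolding V_def by (rule gauss_kernel_mass_pos) simp
  have m: "m \<ge> 0" unfolding m_def by (intro Bochner_Integration.integral_nonneg) simp
  define c where "c = e * V / (m + 1)"
  have c: "c > 0" using V m e by (simp add: c_def)
  have gk: "gauss_kernel (1/c\<^sup>2) (c *\<^sub>R z) = gauss_kernel 1 z" for z :: "real^'n"
    using c by (simp add: gauss_kernel_def power_mult_distrib)
  have "(\<integral>z. norm z * gauss_kernel (1/c\<^sup>2) (z::real^'n) \<partial>lborel) = c ^ CARD('n) * (c * m)"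
    using c by (subst sc[OF c], simp) (simp add: gk m_def mult.assoc)
  also have "\<dots> \<le> c ^ CARD('n) * (e * V)"
  proof (intro mult_left_mono)
    have "c * m \<le> c * (m + 1)" using c by simp
    also have "\<dots> = e * V" using m by (simp add: c_def)
    finally show "c * m \<le> e * V" .
  qed (use c in auto)
  also have "\<dots> = e * (c ^ CARD('n) * V)" by simp
  also have "c ^ CARD('n) * V = (\<integral>z. gauss_kernel (1/c\<^sup>2) (z::real^'n) \<partial>lborel)"
    by (subst sc[OF c], simp) (simp add: gk V_def)
  finally show thesis using c by (intro that[of "1/c\<^sup>2"]) auto
qed

subsection \<open>The kernel as a characteristic function\<close>

definition std_gaussian :: "(real^'n) measure" where
  "std_gaussian = distr (\<Pi>\<^sub>M i\<in>(UNIV::'n set). std_normal_distribution) borel (\<lambda>f. \<chi> i. f i)"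

lemma std_gaussian_meas[measurable]:
  "(\<lambda>f. \<chi> i. f i) \<in> measurable (\<Pi>\<^sub>M i\<in>(UNIV::'n set). std_normal_distribution) (borel :: (real^'n) measure)"
unfolding borel_measurable_euclidean_space[where 'c="real^'n"]
  by (auto simp: Basis_vec_def inner_axis)

lemma prob_space_std_gaussian: "prob_space (std_gaussian :: (real^'n) measure)"
proof -
  interpret product_prob_space "\<lambda>_::'n. std_normal_distribution" UNIV
    by (intro product_prob_spaceI prob_space_normal_density) simp
  interpret P: prob_space "\<Pi>\<^sub>M i\<in>(UNIV::'n set). std_normal_distribution" by (rule prob_space_PiM) (simp add: prob_space_normal_density)
  show ?thesis unfolding std_gaussian_def by (rule P.prob_space_distr) measurable
qed

lemma char_std_gaussian:
  fixes s :: "real^'n"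
  shows "(\<integral>x. iexp (s \<bullet> x) \<partial>std_gaussian) = complex_of_real (exp (- (norm s)\<^sup>2 / 2))"
proof -
  interpret product_sigma_finite "\<lambda>_::'n. std_normal_distribution"
  proof -
    interpret product_prob_space "\<lambda>_::'n. std_normal_distribution" UNIV
      by (intro product_prob_spaceI prob_space_normal_density) simp
    show "product_sigma_finite (\<lambda>_::'n. std_normal_distribution)" ..
  qed
  have int: "integrable std_normal_distribution (\<lambda>x. iexp (c * x))" for c
  proof -
    interpret prob_space std_normal_distribution by (rule prob_space_normal_density) simp
    show ?thesis by (rule integrable_const_bound[where B=1]) auto
  qed
  have "(\<integral>x. iexp (s \<bullet> x) \<partial>std_gaussian)
      = (\<integral>f. iexp (s \<bullet> (\<chi> i. f i)) \<partial>(\<Pi>\<^sub>M i\<in>(UNIV::'n set). std_normal_distribution))"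
    unfolding std_gaussian_def by (subst integral_distr) auto
  also have "\<dots> = (\<integral>f. (\<Prod>i\<in>UNIV. iexp (s $ i * f i)) \<partial>(\<Pi>\<^sub>M i\<in>(UNIV::'n set). std_normal_distribution))"
    by (intro Bochner_Integration.integral_cong)
      (simp_all add: inner_vec_def sum_distrib_left exp_sum)
  also have "\<dots> = (\<Prod>i\<in>UNIV. \<integral>x. iexp (s $ i * x) \<partial>std_normal_distribution)"
    by (rule product_integral_prod) (use int in auto)
  also have "\<dots> = (\<Prod>i\<in>UNIV. complex_of_real (exp (- (s $ i)\<^sup>2 / 2)))"
    using char_std_normal_distribution by (simp add: char_def fun_eq_iff)
  also have "\<dots> = complex_of_real (exp (\<Sum>i\<in>UNIV. - (s $ i)\<^sup>2 / 2))"
    by (simp add: exp_sum)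
  also have "(\<Sum>i\<in>UNIV. - (s $ i)\<^sup>2 / 2) = - (norm s)\<^sup>2 / 2"
    by (simp add: norm_vec_def L2_set_def sum_nonneg sum_divide_distrib sum_negf)
  finally show ?thesis .
qed

subsection \<open>Smoothing a law\<close>

text \<open>Up to normalization, the density of the sum of a variable with law \<open>\<mu>\<close> and an independent Gaussian.\<close>

definition smoothed :: "real \<Rightarrow> (real^'n) measure \<Rightarrow> real^'n \<Rightarrow> real" where
  "smoothed a \<mu> y = (\<integral>x. gauss_kernel a (y - x) \<partial>\<mu>)"

context
  fixes \<mu> :: "(real^'n) measure"
  assumes \<mu>: "prob_space \<mu>" and sets_\<mu>[measurable_cong]: "sets \<mu> = sets borel"
begin

interpretation prob_space \<mu> by (rule \<mu>)
interpretation pair_sigma_finite \<mu> lborel ..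

text \<open>The kernel is itself a Gaussian characteristic function, so Fubini's theorem expresses the smoothed
  density through the characteristic function of \<open>\<mu>\<close>.\<close>

lemma smoothed_fourier:
  assumes a: "a > 0"
  shows "complex_of_real (smoothed a \<mu> y) =
    (\<integral>\<xi>. iexp (sqrt (2*a) * (y \<bullet> \<xi>)) * (\<integral>x. iexp ((- sqrt (2*a) *\<^sub>R \<xi>) \<bullet> x) \<partial>\<mu>) \<partial>std_gaussian)"
proof -
  interpret G: prob_space "std_gaussian :: (real^'n) measure" by (rule prob_space_std_gaussian)
  interpret PG: pair_prob_space \<mu> "std_gaussian :: (real^'n) measure" ..
  have [measurable_cong]: "sets (std_gaussian :: (real^'n) measure) = sets borel" by (simp add: std_gaussian_def)
  have gk: "complex_of_real (gauss_kernel a (y - x)) = (\<integral>\<xi>. iexp ((sqrt (2*a) *\<^sub>R (y - x)) \<bullet> \<xi>) \<partial>std_gaussian)" for x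
    using a unfolding char_std_gaussian by (simp add: gauss_kernel_def power_mult_distrib)
  have "complex_of_real (smoothed a \<mu> y) = (\<integral>x. complex_of_real (gauss_kernel a (y - x)) \<partial>\<mu>)"
    unfolding smoothed_def by simp
  also have "\<dots> = (\<integral>x. (\<integral>\<xi>. iexp ((sqrt (2*a) *\<^sub>R (y - x)) \<bullet> \<xi>) \<partial>std_gaussian) \<partial>\<mu>)"
    unfolding gk ..
  also have "\<dots> = (\<integral>\<xi>. (\<integral>x. iexp ((sqrt (2*a) *\<^sub>R (y - x)) \<bullet> \<xi>) \<partial>\<mu>) \<partial>std_gaussian)"
    by (rule PG.Fubini_integral[symmetric])
      (auto simp: case_prod_unfold intro!: PG.P.integrable_const_bound[where B=1])
  also have "\<dots> = (\<integral>\<xi>. (\<integral>x. iexp (sqrt (2*a) * (y \<bullet> \<xi>)) * iexp ((- sqrt (2*a) *\<^sub>R \<xi>) \<bullet> x) \<partial>\<mu>) \<partial>std_gaussian)"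
    by (intro Bochner_Integration.integral_cong refl)
       (simp add: inner_diff_left inner_commute algebra_simps flip: exp_add)
  also have "\<dots> = (\<integral>\<xi>. iexp (sqrt (2*a) * (y \<bullet> \<xi>)) * (\<integral>x. iexp ((- sqrt (2*a) *\<^sub>R \<xi>) \<bullet> x) \<partial>\<mu>) \<partial>std_gaussian)"
    by simp
  finally show ?thesis .
qed

lemma smoothed_measurable[measurable]: "smoothed a \<mu> \<in> borel_measurable borel"
  unfolding smoothed_def[abs_def] by measurable

lemma smoothed_nonneg: "smoothed a \<mu> y \<ge> 0"
  unfolding smoothed_def by (intro Bochner_Integration.integral_nonneg) simp

lemma gauss_kernel_pair_integrable:
  assumes a: "a > 0"
  shows "integrable (\<mu> \<Otimes>\<^sub>M lborel) (\<lambda>(x, y). gauss_kernel a (y - x))"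
proof (rule integrableI_bounded)
  have "(\<integral>\<^sup>+z. ennreal (norm (case z of (x, y) \<Rightarrow> gauss_kernel a (y - x))) \<partial>(\<mu> \<Otimes>\<^sub>M lborel))
     = (\<integral>\<^sup>+x. (\<integral>\<^sup>+y. ennreal (gauss_kernel a (y - x)) \<partial>lborel) \<partial>\<mu>)"
    by (subst lborel.nn_integral_fst[symmetric]) auto
  also have "\<dots> = (\<integral>\<^sup>+y. gauss_kernel a (y::real^'n) \<partial>lborel)"
    by (subst lborel_translate(2)) (auto simp: emeasure_space_1)
  also have "\<dots> < \<infinity>" using gauss_kernel_integrable[OF a, where 'n='n] by (simp add: integrable_iff_bounded)
  finally show "(\<integral>\<^sup>+z. ennreal (norm (case z of (x, y) \<Rightarrow> gauss_kernel a (y - x))) \<partial>(\<mu> \<Otimes>\<^sub>M lborel)) < \<infinity>" .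
qed measurable

lemma nn_integral_smoothed:
  assumes a: "a > 0"
  shows "(\<integral>\<^sup>+y. smoothed a \<mu> y \<partial>lborel) = ennreal (\<integral>z. gauss_kernel a (z::real^'n) \<partial>lborel)"
    and "integrable lborel (smoothed a \<mu>)"
proof -
  have "integral\<^sup>L lborel (smoothed a \<mu>) = (\<integral>x. (\<integral>y. gauss_kernel a (y - x) \<partial>lborel) \<partial>\<mu>)"
    unfolding smoothed_def[abs_def] by (rule Fubini_integral[OF gauss_kernel_pair_integrable[OF a]])
  also have "\<dots> = (\<integral>z. gauss_kernel a (z::real^'n) \<partial>lborel)"
    by (subst lborel_translate(1)) (auto simp: prob_space)
  finally have eq: "integral\<^sup>L lborel (smoothed a \<mu>) = (\<integral>z. gauss_kernel a (z::real^'n) \<partial>lborel)" .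
  show int: "integrable lborel (smoothed a \<mu>)"
    using integrable_snd[OF gauss_kernel_pair_integrable[OF a]] by (simp add: smoothed_def[abs_def])
  show "(\<integral>\<^sup>+y. smoothed a \<mu> y \<partial>lborel) = ennreal (\<integral>z. gauss_kernel a (z::real^'n) \<partial>lborel)"
    unfolding eq[symmetric] by (rule nn_integral_eq_integral[OF int]) (simp add: smoothed_nonneg)
qed

lemma smoothing_error:
  assumes a: "a > 0" and f: "f \<in> BL1"
  shows "\<bar>(\<integral>z. gauss_kernel a (z::real^'n) \<partial>lborel) * (\<integral>x. f x \<partial>\<mu>) - (\<integral>y. f y * smoothed a \<mu> y \<partial>lborel)\<bar>
    \<le> (\<integral>z. norm z * gauss_kernel a (z::real^'n) \<partial>lborel)"
proof -
  have fb: "\<bar>f x\<bar> \<le> 1" and fl: "\<bar>f x - f y\<bar> \<le> norm (x - y)" for x y using f by (auto simp: BL1_def)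
  have "1-lipschitz_on UNIV f" by (rule lipschitz_onI) (auto simp: dist_norm fl)
  then have "continuous_on UNIV f" by (rule lipschitz_on_continuous_on)
  then have fm[measurable]: "f \<in> borel_measurable borel" by (rule borel_measurable_continuous_onI)
  note gi = gauss_kernel_pair_integrable[OF a]
  have i1: "integrable (\<mu> \<Otimes>\<^sub>M lborel) (\<lambda>(x, y). f x * gauss_kernel a (y - x))"
    by (rule Bochner_Integration.integrable_bound[OF gi]) (auto simp: abs_mult split_beta intro!: AE_I2 mult_left_le_one_le fb)
  have i2: "integrable (\<mu> \<Otimes>\<^sub>M lborel) (\<lambda>(x, y). f y * gauss_kernel a (y - x))"
    by (rule Bochner_Integration.integrable_bound[OF gi]) (auto simp: abs_mult split_beta intro!: AE_I2 mult_left_le_one_le fb)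
  have "(\<integral>y. f y * smoothed a \<mu> y \<partial>lborel) = (\<integral>y. (\<integral>x. f y * gauss_kernel a (y - x) \<partial>\<mu>) \<partial>lborel)"
    by (simp add: smoothed_def)
  also have "\<dots> = (\<integral>x. (\<integral>y. f y * gauss_kernel a (y - x) \<partial>lborel) \<partial>\<mu>)"
    by (rule Fubini_integral[OF i2])
  finally have e2: "(\<integral>y. f y * smoothed a \<mu> y \<partial>lborel) = (\<integral>x. (\<integral>y. f y * gauss_kernel a (y - x) \<partial>lborel) \<partial>\<mu>)" .
  have e1: "(\<integral>z. gauss_kernel a (z::real^'n) \<partial>lborel) * (\<integral>x. f x \<partial>\<mu>) = (\<integral>x. (\<integral>y. f x * gauss_kernel a (y - x) \<partial>lborel) \<partial>\<mu>)"
    by (simp add: lborel_translate(1))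
  have j1: "integrable lborel (\<lambda>y. f x * gauss_kernel a (y - x))" for x
    using lborel_translate(3)[of "gauss_kernel a" x] a by simp
  have j2: "integrable lborel (\<lambda>y. f y * gauss_kernel a (y - x))" for x
    by (rule Bochner_Integration.integrable_bound[OF lborel_translate(3)[of "gauss_kernel a" x]])
       (use a in \<open>auto simp: abs_mult intro!: mult_left_le_one_le fb\<close>)
  have "(\<integral>z. gauss_kernel a (z::real^'n) \<partial>lborel) * (\<integral>x. f x \<partial>\<mu>) - (\<integral>y. f y * smoothed a \<mu> y \<partial>lborel)
    = (\<integral>x. (\<integral>y. f x * gauss_kernel a (y - x) \<partial>lborel) - (\<integral>y. f y * gauss_kernel a (y - x) \<partial>lborel) \<partial>\<mu>)"
    unfolding e1 e2 using integrable_fst[OF i1] integrable_fst[OF i2]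
    by (subst Bochner_Integration.integral_diff) auto
  also have "\<dots> = (\<integral>x. (\<integral>y. (f x - f y) * gauss_kernel a (y - x) \<partial>lborel) \<partial>\<mu>)"
    using j1 j2 by (subst Bochner_Integration.integral_diff[symmetric]) (auto simp: algebra_simps)
  also have "\<bar>\<dots>\<bar> \<le> (\<integral>x. (\<integral>z. norm z * gauss_kernel a (z::real^'n) \<partial>lborel) \<partial>\<mu>)"
  proof (rule integral_abs_bound_integral)
    fix x
    have "\<bar>\<integral>y. (f x - f y) * gauss_kernel a (y - x) \<partial>lborel\<bar> \<le> (\<integral>y. norm (y - x) * gauss_kernel a (y - x) \<partial>lborel)"
    proof (rule integral_abs_bound_integral)
      show "integrable lborel (\<lambda>y. (f x - f y) * gauss_kernel a (y - x))"
        using Bochner_Integration.integrable_diff[OF j1 j2, of x x] by (simp add: left_diff_distrib)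
      show "integrable lborel (\<lambda>y. norm (y - x) * gauss_kernel a (y - x))"
        using lborel_translate(3)[of "\<lambda>z. norm z * gauss_kernel a z" x] a by simp
      fix y show "\<bar>(f x - f y) * gauss_kernel a (y - x)\<bar> \<le> norm (y - x) * gauss_kernel a (y - x)"
        using fl[of x y] by (auto simp: abs_mult norm_minus_commute intro!: mult_right_mono)
    qed
    then show "\<bar>\<integral>y. (f x - f y) * gauss_kernel a (y - x) \<partial>lborel\<bar> \<le> (\<integral>z. norm z * gauss_kernel a (z::real^'n) \<partial>lborel)"
      by (subst (asm) lborel_translate(1)[of "\<lambda>z. norm z * gauss_kernel a z"]) auto
  next
    have "integrable (\<mu> \<Otimes>\<^sub>M lborel) (\<lambda>(x, y). (f x - f y) * gauss_kernel a (y - x))"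
      using Bochner_Integration.integrable_diff[OF i1 i2] by (simp add: case_prod_unfold left_diff_distrib)
    then show "integrable \<mu> (\<lambda>x. \<integral>y. (f x - f y) * gauss_kernel a (y - x) \<partial>lborel)"
      by (rule integrable_fst)
  qed simp
  also have "\<dots> = (\<integral>z. norm z * gauss_kernel a (z::real^'n) \<partial>lborel)" by (simp add: prob_space)
  finally show ?thesis .
qed

end

text \<open>The smoothed densities converge pointwise, as averages of characteristic functions, and they have the
  same mass; by Scheffe's lemma they converge in \<open>L\<^sup>1\<close>. This controls all bounded test functions
  simultaneously, and the smoothing itself moves a Lipschitz function by at most the first absolute
  moment of the kernel.\<close>

theorem char_convergence_imp_uniform_BL:
  fixes \<mu> :: "nat \<Rightarrow> (real^'n) measure" and L :: "(real^'n) measure"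
  assumes \<mu>: "\<And>k. prob_space (\<mu> k)" "\<And>k. sets (\<mu> k) = sets borel"
    and L: "prob_space L" "sets L = sets borel"
    and char: "\<And>c. (\<lambda>k. \<integral>x. iexp (c \<bullet> x) \<partial>\<mu> k) \<longlonglongrightarrow> (\<integral>x. iexp (c \<bullet> x) \<partial>L)"
    and e: "e > 0"
  shows "\<forall>\<^sub>F k in sequentially. \<forall>f\<in>BL1. \<bar>(\<integral>x. f x \<partial>\<mu> k) - (\<integral>x. f x \<partial>L)\<bar> \<le> e"
proof -
  obtain a where a: "a > 0" and conc: "(\<integral>z. norm z * gauss_kernel a (z::real^'n) \<partial>lborel)
    \<le> e / 4 * (\<integral>z. gauss_kernel a (z::real^'n) \<partial>lborel)"
    using gauss_kernel_concentrates[of "e/4"] e by auto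
  define V where "V = (\<integral>z. gauss_kernel a (z::real^'n) \<partial>lborel)"
  have V: "V > 0" unfolding V_def by (rule gauss_kernel_mass_pos[OF a])
  note [measurable] = smoothed_measurable[OF \<mu>(1) \<mu>(2)] smoothed_measurable[OF L]
  have ptw: "(\<lambda>k. smoothed a (\<mu> k) y) \<longlonglongrightarrow> smoothed a L y" for y
  proof -
    interpret G: prob_space "std_gaussian :: (real^'n) measure" by (rule prob_space_std_gaussian)
    have [measurable_cong]: "sets (std_gaussian :: (real^'n) measure) = sets borel" by (simp add: std_gaussian_def)
    have charm: "(\<lambda>\<xi>. \<integral>x. iexp ((- sqrt (2*a) *\<^sub>R \<xi>) \<bullet> x) \<partial>\<nu>) \<in> borel_measurable borel"
      if "prob_space \<nu>" and [measurable_cong]: "sets \<nu> = sets borel" for \<nu> :: "(real^'n) measure"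
    proof -
      interpret prob_space \<nu> by fact
      show ?thesis by measurable
    qed
    note [measurable] = charm[OF \<mu>(1) \<mu>(2)] charm[OF L]
    have "(\<lambda>k. complex_of_real (smoothed a (\<mu> k) y)) \<longlonglongrightarrow> complex_of_real (smoothed a L y)"
      unfolding smoothed_fourier[OF \<mu>(1) \<mu>(2) a] smoothed_fourier[OF L a]
    proof (rule integral_dominated_convergence[where w="\<lambda>_. 1"])
      show "AE \<xi> in std_gaussian. (\<lambda>k. iexp (sqrt (2*a) * (y \<bullet> \<xi>)) * (\<integral>x. iexp ((- sqrt (2*a) *\<^sub>R \<xi>) \<bullet> x) \<partial>\<mu> k))
          \<longlonglongrightarrow> iexp (sqrt (2*a) * (y \<bullet> \<xi>)) * (\<integral>x. iexp ((- sqrt (2*a) *\<^sub>R \<xi>) \<bullet> x) \<partial>L)"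
        by (intro AE_I2 tendsto_mult tendsto_const char)
      show "AE \<xi> in std_gaussian. norm (iexp (sqrt (2*a) * (y \<bullet> \<xi>)) * (\<integral>x. iexp ((- sqrt (2*a) *\<^sub>R \<xi>) \<bullet> x) \<partial>\<mu> k)) \<le> 1" for k
      proof (intro AE_I2)
        fix \<xi>
        interpret prob_space "\<mu> k" by fact
        have "norm (\<integral>x. iexp ((- sqrt (2*a) *\<^sub>R \<xi>) \<bullet> x) \<partial>\<mu> k) \<le> (\<integral>x. norm (iexp ((- sqrt (2*a) *\<^sub>R \<xi>) \<bullet> x)) \<partial>\<mu> k)"
          by (rule integral_norm_bound)
        also have "\<dots> = 1" by (simp add: prob_space)
        finally show "norm (iexp (sqrt (2*a) * (y \<bullet> \<xi>)) * (\<integral>x. iexp ((- sqrt (2*a) *\<^sub>R \<xi>) \<bullet> x) \<partial>\<mu> k)) \<le> 1"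
          by (simp add: norm_mult)
      qed
      show "(\<lambda>\<xi>. iexp (sqrt (2*a) * (y \<bullet> \<xi>)) * (\<integral>x. iexp ((- sqrt (2*a) *\<^sub>R \<xi>) \<bullet> x) \<partial>L)) \<in> borel_measurable std_gaussian"
        by measurable
      show "(\<lambda>\<xi>. iexp (sqrt (2*a) * (y \<bullet> \<xi>)) * (\<integral>x. iexp ((- sqrt (2*a) *\<^sub>R \<xi>) \<bullet> x) \<partial>\<mu> k)) \<in> borel_measurable std_gaussian" for k
        by measurable
    qed simp
    then show ?thesis by (simp only: tendsto_of_real_iff)
  qed
  have "(\<lambda>k. \<integral>\<^sup>+y. norm (smoothed a (\<mu> k) y - smoothed a L y) \<partial>lborel) \<longlonglongrightarrow> 0"
  proof (rule Scheffe_lemma2)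
    show "integrable lborel (smoothed a L)" by (rule nn_integral_smoothed[OF L a])
    show "(\<integral>\<^sup>+y. norm (smoothed a (\<mu> k) y) \<partial>lborel) \<le> (\<integral>\<^sup>+y. norm (smoothed a L y) \<partial>lborel)" for k
      using nn_integral_smoothed(1)[OF \<mu>(1) \<mu>(2) a, of k] nn_integral_smoothed(1)[OF L a]
      by (simp add: smoothed_nonneg[OF \<mu>(1) \<mu>(2)] smoothed_nonneg[OF L])
  qed (auto simp: ptw)
  moreover have "ennreal (V * e / 2) > 0" using V e by simp
  ultimately have "\<forall>\<^sub>F k in sequentially. (\<integral>\<^sup>+y. norm (smoothed a (\<mu> k) y - smoothed a L y) \<partial>lborel) < ennreal (V * e / 2)"
    unfolding order_tendsto_iff by auto
  then show ?thesis
  proof eventually_elim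
    case (elim k)
    note ik = nn_integral_smoothed(2)[OF \<mu>(1)[of k] \<mu>(2) a] and iL = nn_integral_smoothed(2)[OF L a]
    have d: "(\<integral>y. \<bar>smoothed a (\<mu> k) y - smoothed a L y\<bar> \<partial>lborel) \<le> V * e / 2"
    proof -
      have "ennreal (\<integral>y. \<bar>smoothed a (\<mu> k) y - smoothed a L y\<bar> \<partial>lborel) \<le> ennreal (V * e / 2)"
        using elim ik iL by (subst nn_integral_eq_integral[symmetric]) auto
      then show ?thesis using V e by (simp add: ennreal_le_iff)
    qed
    show ?case
    proof
      fix f :: "real^'n \<Rightarrow> real" assume f: "f \<in> BL1"
      have fb: "\<bar>f x\<bar> \<le> 1" and fl: "\<bar>f x - f y\<bar> \<le> norm (x - y)" for x y using f by (auto simp: BL1_def)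
      have "1-lipschitz_on UNIV f" by (rule lipschitz_onI) (auto simp: dist_norm fl)
      then have "continuous_on UNIV f" by (rule lipschitz_on_continuous_on)
      then have fm[measurable]: "f \<in> borel_measurable borel" by (rule borel_measurable_continuous_onI)
      have fi: "integrable lborel (\<lambda>y. f y * g y)" if "integrable lborel g" for g :: "real^'n \<Rightarrow> real"
        by (rule Bochner_Integration.integrable_bound[OF that])
          (use that in \<open>auto simp: abs_mult intro!: mult_left_le_one_le fb\<close>)
      have "\<bar>(\<integral>y. f y * smoothed a (\<mu> k) y \<partial>lborel) - (\<integral>y. f y * smoothed a L y \<partial>lborel)\<bar>
          = \<bar>\<integral>y. f y * (smoothed a (\<mu> k) y - smoothed a L y) \<partial>lborel\<bar>"
        using fi[OF ik] fi[OF iL] by (subst Bochner_Integration.integral_diff[symmetric]) (auto simp: algebra_simps)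
      also have "\<dots> \<le> (\<integral>y. \<bar>smoothed a (\<mu> k) y - smoothed a L y\<bar> \<partial>lborel)"
        using fi[of "\<lambda>y. smoothed a (\<mu> k) y - smoothed a L y"] ik iL
        by (intro integral_abs_bound_integral) (auto simp: abs_mult split_beta intro!: AE_I2 mult_left_le_one_le fb)
      finally have mid: "\<bar>(\<integral>y. f y * smoothed a (\<mu> k) y \<partial>lborel) - (\<integral>y. f y * smoothed a L y \<partial>lborel)\<bar> \<le> V * e / 2"
        using d by simp
      have "\<bar>V * (\<integral>x. f x \<partial>\<mu> k) - V * (\<integral>x. f x \<partial>L)\<bar> \<le> V * e"
        using mid smoothing_error[OF \<mu>(1)[of k] \<mu>(2) a f] smoothing_error[OF L a f] conc
        unfolding V_def by argo
      then have "V * \<bar>(\<integral>x. f x \<partial>\<mu> k) - (\<integral>x. f x \<partial>L)\<bar> \<le> V * e"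
        using V by (simp add: abs_mult flip: right_diff_distrib)
      then show "\<bar>(\<integral>x. f x \<partial>\<mu> k) - (\<integral>x. f x \<partial>L)\<bar> \<le> e" using V by simp
    qed
  qed
qed

section \<open>Sums of independent bounded variables\<close>

lemma (in prob_space) hoeffding_normalized:
  assumes t: "t > 0" and indep: "indep_vars (\<lambda>_. borel) Y {..<t}"
    and bd: "\<And>j \<omega>. j < t \<Longrightarrow> \<omega> \<in> space M \<Longrightarrow> \<bar>Y j \<omega>\<bar> \<le> c" and c: "c > 0" and l: "l \<ge> 0"
  shows "prob {\<omega>\<in>space M. \<bar>\<Sum>j<t. Y j \<omega> - expectation (Y j)\<bar> \<ge> l * c * sqrt (real t)} \<le> 2 * exp (- l\<^sup>2 / 2)"
proof -
  interpret Hoeffding_ineq M "{..<t}" Y "\<lambda>_. -c" "\<lambda>_. c" "\<Sum>j<t. expectation (Y j)"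
    by unfold_locales (use indep bd in \<open>force intro!: AE_I2 simp: abs_le_iff\<close>)+
  have "prob {\<omega>\<in>space M. \<bar>(\<Sum>j<t. Y j \<omega>) - (\<Sum>j<t. expectation (Y j))\<bar> \<ge> l * c * sqrt (real t)}
    \<le> 2 * exp (- 2 * (l * c * sqrt (real t))\<^sup>2 / (\<Sum>j<t. (c - - c)\<^sup>2))"
    using t c l by (intro Hoeffding_ineq_abs_ge) auto
  also have "- 2 * (l * c * sqrt (real t))\<^sup>2 / (\<Sum>j<t. (c - - c)\<^sup>2) = - l\<^sup>2 / 2"
    using t c by (simp add: power_mult_distrib field_simps power2_eq_square)
  finally show ?thesis by (simp add: sum_subtractf)
qed

lemma power_le_fact_exp:
  fixes y :: real assumes "y \<ge> 0" shows "y ^ m \<le> fact m * exp y"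
proof -
  have "(\<Sum>i\<in>{m}. inverse (fact i) *\<^sub>R y ^ i) \<le> (\<Sum>i. inverse (fact i) *\<^sub>R y ^ i)"
    using assms summable_exp_generic[of y] by (intro sum_le_suminf) auto
  then have "y ^ m / fact m \<le> exp y" by (simp add: exp_def field_simps)
  then show ?thesis by (simp add: field_simps)
qed

lemma gauss_tail_poly:
  fixes l :: real assumes "l > 0"
  shows "2 * exp (- l\<^sup>2 / 2) \<le> (2 * fact m * 2 ^ m) / l ^ (2 * m)"
proof -
  have p: "(l\<^sup>2 / 2) ^ m = l ^ (2 * m) / 2 ^ m" by (simp only: power_divide power_mult)
  have "(l\<^sup>2 / 2) ^ m \<le> fact m * exp (l\<^sup>2 / 2)" by (rule power_le_fact_exp) simp
  then have "exp (- l\<^sup>2 / 2) * (l\<^sup>2 / 2) ^ m \<le> exp (- l\<^sup>2 / 2) * (fact m * exp (l\<^sup>2 / 2))"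
    by (intro mult_left_mono) auto
  also have "\<dots> = fact m" by (simp add: exp_minus field_simps)
  finally show ?thesis unfolding p using assms by (simp add: field_simps)
qed

text \<open>The polynomial form of Hoeffding's inequality that chaining consumes.\<close>

lemma (in prob_space) hoeffding_poly:
  assumes t: "t > 0" and indep: "indep_vars (\<lambda>_. borel) Y {..<t}"
    and bd: "\<And>j \<omega>. j < t \<Longrightarrow> \<omega> \<in> space M \<Longrightarrow> \<bar>Y j \<omega>\<bar> \<le> c" and c: "c \<ge> 0" and l: "l > 0"
  shows "prob {\<omega>\<in>space M. \<bar>\<Sum>j<t. Y j \<omega> - expectation (Y j)\<bar> > l * c * sqrt (real t)} \<le> (2 * fact m * 2 ^ m) / l ^ (2 * m)"
proof (cases "c = 0")
  case True
  then have 0: "Y j \<omega> = 0" if "j < t" "\<omega> \<in> space M" for j \<omega> using bd[OF that] by simp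
  then have "expectation (Y j) = 0" if "j < t" for j
    using that by (subst Bochner_Integration.integral_cong[of M M _ "\<lambda>_. 0"]) auto
  then have "{\<omega>\<in>space M. \<bar>\<Sum>j<t. Y j \<omega> - expectation (Y j)\<bar> > l * c * sqrt (real t)} = {}"
    using 0 True by auto
  then show ?thesis using l by (simp only: measure_empty) simp
next
  case False
  have [measurable]: "Y j \<in> borel_measurable M" if "j < t" for j using indep that by (auto simp: indep_vars_def2)
  have "prob {\<omega>\<in>space M. \<bar>\<Sum>j<t. Y j \<omega> - expectation (Y j)\<bar> > l * c * sqrt (real t)}
    \<le> prob {\<omega>\<in>space M. \<bar>\<Sum>j<t. Y j \<omega> - expectation (Y j)\<bar> \<ge> l * c * sqrt (real t)}"
    by (intro finite_measure_mono) auto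
  also have "\<dots> \<le> 2 * exp (- l\<^sup>2 / 2)"
    using assms False by (intro hoeffding_normalized) auto
  also have "\<dots> \<le> (2 * fact m * 2 ^ m) / l ^ (2 * m)" by (rule gauss_tail_poly[OF l])
  finally show ?thesis .
qed

section \<open>Resampling\<close>

text \<open>The bootstrap empirical process: \<open>G_boot\<close> is its value at the selected subgradients, and the
  perturbation in \<open>nu_obj\<close> is \<open>\<epsilon>\<close> times its value at the objective.\<close>

definition boot_fluct :: "nat \<Rightarrow> (nat \<Rightarrow> 'a) \<Rightarrow> ('a \<Rightarrow> 'b::real_vector) \<Rightarrow> (nat \<Rightarrow> nat) \<Rightarrow> 'b" where
  "boot_fluct t x g w = sqrt (real t) *\<^sub>R (emp_boot t x w g - emp t x g)"

text \<open>Multinomial weights count how often each index occurs among \<open>t\<close> independent uniform draws. Sums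
  weighted by counts are sums over the draws, hence sums of independent and identically distributed
  terms.\<close>

definition draws :: "nat \<Rightarrow> (nat \<Rightarrow> nat) pmf" where
  "draws t = Pi_pmf {..<t} undefined (\<lambda>_. pmf_of_set {..<t})"

definition counts :: "nat \<Rightarrow> (nat \<Rightarrow> nat) \<Rightarrow> nat \<Rightarrow> nat" where
  "counts t d = (\<lambda>c. card {j\<in>{..<t}. d j = c})"

lemma boot_weights_draws: "boot_weights t = map_pmf (counts t) (draws t)"
  by (simp add: boot_weights_def multinomial_pmf_def draws_def counts_def[abs_def])

lemma prob_boot_weights:
  "measure_pmf.prob (boot_weights t) {w. P w} = measure_pmf.prob (draws t) {d. P (counts t d)}"
  unfolding boot_weights_draws by (simp add: vimage_def)

lemma draws_lt: "d \<in> set_pmf (draws t) \<Longrightarrow> j < t \<Longrightarrow> d j < t"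
  unfolding draws_def by (subst (asm) set_Pi_pmf) (auto simp: PiE_dflt_def set_pmf_of_set lessThan_empty_iff)

lemma finite_draws: "finite (set_pmf (draws t))"
proof (cases "t = 0")
  case False
  then show ?thesis unfolding draws_def
    by (subst set_Pi_pmf) (auto intro!: finite_PiE_dflt simp: set_pmf_of_set lessThan_empty_iff)
qed (simp add: draws_def)

lemma finite_boot_weights: "finite (set_pmf (boot_weights t))"
  by (simp add: boot_weights_draws finite_draws)

lemma sum_counts:
  fixes g :: "'a \<Rightarrow> real"
  assumes "\<And>j. j < t \<Longrightarrow> d j < t"
  shows "(\<Sum>\<tau><t. real (counts t d \<tau>) * g (x \<tau>)) = (\<Sum>j<t. g (x (d j)))"
proof -
  have "(\<Sum>j<t. g (x (d j))) = (\<Sum>\<tau><t. \<Sum>j\<in>{j\<in>{..<t}. d j = \<tau>}. g (x (d j)))"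
    by (rule sum.group[symmetric]) (use assms in auto)
  also have "\<dots> = (\<Sum>\<tau><t. real (counts t d \<tau>) * g (x \<tau>))"
    by (intro sum.cong refl) (simp add: counts_def)
  finally show ?thesis ..
qed

lemma boot_fluct_counts:
  fixes g :: "'a \<Rightarrow> real"
  assumes t: "t > 0" and d: "d \<in> set_pmf (draws t)"
  shows "boot_fluct t x g (counts t d) = (\<Sum>j<t. g (x (d j)) - emp t x g) / sqrt (real t)"
proof -
  have "boot_fluct t x g (counts t d) = sqrt (real t) * ((\<Sum>j<t. g (x (d j))) / t - emp t x g)"
    unfolding boot_fluct_def emp_boot_def using sum_counts[of t d g x] draws_lt[OF d] by simp
  also have "\<dots> = (\<Sum>j<t. g (x (d j)) - emp t x g) / sqrt (real t)"
  proof -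
    obtain r where "r > 0" "real t = r * r" "sqrt (real t) = r" using t by (metis of_nat_0_le_iff of_nat_0_less_iff real_sqrt_gt_zero real_sqrt_mult_self abs_of_nonneg)
    then show ?thesis by (simp add: sum_subtractf field_simps)
  qed
  finally show ?thesis .
qed

lemma sum_boot_weights: "w \<in> set_pmf (boot_weights t) \<Longrightarrow> (\<Sum>\<tau><t. real (w \<tau>)) = real t"
  using sum_counts[of t _ "\<lambda>_. 1" id] draws_lt by (auto simp: boot_weights_draws)

lemma expectation_draw:
  fixes g :: "'a \<Rightarrow> real"
  assumes t: "t > 0"
  shows "measure_pmf.expectation (pmf_of_set {..<t}) (\<lambda>j. g (x j)) = emp t x g"
  using t by (subst integral_pmf_of_set) (auto simp: emp_def lessThan_empty_iff)

lemma distr_draws_component: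
  assumes "j < t"
  shows "distr (draws t) borel (\<lambda>d. (Y (d j) :: real)) = distr (pmf_of_set {..<t}) borel Y"
proof -
  have "map_pmf (\<lambda>d. d j) (draws t) = pmf_of_set {..<t}"
    unfolding draws_def using assms by (subst Pi_pmf_component) auto
  then have "measure_pmf (pmf_of_set {..<t}) = distr (draws t) (count_space UNIV) (\<lambda>d. d j)"
    by (metis map_pmf_rep_eq)
  then have "distr (pmf_of_set {..<t}) borel Y = distr (distr (draws t) (count_space UNIV) (\<lambda>d. d j)) borel Y"
    by simp
  also have "\<dots> = distr (draws t) borel (\<lambda>d. Y (d j))" by (subst distr_distr) (auto simp: comp_def)
  finally show ?thesis ..
qed

lemma expectation_draws_component:
  fixes Y :: "nat \<Rightarrow> real"
  assumes "j < t"
  shows "measure_pmf.expectation (draws t) (\<lambda>d. Y (d j)) = measure_pmf.expectation (pmf_of_set {..<t}) Y"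
proof -
  have "map_pmf (\<lambda>d. d j) (draws t) = pmf_of_set {..<t}"
    unfolding draws_def using assms by (subst Pi_pmf_component) auto
  then show ?thesis by (metis integral_map_pmf)
qed

lemma indep_draws:
  "prob_space.indep_vars (measure_pmf (draws t)) (\<lambda>_. borel) (\<lambda>j d. (Y (d j) :: real)) {..<t}"
  unfolding draws_def
  by (rule prob_space.indep_vars_compose2[OF measure_pmf.prob_space_axioms indep_vars_Pi_pmf, where Y="\<lambda>_. Y"]) auto

lemma boot_fluct_second_moment:
  fixes g :: "'a \<Rightarrow> real"
  assumes t: "t > 0"
  shows "measure_pmf.expectation (boot_weights t) (\<lambda>w. (boot_fluct t x g w)\<^sup>2) \<le> emp t x (\<lambda>y. (g y)\<^sup>2)"
proof -
  define Y where "Y j = g (x j) - emp t x g" for j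
  define E :: "((nat \<Rightarrow> nat) \<Rightarrow> real) \<Rightarrow> real" where "E = measure_pmf.expectation (draws t)"
  have int: "integrable (draws t) f" for f :: "_ \<Rightarrow> real"
    by (rule integrable_measure_pmf_finite[OF finite_draws])
  have EY: "measure_pmf.expectation (pmf_of_set {..<t}) Y = 0"
    using t expectation_draw[OF t, of g x] unfolding Y_def
    by (subst Bochner_Integration.integral_diff) (auto simp: lessThan_empty_iff intro!: integrable_measure_pmf_finite)
  have EY2: "measure_pmf.expectation (pmf_of_set {..<t}) (\<lambda>j. (Y j)\<^sup>2) = emp t x (\<lambda>y. (g y)\<^sup>2) - (emp t x g)\<^sup>2"
  proof -
    have "(\<Sum>j<t. (Y j)\<^sup>2) = (\<Sum>j<t. (g (x j))\<^sup>2 - 2 * emp t x g * g (x j) + (emp t x g)\<^sup>2)"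
      by (intro sum.cong refl) (simp add: Y_def power2_diff)
    also have "\<dots> = (\<Sum>j<t. (g (x j))\<^sup>2) - 2 * emp t x g * (\<Sum>j<t. g (x j)) + t * (emp t x g)\<^sup>2"
      by (simp add: sum.distrib sum_subtractf sum_distrib_left)
    also have "(\<Sum>j<t. g (x j)) = t * emp t x g" using t by (simp add: emp_def)
    also have "(\<Sum>j<t. (g (x j))\<^sup>2) = t * emp t x (\<lambda>y. (g y)\<^sup>2)" using t by (simp add: emp_def)
    finally have "(\<Sum>j<t. (Y j)\<^sup>2) = t * (emp t x (\<lambda>y. (g y)\<^sup>2) - (emp t x g)\<^sup>2)"
      by (simp add: algebra_simps power2_eq_square)
    then show ?thesis using t by (subst integral_pmf_of_set) (auto simp: lessThan_empty_iff)
  qed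
  have cross: "E (\<lambda>d. Y (d i) * Y (d j)) = (if i = j then emp t x (\<lambda>y. (g y)\<^sup>2) - (emp t x g)\<^sup>2 else 0)"
    if "i < t" "j < t" for i j
  proof (cases "i = j")
    case True
    then show ?thesis using expectation_draws_component[OF that(1), of "\<lambda>j. (Y j)\<^sup>2"] EY2
      by (simp add: E_def power2_eq_square)
  next
    case False
    have "E (\<lambda>d. \<Prod>k\<in>{i,j}. Y (d k)) = (\<Prod>k\<in>{i,j}. E (\<lambda>d. Y (d k)))"
      unfolding E_def
      by (rule prob_space.indep_vars_lebesgue_integral[OF measure_pmf.prob_space_axioms])
        (use that int in \<open>auto intro!: prob_space.indep_vars_subset[OF measure_pmf.prob_space_axioms indep_draws[of t Y]]\<close>)
    then show ?thesis using False expectation_draws_component[OF that(1), of Y] EY by (simp add: E_def)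
  qed
  have "measure_pmf.expectation (boot_weights t) (\<lambda>w. (boot_fluct t x g w)\<^sup>2)
    = E (\<lambda>d. (boot_fluct t x g (counts t d))\<^sup>2)"
    by (simp add: boot_weights_draws E_def)
  also have "\<dots> = E (\<lambda>d. (\<Sum>j<t. Y (d j))\<^sup>2 / t)"
    unfolding E_def using t
    by (intro integral_cong_AE AE_pmfI) (auto simp: boot_fluct_counts Y_def power_divide)
  also have "\<dots> = E (\<lambda>d. \<Sum>i<t. \<Sum>j<t. Y (d i) * Y (d j)) / t"
    by (simp add: E_def power2_eq_square sum_product)
  also have "E (\<lambda>d. \<Sum>i<t. \<Sum>j<t. Y (d i) * Y (d j)) = (\<Sum>i<t. \<Sum>j<t. E (\<lambda>d. Y (d i) * Y (d j)))"
    unfolding E_def using int by (simp add: Bochner_Integration.integral_sum)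
  also have "\<dots> = (\<Sum>i<t. \<Sum>j<t. if i = j then emp t x (\<lambda>y. (g y)\<^sup>2) - (emp t x g)\<^sup>2 else 0)"
    by (intro sum.cong refl cross) auto
  also have "\<dots> / t = emp t x (\<lambda>y. (g y)\<^sup>2) - (emp t x g)\<^sup>2" using t by (simp add: sum.delta)
  finally show ?thesis by simp
qed

lemma boot_fluct_chebyshev:
  fixes g :: "'a \<Rightarrow> real"
  assumes t: "t > 0" and a: "a > 0"
  shows "measure_pmf.prob (boot_weights t) {w. \<bar>boot_fluct t x g w\<bar> > a} \<le> emp t x (\<lambda>y. (g y)\<^sup>2) / a\<^sup>2"
proof -
  have "measure_pmf.prob (boot_weights t) {w. \<bar>boot_fluct t x g w\<bar> > a}
    \<le> measure_pmf.prob (boot_weights t) {w \<in> space (measure_pmf (boot_weights t)). (boot_fluct t x g w)\<^sup>2 \<ge> a\<^sup>2}"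
    using a by (intro measure_pmf.finite_measure_mono) (auto simp: abs_le_square_iff[symmetric])
  also have "\<dots> \<le> measure_pmf.expectation (boot_weights t) (\<lambda>w. (boot_fluct t x g w)\<^sup>2) / a\<^sup>2"
    using a by (intro integral_Markov_inequality_measure[where A="{}"])
      (auto intro!: integrable_measure_pmf_finite finite_boot_weights)
  also have "\<dots> \<le> emp t x (\<lambda>y. (g y)\<^sup>2) / a\<^sup>2"
    using a boot_fluct_second_moment[OF t] by (intro divide_right_mono) auto
  finally show ?thesis .
qed

lemma boot_fluct_tail:
  fixes g :: "'a \<Rightarrow> real"
  assumes t: "t > 0" and bd: "\<And>\<tau>. \<tau> < t \<Longrightarrow> \<bar>g (x \<tau>)\<bar> \<le> c" and c: "c \<ge> 0" and l: "l > 0"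
  shows "measure_pmf.prob (boot_weights t) {w. \<bar>boot_fluct t x g w\<bar> > l * c} \<le> (2 * fact m * 2 ^ m) / l ^ (2 * m)"
proof -
  define Y where "Y j = (if j < t then g (x j) else 0)" for j
  have EY: "measure_pmf.expectation (pmf_of_set {..<t}) Y = emp t x g"
    using t by (subst integral_pmf_of_set) (auto simp: emp_def lessThan_empty_iff Y_def)
  have "measure_pmf.prob (boot_weights t) {w. \<bar>boot_fluct t x g w\<bar> > l * c}
    = measure_pmf.prob (draws t) {d. \<bar>boot_fluct t x g (counts t d)\<bar> > l * c}"
    by (rule prob_boot_weights)
  also have "\<dots> = measure_pmf.prob (draws t) {d \<in> space (measure_pmf (draws t)).
      \<bar>\<Sum>j<t. Y (d j) - measure_pmf.expectation (draws t) (\<lambda>d. Y (d j))\<bar> > l * c * sqrt (real t)}"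
  proof (rule measure_pmf.finite_measure_eq_AE, rule AE_pmfI)
    fix d assume d: "d \<in> set_pmf (draws t)"
    have "(\<Sum>j<t. Y (d j) - measure_pmf.expectation (draws t) (\<lambda>d. Y (d j))) = (\<Sum>j<t. g (x (d j)) - emp t x g)"
      by (intro sum.cong refl) (use draws_lt[OF d] in \<open>simp add: expectation_draws_component EY, simp add: Y_def\<close>)
    then show "(d \<in> {d. \<bar>boot_fluct t x g (counts t d)\<bar> > l * c}) = (d \<in> {d \<in> space (measure_pmf (draws t)).
      \<bar>\<Sum>j<t. Y (d j) - measure_pmf.expectation (draws t) (\<lambda>d. Y (d j))\<bar> > l * c * sqrt (real t)})"
      using t by (simp add: boot_fluct_counts[OF t d] pos_less_divide_eq)
  qed auto
  also have "\<dots> \<le> (2 * fact m * 2 ^ m) / l ^ (2 * m)"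
    by (intro measure_pmf.hoeffding_poly indep_draws t c l) (use bd c in \<open>auto simp: Y_def\<close>)
  finally show ?thesis .
qed

lemma exp_minus_approx:
  fixes y :: real assumes "y \<ge> 0" shows "\<bar>exp (- y) - (1 - y)\<bar> \<le> y\<^sup>2"
proof -
  have "1 - y \<le> exp (- y)" using exp_ge_add_one_self[of "-y"] by simp
  moreover have "exp (- y) \<le> 1 / (1 + y)"
    using exp_ge_add_one_self[of y] assms by (simp add: exp_minus inverse_eq_divide frac_le)
  moreover have "1 / (1 + y) \<le> 1 - y + y\<^sup>2"
  proof -
    have "1 \<le> (1 - y + y\<^sup>2) * (1 + y)" using assms by (simp add: algebra_simps power2_eq_square)
    then show ?thesis using assms by (simp add: field_simps)
  qed
  ultimately show ?thesis by simp
qed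

text \<open>The characteristic function is a \<open>t\<close>-th power, compared with the \<open>t\<close>-th power of \<open>exp (- y)\<close> for
  \<open>y = s2 / (2 * t)\<close>. The error is explicit and depends on the sample only through the bound \<open>c\<close>, so the
  result applies to triangular arrays.\<close>

lemma boot_fluct_char_approx:
  fixes g :: "'a \<Rightarrow> real"
  assumes t: "t > 0" and bd: "\<And>\<tau>. \<tau> < t \<Longrightarrow> \<bar>g (x \<tau>)\<bar> \<le> c"
  defines "s2 \<equiv> emp t x (\<lambda>y. (g y)\<^sup>2) - (emp t x g)\<^sup>2"
  shows "cmod ((CLINT w|boot_weights t. iexp (boot_fluct t x g w)) - exp (- s2 / 2))
      \<le> ((2 * c)^3 / 6 + c^4 / 4) / sqrt (real t)"
proof -
  have c: "c \<ge> 0" using bd[of 0] t by simp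
  define Y where "Y j = (if j < t then g (x j) - emp t x g else 0)" for j
  have "\<bar>emp t x g\<bar> \<le> c"
  proof -
    have "\<bar>\<Sum>\<tau><t. g (x \<tau>)\<bar> \<le> (\<Sum>\<tau><t. c)" by (rule order_trans[OF sum_abs]) (intro sum_mono, use bd in auto)
    then show ?thesis using t by (simp add: emp_def abs_mult field_simps)
  qed
  then have Yb: "\<bar>Y j\<bar> \<le> 2 * c" for j using bd[of j] c by (auto simp: Y_def)
  let ?p = "pmf_of_set {..<t}"
  have EY: "measure_pmf.expectation ?p Y = 0"
  proof -
    have "(\<Sum>j<t. g (x j)) = t * emp t x g" using t by (simp add: emp_def)
    then have "(\<Sum>j<t. Y j) = 0" by (simp add: Y_def sum_subtractf)
    then show ?thesis using t by (subst integral_pmf_of_set) (auto simp: lessThan_empty_iff)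
  qed
  have EY2: "measure_pmf.expectation ?p (\<lambda>j. (Y j)\<^sup>2) = s2"
  proof -
    have "(\<Sum>j<t. (Y j)\<^sup>2) = (\<Sum>j<t. (g (x j))\<^sup>2 - 2 * emp t x g * g (x j) + (emp t x g)\<^sup>2)"
      by (intro sum.cong refl) (simp add: Y_def power2_diff)
    also have "\<dots> = (\<Sum>j<t. (g (x j))\<^sup>2) - 2 * emp t x g * (\<Sum>j<t. g (x j)) + t * (emp t x g)\<^sup>2"
      by (simp add: sum.distrib sum_subtractf sum_distrib_left)
    also have "(\<Sum>j<t. g (x j)) = t * emp t x g" using t by (simp add: emp_def)
    also have "(\<Sum>j<t. (g (x j))\<^sup>2) = t * emp t x (\<lambda>y. (g y)\<^sup>2)" using t by (simp add: emp_def)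
    finally have "(\<Sum>j<t. (Y j)\<^sup>2) = t * s2"
      by (simp add: algebra_simps power2_eq_square s2_def)
    then show ?thesis using t by (subst integral_pmf_of_set) (auto simp: lessThan_empty_iff)
  qed
  have s2: "s2 \<ge> 0" unfolding EY2[symmetric] by (intro Bochner_Integration.integral_nonneg) simp
  have s2c: "s2 \<le> c\<^sup>2"
  proof -
    have "(\<Sum>\<tau><t. (g (x \<tau>))\<^sup>2) \<le> (\<Sum>\<tau><t. c\<^sup>2)"
      using bd c by (intro sum_mono) (auto simp: abs_le_square_iff[symmetric])
    then have "emp t x (\<lambda>y. (g y)\<^sup>2) \<le> c\<^sup>2" using t by (simp add: emp_def field_simps)
    then show ?thesis by (simp add: s2_def add.commute add_increasing2 diff_le_eq)
  qed
  define r where "r = 1 / sqrt (real t)"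
  have r: "r > 0" "r\<^sup>2 = 1 / t" using t by (auto simp: r_def power_divide)
  define \<phi> where "\<phi> = char (distr ?p borel Y) r"
  have fin: "finite (set_pmf ?p)" using t by (simp add: set_pmf_of_set lessThan_empty_iff)
  interpret D: real_distribution "distr ?p borel Y"
    by (rule prob_space.real_distribution_distr[OF measure_pmf.prob_space_axioms]) simp
  have "(CLINT w|boot_weights t. iexp (boot_fluct t x g w)) = (CLINT d|draws t. iexp (boot_fluct t x g (counts t d)))"
    by (simp add: boot_weights_draws)
  also have "\<dots> = (CLINT d|draws t. iexp (r * (\<Sum>j<t. Y (d j))))"
  proof (intro integral_cong_AE AE_pmfI)
    fix d assume d: "d \<in> set_pmf (draws t)"
    have "(\<Sum>j<t. g (x (d j)) - emp t x g) = (\<Sum>j<t. Y (d j))"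
      by (intro sum.cong refl) (use draws_lt[OF d] in \<open>simp add: Y_def\<close>)
    then have "boot_fluct t x g (counts t d) = r * (\<Sum>j<t. Y (d j))"
      by (simp add: boot_fluct_counts[OF t d] r_def)
    then show "iexp (boot_fluct t x g (counts t d)) = iexp (r * (\<Sum>j<t. Y (d j)))" by simp
  qed auto
  also have "\<dots> = char (distr (draws t) borel (\<lambda>d. \<Sum>j<t. Y (d j))) r"
    unfolding char_def by (subst integral_distr) auto
  also have "\<dots> = (\<Prod>j<t. char (distr (draws t) borel (\<lambda>d. Y (d j))) r)"
    by (rule prob_space.char_distr_sum[OF measure_pmf.prob_space_axioms indep_draws])
  also have "\<dots> = \<phi> ^ t" by (simp add: distr_draws_component \<phi>_def)
  finally have prod: "(CLINT w|boot_weights t. iexp (boot_fluct t x g w)) = \<phi> ^ t" .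
  have a1: "cmod (\<phi> - (1 - r\<^sup>2 * s2 / 2)) \<le> r^3 * (2 * c)^3 / 6"
  proof -
    have h1: "cmod (\<phi> - (1 - r\<^sup>2 * s2 / 2)) \<le> r\<^sup>2 / 6 * measure_pmf.expectation ?p (\<lambda>x. min (6 * (Y x)\<^sup>2) (\<bar>r\<bar> * \<bar>Y x\<bar>^3))"
      unfolding \<phi>_def
      by (rule prob_space.char_approx3'[OF measure_pmf.prob_space_axioms]) (use EY EY2 fin in \<open>auto intro!: integrable_measure_pmf_finite\<close>)
    have "measure_pmf.expectation ?p (\<lambda>x. min (6 * (Y x)\<^sup>2) (\<bar>r\<bar> * \<bar>Y x\<bar>^3)) \<le> measure_pmf.expectation ?p (\<lambda>x. r * (2*c)^3)"
    proof (intro Bochner_Integration.integral_mono integrable_measure_pmf_finite fin)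
      fix j
      have "\<bar>Y j\<bar>^3 \<le> (2*c)^3" using Yb by (intro power_mono) auto
      then show "min (6 * (Y j)\<^sup>2) (\<bar>r\<bar> * \<bar>Y j\<bar>^3) \<le> r * (2*c)^3"
        using r by (intro min.coboundedI2) (auto intro!: mult_left_mono)
    qed
    then have "r\<^sup>2 / 6 * measure_pmf.expectation ?p (\<lambda>x. min (6 * (Y x)\<^sup>2) (\<bar>r\<bar> * \<bar>Y x\<bar>^3)) \<le> r\<^sup>2 / 6 * (r * (2*c)^3)"
      by (intro mult_left_mono) auto
    also have "\<dots> = r^3 * (2 * c)^3 / 6" by (simp add: power3_eq_cube power2_eq_square)
    finally show ?thesis using h1 by linarith
  qed
  define y where "y = r\<^sup>2 * s2 / 2"
  have y: "y \<ge> 0" "t * y = s2 / 2" using s2 r t by (auto simp: y_def)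
  have "cmod (\<phi> ^ t - complex_of_real (exp (- y)) ^ t) \<le> t * cmod (\<phi> - complex_of_real (exp (- y)))"
    using y D.cmod_char_le_1 by (intro norm_power_diff) (auto simp: \<phi>_def)
  also have "cmod (\<phi> - complex_of_real (exp (- y))) \<le> r^3 * (2 * c)^3 / 6 + y\<^sup>2"
  proof -
    have "cmod (\<phi> - complex_of_real (exp (- y))) \<le> cmod (\<phi> - complex_of_real (1 - y)) + cmod (complex_of_real (1 - y) - complex_of_real (exp (- y)))"
      using norm_triangle_ineq[of "\<phi> - complex_of_real (1 - y)" "complex_of_real (1 - y) - complex_of_real (exp (- y))"] by simp
    moreover have "cmod (complex_of_real (1 - y) - complex_of_real (exp (- y))) \<le> y\<^sup>2"
      using exp_minus_approx[OF y(1)] by (metis abs_minus_commute norm_of_real of_real_diff)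
    moreover have "cmod (\<phi> - complex_of_real (1 - y)) \<le> r^3 * (2 * c)^3 / 6" using a1 by (simp add: y_def)
    ultimately show ?thesis by linarith
  qed
  also have "t * (r^3 * (2 * c)^3 / 6 + y\<^sup>2) \<le> ((2 * c)^3 / 6 + c^4 / 4) * r"
  proof -
    have "t * r^3 = r" using r t by (simp add: power3_eq_cube power2_eq_square field_simps)
    then have "t * (r^3 * (2 * c)^3 / 6) = (2 * c)^3 / 6 * r" by (simp add: field_simps)
    moreover have "t * y\<^sup>2 \<le> c^4 / 4 * r"
    proof -
      have "r \<le> 1" using t by (simp add: r_def)
      then have rr: "r * r \<le> r" using r by (intro mult_left_le) auto
      have "t * y\<^sup>2 = r * r * (s2\<^sup>2 / 4)" using r t by (simp add: y_def power2_eq_square field_simps)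
      also have "\<dots> \<le> r * (c^4 / 4)"
      proof (intro mult_mono rr)
        have "s2\<^sup>2 \<le> (c\<^sup>2)\<^sup>2" using s2 s2c by (intro power_mono)
        then show "s2\<^sup>2 / 4 \<le> c^4 / 4" by simp
      qed (use r in auto)
      finally show ?thesis by (simp add: mult.commute)
    qed
    ultimately show ?thesis unfolding distrib_left distrib_right by linarith
  qed
  finally have "cmod (\<phi> ^ t - complex_of_real (exp (- y)) ^ t) \<le> ((2 * c)^3 / 6 + c^4 / 4) * r"
    by (simp add: mult_left_mono)
  moreover have "complex_of_real (exp (- y)) ^ t = exp (- s2 / 2)"
    using y(2) by (simp flip: of_real_power exp_of_nat_mult)
  ultimately show ?thesis unfolding prod by (simp add: r_def)
qed

section \<open>Second-order expansions\<close>

lemma GDERIV_grad: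
  fixes f :: "real^'n \<Rightarrow> real"
  assumes "f differentiable (at x)"
  shows "GDERIV f x :> grad f x"
proof -
  obtain f' where f': "(f has_derivative f') (at x)" using assms by (auto simp: differentiable_def)
  interpret linear f' using f' by (rule has_derivative_linear)
  define D where "D = (\<Sum>b\<in>Basis. f' b *\<^sub>R b)"
  have "f' h = h \<bullet> D" for h
  proof -
    have "f' h = f' (\<Sum>b\<in>Basis. (h \<bullet> b) *\<^sub>R b)" by (simp add: euclidean_representation)
    also have "\<dots> = (\<Sum>b\<in>Basis. (h \<bullet> b) * f' b)" by (simp add: sum scale)
    also have "\<dots> = h \<bullet> D" by (simp add: D_def inner_sum_right mult.commute)
    finally show ?thesis .
  qed
  then have "f' = (\<lambda>h. h \<bullet> D)" by (rule ext)
  then have D: "GDERIV f x :> D" using f' by (simp add: gderiv_def)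
  have "D' = D" if "GDERIV f x :> D'" for D'
  proof -
    have "(\<lambda>h. h \<bullet> D') = (\<lambda>h. h \<bullet> D)"
      using that D unfolding gderiv_def by (rule has_derivative_unique)
    then have "(D' - D) \<bullet> (D' - D) = 0" by (simp add: fun_eq_iff inner_diff_right)
    then show ?thesis by simp
  qed
  then show ?thesis using D unfolding grad_def by (rule theI[of "\<lambda>D. GDERIV f x :> D", rotated])
qed

lemma grad_eqI:
  fixes f :: "real^'n \<Rightarrow> real"
  assumes "GDERIV f x :> D" shows "grad f x = D"
proof -
  have "f differentiable (at x)" using assms by (auto simp: gderiv_def differentiable_def)
  then have "GDERIV f x :> grad f x" by (rule GDERIV_grad)
  then have "(\<lambda>h. h \<bullet> grad f x) = (\<lambda>h. h \<bullet> D)"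
    using assms unfolding gderiv_def by (rule has_derivative_unique)
  then have "(grad f x - D) \<bullet> (grad f x - D) = 0" by (simp add: fun_eq_iff inner_diff_right)
  then show ?thesis by simp
qed

text \<open>The two ways in which \<open>twice_cont_diff_on\<close> is used: a ball on which the gradient exists, and the
  first-order expansion of the gradient there.\<close>

lemma grad_expansion:
  fixes f :: "real^'n \<Rightarrow> real"
  assumes U: "open U" "x \<in> U" "twice_cont_diff_on f U" and e: "e > 0"
  obtains d where "d > 0" "\<And>y. norm (y - x) < d \<Longrightarrow> y \<in> U"
    "\<And>y. norm (y - x) < d \<Longrightarrow> norm (grad f y - grad f x - hessian f x *v (y - x)) \<le> e * norm (y - x)"
proof -
  have "grad f differentiable (at x)" using U by (auto simp: twice_cont_diff_on_def)
  then have fd: "(grad f has_derivative frechet_derivative (grad f) (at x)) (at x)"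
    by (simp add: frechet_derivative_works)
  have "frechet_derivative (grad f) (at x) = (\<lambda>h. hessian f x *v h)"
    unfolding hessian_def using has_derivative_linear[OF fd] by (simp add: matrix_works fun_eq_iff)
  with fd have "(grad f has_derivative (\<lambda>h. hessian f x *v h)) (at x)" by simp
  then obtain d1 where d1: "d1 > 0"
    "\<And>y. norm (y - x) < d1 \<Longrightarrow> norm (grad f y - grad f x - hessian f x *v (y - x)) \<le> e * norm (y - x)"
    unfolding has_derivative_at_alt using e by blast
  obtain d2 where d2: "d2 > 0" "\<And>y. dist y x < d2 \<Longrightarrow> y \<in> U" using U by (auto simp: open_dist)
  show thesis by (rule that[of "min d1 d2"]) (use d1 d2 in \<open>auto simp: dist_norm\<close>)
qed

lemma DERIV_along_line:
  fixes f :: "real^'n \<Rightarrow> real"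
  assumes "f differentiable (at (p + s *\<^sub>R h))"
  shows "((\<lambda>s. f (p + s *\<^sub>R h)) has_real_derivative (h \<bullet> grad f (p + s *\<^sub>R h))) (at s)"
proof -
  have "(f has_derivative (\<lambda>k. k \<bullet> grad f (p + s *\<^sub>R h))) (at (p + s *\<^sub>R h))"
    using GDERIV_grad[OF assms] by (simp add: gderiv_def)
  moreover have "((\<lambda>s. p + s *\<^sub>R h) has_derivative (\<lambda>r. r *\<^sub>R h)) (at s)"
    by (auto intro!: derivative_eq_intros)
  ultimately have "((\<lambda>s. f (p + s *\<^sub>R h)) has_derivative (\<lambda>r. (r *\<^sub>R h) \<bullet> grad f (p + s *\<^sub>R h))) (at s)"
    by (rule has_derivative_compose[rotated])
  then show ?thesis by (rule has_derivative_imp_has_field_derivative) simp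
qed

text \<open>The derivative of \<open>f (x + s *\<^sub>R h)\<close> minus its quadratic model is \<open>o(\<parallel>h\<parallel>\<^sup>2)\<close> along the segment, and the
  mean value theorem integrates it.\<close>

lemma second_order_taylor:
  fixes f :: "real^'n \<Rightarrow> real"
  assumes U: "open U" "x \<in> U" "twice_cont_diff_on f U" and e: "e > 0"
  obtains d where "d > 0"
    "\<And>h. norm h < d \<Longrightarrow> \<bar>f (x + h) - f x - grad f x \<bullet> h - 1/2 * (h \<bullet> (hessian f x *v h))\<bar> \<le> e * (norm h)\<^sup>2"
proof -
  obtain d where d: "d > 0" "\<And>y. norm (y - x) < d \<Longrightarrow> y \<in> U"
    "\<And>y. norm (y - x) < d \<Longrightarrow> norm (grad f y - grad f x - hessian f x *v (y - x)) \<le> e * norm (y - x)"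
    using grad_expansion[OF U e] by metis
  show thesis
  proof (rule that[OF d(1)])
    fix h :: "real^'n" assume h: "norm h < d"
    let ?A = "hessian f x"
    define \<psi> where "\<psi> s = f (x + s *\<^sub>R h) - s * (grad f x \<bullet> h) - s\<^sup>2 / 2 * (h \<bullet> (?A *v h))" for s
    define \<psi>' where "\<psi>' s = h \<bullet> grad f (x + s *\<^sub>R h) - grad f x \<bullet> h - s * (h \<bullet> (?A *v h))" for s
    have small: "norm (s *\<^sub>R h) < d" if "0 \<le> s" "s \<le> 1" for s
    proof -
      have "norm (s *\<^sub>R h) \<le> 1 * norm h" unfolding norm_scaleR using that by (intro mult_right_mono) auto
      then show ?thesis using h by simp
    qed
    have "\<exists>z. 0 < z \<and> z < 1 \<and> \<psi> 1 - \<psi> 0 = (1 - 0) * \<psi>' z"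
    proof (rule MVT2)
      fix s :: real assume s: "0 \<le> s" "s \<le> 1"
      have "x + s *\<^sub>R h \<in> U" using small[OF s] d(2)[of "x + s *\<^sub>R h"] by simp
      then have "f differentiable (at (x + s *\<^sub>R h))" using U by (auto simp: twice_cont_diff_on_def)
      from DERIV_along_line[OF this] show "(\<psi> has_real_derivative \<psi>' s) (at s)"
        unfolding \<psi>_def[abs_def] \<psi>'_def by (auto intro!: derivative_eq_intros)
    qed simp
    then obtain z where z: "0 < z" "z < 1" "\<psi> 1 - \<psi> 0 = \<psi>' z" by auto
    have "\<psi>' z = h \<bullet> (grad f (x + z *\<^sub>R h) - grad f x - ?A *v (z *\<^sub>R h))"
      by (simp add: \<psi>'_def inner_diff_right matrix_vector_mult_scaleR inner_commute)
    also have "\<bar>\<dots>\<bar> \<le> norm h * norm (grad f (x + z *\<^sub>R h) - grad f x - ?A *v (z *\<^sub>R h))"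
      by (rule Cauchy_Schwarz_ineq2)
    also have "\<dots> \<le> norm h * (e * norm (z *\<^sub>R h))"
      using d(3)[of "x + z *\<^sub>R h"] small[of z] z by (intro mult_left_mono) auto
    also have "\<dots> \<le> norm h * (e * (1 * norm h))"
      unfolding norm_scaleR using z e by (intro mult_left_mono mult_right_mono) auto
    finally show "\<bar>f (x + h) - f x - grad f x \<bullet> h - 1/2 * (h \<bullet> (?A *v h))\<bar> \<le> e * (norm h)\<^sup>2"
      using z by (simp add: \<psi>_def power2_eq_square mult_ac)
  qed
qed

text \<open>The second difference \<open>f (x + t h + t k) - f (x + t h) - f (x + t k) + f x\<close> is symmetric in \<open>h\<close> and
  \<open>k\<close>, and the mean value theorem together with \<open>grad_expansion\<close> shows that it equals
  \<open>t\<^sup>2 * (h \<bullet> (hessian f x *v k))\<close> up to \<open>o(t\<^sup>2)\<close>.\<close>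

lemma hessian_symmetric:
  fixes f :: "real^'n \<Rightarrow> real"
  assumes U: "open U" "x \<in> U" "twice_cont_diff_on f U"
  shows "h \<bullet> (hessian f x *v k) = k \<bullet> (hessian f x *v h)"
proof -
  let ?A = "hessian f x"
  define m where "m = norm h + norm k"
  have key: "\<exists>t0>0. \<forall>t. 0 < t \<and> t < t0 \<longrightarrow>
      \<bar>(f (x + t *\<^sub>R h + t *\<^sub>R k) - f (x + t *\<^sub>R h) - f (x + t *\<^sub>R k) + f x) - t\<^sup>2 * (h \<bullet> (?A *v k))\<bar> \<le> t\<^sup>2 * (2 * e * m\<^sup>2)"
    if e: "e > 0" and m: "norm h + norm k = m" for e h k
  proof -
    have m0: "m \<ge> 0" using m by (metis add_nonneg_nonneg norm_ge_zero)
    obtain d where d: "d > 0" "\<And>y. norm (y - x) < d \<Longrightarrow> y \<in> U"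
      "\<And>y. norm (y - x) < d \<Longrightarrow> norm (grad f y - grad f x - ?A *v (y - x)) \<le> e * norm (y - x)"
      using grad_expansion[OF U e] by metis
    show ?thesis
    proof (intro exI[of _ "d / (m + 1)"] conjI allI impI)
      show "0 < d / (m + 1)" using d m0 by simp
      fix t assume t: "0 < t \<and> t < d / (m + 1)"
      then have tm: "t * m < d" using m0 by (simp add: field_simps)
      define \<psi> where "\<psi> s = f ((x + t *\<^sub>R k) + s *\<^sub>R (t *\<^sub>R h)) - f (x + s *\<^sub>R (t *\<^sub>R h))" for s
      define \<psi>' where "\<psi>' s = (t *\<^sub>R h) \<bullet> grad f ((x + t *\<^sub>R k) + s *\<^sub>R (t *\<^sub>R h)) - (t *\<^sub>R h) \<bullet> grad f (x + s *\<^sub>R (t *\<^sub>R h))" for s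
      have n1: "norm (s *\<^sub>R (t *\<^sub>R h)) \<le> t * m" if "0 \<le> s" "s \<le> 1" for s
      proof -
        have "norm (s *\<^sub>R (t *\<^sub>R h)) = s * (t * norm h)" using that t by simp
        also have "\<dots> \<le> 1 * (t * m)" using that t m by (intro mult_mono) auto
        finally show ?thesis by simp
      qed
      have n2: "norm (t *\<^sub>R k + s *\<^sub>R (t *\<^sub>R h)) \<le> t * m" if "0 \<le> s" "s \<le> 1" for s
      proof -
        have "norm (t *\<^sub>R k + s *\<^sub>R (t *\<^sub>R h)) \<le> t * norm k + s * (t * norm h)"
          using that t norm_triangle_ineq[of "t *\<^sub>R k" "s *\<^sub>R (t *\<^sub>R h)"] by simp
        also have "s * (t * norm h) \<le> 1 * (t * norm h)" using that t by (intro mult_right_mono) auto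
        finally show ?thesis using m by (simp add: algebra_simps flip: m)
      qed
      have "\<exists>z. 0 < z \<and> z < 1 \<and> \<psi> 1 - \<psi> 0 = (1 - 0) * \<psi>' z"
      proof (rule MVT2)
        fix s :: real assume s: "0 \<le> s" "s \<le> 1"
        have "x + s *\<^sub>R (t *\<^sub>R h) \<in> U" using n1[OF s] tm d(2)[of "x + s *\<^sub>R (t *\<^sub>R h)"] by simp
        moreover have "(x + t *\<^sub>R k) + s *\<^sub>R (t *\<^sub>R h) \<in> U" using n2[OF s] tm d(2)[of "(x + t *\<^sub>R k) + s *\<^sub>R (t *\<^sub>R h)"]
          by (simp add: algebra_simps)
        ultimately have "f differentiable (at (x + s *\<^sub>R (t *\<^sub>R h)))" "f differentiable (at ((x + t *\<^sub>R k) + s *\<^sub>R (t *\<^sub>R h)))"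
          using U by (auto simp: twice_cont_diff_on_def)
        from DERIV_along_line[OF this(1)] DERIV_along_line[OF this(2)]
        show "(\<psi> has_real_derivative \<psi>' s) (at s)"
          unfolding \<psi>_def[abs_def] \<psi>'_def by (rule DERIV_diff[rotated])
      qed simp
      then obtain z where z: "0 < z" "z < 1" "\<psi> 1 - \<psi> 0 = \<psi>' z" by auto
      define y1 y2 where "y1 = x + z *\<^sub>R (t *\<^sub>R h)" and "y2 = (x + t *\<^sub>R k) + z *\<^sub>R (t *\<^sub>R h)"
      have "?A *v (y2 - x) - ?A *v (y1 - x) = t *\<^sub>R (?A *v k)"
        by (simp add: y1_def y2_def matrix_vector_right_distrib matrix_vector_mult_diff_distrib matrix_vector_mult_scaleR)
      moreover have "(grad f y2 - grad f x - ?A *v (y2 - x)) - (grad f y1 - grad f x - ?A *v (y1 - x))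
          = grad f y2 - grad f y1 - (?A *v (y2 - x) - ?A *v (y1 - x))" by simp
      ultimately have R: "(grad f y2 - grad f x - ?A *v (y2 - x)) - (grad f y1 - grad f x - ?A *v (y1 - x))
          = grad f y2 - grad f y1 - t *\<^sub>R (?A *v k)" by (simp only:)
      have "\<psi>' z = (t *\<^sub>R h) \<bullet> grad f y2 - (t *\<^sub>R h) \<bullet> grad f y1" by (simp only: \<psi>'_def y1_def y2_def)
      then have "\<psi>' z - t\<^sup>2 * (h \<bullet> (?A *v k)) = (t *\<^sub>R h) \<bullet> ((grad f y2 - grad f x - ?A *v (y2 - x)) - (grad f y1 - grad f x - ?A *v (y1 - x)))"
        unfolding R by (simp add: power2_eq_square inner_diff_right right_diff_distrib)
      also have "\<bar>\<dots>\<bar> \<le> norm (t *\<^sub>R h) * norm ((grad f y2 - grad f x - ?A *v (y2 - x)) - (grad f y1 - grad f x - ?A *v (y1 - x)))"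
        by (rule Cauchy_Schwarz_ineq2)
      also have "\<dots> \<le> (t * m) * (e * (t * m) + e * (t * m))"
      proof (intro mult_mono)
        show "norm (t *\<^sub>R h) \<le> t * m" using t m by auto
        have y1: "norm (y1 - x) \<le> t * m" using n1[of z] z by (simp add: y1_def)
        have y2: "norm (y2 - x) \<le> t * m" using n2[of z] z by (simp add: y2_def algebra_simps)
        have "norm (grad f y1 - grad f x - ?A *v (y1 - x)) \<le> e * (t * m)"
          using d(3)[of y1] y1 tm e by (intro order_trans[OF d(3)] mult_left_mono) auto
        moreover have "norm (grad f y2 - grad f x - ?A *v (y2 - x)) \<le> e * (t * m)"
          using d(3)[of y2] y2 tm e by (intro order_trans[OF d(3)] mult_left_mono) auto
        ultimately show "norm ((grad f y2 - grad f x - ?A *v (y2 - x)) - (grad f y1 - grad f x - ?A *v (y1 - x))) \<le> e * (t * m) + e * (t * m)"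
          by (intro norm_triangle_le_diff) linarith
      qed (use t m0 in auto)
      also have "\<dots> = t\<^sup>2 * (2 * e * m\<^sup>2)" by (simp add: power2_eq_square algebra_simps)
      finally have fin: "\<bar>\<psi>' z - t\<^sup>2 * (h \<bullet> (?A *v k))\<bar> \<le> t\<^sup>2 * (2 * e * m\<^sup>2)" .
      have "\<psi>' z = f (x + t *\<^sub>R h + t *\<^sub>R k) - f (x + t *\<^sub>R h) - f (x + t *\<^sub>R k) + f x"
        unfolding z(3)[symmetric] \<psi>_def by (simp add: algebra_simps)
      then show "\<bar>(f (x + t *\<^sub>R h + t *\<^sub>R k) - f (x + t *\<^sub>R h) - f (x + t *\<^sub>R k) + f x) - t\<^sup>2 * (h \<bullet> (?A *v k))\<bar> \<le> t\<^sup>2 * (2 * e * m\<^sup>2)"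
        using fin by simp
    qed
  qed
  have "\<bar>h \<bullet> (?A *v k) - k \<bullet> (?A *v h)\<bar> \<le> e" if e: "e > 0" for e
  proof -
    \<comment> \<open>\<open>m\<^sup>2 + 1\<close> instead of \<open>m\<^sup>2\<close> because \<open>h\<close> and \<open>k\<close> may vanish\<close>
    define e' where "e' = e / (4 * (m\<^sup>2 + 1))"
    have e': "e' > 0" unfolding e'_def using e by (intro divide_pos_pos mult_pos_pos add_nonneg_pos) auto
    obtain t1 where t1: "t1 > 0" "\<And>t. 0 < t \<Longrightarrow> t < t1 \<Longrightarrow>
      \<bar>(f (x + t *\<^sub>R h + t *\<^sub>R k) - f (x + t *\<^sub>R h) - f (x + t *\<^sub>R k) + f x) - t\<^sup>2 * (h \<bullet> (?A *v k))\<bar> \<le> t\<^sup>2 * (2 * e' * m\<^sup>2)"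
      using key[OF e', of h k] by (auto simp: m_def)
    obtain t2 where t2: "t2 > 0" "\<And>t. 0 < t \<Longrightarrow> t < t2 \<Longrightarrow>
      \<bar>(f (x + t *\<^sub>R k + t *\<^sub>R h) - f (x + t *\<^sub>R k) - f (x + t *\<^sub>R h) + f x) - t\<^sup>2 * (k \<bullet> (?A *v h))\<bar> \<le> t\<^sup>2 * (2 * e' * m\<^sup>2)"
      using key[OF e', of k h] by (auto simp: m_def)
    define t where "t = min t1 t2 / 2"
    have t: "0 < t" "t < t1" "t < t2" using t1(1) t2(1) by (auto simp: t_def)
    have eq: "x + t *\<^sub>R k + t *\<^sub>R h = x + t *\<^sub>R h + t *\<^sub>R k" by (simp add: algebra_simps)
    have "\<bar>t\<^sup>2 * (h \<bullet> (?A *v k)) - t\<^sup>2 * (k \<bullet> (?A *v h))\<bar> \<le> t\<^sup>2 * (2 * e' * m\<^sup>2) + t\<^sup>2 * (2 * e' * m\<^sup>2)"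
      using t1(2)[OF t(1,2)] t2(2)[OF t(1,3)] unfolding eq by linarith
    then have "t\<^sup>2 * \<bar>h \<bullet> (?A *v k) - k \<bullet> (?A *v h)\<bar> \<le> t\<^sup>2 * (4 * e' * m\<^sup>2)"
      by (simp add: abs_mult mult_ac flip: right_diff_distrib)
    then have "\<bar>h \<bullet> (?A *v k) - k \<bullet> (?A *v h)\<bar> \<le> 4 * e' * m\<^sup>2" using t by simp
    also have "4 * e' * m\<^sup>2 = e * (m\<^sup>2 / (m\<^sup>2 + 1))"
    proof -
      have "4 * (e / (4 * X)) * y = e * (y / X)" for X y :: real by simp
      then show ?thesis unfolding e'_def .
    qed
    also have "\<dots> \<le> e * 1"
    proof (intro mult_left_mono)
      have "m\<^sup>2 + 1 > 0" by (intro add_nonneg_pos) auto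
      then show "m\<^sup>2 / (m\<^sup>2 + 1) \<le> 1" by (subst divide_le_eq_1_pos) auto
    qed (use e in auto)
    finally show ?thesis by simp
  qed
  note small = this
  have "\<bar>h \<bullet> (?A *v k) - k \<bullet> (?A *v h)\<bar> \<le> 0" by (rule field_le_epsilon) (simp add: small)
  then show ?thesis by simp
qed

section \<open>Norm bounds by coordinates\<close>

lemma norm_le_card:
  assumes "\<And>i. \<bar>(z::real^'n) $ i\<bar> \<le> L" shows "norm z \<le> real CARD('n) * L"
proof -
  have "norm z \<le> (\<Sum>i\<in>UNIV. \<bar>z $ i\<bar>)" by (rule norm_le_l1_cart)
  also have "\<dots> \<le> (\<Sum>i\<in>(UNIV::'n set). L)" by (intro sum_mono assms)
  finally show ?thesis by simp
qed

lemma norm_matrix_vector_le: "norm (B *v h) \<le> real CARD('n) * norm B * norm (h :: real^'n)"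
  for B :: "real^'n^'n"
proof -
  have "norm (B *v h) \<le> real CARD('n) * (norm B * norm h)"
  proof (rule norm_le_card)
    fix i
    have "(B *v h) $ i = B $ i \<bullet> h" by (simp add: matrix_vector_mult_def inner_vec_def)
    then have "\<bar>(B *v h) $ i\<bar> \<le> norm (B $ i) * norm h" using Cauchy_Schwarz_ineq2[of "B $ i" h] by simp
    also have "\<dots> \<le> norm B * norm h" by (intro mult_right_mono Finite_Cartesian_Product.norm_nth_le) auto
    finally show "\<bar>(B *v h) $ i\<bar> \<le> norm B * norm h" .
  qed
  then show ?thesis by (simp add: mult.assoc)
qed

section \<open>Quadratic programs over a cone\<close>

definition quad :: "real^'n^'n \<Rightarrow> real^'n \<Rightarrow> real^'n \<Rightarrow> real" where
  "quad A g h = g \<bullet> h + 1/2 * (h \<bullet> (A *v h))"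

text \<open>The limit law is the law of \<open>sol\<close> applied to a Gaussian vector. Strong convexity gives all that is
  used about \<open>sol\<close>: it is Lipschitz, and near-minimizers are close to it.\<close>

locale quadratic_program =
  fixes A :: "real^'n^'n" and c :: real and C :: "(real^'n) set"
  assumes c: "c > 0" and coercive: "\<And>h. c * (norm h)\<^sup>2 \<le> h \<bullet> (A *v h)"
    and sym: "\<And>h k. h \<bullet> (A *v k) = k \<bullet> (A *v h)"
    and convex: "convex C" and closed: "closed C" and zero: "0 \<in> C"
begin

definition sol :: "real^'n \<Rightarrow> real^'n" where
  "sol g = arg_min_on (\<lambda>h. sqnorm A (h + matrix_inv A *v g)) C"

lemma matrix_inv_mult: "A *v (matrix_inv A *v g) = g"
proof -
  have "inj ((*v) A)"
  proof (rule linear_injective_0[THEN iffD2, OF matrix_vector_mul_linear], intro allI impI)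
    fix h assume "A *v h = 0"
    then have "c * (norm h)\<^sup>2 \<le> 0" using coercive[of h] by simp
    then show "h = 0" using c by (simp add: mult_le_0_iff)
  qed
  then have "invertible A" by (simp add: invertible_left_inverse matrix_left_invertible_injective)
  then have "A ** matrix_inv A = mat 1"
    unfolding invertible_def matrix_inv_def by (rule someI2_ex) blast
  then show ?thesis by (simp add: matrix_vector_mul_assoc)
qed

text \<open>Completing the square: the projection of the definition of the limit law minimizes \<open>quad A g\<close>. Here
  the symmetry of \<open>A\<close> is essential.\<close>

lemma sqnorm_quad: "sqnorm A (h + matrix_inv A *v g) = 2 * quad A g h + g \<bullet> (matrix_inv A *v g)"
proof -
  let ?p = "matrix_inv A *v g"
  have "sqnorm A (h + ?p) = h \<bullet> (A *v h) + h \<bullet> g + ?p \<bullet> (A *v h) + ?p \<bullet> g"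
    by (simp add: sqnorm_def matrix_vector_right_distrib matrix_inv_mult inner_add_left inner_add_right)
  also have "?p \<bullet> (A *v h) = h \<bullet> g" using sym[of ?p h] by (simp add: matrix_inv_mult)
  finally show ?thesis by (simp add: quad_def inner_commute algebra_simps)
qed

lemma quad_mid: "quad A g ((1/2) *\<^sub>R (h + k)) = quad A g h / 2 + quad A g k / 2 - 1/8 * ((h - k) \<bullet> (A *v (h - k)))"
  using sym[of h k] by (simp add: quad_def matrix_vector_mult_scaleR matrix_vector_right_distrib
      matrix_vector_mult_diff_distrib inner_add_left inner_add_right inner_diff_left inner_diff_right) argo

lemma exists_minimizer: "\<exists>h\<in>C. \<forall>k\<in>C. quad A g h \<le> quad A g k"
proof -
  define R where "R = 2 * norm g / c"
  have R: "R \<ge> 0" using c by (simp add: R_def)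
  have cont: "continuous_on (C \<inter> cball 0 R) (quad A g)"
    unfolding quad_def[abs_def] by (intro continuous_intros)
  have "compact (C \<inter> cball 0 R)" using closed by (intro closed_Int_compact) auto
  moreover have "C \<inter> cball 0 R \<noteq> {}" using zero R by auto
  ultimately obtain h where h: "h \<in> C \<inter> cball 0 R" "\<And>k. k \<in> C \<inter> cball 0 R \<Longrightarrow> quad A g h \<le> quad A g k"
    using continuous_attains_inf[OF _ _ cont] by blast
  have "quad A g h \<le> quad A g k" if k: "k \<in> C" for k
  proof (cases "norm k \<le> R")
    case True
    then show ?thesis using h k by auto
  next
    case False
    have "quad A g h \<le> quad A g 0" using h(2)[of 0] zero R by auto
    also have "quad A g 0 = 0" by (simp add: quad_def)
    also have "0 \<le> norm k * (c / 2 * norm k - norm g)"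
      using False c by (intro mult_nonneg_nonneg) (auto simp: R_def field_simps)
    also have "\<dots> \<le> quad A g k"
    proof -
      have "\<bar>g \<bullet> k\<bar> \<le> norm g * norm k" by (rule Cauchy_Schwarz_ineq2)
      then have "g \<bullet> k \<ge> - (norm g * norm k)" by linarith
      then show ?thesis using coercive[of k] by (simp add: quad_def power2_eq_square algebra_simps)
    qed
    finally show ?thesis .
  qed
  then show ?thesis using h by blast
qed

lemma sol_minimizes: "sol g \<in> C" "k \<in> C \<Longrightarrow> quad A g (sol g) \<le> quad A g k"
proof -
  obtain h where h: "h \<in> C" "\<And>k. k \<in> C \<Longrightarrow> quad A g h \<le> quad A g k" using exists_minimizer by blast
  have "is_arg_min (\<lambda>h. sqnorm A (h + matrix_inv A *v g)) (\<lambda>h. h \<in> C) h"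
    using h unfolding is_arg_min_linorder sqnorm_quad by auto
  then have "is_arg_min (\<lambda>h. sqnorm A (h + matrix_inv A *v g)) (\<lambda>h. h \<in> C) (sol g)"
    unfolding sol_def arg_min_on_def arg_min_def by (rule someI)
  then show "sol g \<in> C" "k \<in> C \<Longrightarrow> quad A g (sol g) \<le> quad A g k"
    unfolding is_arg_min_linorder sqnorm_quad by auto
qed

text \<open>Comparison with the midpoint of \<open>h\<close> and \<open>sol g\<close>, which lies in the convex set \<open>C\<close>.\<close>

lemma quad_growth:
  assumes h: "h \<in> C"
  shows "quad A g (sol g) + c / 4 * (norm (h - sol g))\<^sup>2 \<le> quad A g h"
proof -
  have "(1/2) *\<^sub>R (h + sol g) \<in> C"
    using convexD[OF convex h sol_minimizes(1)[of g], of "1/2" "1/2"] by (simp add: scaleR_add_right)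
  then have "quad A g (sol g) \<le> quad A g ((1/2) *\<^sub>R (h + sol g))" by (rule sol_minimizes)
  then show ?thesis using coercive[of "h - sol g"] unfolding quad_mid by argo
qed

text \<open>Adding the growth inequalities at \<open>g\<close> and at \<open>g'\<close> cancels the quadratic terms.\<close>

lemma sol_lipschitz: "norm (sol g - sol g') \<le> 2 / c * norm (g - g')"
proof -
  define D where "D = norm (sol g - sol g')"
  have "quad A g (sol g) + c / 4 * D\<^sup>2 \<le> quad A g (sol g')"
    using quad_growth[OF sol_minimizes(1)[of g'], of g] by (simp add: D_def norm_minus_commute)
  moreover have "quad A g' (sol g') + c / 4 * D\<^sup>2 \<le> quad A g' (sol g)"
    using quad_growth[OF sol_minimizes(1)[of g], of g'] by (simp add: D_def)
  ultimately have "c / 2 * D\<^sup>2 \<le> (g - g') \<bullet> (sol g' - sol g)"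
    by (simp add: quad_def inner_diff_left inner_diff_right)
  also have "\<dots> \<le> norm (g - g') * D"
    using Cauchy_Schwarz_ineq2[of "g - g'" "sol g' - sol g"] by (simp add: D_def norm_minus_commute)
  finally have "D * (c / 2 * D) \<le> D * norm (g - g')" by (simp add: power2_eq_square mult_ac)
  then have "c / 2 * D \<le> norm (g - g')"
    using c by (cases "D = 0") (auto simp: D_def)
  then show ?thesis using c by (simp add: D_def field_simps)
qed

lemma sol_0: "sol 0 = 0"
proof -
  have "quad A 0 (sol 0) + c / 4 * (norm (0 - sol 0))\<^sup>2 \<le> quad A 0 0"
    by (rule quad_growth[OF zero])
  moreover have "quad A 0 (sol 0) \<ge> 0" using coercive[of "sol 0"] c by (simp add: quad_def) (smt (verit) mult_nonneg_nonneg zero_le_power2)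
  ultimately have "c / 4 * (norm (sol 0))\<^sup>2 \<le> 0" by (simp add: quad_def)
  then show ?thesis using c by (simp add: mult_le_0_iff)
qed

lemma norm_sol: "norm (sol g) \<le> 2 / c * norm g"
  using sol_lipschitz[of g 0] by (simp add: sol_0)

lemma near_minimizer_close:
  assumes h: "h \<in> C" and le: "quad A g h \<le> quad A g (sol g) + \<delta>" and d: "4 * \<delta> \<le> c * r\<^sup>2" "r \<ge> 0"
  shows "norm (h - sol g) \<le> r"
proof -
  have "c * (norm (h - sol g))\<^sup>2 \<le> c * r\<^sup>2" using quad_growth[OF h, of g] le d by linarith
  then show ?thesis using c d(2) by (simp add: power2_le_iff_abs_le)
qed

lemma sol_measurable[measurable]: "sol \<in> borel_measurable borel"
proof -
  have "(2 / c)-lipschitz_on UNIV sol"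
    using c by (intro lipschitz_onI) (auto simp: dist_norm intro!: order_trans[OF sol_lipschitz])
  then have "continuous_on UNIV sol" by (rule lipschitz_on_continuous_on)
  then show ?thesis by (rule borel_measurable_continuous_onI)
qed

end

section \<open>The highest paced bid\<close>

definition top_bid :: "('n::finite \<Rightarrow> 'a \<Rightarrow> real) \<Rightarrow> real^'n \<Rightarrow> 'a \<Rightarrow> real" where
  "top_bid v \<beta> x = Max (range (\<lambda>i. \<beta> $ i * v i x))"

lemma F_obj_top_bid: "F_obj v b x \<beta> = top_bid v \<beta> x - (\<Sum>i\<in>UNIV. b $ i * ln (\<beta> $ i))"
  by (simp add: F_obj_def top_bid_def)

lemma top_bid_ge: "\<beta> $ i * v i x \<le> top_bid v \<beta> x"
  unfolding top_bid_def by (rule Max_ge) auto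

lemma top_bid_attained: obtains i where "top_bid v \<beta> x = \<beta> $ i * v i x"
proof -
  have "top_bid v \<beta> x \<in> range (\<lambda>i. \<beta> $ i * v i x)" unfolding top_bid_def by (rule Max_in) auto
  then show thesis using that by auto
qed

lemma top_bid_le_iff: "top_bid v \<beta> x \<le> r \<longleftrightarrow> (\<forall>i. \<beta> $ i * v i x \<le> r)"
  unfolding top_bid_def by (subst Max_le_iff) auto

lemma top_bid_convex:
  assumes "0 \<le> s" "s \<le> 1"
  shows "top_bid v ((1 - s) *\<^sub>R a + s *\<^sub>R c) x \<le> (1 - s) * top_bid v a x + s * top_bid v c x"
  unfolding top_bid_le_iff
proof
  fix i
  have "((1 - s) *\<^sub>R a + s *\<^sub>R c) $ i * v i x = (1 - s) * (a $ i * v i x) + s * (c $ i * v i x)"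
    by (simp add: algebra_simps)
  also have "\<dots> \<le> (1 - s) * top_bid v a x + s * top_bid v c x"
    using assms top_bid_ge by (intro add_mono mult_left_mono) auto
  finally show "((1 - s) *\<^sub>R a + s *\<^sub>R c) $ i * v i x \<le> (1 - s) * top_bid v a x + s * top_bid v c x" .
qed

lemma top_bid_lipschitz:
  assumes v: "\<And>i. 0 \<le> v i x" "\<And>i. v i x \<le> C"
  shows "\<bar>top_bid v a x - top_bid v c x\<bar> \<le> C * norm (a - c)"
proof -
  have "top_bid v a x \<le> top_bid v c x + C * norm (a - c)" for a c
    unfolding top_bid_le_iff
  proof
    fix i
    have "(a $ i - c $ i) * v i x \<le> \<bar>(a - c) $ i\<bar> * v i x" using v(1)[of i] by (intro mult_right_mono) auto
    also have "\<dots> \<le> norm (a - c) * C" using v[of i] component_le_norm_cart[of "a - c" i] by (intro mult_mono) auto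
    finally show "a $ i * v i x \<le> top_bid v c x + C * norm (a - c)"
      using top_bid_ge[of c i v x] by (simp add: algebra_simps)
  qed
  from this[of a c] this[of c a] show ?thesis by (simp add: norm_minus_commute)
qed

lemma top_bid_nonneg:
  assumes "\<And>i. 0 \<le> v i x" "\<And>i. 0 \<le> \<beta> $ i"
  shows "0 \<le> top_bid v \<beta> x"
  using top_bid_ge[of \<beta> undefined v x] assms by (meson mult_nonneg_nonneg order_trans)

lemma top_bid_le:
  assumes "\<And>i. 0 \<le> v i x" "\<And>i. v i x \<le> C" "\<And>i. 0 \<le> \<beta> $ i" "\<And>i. \<beta> $ i \<le> 1"
  shows "top_bid v \<beta> x \<le> C"
  unfolding top_bid_le_iff
proof
  fix i
  have "\<beta> $ i * v i x \<le> 1 * C" using assms order_trans[OF assms(1,2)] by (intro mult_mono) auto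
  then show "\<beta> $ i * v i x \<le> C" by simp
qed

lemma top_bid_measurable[measurable]:
  assumes [measurable]: "\<And>i. v i \<in> borel_measurable M"
  shows "top_bid v \<beta> \<in> borel_measurable M"
  unfolding top_bid_def[abs_def]
  by (intro borel_measurable_Max) auto

text \<open>The valuation of the winning buyer in the winner's coordinate. It is the gradient of the highest paced
  bid wherever this exists; on ties it is \<open>0\<close> by convention, so that it is measurable.\<close>

definition win_grad :: "('n::finite \<Rightarrow> 'a \<Rightarrow> real) \<Rightarrow> real^'n \<Rightarrow> 'a \<Rightarrow> real^'n" where
  "win_grad v \<beta> x = (\<chi> i. if \<forall>j. j \<noteq> i \<longrightarrow> \<beta> $ j * v j x < \<beta> $ i * v i x then v i x else 0)"

text \<open>A winner with margin \<open>\<delta>\<close>, or an item that nobody values. The second case belongs here although all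
  bids tie: the highest paced bid vanishes identically, so it is still linear.\<close>

definition clear_win :: "('n::finite \<Rightarrow> 'a \<Rightarrow> real) \<Rightarrow> real^'n \<Rightarrow> real \<Rightarrow> 'a \<Rightarrow> bool" where
  "clear_win v \<beta> \<delta> x \<longleftrightarrow> (\<exists>i. \<forall>j. j \<noteq> i \<longrightarrow> \<beta> $ j * v j x + \<delta> < \<beta> $ i * v i x) \<or> (\<forall>i. v i x = 0)"

lemma clear_win_mono: "clear_win v \<beta> \<delta> x \<Longrightarrow> \<delta>' \<le> \<delta> \<Longrightarrow> clear_win v \<beta> \<delta>' x"
  unfolding clear_win_def by (meson add_left_mono le_less_trans)

lemma clear_win_measurable[measurable]:
  assumes [measurable]: "\<And>i. v i \<in> borel_measurable M"
  shows "Measurable.pred M (clear_win v \<beta> \<delta>)"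
  unfolding clear_win_def[abs_def] by measurable

lemma win_grad_measurable[measurable]:
  assumes [measurable]: "\<And>i. v i \<in> borel_measurable M"
  shows "(\<lambda>x. win_grad v \<beta> x $ i) \<in> borel_measurable M"
  unfolding win_grad_def by (simp, measurable)

text \<open>Moving every coordinate by at most \<open>\<delta> / (2 * C)\<close> changes each bid by at most \<open>\<delta> / 2\<close>, so the winner
  does not change.\<close>

lemma top_bid_linear:
  assumes v: "\<And>i. 0 \<le> v i x" "\<And>i. v i x \<le> C" and cw: "clear_win v \<beta> \<delta> x"
    and y: "\<And>i. 2 * C * \<bar>y $ i - \<beta> $ i\<bar> \<le> \<delta>" and \<delta>: "\<delta> \<ge> 0"
  shows "top_bid v y x = y \<bullet> win_grad v \<beta> x"
  using cw unfolding clear_win_def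
proof
  assume "\<exists>i. \<forall>j. j \<noteq> i \<longrightarrow> \<beta> $ j * v j x + \<delta> < \<beta> $ i * v i x"
  then obtain i where i: "\<And>j. j \<noteq> i \<Longrightarrow> \<beta> $ j * v j x + \<delta> < \<beta> $ i * v i x" by blast
  have near: "\<bar>y $ j * v j x - \<beta> $ j * v j x\<bar> \<le> \<delta> / 2" for j
  proof -
    have "\<bar>y $ j - \<beta> $ j\<bar> * v j x \<le> \<bar>y $ j - \<beta> $ j\<bar> * C" using v by (intro mult_left_mono) auto
    also have "\<dots> \<le> \<delta> / 2" using y[of j] by (simp add: mult_ac)
    finally show ?thesis using v(1)[of j] by (simp add: abs_mult flip: left_diff_distrib)
  qed
  have "top_bid v y x = y $ i * v i x"
  proof (rule antisym[OF _ top_bid_ge], unfold top_bid_le_iff, rule allI)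
    fix j show "y $ j * v j x \<le> y $ i * v i x"
    proof (cases "j = i")
      case False
      then show ?thesis using near[of i] near[of j] i[OF False] by linarith
    qed simp
  qed
  moreover have "win_grad v \<beta> x = (\<chi> j. if j = i then v i x else 0)"
    unfolding vec_eq_iff
  proof
    fix k
    show "win_grad v \<beta> x $ k = (\<chi> j. if j = i then v i x else 0) $ k"
    proof (cases "k = i")
      case True
      have "\<forall>j. j \<noteq> i \<longrightarrow> \<beta> $ j * v j x < \<beta> $ i * v i x" using i \<delta> by force
      then show ?thesis using True by (simp add: win_grad_def)
    next
      case False
      have "\<not> \<beta> $ i * v i x < \<beta> $ k * v k x" using i[OF False] \<delta> by linarith
      then show ?thesis using False by (auto simp: win_grad_def)
    qed
  qed
  then have "y \<bullet> win_grad v \<beta> x = y $ i * v i x"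
    by (simp add: inner_vec_def if_distrib[of "\<lambda>z. _ * z"] cong: if_cong)
  ultimately show ?thesis by simp
next
  assume z: "\<forall>i. v i x = 0"
  then have "win_grad v \<beta> x = 0" by (simp add: win_grad_def vec_eq_iff)
  moreover have "top_bid v y x = 0" using z top_bid_attained[of v y x] by (metis mult_zero_right)
  ultimately show ?thesis by simp
qed

lemma win_grad_bound:
  assumes "\<And>i. 0 \<le> v i x" "\<And>i. v i x \<le> C"
  shows "\<bar>win_grad v \<beta> x $ i\<bar> \<le> C"
  using assms[of i] by (auto simp: win_grad_def)

lemma not_clear_winD:
  assumes n: "\<not> clear_win v \<beta> 0 x" and v: "\<And>i. 0 \<le> v i x" and \<beta>: "\<And>i. 0 < \<beta> $ i"
  obtains i j where "i \<noteq> j" "v i x > 0" "top_bid v \<beta> x = \<beta> $ i * v i x" "top_bid v \<beta> x = \<beta> $ j * v j x"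
proof -
  obtain i where i: "top_bid v \<beta> x = \<beta> $ i * v i x" by (rule top_bid_attained)
  obtain k where k: "v k x > 0" using n v unfolding clear_win_def by (metis less_eq_real_def)
  have "0 < \<beta> $ k * v k x" using k \<beta> by simp
  also have "\<dots> \<le> top_bid v \<beta> x" by (rule top_bid_ge)
  finally have "v i x \<noteq> 0" using i by auto
  then have vi: "v i x > 0" using v[of i] by simp
  obtain j where j: "j \<noteq> i" "\<not> \<beta> $ j * v j x < \<beta> $ i * v i x" using n unfolding clear_win_def by auto
  have "top_bid v \<beta> x = \<beta> $ j * v j x" using j i top_bid_ge[of \<beta> j v x] by auto
  then show thesis using that[of i j] vi i j(1) by metis
qed

text \<open>At a tie the bid has a kink: raising \<open>\<beta> $ i\<close> raises the maximum, while lowering it leaves the maximum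
  to buyer \<open>j\<close>.\<close>

lemma tie_second_difference:
  assumes v: "\<And>i. 0 \<le> v i x" and ij: "i \<noteq> j" "top_bid v \<beta> x = \<beta> $ i * v i x" "top_bid v \<beta> x = \<beta> $ j * v j x"
  shows "top_bid v (\<beta> + h *\<^sub>R axis i 1) x + top_bid v (\<beta> - h *\<^sub>R axis i 1) x - 2 * top_bid v \<beta> x \<ge> h * v i x"
proof -
  have "top_bid v (\<beta> + h *\<^sub>R axis i 1) x \<ge> top_bid v \<beta> x + h * v i x"
    using top_bid_ge[of "\<beta> + h *\<^sub>R axis i 1" i v x] ij by (simp add: algebra_simps)
  moreover have "top_bid v (\<beta> - h *\<^sub>R axis i 1) x \<ge> top_bid v \<beta> x"
    using top_bid_ge[of "\<beta> - h *\<^sub>R axis i 1" j v x] ij by (simp add: axis_def)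
  ultimately show ?thesis by simp
qed

lemma second_difference_nonneg:
  "top_bid v (\<beta> + h) x + top_bid v (\<beta> - h) x - 2 * top_bid v \<beta> x \<ge> 0"
  using top_bid_convex[of "1/2" v "\<beta> + h" "\<beta> - h" x] by (simp add: algebra_simps flip: scaleR_add_left)

section \<open>Convex objectives with a logarithmic barrier\<close>

definition log_obj :: "(real^'n \<Rightarrow> real) \<Rightarrow> real^'n \<Rightarrow> real^'n \<Rightarrow> real" where
  "log_obj g b \<beta> = g \<beta> - (\<Sum>i\<in>UNIV. b $ i * ln (\<beta> $ i))"

text \<open>On \<open>(0, 1]\<close> the function \<open>- ln\<close> is strongly convex with modulus \<open>1\<close>.\<close>

lemma ln_mid:
  fixes a c :: real assumes "0 < a" "a \<le> 1" "0 < c" "c \<le> 1"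
  shows "- ln ((a + c) / 2) \<le> - ln a / 2 - ln c / 2 - (a - c)\<^sup>2 / 8"
proof -
  define m where "m = (a + c) / 2"
  have m: "0 < m" "m \<le> 1" using assms by (auto simp: m_def)
  have eq: "a * c / m\<^sup>2 = 1 - (a - c)\<^sup>2 / (4 * m\<^sup>2)"
  proof -
    have "a * c = m\<^sup>2 - (a - c)\<^sup>2 / 4" by (simp add: m_def field_simps power2_eq_square)
    then show ?thesis using m by (simp add: diff_divide_distrib)
  qed
  have "ln a + ln c - 2 * ln m = ln (a * c / m\<^sup>2)"
    using assms m by (simp add: ln_mult ln_div ln_realpow)
  also have "\<dots> \<le> a * c / m\<^sup>2 - 1" using assms m by (intro ln_le_minus_one) auto
  also have "\<dots> = - ((a - c)\<^sup>2 / (4 * m\<^sup>2))" unfolding eq by simp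
  also have "\<dots> \<le> - ((a - c)\<^sup>2 / 4)"
  proof -
    have "m\<^sup>2 \<le> 1" using m by (simp add: power_le_one)
    then have "(a - c)\<^sup>2 / 4 \<le> (a - c)\<^sup>2 / (4 * m\<^sup>2)" using m by (intro divide_left_mono) auto
    then show ?thesis by simp
  qed
  finally show ?thesis by (simp add: m_def)
qed

lemma ln_convex:
  fixes a c s :: real assumes "0 < a" "0 < c" "0 \<le> s" "s \<le> 1"
  shows "- ln ((1 - s) * a + s * c) \<le> (1 - s) * - ln a + s * - ln c"
proof -
  have "convex_on {0<..} (\<lambda>x::real. - ln x)" using ln_concave by (simp add: concave_on_def)
  from convex_onD[OF this, of s a c] show ?thesis using assms by simp
qed

text \<open>Both the population and the observed objective are \<open>log_obj g b\<close> for a convex Lipschitz function \<open>g\<close>: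
  the mean of the highest paced bid under the supply or under the sample.\<close>

locale barrier =
  fixes g :: "real^'n \<Rightarrow> real" and b :: "real^'n" and C b0 :: real
  assumes g_convex: "\<And>a c s. 0 \<le> s \<Longrightarrow> s \<le> 1 \<Longrightarrow> g ((1 - s) *\<^sub>R a + s *\<^sub>R c) \<le> (1 - s) * g a + s * g c"
    and g_lip: "\<And>a c. \<bar>g a - g c\<bar> \<le> C * norm (a - c)"
    and g_nonneg: "\<And>\<beta>. (\<And>i. 0 \<le> \<beta> $ i) \<Longrightarrow> 0 \<le> g \<beta>"
    and g_one: "g (\<chi> i. 1) \<le> C"
    and C: "C > 0" and b0: "b0 > 0" and b: "\<And>i. b0 \<le> b $ i"
begin

lemma b_pos: "0 < b $ i" using b0 b[of i] by simp

text \<open>Below \<open>low $ i\<close> the barrier of buyer \<open>i\<close> alone exceeds \<open>C\<close>, an upper bound for the objective at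
  \<open>(1, \<dots>, 1)\<close>. Minimization over the half-open box thus takes place on a compact box that depends only
  on \<open>b\<close> and \<open>C\<close>.\<close>

definition low :: "real^'n" where "low = (\<chi> i. exp (- C / b $ i))"

lemma low: "0 < low $ i" "low $ i \<le> 1"
  using C b_pos[of i] by (auto simp: low_def)

lemma continuous_g: "continuous_on S g"
proof -
  have "C-lipschitz_on S g" using C by (intro lipschitz_onI) (auto simp: dist_norm g_lip)
  then show ?thesis by (rule lipschitz_on_continuous_on)
qed

lemma continuous_log_obj: "continuous_on (pos_orthant :: (real^'n) set) (log_obj g b)"
  unfolding log_obj_def[abs_def]
  by (intro continuous_intros continuous_g) (auto simp: pos_orthant_def, metis less_irrefl)

lemma log_obj_one: "log_obj g b (\<chi> i. 1) \<le> C"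
  using g_one by (simp add: log_obj_def)

lemma below_low:
  assumes "\<beta> \<in> pacing_box" "\<not> low $ i \<le> \<beta> $ i"
  shows "C < log_obj g b \<beta>"
proof -
  have \<beta>: "0 < \<beta> $ j" "\<beta> $ j \<le> 1" for j using assms(1) by (auto simp: pacing_box_def)
  have "ln (\<beta> $ i) < ln (exp (- C / b $ i))" using assms(2) \<beta>[of i] by (subst ln_less_cancel_iff) (auto simp: low_def)
  then have "ln (\<beta> $ i) < - C / b $ i" by simp
  then have "C < b $ i * - ln (\<beta> $ i)" using b_pos[of i] by (simp add: field_simps)
  also have "\<dots> \<le> (\<Sum>j\<in>UNIV. b $ j * - ln (\<beta> $ j))"
    using \<beta> b_pos by (intro member_le_sum) (auto intro!: mult_nonneg_nonpos simp: less_imp_le)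
  also have "\<dots> \<le> log_obj g b \<beta>"
    using g_nonneg[of \<beta>] \<beta> by (simp add: log_obj_def sum_negf less_imp_le)
  finally show ?thesis .
qed

lemma exists_arg_min: "\<exists>\<beta>\<in>cbox low (\<chi> i. 1). is_arg_min (log_obj g b) (\<lambda>\<beta>. \<beta> \<in> pacing_box) \<beta>"
proof -
  have sub: "cbox low (\<chi> i. 1) \<subseteq> pos_orthant" "cbox low (\<chi> i. 1) \<subseteq> pacing_box"
    using low(1) by (auto simp: mem_box_cart pos_orthant_def pacing_box_def) (metis less_le_trans)+
  have "(\<chi> i. 1) \<in> cbox low (\<chi> i. 1)" using low by (auto simp: mem_box_cart)
  then obtain \<beta> where \<beta>: "\<beta> \<in> cbox low (\<chi> i. 1)" "\<And>y. y \<in> cbox low (\<chi> i. 1) \<Longrightarrow> log_obj g b \<beta> \<le> log_obj g b y"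
    using continuous_attains_inf[OF compact_cbox _ continuous_on_subset[OF continuous_log_obj sub(1)]] by blast
  have "log_obj g b \<beta> \<le> log_obj g b y" if y: "y \<in> pacing_box" for y
  proof (cases "\<forall>i. low $ i \<le> y $ i")
    case True
    then show ?thesis using y \<beta> by (auto simp: mem_box_cart pacing_box_def)
  next
    case False
    then obtain i where "\<not> low $ i \<le> y $ i" by blast
    from below_low[OF y this] have "C < log_obj g b y" .
    moreover have "log_obj g b \<beta> \<le> log_obj g b (\<chi> i. 1)" using low by (intro \<beta>) (auto simp: mem_box_cart)
    ultimately show ?thesis using log_obj_one by simp
  qed
  then show ?thesis using \<beta>(1) sub(2) by (auto simp: is_arg_min_linorder)
qed

lemma arg_min_on_is_arg_min: "is_arg_min (log_obj g b) (\<lambda>\<beta>. \<beta> \<in> pacing_box) (arg_min_on (log_obj g b) pacing_box)"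
  unfolding arg_min_on_def arg_min_def using exists_arg_min by (meson someI_ex)

lemma arg_min_in_cbox:
  assumes "is_arg_min (log_obj g b) (\<lambda>\<beta>. \<beta> \<in> pacing_box) \<beta>"
  shows "\<beta> \<in> cbox low (\<chi> i. 1)"
proof -
  have \<beta>: "\<beta> \<in> pacing_box" "\<And>y. y \<in> pacing_box \<Longrightarrow> log_obj g b \<beta> \<le> log_obj g b y"
    using assms by (auto simp: is_arg_min_linorder)
  have "log_obj g b \<beta> \<le> log_obj g b (\<chi> i. 1)" by (rule \<beta>) (simp add: pacing_box_def)
  then have "log_obj g b \<beta> \<le> C" using log_obj_one by simp
  then have "low $ i \<le> \<beta> $ i" for i using below_low[OF \<beta>(1), of i] by force
  then show ?thesis using \<beta>(1) by (auto simp: mem_box_cart pacing_box_def)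
qed

lemma log_obj_convex:
  assumes "a \<in> pos_orthant" "c \<in> pos_orthant" "0 \<le> s" "s \<le> 1"
  shows "log_obj g b ((1 - s) *\<^sub>R a + s *\<^sub>R c) \<le> (1 - s) * log_obj g b a + s * log_obj g b c"
proof -
  have "(\<Sum>i\<in>UNIV. b $ i * - ln (((1 - s) *\<^sub>R a + s *\<^sub>R c) $ i))
    \<le> (\<Sum>i\<in>UNIV. b $ i * ((1 - s) * - ln (a $ i) + s * - ln (c $ i)))"
    using assms b_pos ln_convex[of "a $ _" "c $ _" s]
    by (intro sum_mono mult_left_mono) (auto simp: pos_orthant_def less_imp_le)
  also have "\<dots> = (1 - s) * (\<Sum>i\<in>UNIV. b $ i * - ln (a $ i)) + s * (\<Sum>i\<in>UNIV. b $ i * - ln (c $ i))"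
    by (simp only: sum_distrib_left sum.distrib[symmetric]) (intro sum.cong refl, simp add: algebra_simps)
  finally show ?thesis using g_convex[OF assms(3,4), of a c]
    by (simp add: log_obj_def sum_negf algebra_simps)
qed

lemma log_obj_mid:
  assumes "a \<in> pacing_box" "c \<in> pacing_box"
  shows "log_obj g b ((1/2) *\<^sub>R (a + c)) \<le> log_obj g b a / 2 + log_obj g b c / 2 - b0 / 8 * (norm (a - c))\<^sup>2"
proof -
  have "(\<Sum>i\<in>UNIV. b $ i * - ln (((1/2) *\<^sub>R (a + c)) $ i))
    \<le> (\<Sum>i\<in>UNIV. b $ i * (- ln (a $ i) / 2 - ln (c $ i) / 2 - (a $ i - c $ i)\<^sup>2 / 8))"
    using assms b_pos ln_mid[of "a $ _" "c $ _"]
    by (intro sum_mono mult_left_mono) (auto simp: pacing_box_def less_imp_le)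
  also have "\<dots> = (\<Sum>i\<in>UNIV. b $ i * - ln (a $ i)) / 2 + (\<Sum>i\<in>UNIV. b $ i * - ln (c $ i)) / 2 - (\<Sum>i\<in>UNIV. b $ i * (a $ i - c $ i)\<^sup>2) / 8"
    by (simp only: sum_divide_distrib sum.distrib[symmetric] sum_subtractf[symmetric]) (intro sum.cong refl, simp add: algebra_simps)
  also have "b0 * (norm (a - c))\<^sup>2 \<le> (\<Sum>i\<in>UNIV. b $ i * (a $ i - c $ i)\<^sup>2)"
    by (simp add: norm_vec_def L2_set_def sum_nonneg sum_distrib_left) (intro sum_mono mult_right_mono b, simp)
  then have "(\<Sum>i\<in>UNIV. b $ i * - ln (a $ i)) / 2 + (\<Sum>i\<in>UNIV. b $ i * - ln (c $ i)) / 2 - (\<Sum>i\<in>UNIV. b $ i * (a $ i - c $ i)\<^sup>2) / 8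
    \<le> (\<Sum>i\<in>UNIV. b $ i * - ln (a $ i)) / 2 + (\<Sum>i\<in>UNIV. b $ i * - ln (c $ i)) / 2 - b0 / 8 * (norm (a - c))\<^sup>2" by simp
  finally have "(\<Sum>i\<in>UNIV. b $ i * - ln (((1/2) *\<^sub>R (a + c)) $ i)) \<le> (\<Sum>i\<in>UNIV. b $ i * - ln (a $ i)) / 2 + (\<Sum>i\<in>UNIV. b $ i * - ln (c $ i)) / 2 - b0 / 8 * (norm (a - c))\<^sup>2" .
  moreover have "g ((1/2) *\<^sub>R (a + c)) \<le> g a / 2 + g c / 2"
    using g_convex[of "1/2" a c] by (simp add: scaleR_add_right)
  ultimately have f: "g ((1/2) *\<^sub>R (a + c)) + (\<Sum>i\<in>UNIV. b $ i * - ln (((1/2) *\<^sub>R (a + c)) $ i))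
    \<le> (g a + (\<Sum>i\<in>UNIV. b $ i * - ln (a $ i))) / 2 + (g c + (\<Sum>i\<in>UNIV. b $ i * - ln (c $ i))) / 2 - b0 / 8 * (norm (a - c))\<^sup>2"
    unfolding add_divide_distrib by argo
  have "log_obj g b \<beta> = g \<beta> + (\<Sum>i\<in>UNIV. b $ i * - ln (\<beta> $ i))" for \<beta>
    by (simp add: log_obj_def sum_negf)
  with f show ?thesis by (simp only:)
qed

lemma pacing_box_mid: "a \<in> pacing_box \<Longrightarrow> c \<in> pacing_box \<Longrightarrow> (1/2) *\<^sub>R (a + c) \<in> (pacing_box :: (real^'n) set)"
  unfolding pacing_box_def by auto (smt (verit))+

text \<open>The midpoint of \<open>y\<close> and the minimizer lies in the box. The growth is global and holds with the same
  constant for every sample, so it yields consistency and rates at once, and it shows that the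
  minimizer is unique.\<close>

lemma quadratic_growth:
  assumes "is_arg_min (log_obj g b) (\<lambda>\<beta>. \<beta> \<in> pacing_box) \<beta>" "y \<in> pacing_box"
  shows "log_obj g b \<beta> + b0 / 4 * (norm (y - \<beta>))\<^sup>2 \<le> log_obj g b y"
proof -
  have \<beta>: "\<beta> \<in> pacing_box" "\<And>y. y \<in> pacing_box \<Longrightarrow> log_obj g b \<beta> \<le> log_obj g b y"
    using assms by (auto simp: is_arg_min_linorder)
  have "log_obj g b \<beta> \<le> log_obj g b ((1/2) *\<^sub>R (y + \<beta>))" by (intro \<beta> pacing_box_mid assms)
  then show ?thesis using log_obj_mid[OF assms(2) \<beta>(1)] by argo
qed

end

section \<open>Measurability of minimizers\<close>

text \<open>The minimizer lies in a compact set \<open>S\<close> iff the infimum of \<open>f x\<close> over \<open>S\<close> equals its infimum over \<open>K\<close>.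
  By continuity both infima may be taken over countable dense subsets, which makes this a countable
  combination of measurable conditions.\<close>

lemma unique_minimizer_measurable:
  fixes f :: "'a \<Rightarrow> real^'n \<Rightarrow> real" and m :: "'a \<Rightarrow> real^'n"
  assumes meas: "\<And>\<beta>. (\<lambda>x. f x \<beta>) \<in> borel_measurable M"
    and cont: "\<And>x. x \<in> space M \<Longrightarrow> continuous_on K (f x)" and K: "compact K"
    and m: "\<And>x. x \<in> space M \<Longrightarrow> m x \<in> K"
    and uniq: "\<And>x \<beta>. x \<in> space M \<Longrightarrow> \<beta> \<in> K \<Longrightarrow> \<beta> \<noteq> m x \<Longrightarrow> f x (m x) < f x \<beta>"
  shows "m \<in> borel_measurable M"
  unfolding borel_measurable_iff_halfspace_le
proof (intro ballI allI)
  fix i :: "real^'n" and a :: real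
  have dense: "\<exists>q\<in>T. \<bar>h q - h y\<bar> < e"
    if "S \<subseteq> closure T" "T \<subseteq> S" "continuous_on S h" "y \<in> S" "e > 0" for S T and h :: "real^'n \<Rightarrow> real" and y e
  proof -
    obtain d where d: "d > 0" "\<And>q. q \<in> S \<Longrightarrow> dist q y < d \<Longrightarrow> dist (h q) (h y) < e"
      using \<open>continuous_on S h\<close> \<open>y \<in> S\<close> \<open>e > 0\<close> unfolding continuous_on_iff by blast
    have "y \<in> closure T" using that by blast
    then obtain q where "q \<in> T" "dist q y < d" using d(1) unfolding closure_approachable by blast
    then show ?thesis using d(2)[of q] that by (auto simp: dist_real_def)
  qed
  define S where "S = K \<inter> {\<beta>. \<beta> \<bullet> i \<le> a}"
  have "closed {\<beta>. \<beta> \<bullet> i \<le> a}" using closed_halfspace_le[of i a] by (simp add: inner_commute)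
  then have S: "compact S" unfolding S_def using K by (rule compact_Int_closed[rotated])
  obtain T where T: "countable T" "T \<subseteq> S" "S \<subseteq> closure T" by (rule separable)
  obtain D where D: "countable D" "D \<subseteq> K" "K \<subseteq> closure D" by (rule separable)
  have "{x\<in>space M. m x \<bullet> i \<le> a}
    = {x\<in>space M. \<forall>n::nat. \<exists>q\<in>T. \<forall>d\<in>D. f x q \<le> f x d + 1 / Suc n}" (is "?L = ?R")
  proof (intro set_eqI iffI)
    fix x assume "x \<in> ?L"
    then have x: "x \<in> space M" and mS: "m x \<in> S" using m by (auto simp: S_def)
    have "\<exists>q\<in>T. \<forall>d\<in>D. f x q \<le> f x d + 1 / Suc n" for n :: nat
    proof -
      have "continuous_on S (f x)" using cont[OF x] by (rule continuous_on_subset) (auto simp: S_def)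
      then obtain q where q: "q \<in> T" "\<bar>f x q - f x (m x)\<bar> < 1 / Suc n"
        using dense[OF T(3,2) _ mS, of "f x" "1 / Suc n"] by auto
      have "f x (m x) \<le> f x d" if "d \<in> D" for d
        using uniq[OF x, of d] D(2) that by (cases "d = m x") auto
      then show ?thesis using q by (intro bexI[of _ q] ballI) fastforce+
    qed
    then show "x \<in> ?R" using x by blast
  next
    fix x assume "x \<in> ?R"
    then have x: "x \<in> space M" and R: "\<And>n::nat. \<exists>q\<in>T. \<forall>d\<in>D. f x q \<le> f x d + 1 / Suc n" by auto
    have "S \<noteq> {}" using R[of 0] T(2) by blast
    moreover have "continuous_on S (f x)" using cont[OF x] by (rule continuous_on_subset) (auto simp: S_def)
    ultimately obtain c where c: "c \<in> S" "\<And>y. y \<in> S \<Longrightarrow> f x c \<le> f x y"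
      using continuous_attains_inf[OF S] by blast
    have "f x c \<le> f x (m x) + e" if e: "e > 0" for e
    proof -
      obtain n :: nat where n: "1 / Suc n < e / 2" using nat_approx_posE[of "e/2"] e by auto
      obtain q where q: "q \<in> T" "\<And>d. d \<in> D \<Longrightarrow> f x q \<le> f x d + 1 / Suc n" using R by blast
      obtain d where d: "d \<in> D" "\<bar>f x d - f x (m x)\<bar> < e / 2"
        using dense[OF D(3,2) cont[OF x] m[OF x], of "e/2"] e by auto
      have "f x c \<le> f x q" using c(2) q(1) T(2) by blast
      then show ?thesis using q(2)[OF d(1)] d(2) n by linarith
    qed
    then have "f x c \<le> f x (m x)" by (rule field_le_epsilon)
    then have "c = m x" using uniq[OF x, of c] c(1) by (force simp: S_def)
    then show "x \<in> ?L" using c(1) x by (auto simp: S_def)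
  qed
  also have "\<dots> \<in> sets M"
  proof (rule sets.sets_Collect_countable_All, rule sets.sets_Collect_countable_Ex'[OF _ T(1)], rule sets.sets_Collect_countable_All'[OF _ D(1)])
    fix n :: nat and q d
    note [measurable] = meas
    show "{x\<in>space M. f x q \<le> f x d + 1 / Suc n} \<in> sets M" by measurable
  qed
  finally show "{x\<in>space M. m x \<bullet> i \<le> a} \<in> sets M" .
qed

section \<open>The population problem\<close>

lemma ln_second_difference:
  fixes a d :: real
  assumes a: "0 < a" "a \<le> 1" and d: "\<bar>d\<bar> < a"
  shows "ln (a + d) + ln (a - d) - 2 * ln a \<le> - d\<^sup>2"
proof -
  have p: "0 < a + d" "0 < a - d" using d by auto
  have "ln (a + d) + ln (a - d) - 2 * ln a = ln ((a + d) * (a - d) / a\<^sup>2)"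
    using p a by (simp add: ln_mult ln_div ln_realpow)
  also have "\<dots> \<le> (a + d) * (a - d) / a\<^sup>2 - 1"
    using p a by (intro ln_le_minus_one) auto
  also have "(a + d) * (a - d) = a\<^sup>2 - d\<^sup>2" by (simp add: algebra_simps power2_eq_square)
  also have "(a\<^sup>2 - d\<^sup>2) / a\<^sup>2 - 1 = - (d\<^sup>2 / a\<^sup>2)" using a by (simp add: diff_divide_distrib)
  also have "\<dots> \<le> - d\<^sup>2"
  proof -
    have "a\<^sup>2 \<le> 1" using a by (simp add: power_le_one)
    then have "d\<^sup>2 / 1 \<le> d\<^sup>2 / a\<^sup>2" using a by (intro divide_left_mono) auto
    then show ?thesis by simp
  qed
  finally show ?thesis .
qed

lemma integral_abs_le:
  fixes f g :: "'b \<Rightarrow> real"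
  assumes "integrable M f" "integrable M g" "\<And>x. x \<in> space M \<Longrightarrow> \<bar>f x\<bar> \<le> g x"
  shows "\<bar>\<integral>x. f x \<partial>M\<bar> \<le> (\<integral>x. g x \<partial>M)"
  by (rule order_trans[OF integral_abs_bound integral_mono]) (use assms in auto)

text \<open>All computations take place under the law \<open>P\<close> of one item. The bound \<open>C\<close> is common to all valuations.\<close>

locale market =
  fixes \<Theta> :: "'a measure" and s :: "'a \<Rightarrow> real"
    and v :: "'n::finite \<Rightarrow> 'a \<Rightarrow> real" and b :: "real^'n" and C :: real
  assumes budgets: "\<And>i. b $ i > 0"
    and v_nonneg: "\<And>i x. x \<in> space \<Theta> \<Longrightarrow> v i x \<ge> 0"
    and v_le: "\<And>i x. x \<in> space \<Theta> \<Longrightarrow> v i x \<le> C" and C: "C > 0"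
    and v_measurable[measurable]: "\<And>i. v i \<in> borel_measurable \<Theta>"
    and s_nonneg: "\<And>x. x \<in> space \<Theta> \<Longrightarrow> s x \<ge> 0"
    and s_measurable[measurable]: "s \<in> borel_measurable \<Theta>"
    and s_prob: "prob_space (density \<Theta> (\<lambda>x. ennreal (s x)))"
begin

definition "P = density \<Theta> (\<lambda>x. ennreal (s x))"

sublocale P: prob_space P unfolding P_def by (rule s_prob)

lemma sets_P[measurable_cong, simp]: "sets P = sets \<Theta>" and space_P[simp]: "space P = space \<Theta>"
  by (simp_all add: P_def)

lemma prob_Theta: "measure P (space \<Theta>) = 1"
  using P.prob_space by simp

lemma E_supply_P:
  assumes [measurable]: "g \<in> borel_measurable \<Theta>"
  shows "E_supply \<Theta> s g = (\<integral>x. g x \<partial>P)"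
  unfolding P_def E_supply_def
  by (subst integral_density) (auto simp: mult.commute intro!: AE_I2 s_nonneg)

lemma integrable_bounded:
  fixes g :: "'a \<Rightarrow> real"
  assumes "g \<in> borel_measurable \<Theta>" "\<And>x. x \<in> space \<Theta> \<Longrightarrow> \<bar>g x\<bar> \<le> K"
  shows "integrable P g"
  using assms by (intro P.integrable_const_bound[where B=K]) auto

definition "b0 = Min (range (\<lambda>i. b $ i))"

lemma b0: "b0 > 0" "b0 \<le> b $ i"
  using budgets unfolding b0_def by (auto intro!: Min_le)

definition mean_bid :: "real^'n \<Rightarrow> real" where "mean_bid \<beta> = (\<integral>x. top_bid v \<beta> x \<partial>P)"

lemma top_bid_lip: "x \<in> space \<Theta> \<Longrightarrow> \<bar>top_bid v a x - top_bid v c x\<bar> \<le> C * norm (a - c)"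
  by (intro top_bid_lipschitz v_nonneg v_le)

lemma top_bid_zero: "top_bid v 0 x = 0"
  by (metis mult_zero_left top_bid_attained zero_index)

lemma top_bid_abs: "x \<in> space \<Theta> \<Longrightarrow> \<bar>top_bid v \<beta> x\<bar> \<le> C * norm \<beta>"
  using top_bid_lip[of x \<beta> 0] by (simp add: top_bid_zero)

lemma integrable_top_bid: "integrable P (top_bid v \<beta>)"
  by (rule integrable_bounded[OF _ top_bid_abs]) measurable

lemma barrier_mean_bid: "barrier mean_bid b C b0"
proof
  fix a c :: "real^'n" and r :: real assume r: "0 \<le> r" "r \<le> 1"
  have "mean_bid ((1 - r) *\<^sub>R a + r *\<^sub>R c) \<le> (\<integral>x. (1 - r) * top_bid v a x + r * top_bid v c x \<partial>P)"
    unfolding mean_bid_def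
    by (intro integral_mono integrable_top_bid Bochner_Integration.integrable_add integrable_mult_right top_bid_convex r)
  also have "\<dots> = (1 - r) * mean_bid a + r * mean_bid c"
    unfolding mean_bid_def using integrable_top_bid by simp
  finally show "mean_bid ((1 - r) *\<^sub>R a + r *\<^sub>R c) \<le> (1 - r) * mean_bid a + r * mean_bid c" .
next
  fix a c :: "real^'n"
  have "mean_bid a - mean_bid c = (\<integral>x. top_bid v a x - top_bid v c x \<partial>P)"
    unfolding mean_bid_def using integrable_top_bid by simp
  also have "\<bar>\<dots>\<bar> \<le> (\<integral>x. C * norm (a - c) \<partial>P)"
    by (intro integral_abs_le) (auto intro!: top_bid_lip integrable_top_bid)
  finally show "\<bar>mean_bid a - mean_bid c\<bar> \<le> C * norm (a - c)" by (simp add: prob_Theta)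
next
  fix \<beta> :: "real^'n" assume "\<And>i. 0 \<le> \<beta> $ i"
  then show "0 \<le> mean_bid \<beta>" unfolding mean_bid_def
    by (intro integral_nonneg_AE AE_I2 top_bid_nonneg) (auto intro: v_nonneg)
next
  have "mean_bid (\<chi> i. 1) \<le> (\<integral>x. C \<partial>P)" unfolding mean_bid_def
    by (intro integral_mono integrable_top_bid top_bid_le v_nonneg v_le) auto
  then show "mean_bid (\<chi> i. 1) \<le> C" by (simp add: prob_Theta)
qed (use C b0 in auto)

sublocale pop: barrier mean_bid b C b0 by (rule barrier_mean_bid)

lemma H_obj_eq: "H_obj \<Theta> s v b = log_obj mean_bid b"
proof
  fix \<beta>
  have [measurable]: "(\<lambda>x. F_obj v b x \<beta>) \<in> borel_measurable \<Theta>" unfolding F_obj_top_bid by measurable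
  have "H_obj \<Theta> s v b \<beta> = (\<integral>x. F_obj v b x \<beta> \<partial>P)" unfolding H_obj_def by (rule E_supply_P) measurable
  also have "\<dots> = log_obj mean_bid b \<beta>" unfolding F_obj_top_bid log_obj_def mean_bid_def
    using integrable_top_bid by (simp add: prob_Theta)
  finally show "H_obj \<Theta> s v b \<beta> = log_obj mean_bid b \<beta>" .
qed

abbreviation "H \<equiv> H_obj \<Theta> s v b"
abbreviation "bs \<equiv> beta_star \<Theta> s v b"

lemma bs_arg_min: "is_arg_min H (\<lambda>\<beta>. \<beta> \<in> pacing_box) bs"
  unfolding beta_star_def H_obj_eq by (rule pop.arg_min_on_is_arg_min)

lemma bs: "0 < bs $ i" "bs $ i \<le> 1" and bs_box: "bs \<in> pacing_box"
  using bs_arg_min by (auto simp: is_arg_min_linorder pacing_box_def)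

lemma H_growth: "y \<in> pacing_box \<Longrightarrow> H bs + b0 / 4 * (norm (y - bs))\<^sup>2 \<le> H y"
  using pop.quadratic_growth[of bs y] bs_arg_min unfolding H_obj_eq by blast

lemma mean_bid_second_difference: "mean_bid (\<beta> + h) + mean_bid (\<beta> - h) - 2 * mean_bid \<beta> \<ge> 0"
  using pop.g_convex[of "1/2" "\<beta> + h" "\<beta> - h"] by (simp add: algebra_simps flip: scaleR_add_left)

end

locale smooth_market = market \<Theta> s v b C
  for \<Theta> :: "'a measure" and s :: "'a \<Rightarrow> real" and v :: "'n::finite \<Rightarrow> 'a \<Rightarrow> real" and b :: "real^'n" and C :: real +
  assumes H_smooth: "\<exists>U. open U \<and> bs \<in> U \<and> twice_cont_diff_on H U"
    and exhaust: "I_gt \<Theta> s v b = {}"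
begin

abbreviation "A \<equiv> hess_star \<Theta> s v b"

lemma H_differentiable: "H differentiable (at bs)"
  using H_smooth by (auto simp: twice_cont_diff_on_def)

lemma H_axis_deriv: "((\<lambda>r. H (bs + r *\<^sub>R axis i 1)) has_real_derivative (grad H bs $ i)) (at 0)"
  using DERIV_along_line[of H bs 0 "axis i 1"] H_differentiable by (simp add: inner_axis' )

lemma grad_H_le: "grad H bs $ i \<le> 0"
proof (rule ccontr)
  assume "\<not> grad H bs $ i \<le> 0"
  then have "grad H bs $ i > 0" by simp
  from DERIV_pos_inc_left[OF H_axis_deriv this]
  obtain d where d: "d > 0" "\<And>h. 0 < h \<Longrightarrow> h < d \<Longrightarrow> H (bs - h *\<^sub>R axis i 1) < H bs" by auto
  define h where "h = min d (bs $ i) / 2"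
  have h: "0 < h" "h < d" "h < bs $ i" using d(1) bs(1)[of i] by (auto simp: h_def)
  have "bs - h *\<^sub>R axis i 1 \<in> pacing_box"
  proof -
    have "bs $ i - h \<le> 1" using bs(2)[of i] h by linarith
    then show ?thesis using bs h by (auto simp: pacing_box_def axis_def)
  qed
  then have "H bs \<le> H (bs - h *\<^sub>R axis i 1)" using bs_arg_min by (auto simp: is_arg_min_linorder)
  then show False using d(2)[OF h(1,2)] by simp
qed

text \<open>First-order conditions: the gradient vanishes in the coordinates below \<open>1\<close>, and in the others it is
  minus the leftover budget, which cannot be positive by assumption.\<close>

lemma grad_H_zero: "grad H bs = 0"
proof (rule vec_eq_iff[THEN iffD2], rule allI)
  fix i
  show "grad H bs $ i = 0 $ i"
  proof (cases "bs $ i = 1")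
    case True
    then have "\<not> leftover \<Theta> s v b $ i > 0" using exhaust by (auto simp: I_gt_def)
    then show ?thesis using grad_H_le[of i] by (simp add: leftover_def)
  next
    case False
    then have lt: "bs $ i < 1" using bs(2)[of i] by simp
    have "\<not> grad H bs $ i < 0"
    proof
      assume "grad H bs $ i < 0"
      from DERIV_neg_dec_right[OF H_axis_deriv this]
      obtain d where d: "d > 0" "\<And>h. 0 < h \<Longrightarrow> h < d \<Longrightarrow> H (bs + h *\<^sub>R axis i 1) < H bs" by auto
      define h where "h = min d (1 - bs $ i) / 2"
      have "h \<le> (1 - bs $ i) / 2" by (simp add: h_def)
      then have "bs $ i + h < 1" using lt by (simp add: field_simps)
      moreover have "0 < h" "h < d" using d(1) lt by (auto simp: h_def)
      ultimately have h: "0 < h" "h < d" "bs $ i + h < 1" by auto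
      have "bs + h *\<^sub>R axis i 1 \<in> pacing_box"
        using bs h by (auto simp: pacing_box_def axis_def add_pos_pos)
      then have "H bs \<le> H (bs + h *\<^sub>R axis i 1)" using bs_arg_min by (auto simp: is_arg_min_linorder)
      then show False using d(2)[OF h(1,2)] by simp
    qed
    then show ?thesis using grad_H_le[of i] by simp
  qed
qed

lemma H_taylor:
  assumes "e > 0"
  obtains d where "d > 0" "\<And>h. norm h < d \<Longrightarrow> \<bar>H (bs + h) - H bs - 1/2 * (h \<bullet> (A *v h))\<bar> \<le> e * (norm h)\<^sup>2"
proof -
  obtain U where U: "open U" "bs \<in> U" "twice_cont_diff_on H U" using H_smooth by blast
  from second_order_taylor[OF U assms] show thesis
    using that by (auto simp: grad_H_zero hess_star_def)
qed

lemma A_sym: "h \<bullet> (A *v k) = k \<bullet> (A *v h)"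
  using H_smooth hessian_symmetric unfolding hess_star_def by blast

lemma log_obj_second_difference:
  "H (bs + h) + H (bs - h) - 2 * H bs = (mean_bid (bs + h) + mean_bid (bs - h) - 2 * mean_bid bs)
     - (\<Sum>i\<in>UNIV. b $ i * (ln (bs $ i + h $ i) + ln (bs $ i - h $ i) - 2 * ln (bs $ i)))"
  unfolding H_obj_eq log_obj_def
  by (simp add: sum.distrib sum_subtractf distrib_left right_diff_distrib sum_distrib_left mult.left_commute)

text \<open>The second difference of the mean bid is nonnegative by convexity, and that of the barrier is at least
  \<open>b0 * (norm h)\<^sup>2\<close>. This is where the positive definiteness of the Hessian comes from.\<close>

lemma A_coercive: "b0 * (norm h)\<^sup>2 \<le> h \<bullet> (A *v h)"
proof (cases "h = 0")
  case False
  have "b0 * (norm h)\<^sup>2 \<le> h \<bullet> (A *v h) + e" if e: "e > 0" for e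
  proof -
    define e' where "e' = e / (2 * (norm h)\<^sup>2)"
    have e': "e' > 0" using e False by (simp add: e'_def)
    obtain d where d: "d > 0" "\<And>h. norm h < d \<Longrightarrow> \<bar>H (bs + h) - H bs - 1/2 * (h \<bullet> (A *v h))\<bar> \<le> e' * (norm h)\<^sup>2"
      using H_taylor[OF e'] by metis
    define m where "m = Min (range (\<lambda>i. bs $ i))"
    have m: "m > 0" "\<And>i. m \<le> bs $ i" using bs(1) unfolding m_def by (auto intro!: Min_le)
    define r where "r = min d m / (2 * norm h)"
    have r: "r > 0" "r * norm h < d" "r * norm h < m" using d(1) m(1) False by (auto simp: r_def min_def)
    define k where "k = r *\<^sub>R h"
    have nk: "norm k < d" "norm k < m" "norm (- k) < d" using r by (auto simp: k_def)
    have ki: "\<bar>k $ i\<bar> < bs $ i" for i using component_le_norm_cart[of k i] nk(2) m(2)[of i] by linarith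
    have "b0 * (norm k)\<^sup>2 \<le> (\<Sum>i\<in>UNIV. b $ i * (k $ i)\<^sup>2)"
      by (simp add: norm_vec_def L2_set_def sum_nonneg sum_distrib_left) (intro sum_mono mult_right_mono b0, simp)
    also have "\<dots> \<le> (\<Sum>i\<in>UNIV. - (b $ i * (ln (bs $ i + k $ i) + ln (bs $ i - k $ i) - 2 * ln (bs $ i))))"
    proof (rule sum_mono)
      fix i
      have "b $ i * (ln (bs $ i + k $ i) + ln (bs $ i - k $ i) - 2 * ln (bs $ i)) \<le> b $ i * - (k $ i)\<^sup>2"
        using budgets[of i] by (intro mult_left_mono ln_second_difference bs ki) auto
      then show "b $ i * (k $ i)\<^sup>2 \<le> - (b $ i * (ln (bs $ i + k $ i) + ln (bs $ i - k $ i) - 2 * ln (bs $ i)))" by simp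
    qed
    also have "\<dots> \<le> H (bs + k) + H (bs - k) - 2 * H bs"
      unfolding log_obj_second_difference sum_negf using mean_bid_second_difference[of bs k] by simp
    also have "\<dots> \<le> k \<bullet> (A *v k) + 2 * e' * (norm k)\<^sup>2"
    proof -
      have "(- k) \<bullet> (A *v (- k)) = k \<bullet> (A *v k)"
        using matrix_vector_mult_scaleR[of A "-1" k] by simp
      then show ?thesis using d(2)[OF nk(1)] d(2)[OF nk(3)] by simp
    qed
    also have "k \<bullet> (A *v k) = r\<^sup>2 * (h \<bullet> (A *v h))" by (simp add: k_def matrix_vector_mult_scaleR power2_eq_square)
    also have "2 * e' * (norm k)\<^sup>2 = r\<^sup>2 * e"
      using False by (simp add: k_def e'_def power_mult_distrib)
    finally have "r\<^sup>2 * (b0 * (norm h)\<^sup>2) \<le> r\<^sup>2 * (h \<bullet> (A *v h) + e)"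
      by (simp add: k_def power_mult_distrib algebra_simps)
    then show ?thesis using r(1) by simp
  qed
  then show ?thesis by (rule field_le_epsilon)
qed simp

lemma limit_cone_eq: "limit_cone \<Theta> s v b = {h. \<forall>i\<in>I_eq \<Theta> s v b. h $ i \<le> 0}"
  by (simp add: limit_cone_def exhaust)

lemma I_eq_eq: "I_eq \<Theta> s v b = {i. bs $ i = 1}"
  by (simp add: I_eq_def leftover_def grad_H_zero)

lemma limit_cone_iff: "h \<in> limit_cone \<Theta> s v b \<longleftrightarrow> (\<forall>i. bs $ i = 1 \<longrightarrow> h $ i \<le> 0)"
  by (simp add: limit_cone_eq I_eq_eq)

sublocale qp: quadratic_program A b0 "limit_cone \<Theta> s v b"
proof
  have eq: "limit_cone \<Theta> s v b = (\<Inter>i\<in>{i. bs $ i = 1}. {h. h $ i \<le> 0})"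
    by (auto simp: limit_cone_iff)
  have c: "closed {h :: real^'n. h $ i \<le> 0}" for i by (intro closed_Collect_le continuous_intros)
  have x: "convex {h :: real^'n. h $ i \<le> 0}" for i
    using convex_halfspace_le[of "axis i 1 :: real^'n" 0] by (simp add: inner_axis')
  show "closed (limit_cone \<Theta> s v b)" unfolding eq using c by auto
  show "convex (limit_cone \<Theta> s v b)" unfolding eq using x by (intro convex_INT) auto
  show "0 \<in> limit_cone \<Theta> s v b" by (simp add: limit_cone_iff)
qed (use b0 A_coercive A_sym in auto)

lemma J_FPPE_eq: "J_FPPE \<Theta> s v b N = distr N borel qp.sol"
  by (simp add: J_FPPE_def qp.sol_def[abs_def])

subsection \<open>Ties\<close>

text \<open>A tie contributes at least \<open>h * v i x\<close> to the second difference of the bid in the direction of buyer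
  \<open>i\<close>, whereas the second difference of \<open>H\<close> is only of order \<open>h\<^sup>2\<close>. Hence the mean valuation of buyer \<open>i\<close> on
  the ties that \<open>i\<close> takes part in is zero.\<close>

lemma AE_clear_win: "AE x in P. clear_win v bs 0 x"
proof -
  define tie where "tie i x \<longleftrightarrow> (\<exists>j. j \<noteq> i \<and> top_bid v bs x = bs $ i * v i x \<and> top_bid v bs x = bs $ j * v j x)" for i x
  have [measurable]: "Measurable.pred \<Theta> (tie i)" for i unfolding tie_def[abs_def] by measurable
  have "AE x in P. \<not> (tie i x \<and> v i x > 0)" for i
  proof -
    define f where "f x = v i x * indicator {x. tie i x} x" for x
    have [measurable]: "f \<in> borel_measurable \<Theta>" unfolding f_def[abs_def] by measurable
    have f0: "x \<in> space \<Theta> \<Longrightarrow> 0 \<le> f x" "x \<in> space \<Theta> \<Longrightarrow> f x \<le> C" for x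
      using v_nonneg[of x i] v_le[of x i] C by (auto simp: f_def indicator_def)
    have fi: "integrable P f" by (rule integrable_bounded[where K=C]) (use f0 in auto)
    define e :: "real^'n" where "e = axis i 1"
    obtain d where d: "d > 0" "\<And>h. norm h < d \<Longrightarrow> \<bar>H (bs + h) - H bs - 1/2 * (h \<bullet> (A *v h))\<bar> \<le> 1 * (norm h)\<^sup>2"
      using H_taylor[of 1] by auto
    define K where "K = \<bar>e \<bullet> (A *v e)\<bar> + 2"
    have le: "(\<integral>x. f x \<partial>P) \<le> h * K" if h: "0 < h" "h < d" "h < bs $ i" for h
    proof -
      have nh: "norm (h *\<^sub>R e) < d" "norm (- (h *\<^sub>R e)) < d" using h by (auto simp: e_def)
      have "h * (\<integral>x. f x \<partial>P) = (\<integral>x. h * f x \<partial>P)" by simp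
      also have "\<dots> \<le> (\<integral>x. top_bid v (bs + h *\<^sub>R e) x + top_bid v (bs - h *\<^sub>R e) x - 2 * top_bid v bs x \<partial>P)"
      proof (rule integral_mono)
        fix x assume x: "x \<in> space P"
        show "h * f x \<le> top_bid v (bs + h *\<^sub>R e) x + top_bid v (bs - h *\<^sub>R e) x - 2 * top_bid v bs x"
        proof (cases "tie i x")
          case True
          then obtain j where "j \<noteq> i" "top_bid v bs x = bs $ i * v i x" "top_bid v bs x = bs $ j * v j x" by (auto simp: tie_def)
          from tie_second_difference[OF _ this(1)[symmetric] this(2,3), of h] show ?thesis
            using x True v_nonneg by (simp add: f_def e_def)
        next
          case False
          then show ?thesis using second_difference_nonneg[of v bs "h *\<^sub>R e" x] by (simp add: f_def)
        qed
      qed (use fi integrable_top_bid in auto)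
      also have "\<dots> = mean_bid (bs + h *\<^sub>R e) + mean_bid (bs - h *\<^sub>R e) - 2 * mean_bid bs"
        unfolding mean_bid_def using integrable_top_bid by simp
      also have "\<dots> \<le> H (bs + h *\<^sub>R e) + H (bs - h *\<^sub>R e) - 2 * H bs"
      proof -
        have "(\<Sum>j\<in>UNIV. b $ j * (ln (bs $ j + (h *\<^sub>R e) $ j) + ln (bs $ j - (h *\<^sub>R e) $ j) - 2 * ln (bs $ j))) \<le> 0"
        proof (intro sum_nonpos mult_nonneg_nonpos)
          fix j
          have "\<bar>(h *\<^sub>R e) $ j\<bar> < bs $ j" using h bs(1)[of j] by (auto simp: e_def axis_def)
          from ln_second_difference[OF bs this] show "ln (bs $ j + (h *\<^sub>R e) $ j) + ln (bs $ j - (h *\<^sub>R e) $ j) - 2 * ln (bs $ j) \<le> 0"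
            by (rule order_trans) simp
        qed (use budgets in \<open>auto simp: less_imp_le\<close>)
        then show ?thesis unfolding log_obj_second_difference by simp
      qed
      also have "\<dots> \<le> (h *\<^sub>R e) \<bullet> (A *v (h *\<^sub>R e)) + 2 * (norm (h *\<^sub>R e))\<^sup>2"
      proof -
        have "(- (h *\<^sub>R e)) \<bullet> (A *v (- (h *\<^sub>R e))) = (h *\<^sub>R e) \<bullet> (A *v (h *\<^sub>R e))"
          using matrix_vector_mult_scaleR[of A "-1" "h *\<^sub>R e"] by simp
        then show ?thesis using d(2)[OF nh(1)] d(2)[OF nh(2)] by simp
      qed
      also have "\<dots> = h * (h * ((e \<bullet> (A *v e)) + 2))"
        by (simp add: matrix_vector_mult_scaleR e_def power2_eq_square algebra_simps)
      also have "\<dots> \<le> h * (h * K)" using h by (intro mult_left_mono) (auto simp: K_def)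
      finally show ?thesis using h by simp
    qed
    have "(\<integral>x. f x \<partial>P) \<le> 0 + \<epsilon>" if \<epsilon>: "\<epsilon> > 0" for \<epsilon>
    proof -
      have K: "K > 0" by (simp add: K_def)
      define q where "q = min (\<epsilon> / K) (min d (bs $ i))"
      define h where "h = q / 2"
      have q: "q > 0" "q \<le> \<epsilon> / K" "q \<le> d" "q \<le> bs $ i" using d(1) bs(1)[of i] \<epsilon> K by (auto simp: q_def)
      have "0 < h" "h < q" using q(1) by (simp_all add: h_def)
      then have h: "0 < h" "h < d" "h < bs $ i" "h \<le> \<epsilon> / K" using q by linarith+
      have "h * K \<le> \<epsilon>" using h(4) K by (simp add: field_simps)
      then show ?thesis using le[OF h(1-3)] by simp
    qed
    then have "(\<integral>x. f x \<partial>P) \<le> 0" by (rule field_le_epsilon)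
    moreover have "(\<integral>x. f x \<partial>P) \<ge> 0" using f0 by (intro integral_nonneg_AE AE_I2) auto
    ultimately have "(\<integral>x. f x \<partial>P) = 0" by simp
    then have "AE x in P. f x = 0" using fi f0 by (subst (asm) integral_nonneg_eq_0_iff_AE) (auto intro!: AE_I2)
    then show ?thesis by eventually_elim (auto simp: f_def)
  qed
  then have "AE x in P. \<forall>i. \<not> (tie i x \<and> v i x > 0)" by (subst AE_all_countable) blast
  moreover have "AE x in P. (\<forall>i. \<not> (tie i x \<and> v i x > 0)) \<longrightarrow> clear_win v bs 0 x"
  proof (intro AE_I2 impI, rule ccontr)
    fix x assume x: "x \<in> space P" and n: "\<forall>i. \<not> (tie i x \<and> v i x > 0)" and c: "\<not> clear_win v bs 0 x"
    obtain i j where "i \<noteq> j" "v i x > 0" "top_bid v bs x = bs $ i * v i x" "top_bid v bs x = bs $ j * v j x"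
      using not_clear_winD[OF c] bs(1) v_nonneg x by (metis space_P)
    then show False using n unfolding tie_def by metis
  qed
  ultimately show ?thesis by eventually_elim simp
qed

lemma clear_win_0D: "clear_win v bs 0 x \<Longrightarrow> \<exists>m::nat. clear_win v bs (1 / Suc m) x"
proof -
  assume "clear_win v bs 0 x"
  then consider i where "\<And>j. j \<noteq> i \<Longrightarrow> bs $ j * v j x < bs $ i * v i x" | "\<forall>i. v i x = 0"
    unfolding clear_win_def by auto
  then show ?thesis
  proof cases
    case (1 i)
    define \<delta> where "\<delta> = Min (insert 1 ((\<lambda>j. bs $ i * v i x - bs $ j * v j x) ` {j. j \<noteq> i}))"
    have "\<delta> > 0" unfolding \<delta>_def by (subst Min_gr_iff) (use 1 in auto)
    then obtain m :: nat where m: "1 / Suc m < \<delta>" using nat_approx_posE by metis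
    have "bs $ j * v j x + 1 / Suc m < bs $ i * v i x" if "j \<noteq> i" for j
    proof -
      have "\<delta> \<le> bs $ i * v i x - bs $ j * v j x" unfolding \<delta>_def by (rule Min_le) (use that in auto)
      then show ?thesis using m by linarith
    qed
    then show ?thesis unfolding clear_win_def by blast
  qed (auto simp: clear_win_def)
qed

text \<open>Continuity from above: the sets of items without a winner of margin \<open>\<delta>\<close> shrink to the null set of
  ties as \<open>\<delta> \<rightarrow> 0\<close>.\<close>

lemma near_ties_rare:
  assumes e: "e > 0"
  obtains \<delta> where "\<delta> > 0" "measure P {x\<in>space \<Theta>. \<not> clear_win v bs \<delta> x} < e"
proof -
  define B where "B m = {x\<in>space \<Theta>. \<not> clear_win v bs (1 / Suc m) x}" for m :: nat
  have [measurable]: "B m \<in> sets \<Theta>" for m unfolding B_def by measurable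
  have "decseq B"
  proof (unfold decseq_def, intro allI impI subsetI)
    fix m n :: nat and x assume mn: "m \<le> n" and x: "x \<in> B n"
    have "1 / real (Suc n) \<le> 1 / real (Suc m)" using mn by (simp add: frac_le)
    then show "x \<in> B m" using x clear_win_mono[of v bs "1 / Suc m" x "1 / Suc n"] by (auto simp: B_def)
  qed
  then have "(\<lambda>m. measure P (B m)) \<longlonglongrightarrow> measure P (\<Inter>m. B m)"
    by (intro P.finite_Lim_measure_decseq) auto
  also have "measure P (\<Inter>m. B m) = 0"
  proof -
    have "AE x in P. x \<notin> (\<Inter>m. B m)"
      using AE_clear_win by eventually_elim (use clear_win_0D in \<open>auto simp: B_def\<close>)
    moreover have "(\<Inter>m. B m) \<in> sets P" by auto
    ultimately show ?thesis by (subst P.prob_eq_0) auto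
  qed
  finally have "eventually (\<lambda>m. measure P (B m) < e) sequentially" using e by (rule order_tendstoD)
  then obtain m where "measure P (B m) < e" by (auto simp: eventually_sequentially)
  then show thesis by (intro that[of "1 / Suc m"]) (auto simp: B_def)
qed

end

section \<open>Gradients and subgradients of the objective\<close>

lemma log_sum_has_derivative:
  fixes b \<beta> :: "real^'n"
  assumes "\<And>i. 0 < \<beta> $ i"
  shows "((\<lambda>y. \<Sum>i\<in>UNIV. b $ i * ln (y $ i)) has_derivative (\<lambda>h. h \<bullet> (\<chi> i. b $ i / \<beta> $ i))) (at \<beta>)"
proof -
  have "((\<lambda>y. \<Sum>i\<in>UNIV. b $ i * ln (y $ i)) has_derivative (\<lambda>h. \<Sum>i\<in>UNIV. b $ i * (h $ i * inverse (\<beta> $ i)))) (at \<beta>)"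
    using assms
    by (intro has_derivative_sum has_derivative_mult_right has_derivative_ln bounded_linear_imp_has_derivative bounded_linear_vec_nth) auto
  then show ?thesis by (simp add: inner_vec_def divide_inverse mult_ac)
qed

text \<open>After adding back the gradient of the barrier, a subgradient of \<open>F_obj\<close> is bounded by the one-sided
  slopes of the highest paced bid. This is used with crude slopes, for boundedness, and with exact
  slopes where the bid is linear, to identify the subgradient.\<close>

lemma subgradient_le:
  fixes v :: "'n::finite \<Rightarrow> 'a \<Rightarrow> real" and b \<beta> g h :: "real^'n"
  assumes \<beta>: "\<beta> \<in> pos_orthant" and g: "g \<in> subdifferential_on pos_orthant (F_obj v b y) \<beta>"
    and r0: "r0 > 0" and le: "\<And>r. 0 < r \<Longrightarrow> r < r0 \<Longrightarrow> top_bid v (\<beta> + r *\<^sub>R h) y - top_bid v \<beta> y \<le> r * q"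
  shows "(g + (\<chi> i. b $ i / \<beta> $ i)) \<bullet> h \<le> q"
proof -
  define l where "l y = (\<Sum>i\<in>UNIV. b $ i * ln (y $ i))" for y :: "real^'n"
  have pos: "0 < \<beta> $ i" for i using \<beta> by (simp add: pos_orthant_def)
  have "(l has_derivative (\<lambda>h. h \<bullet> (\<chi> i. b $ i / \<beta> $ i))) (at (\<beta> + 0 *\<^sub>R h))"
    unfolding l_def[abs_def] using log_sum_has_derivative[OF pos, where b=b] by simp
  moreover have "((\<lambda>s. \<beta> + s *\<^sub>R h) has_derivative (\<lambda>r. r *\<^sub>R h)) (at 0)" by (auto intro!: derivative_eq_intros)
  ultimately have "((\<lambda>s. l (\<beta> + s *\<^sub>R h)) has_derivative (\<lambda>r. (r *\<^sub>R h) \<bullet> (\<chi> i. b $ i / \<beta> $ i))) (at 0)"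
    by (rule has_derivative_compose[rotated])
  then have "((\<lambda>s. l (\<beta> + s *\<^sub>R h)) has_real_derivative (h \<bullet> (\<chi> i. b $ i / \<beta> $ i))) (at 0)"
    by (rule has_derivative_imp_has_field_derivative) simp
  then have "((\<lambda>r. (l (\<beta> + (0 + r) *\<^sub>R h) - l (\<beta> + 0 *\<^sub>R h)) / r) \<longlongrightarrow> h \<bullet> (\<chi> i. b $ i / \<beta> $ i)) (at_right 0)"
    unfolding DERIV_def by (rule tendsto_within_subset[OF _ subset_UNIV])
  then have lim: "((\<lambda>r. (l (\<beta> + r *\<^sub>R h) - l \<beta>) / r + g \<bullet> h) \<longlongrightarrow> h \<bullet> (\<chi> i. b $ i / \<beta> $ i) + g \<bullet> h) (at_right 0)"
    by (intro tendsto_add tendsto_const) simp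
  have "\<forall>\<^sub>F r in at_right 0. (l (\<beta> + r *\<^sub>R h) - l \<beta>) / r + g \<bullet> h \<le> q"
  proof -
    have "open (pos_orthant :: (real^'n) set)"
    proof -
      have "pos_orthant = (\<Inter>i. {\<beta> :: real^'n. 0 < \<beta> $ i})" by (auto simp: pos_orthant_def)
      also have "open \<dots>" by (intro open_INT ballI open_Collect_less continuous_intros) auto
      finally show ?thesis .
    qed
    moreover have "((\<lambda>r. \<beta> + r *\<^sub>R h) \<longlongrightarrow> \<beta> + 0 *\<^sub>R h) (at_right 0)" by (intro tendsto_intros)
    ultimately have "\<forall>\<^sub>F r in at_right 0. \<beta> + r *\<^sub>R h \<in> pos_orthant"
      using \<beta> by (intro topological_tendstoD) auto
    moreover have "\<forall>\<^sub>F r in at_right 0. r \<in> {0<..<r0}" using eventually_at_right_real[OF r0] .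
    ultimately show ?thesis
    proof eventually_elim
      case (elim r)
      have "F_obj v b y (\<beta> + r *\<^sub>R h) \<ge> F_obj v b y \<beta> + g \<bullet> (r *\<^sub>R h)"
        using g elim(1) by (auto simp: subdifferential_on_def dest!: bspec)
      then have "l (\<beta> + r *\<^sub>R h) - l \<beta> + r * (g \<bullet> h) \<le> r * q"
        using le[of r] elim(2) by (simp add: F_obj_top_bid l_def)
      then have "((l (\<beta> + r *\<^sub>R h) - l \<beta>) + r * (g \<bullet> h)) / r \<le> q" using elim(2) by (simp add: divide_le_eq mult.commute)
      then show ?case using elim(2) by (simp add: add_divide_distrib)
    qed
  qed
  then have "h \<bullet> (\<chi> i. b $ i / \<beta> $ i) + g \<bullet> h \<le> q" by (intro tendsto_upperbound[OF lim]) auto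
  then show ?thesis by (simp add: inner_add_left inner_add_right inner_commute)
qed

context smooth_market begin

abbreviation "win \<equiv> win_grad v bs"

lemma win_abs: "x \<in> space \<Theta> \<Longrightarrow> \<bar>win x $ i\<bar> \<le> C"
  by (rule win_grad_bound) (auto intro: v_nonneg v_le)

lemma integrable_win: "integrable P (\<lambda>x. win x $ i)"
  by (rule integrable_bounded[OF _ win_abs]) auto

lemma win_mult_abs:
  assumes "x \<in> space \<Theta>" shows "\<bar>win x $ i * win x $ j\<bar> \<le> C * C"
  unfolding abs_mult using win_abs[OF assms, of i] win_abs[OF assms, of j] by (intro mult_mono) (use C in auto)

lemma integrable_win_mult: "integrable P (\<lambda>x. win x $ i * win x $ j)"
  by (rule integrable_bounded[OF _ win_mult_abs]) auto

lemma GDERIV_F: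
  assumes x: "x \<in> space \<Theta>" and cw: "clear_win v bs 0 x"
  shows "GDERIV (F_obj v b x) bs :> win x - (\<chi> i. b $ i / bs $ i)"
proof -
  obtain m :: nat where m: "clear_win v bs (1 / Suc m) x" using clear_win_0D[OF cw] by blast
  define r where "r = 1 / Suc m / (2 * C)"
  have r: "r > 0" using C by (simp add: r_def)
  have near: "top_bid v y x = y \<bullet> win x" if "dist y bs < r" for y
  proof (rule top_bid_linear[OF _ _ m])
    fix i
    have "\<bar>y $ i - bs $ i\<bar> \<le> r" using that component_le_norm_cart[of "y - bs" i] by (simp add: dist_norm)
    then have "2 * C * \<bar>y $ i - bs $ i\<bar> \<le> 2 * C * r" using C by (intro mult_left_mono) auto
    also have "\<dots> = 1 / Suc m" using C by (simp add: r_def)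
    finally show "2 * C * \<bar>y $ i - bs $ i\<bar> \<le> 1 / Suc m" .
  qed (use x in \<open>auto intro: v_nonneg v_le\<close>)
  have "((\<lambda>y. y \<bullet> win x - (\<Sum>i\<in>UNIV. b $ i * ln (y $ i))) has_derivative
      (\<lambda>h. h \<bullet> win x - h \<bullet> (\<chi> i. b $ i / bs $ i))) (at bs)"
    by (intro has_derivative_diff log_sum_has_derivative bs has_derivative_inner_left has_derivative_ident)
  then have "(F_obj v b x has_derivative (\<lambda>h. h \<bullet> win x - h \<bullet> (\<chi> i. b $ i / bs $ i))) (at bs)"
    by (rule has_derivative_transform_within[OF _ r]) (auto simp: F_obj_top_bid near)
  then show ?thesis by (simp add: gderiv_def inner_diff_right)
qed

text \<open>Together with \<open>GDERIV_F\<close> this determines \<open>grad\<close> at every item: where the derivative fails to exist it is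
  one fixed vector. The integrands in \<open>grad_cov\<close> are therefore measurable.\<close>

lemma not_GDERIV_F:
  assumes x: "x \<in> space \<Theta>" and cw: "\<not> clear_win v bs 0 x"
  shows "\<not> GDERIV (F_obj v b x) bs :> D"
proof
  assume "GDERIV (F_obj v b x) bs :> D"
  then have "(F_obj v b x has_derivative (\<lambda>h. h \<bullet> D)) (at bs)" by (simp add: gderiv_def)
  from has_derivative_add[OF this log_sum_has_derivative[OF bs(1), where b=b]]
  have td: "((\<lambda>y. top_bid v y x) has_derivative (\<lambda>h. h \<bullet> (D + (\<chi> i. b $ i / bs $ i)))) (at bs)"
    by (simp add: F_obj_top_bid inner_add_right)
  obtain i j where ij: "i \<noteq> j" "v i x > 0" "top_bid v bs x = bs $ i * v i x" "top_bid v bs x = bs $ j * v j x"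
    using not_clear_winD[OF cw] bs(1) v_nonneg x by metis
  define f where "f r = top_bid v (bs + r *\<^sub>R axis i 1) x" for r
  have "((\<lambda>y. top_bid v y x) has_derivative (\<lambda>h. h \<bullet> (D + (\<chi> i. b $ i / bs $ i)))) (at (bs + 0 *\<^sub>R axis i 1))"
    using td by simp
  moreover have "((\<lambda>s. bs + s *\<^sub>R axis i 1) has_derivative (\<lambda>r. r *\<^sub>R axis i 1)) (at 0)"
    by (auto intro!: derivative_eq_intros)
  ultimately have "(f has_derivative (\<lambda>r. (r *\<^sub>R axis i 1) \<bullet> (D + (\<chi> i. b $ i / bs $ i)))) (at 0)"
    unfolding f_def[abs_def] by (rule has_derivative_compose[rotated])
  then have fd: "(f has_real_derivative (axis i 1 \<bullet> (D + (\<chi> i. b $ i / bs $ i)))) (at 0)" (is "(f has_real_derivative ?l) _")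
    by (rule has_derivative_imp_has_field_derivative) simp
  then have l1: "((\<lambda>h. (f (0 + h) - f 0) / h) \<longlongrightarrow> ?l) (at_right 0)"
    unfolding DERIV_def by (rule tendsto_within_subset[OF _ subset_UNIV])
  have "((\<lambda>r. f (- r)) has_real_derivative - ?l) (at 0)"
    using DERIV_mirror[of f ?l 0] fd by simp
  then have l2: "((\<lambda>h. (f (- (0 + h)) - f (- 0)) / h) \<longlongrightarrow> - ?l) (at_right 0)"
    unfolding DERIV_def by (rule tendsto_within_subset[OF _ subset_UNIV])
  have "((\<lambda>h. (f (0 + h) - f 0) / h + (f (- (0 + h)) - f (- 0)) / h) \<longlongrightarrow> ?l + - ?l) (at_right 0)"
    by (rule tendsto_add[OF l1 l2])
  moreover have "eventually (\<lambda>h. v i x \<le> (f (0 + h) - f 0) / h + (f (- (0 + h)) - f (- 0)) / h) (at_right 0)"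
    using eventually_at_right_less[of "0::real"]
  proof eventually_elim
    case (elim h)
    have "h * v i x \<le> f h + f (- h) - 2 * f 0"
      using tie_second_difference[OF _ ij(1,3,4), of h] v_nonneg x by (simp add: f_def)
    then have "v i x \<le> (f h + f (- h) - 2 * f 0) / h" using elim by (simp add: pos_le_divide_eq mult.commute)
    then show ?case by (simp add: add_divide_distrib[symmetric])
  qed
  ultimately have "v i x \<le> ?l + - ?l"
    by (intro tendsto_lowerbound) auto
  then show False using ij(2) by simp
qed

lemma grad_F:
  assumes x: "x \<in> space \<Theta>"
  shows "grad (F_obj v b x) bs = (if clear_win v bs 0 x then win x - (\<chi> i. b $ i / bs $ i) else (THE D. False))"
proof (cases "clear_win v bs 0 x")
  case True
  then show ?thesis using grad_eqI[OF GDERIV_F[OF x]] by simp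
next
  case False
  then show ?thesis using not_GDERIV_F[OF x] by (simp add: grad_def)
qed

end

context smooth_market begin

abbreviation "S \<equiv> grad_cov \<Theta> s v b"

lemma cov_entry: "S $ i $ j = (\<integral>x. win x $ i * win x $ j \<partial>P) - (\<integral>x. win x $ i \<partial>P) * (\<integral>x. win x $ j \<partial>P)"
proof -
  define D where "D x = grad (F_obj v b x) bs" for x
  define z where "z = (THE D :: real^'n. False)"
  define d where "d x = (if clear_win v bs 0 x then win x - (\<chi> i. b $ i / bs $ i) else z)" for x
  have [measurable]: "(\<lambda>x. d x $ i) \<in> borel_measurable \<Theta>" for i
  proof -
    have "(\<lambda>x. d x $ i) = (\<lambda>x. if clear_win v bs 0 x then win x $ i - b $ i / bs $ i else z $ i)"
      by (auto simp: d_def fun_eq_iff)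
    also have "\<dots> \<in> borel_measurable \<Theta>" by measurable
    finally show ?thesis .
  qed
  have cong: "E_supply \<Theta> s f = E_supply \<Theta> s g" if "\<And>x. x \<in> space \<Theta> \<Longrightarrow> f x = g x" for f g
    unfolding E_supply_def by (intro Bochner_Integration.integral_cong) (auto simp: that)
  have Dd: "x \<in> space \<Theta> \<Longrightarrow> D x = d x" for x by (simp add: D_def d_def z_def grad_F)
  have m: "E_supply \<Theta> s (\<lambda>x. D x $ i) = (\<integral>x. win x $ i \<partial>P) - b $ i / bs $ i" for i
  proof -
    have "E_supply \<Theta> s (\<lambda>x. D x $ i) = E_supply \<Theta> s (\<lambda>x. d x $ i)" by (rule cong) (simp add: Dd)
    also have "\<dots> = (\<integral>x. d x $ i \<partial>P)" by (rule E_supply_P) measurable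
    also have "\<dots> = (\<integral>x. win x $ i - b $ i / bs $ i \<partial>P)"
    proof (rule integral_cong_AE)
      show "AE x in P. d x $ i = win x $ i - b $ i / bs $ i" using AE_clear_win by eventually_elim (simp add: d_def)
    qed measurable
    also have "\<dots> = (\<integral>x. win x $ i \<partial>P) - b $ i / bs $ i" using integrable_win by (simp add: prob_Theta)
    finally show ?thesis .
  qed
  define e where "e i = (\<integral>x. win x $ i \<partial>P)" for i
  have "S $ i $ j = E_supply \<Theta> s (\<lambda>x. (D x $ i - (e i - b $ i / bs $ i)) * (D x $ j - (e j - b $ j / bs $ j)))"
    unfolding grad_cov_def Let_def D_def[symmetric] m by (simp add: e_def)
  also have "\<dots> = E_supply \<Theta> s (\<lambda>x. (d x $ i - (e i - b $ i / bs $ i)) * (d x $ j - (e j - b $ j / bs $ j)))"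
    by (rule cong) (simp add: Dd)
  also have "\<dots> = (\<integral>x. (d x $ i - (e i - b $ i / bs $ i)) * (d x $ j - (e j - b $ j / bs $ j)) \<partial>P)"
    by (rule E_supply_P) measurable
  also have "\<dots> = (\<integral>x. win x $ i * win x $ j - e i * win x $ j - e j * win x $ i + e i * e j \<partial>P)"
  proof (rule integral_cong_AE)
    show "AE x in P. (d x $ i - (e i - b $ i / bs $ i)) * (d x $ j - (e j - b $ j / bs $ j)) =
        win x $ i * win x $ j - e i * win x $ j - e j * win x $ i + e i * e j"
      using AE_clear_win by eventually_elim (simp add: d_def algebra_simps)
  qed measurable
  also have "\<dots> = (\<integral>x. win x $ i * win x $ j \<partial>P) - e i * e j - e j * e i + e i * e j"
    using integrable_win integrable_win_mult by (simp add: prob_Theta e_def)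
  finally show ?thesis by (simp add: e_def)
qed

lemma cov_form: "c \<bullet> (S *v c) = (\<integral>x. (c \<bullet> win x)\<^sup>2 \<partial>P) - (\<integral>x. c \<bullet> win x \<partial>P)\<^sup>2"
proof -
  have "(\<integral>x. (c \<bullet> win x)\<^sup>2 \<partial>P) = (\<integral>x. (\<Sum>i\<in>UNIV. \<Sum>j\<in>UNIV. c $ i * (c $ j * (win x $ i * win x $ j))) \<partial>P)"
    by (intro Bochner_Integration.integral_cong refl) (simp add: inner_vec_def power2_eq_square sum_product mult_ac)
  also have "\<dots> = (\<Sum>i\<in>UNIV. \<Sum>j\<in>UNIV. c $ i * (c $ j * (\<integral>x. win x $ i * win x $ j \<partial>P)))"
    using integrable_win_mult by (simp add: Bochner_Integration.integral_sum)
  finally have 1: "(\<integral>x. (c \<bullet> win x)\<^sup>2 \<partial>P) = \<dots>" .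
  have "(\<integral>x. c \<bullet> win x \<partial>P) = (\<Sum>i\<in>UNIV. c $ i * (\<integral>x. win x $ i \<partial>P))"
    unfolding inner_vec_def using integrable_win by (simp add: Bochner_Integration.integral_sum)
  then have 2: "(\<integral>x. c \<bullet> win x \<partial>P)\<^sup>2 = (\<Sum>i\<in>UNIV. \<Sum>j\<in>UNIV. c $ i * (c $ j * ((\<integral>x. win x $ i \<partial>P) * (\<integral>x. win x $ j \<partial>P))))"
    by (simp add: power2_eq_square sum_product mult_ac)
  have "c \<bullet> (S *v c) = (\<Sum>i\<in>UNIV. \<Sum>j\<in>UNIV. c $ i * (c $ j * S $ i $ j))"
    by (simp add: inner_vec_def matrix_vector_mult_def sum_distrib_left mult_ac)
  also have "\<dots> = (\<integral>x. (c \<bullet> win x)\<^sup>2 \<partial>P) - (\<integral>x. c \<bullet> win x \<partial>P)\<^sup>2"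
    unfolding 1 2 cov_entry by (simp add: right_diff_distrib sum_subtractf)
  finally show ?thesis .
qed

lemma cov_nonneg: "0 \<le> c \<bullet> (S *v c)"
proof -
  have i1: "integrable P (\<lambda>x. c \<bullet> win x)" unfolding inner_vec_def using integrable_win by simp
  have i2: "integrable P (\<lambda>x. (c \<bullet> win x)\<^sup>2)"
  proof -
    have "(\<lambda>x. (c \<bullet> win x)\<^sup>2) = (\<lambda>x. (\<Sum>i\<in>UNIV. \<Sum>j\<in>UNIV. c $ i * (c $ j * (win x $ i * win x $ j))))"
      by (simp add: inner_vec_def power2_eq_square sum_product mult_ac)
    then show ?thesis using integrable_win_mult by simp
  qed
  show ?thesis unfolding cov_form using P.variance_eq[OF i1 i2] P.variance_positive[of "\<lambda>x. c \<bullet> win x"] by simp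
qed

end

lemma char_normal_law:
  assumes "var \<ge> 0"
  shows "(\<integral>x. iexp x \<partial>normal_law 0 var) = complex_of_real (exp (- var / 2))"
proof (cases "var = 0")
  case True
  then show ?thesis by (simp add: normal_law_def integral_return)
next
  case False
  define \<sigma> where "\<sigma> = sqrt var"
  have \<sigma>: "\<sigma> > 0" using assms False by (simp add: \<sigma>_def)
  interpret prob_space std_normal_distribution by (rule prob_space_normal_density) simp
  have "distributed std_normal_distribution lborel (\<lambda>x. x) (normal_density 0 1)"
    unfolding distributed_def by (auto simp: distr_id2)
  from normal_density_affine[OF this, of \<sigma> 0]
  have "distributed std_normal_distribution lborel (\<lambda>x. \<sigma> * x) (normal_density 0 \<sigma>)"
    using \<sigma> by simp
  then have eq: "distr std_normal_distribution lborel (\<lambda>x. \<sigma> * x) = density lborel (normal_density 0 \<sigma>)"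
    by (rule distributed_distr_eq_density)
  have "(\<integral>x. iexp x \<partial>normal_law 0 var) = (\<integral>x. iexp x \<partial>distr std_normal_distribution lborel (\<lambda>x. \<sigma> * x))"
    unfolding eq using False by (simp add: normal_law_def \<sigma>_def)
  also have "\<dots> = (\<integral>x. iexp (\<sigma> * x) \<partial>std_normal_distribution)"
    by (subst integral_distr) auto
  also have "\<dots> = char std_normal_distribution \<sigma>" by (simp add: char_def)
  also have "\<dots> = complex_of_real (exp (- \<sigma>\<^sup>2 / 2))" using char_std_normal_distribution by (simp add: fun_eq_iff)
  finally show ?thesis using assms by (simp add: \<sigma>_def)
qed

text \<open>The characteristic function only sees the one-dimensional projections by which normality is defined.\<close>

lemma char_multivariate_normal:
  assumes N: "multivariate_normal 0 V N" and nn: "0 \<le> c \<bullet> (V *v c)"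
  shows "(\<integral>x. iexp (c \<bullet> x) \<partial>N) = complex_of_real (exp (- (c \<bullet> (V *v c)) / 2))"
proof -
  have [measurable_cong]: "sets N = sets borel" using N by (simp add: multivariate_normal_def)
  have "(\<integral>x. iexp (c \<bullet> x) \<partial>N) = (\<integral>y. iexp y \<partial>distr N borel (\<lambda>x. c \<bullet> x))"
    by (subst integral_distr) auto
  also have "distr N borel (\<lambda>x. c \<bullet> x) = normal_law 0 (c \<bullet> (V *v c))"
    using N by (simp add: multivariate_normal_def)
  finally show ?thesis using char_normal_law[OF nn] by simp
qed

section \<open>Typical samples\<close>

text \<open>What is needed from the data, in order: the observed objective has the population shape at scale \<open>\<epsilon>\<close>;
  near ties are infrequent; the first and second empirical moments of the gradient are close to their
  population values. The tolerance \<open>1 / Suc j\<close> and the radius \<open>K\<close> range over \<open>nat\<close>, so that countably many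
  properties describe the limit.\<close>

definition typical_sample ::
    "('n::finite \<Rightarrow> 'a \<Rightarrow> real) \<Rightarrow> real^'n \<Rightarrow> 'a measure \<Rightarrow> (real^'n \<Rightarrow> real) \<Rightarrow> nat \<Rightarrow> nat \<Rightarrow> real \<Rightarrow> nat \<Rightarrow> (nat \<Rightarrow> 'a) \<Rightarrow> bool" where
  "typical_sample v \<beta> P m K j \<epsilon> t x \<longleftrightarrow>
     (\<forall>u. (\<forall>i. \<bar>u $ i\<bar> \<le> real K) \<longrightarrow>
        \<bar>(emp t x (top_bid v (\<beta> + \<epsilon> *\<^sub>R u)) - emp t x (top_bid v \<beta>)) - (m (\<beta> + \<epsilon> *\<^sub>R u) - m \<beta>)\<bar> \<le> \<epsilon>\<^sup>2 / Suc j) \<and>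
     emp t x (\<lambda>y. if clear_win v \<beta> (K * \<epsilon>) y then 0 else 1 :: real) \<le> 1 / Suc j \<and>
     (\<forall>i. \<bar>emp t x (\<lambda>y. win_grad v \<beta> y $ i) - (\<integral>y. win_grad v \<beta> y $ i \<partial>P)\<bar> \<le> 1 / Suc j) \<and>
     (\<forall>i k. \<bar>emp t x (\<lambda>y. win_grad v \<beta> y $ i * win_grad v \<beta> y $ k) - (\<integral>y. win_grad v \<beta> y $ i * win_grad v \<beta> y $ k \<partial>P)\<bar> \<le> 1 / Suc j)"

locale sampled_market = smooth_market \<Theta> s v b C
  for \<Theta> :: "'a measure" and s :: "'a \<Rightarrow> real" and v :: "'n::finite \<Rightarrow> 'a \<Rightarrow> real" and b :: "real^'n" and C :: real +
  fixes M :: "'w measure" and \<theta> :: "nat \<Rightarrow> 'w \<Rightarrow> 'a" and \<epsilon> :: "nat \<Rightarrow> real"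
  assumes M: "prob_space M"
    and iid_indep: "prob_space.indep_vars M (\<lambda>_. \<Theta>) \<theta> UNIV"
    and iid_density: "\<And>\<tau>. distributed M \<Theta> (\<theta> \<tau>) (\<lambda>x. ennreal (s x))"
    and eps_pos: "\<And>t. \<epsilon> t > 0" and eps_zero: "\<epsilon> \<longlonglongrightarrow> 0"
    and eps_slow: "filterlim (\<lambda>t. sqrt (real t) * \<epsilon> t) at_top sequentially"
begin

sublocale M: prob_space M by (rule M)

lemma \<theta>_measurable[measurable]: "\<theta> \<tau> \<in> measurable M \<Theta>"
  using iid_indep by (auto simp: M.indep_vars_def2)

lemma \<theta>_space: "\<omega> \<in> space M \<Longrightarrow> \<theta> \<tau> \<omega> \<in> space \<Theta>"
  by (rule measurable_space[OF \<theta>_measurable])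

lemma expectation_\<theta>:
  fixes g :: "'a \<Rightarrow> real"
  assumes [measurable]: "g \<in> borel_measurable \<Theta>"
  shows "M.expectation (\<lambda>\<omega>. g (\<theta> \<tau> \<omega>)) = (\<integral>x. g x \<partial>P)"
  using iid_density[of \<tau>, THEN distributed_distr_eq_density] unfolding P_def
  by (metis (no_types) assms integral_distr \<theta>_measurable)

lemma emp_sample: "emp t (sample \<theta> t \<omega>) g = (1 / real t) *\<^sub>R (\<Sum>\<tau><t. g (\<theta> \<tau> \<omega>))"
  by (simp add: emp_def sample_def)

lemma emp_deviation:
  assumes g[measurable]: "g \<in> borel_measurable \<Theta>" and bd: "\<And>x. x \<in> space \<Theta> \<Longrightarrow> \<bar>g x\<bar> \<le> c" and c: "c \<ge> 0" and l: "l > 0" and t: "t > 0"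
  shows "M.prob {\<omega>\<in>space M. sqrt (real t) * \<bar>emp t (sample \<theta> t \<omega>) g - (\<integral>x. g x \<partial>P)\<bar> > l * c} \<le> (2 * fact m * 2 ^ m) / l ^ (2 * m)"
proof -
  have "M.indep_vars (\<lambda>_. borel) (\<lambda>j \<omega>. g (\<theta> j \<omega>)) {..<t}"
    by (rule M.indep_vars_compose2[OF M.indep_vars_subset[OF iid_indep]]) auto
  from M.hoeffding_poly[OF t this _ c l, of m]
  have "M.prob {\<omega>\<in>space M. \<bar>\<Sum>j<t. g (\<theta> j \<omega>) - M.expectation (\<lambda>\<omega>. g (\<theta> j \<omega>))\<bar> > l * c * sqrt (real t)} \<le> (2 * fact m * 2 ^ m) / l ^ (2 * m)"
    using bd \<theta>_space by blast
  also have "{\<omega>\<in>space M. \<bar>\<Sum>j<t. g (\<theta> j \<omega>) - M.expectation (\<lambda>\<omega>. g (\<theta> j \<omega>))\<bar> > l * c * sqrt (real t)}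
    = {\<omega>\<in>space M. sqrt (real t) * \<bar>emp t (sample \<theta> t \<omega>) g - (\<integral>x. g x \<partial>P)\<bar> > l * c}"
  proof (intro Collect_cong conj_cong refl)
    fix \<omega>
    have "(\<Sum>j<t. g (\<theta> j \<omega>) - M.expectation (\<lambda>\<omega>. g (\<theta> j \<omega>))) = t * (emp t (sample \<theta> t \<omega>) g - (\<integral>x. g x \<partial>P))"
      using t by (simp add: expectation_\<theta>[OF g] sum_subtractf emp_sample right_diff_distrib)
    then have "\<bar>\<Sum>j<t. g (\<theta> j \<omega>) - M.expectation (\<lambda>\<omega>. g (\<theta> j \<omega>))\<bar> = sqrt (real t) * (sqrt (real t) * \<bar>emp t (sample \<theta> t \<omega>) g - (\<integral>x. g x \<partial>P)\<bar>)"
      by (simp add: abs_mult mult.assoc[symmetric])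
    then show "(l * c * sqrt (real t) < \<bar>\<Sum>j<t. g (\<theta> j \<omega>) - M.expectation (\<lambda>\<omega>. g (\<theta> j \<omega>))\<bar>) =
       (l * c < sqrt (real t) * \<bar>emp t (sample \<theta> t \<omega>) g - (\<integral>x. g x \<partial>P)\<bar>)"
      using t by (simp add: mult.commute[of _ "sqrt (real t)"])
  qed
  finally show ?thesis .
qed

text \<open>The functions may change with the sample size, which is needed for near ties at scale \<open>\<epsilon> t\<close>.\<close>

lemma law_of_large_numbers:
  fixes g :: "nat \<Rightarrow> 'a \<Rightarrow> real"
  assumes g[measurable]: "\<And>t. g t \<in> borel_measurable \<Theta>" and bd: "\<And>t x. x \<in> space \<Theta> \<Longrightarrow> \<bar>g t x\<bar> \<le> c" and c: "c > 0" and a: "a > 0"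
  shows "outer_vanishing M (\<lambda>t \<omega>. \<bar>emp t (sample \<theta> t \<omega>) (g t) - (\<integral>x. g t x \<partial>P)\<bar> > a)"
proof (rule outer_vanishing_prob_le[OF M])
  show "(\<lambda>t. 4 * c\<^sup>2 / a\<^sup>2 / real t) \<longlonglongrightarrow> 0" by (rule lim_const_over_n)
  show "\<forall>\<^sub>F t in sequentially. \<exists>E\<in>M.events.
      (\<forall>\<omega>\<in>space M. \<bar>emp t (sample \<theta> t \<omega>) (g t) - (\<integral>x. g t x \<partial>P)\<bar> > a \<longrightarrow> \<omega> \<in> E) \<and> M.prob E \<le> 4 * c\<^sup>2 / a\<^sup>2 / real t"
    using eventually_gt_at_top[of 0]
  proof eventually_elim
    case (elim t)
    define l where "l = sqrt (real t) * a / c"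
    have l: "l > 0" using elim a c by (simp add: l_def)
    define E where "E = {\<omega>\<in>space M. sqrt (real t) * \<bar>emp t (sample \<theta> t \<omega>) (g t) - (\<integral>x. g t x \<partial>P)\<bar> > l * c}"
    have "M.prob E \<le> (2 * fact 1 * 2 ^ 1) / l ^ (2 * 1)"
      unfolding E_def using bd c l elim by (intro emp_deviation) auto
    also have "\<dots> = 4 * c\<^sup>2 / a\<^sup>2 / real t" using elim a c by (simp add: l_def power_mult_distrib power_divide)
    finally have "M.prob E \<le> 4 * c\<^sup>2 / a\<^sup>2 / real t" .
    moreover have "E \<in> M.events" unfolding E_def emp_sample by measurable
    moreover have "\<omega> \<in> E" if "\<omega> \<in> space M" "\<bar>emp t (sample \<theta> t \<omega>) (g t) - (\<integral>x. g t x \<partial>P)\<bar> > a" for \<omega>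
      using that elim c by (simp add: E_def l_def)
    ultimately show ?case by blast
  qed
qed

text \<open>The rescaled empirical process \<open>u \<mapsto> \<surd>t (P\<^sub>t - P) (bid (\<beta>\<^sup>* + \<epsilon> u)) / (\<epsilon> C)\<close> has Hoeffding increments, so by
  chaining its supremum over a cube is bounded in probability. The claim allows a supremum of order
  \<open>\<surd>t * \<epsilon> t\<close>, which tends to infinity.\<close>

lemma uniform_deviation:
  assumes a: "a > 0"
  shows "outer_vanishing M (\<lambda>t \<omega>. \<exists>u. (\<forall>i. \<bar>u $ i\<bar> \<le> real K) \<and>
      \<bar>(emp t (sample \<theta> t \<omega>) (top_bid v (bs + \<epsilon> t *\<^sub>R u)) - emp t (sample \<theta> t \<omega>) (top_bid v bs))
         - (mean_bid (bs + \<epsilon> t *\<^sub>R u) - mean_bid bs)\<bar> > a * (\<epsilon> t)\<^sup>2)"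
proof -
  define n where "n = CARD('n)"
  define B :: real where "B = 2 * fact (2 * n) * 2 ^ (2 * n)"
  \<comment> \<open>solves \<open>4 * L t * Suc K = a * (sqrt t * \<epsilon> t) / C\<close>; \<open>Suc K\<close> because a cube of radius \<open>0\<close> is excluded\<close>
  define L where "L t = a * (sqrt (real t) * \<epsilon> t) / (4 * C * Suc K)" for t
  have L_lim: "filterlim L at_top sequentially"
  proof -
    have "filterlim (\<lambda>t. (a / (4 * C * Suc K)) * (sqrt (real t) * \<epsilon> t)) at_top sequentially"
      using a C by (intro filterlim_tendsto_pos_mult_at_top[OF tendsto_const _ eps_slow]) auto
    then show ?thesis by (simp add: L_def[abs_def])
  qed
  show ?thesis
  proof (rule outer_vanishing_prob_le[OF M])
    have n: "4 * n > 0" by (simp add: n_def)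
    have "(\<lambda>t. (3 * n) ^ (4 * n) * B * inverse (L t ^ (4 * n))) \<longlonglongrightarrow> (3 * n) ^ (4 * n) * B * 0"
      by (intro tendsto_mult tendsto_const tendsto_inverse_0_at_top filterlim_pow_at_top[OF n] L_lim)
    then show "(\<lambda>t. (3 * n) ^ (4 * n) * B / L t ^ (4 * n)) \<longlonglongrightarrow> 0" by (simp add: divide_inverse)
    show "\<forall>\<^sub>F t in sequentially. \<exists>E\<in>M.events. (\<forall>\<omega>\<in>space M. (\<exists>u. (\<forall>i. \<bar>u $ i\<bar> \<le> real K) \<and>
      \<bar>(emp t (sample \<theta> t \<omega>) (top_bid v (bs + \<epsilon> t *\<^sub>R u)) - emp t (sample \<theta> t \<omega>) (top_bid v bs))
         - (mean_bid (bs + \<epsilon> t *\<^sub>R u) - mean_bid bs)\<bar> > a * (\<epsilon> t)\<^sup>2) \<longrightarrow> \<omega> \<in> E) \<and> M.prob E \<le> (3 * n) ^ (4 * n) * B / L t ^ (4 * n)"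
      using eventually_gt_at_top[of 0]
    proof eventually_elim
      case (elim t)
      have e: "\<epsilon> t > 0" by (rule eps_pos)
      define f where "f u y = top_bid v (bs + \<epsilon> t *\<^sub>R u) y / (\<epsilon> t * C)" for u y
      have [measurable]: "f u \<in> borel_measurable \<Theta>" for u unfolding f_def[abs_def] by measurable
      have fi: "integrable P (f u)" for u unfolding f_def[abs_def] using integrable_top_bid by simp
      have f_lip: "\<bar>f u y - f u' y\<bar> \<le> norm (u - u')" if "y \<in> space \<Theta>" for u u' y
      proof -
        have "\<bar>top_bid v (bs + \<epsilon> t *\<^sub>R u) y - top_bid v (bs + \<epsilon> t *\<^sub>R u') y\<bar> \<le> C * norm ((bs + \<epsilon> t *\<^sub>R u) - (bs + \<epsilon> t *\<^sub>R u'))"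
          by (rule top_bid_lip[OF that])
        also have "(bs + \<epsilon> t *\<^sub>R u) - (bs + \<epsilon> t *\<^sub>R u') = \<epsilon> t *\<^sub>R (u - u')" by (simp add: algebra_simps)
        finally show ?thesis using e C by (simp add: f_def diff_divide_distrib[symmetric] divide_le_eq mult_ac)
      qed
      define Z where "Z u \<omega> = sqrt (real t) * (emp t (sample \<theta> t \<omega>) (f u) - (\<integral>y. f u y \<partial>P))" for u \<omega>
      have diff: "Z u \<omega> - Z u' \<omega> = sqrt (real t) * (emp t (sample \<theta> t \<omega>) (\<lambda>y. f u y - f u' y) - (\<integral>y. f u y - f u' y \<partial>P))" for u u' \<omega>
        using fi by (simp add: Z_def emp_def sum_subtractf algebra_simps)
      have "t > 0" by fact
      obtain E where E: "E \<in> M.events" "M.prob E \<le> (3 * n) ^ (4 * n) * B / L t ^ (4 * n)"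
          "\<And>\<omega> u. \<omega> \<in> space M - E \<Longrightarrow> (\<And>i. \<bar>u $ i\<bar> \<le> real (Suc K)) \<Longrightarrow> \<bar>Z u \<omega> - Z 0 \<omega>\<bar> \<le> 4 * L t * real (Suc K)"
      proof (rule M.chaining_maximal_inequality[where R = "real (Suc K)" and \<kappa> = "L t" and Z = Z and a = 0 and B = B])
        show "L t > 0" using e C a elim by (simp add: L_def)
        show "Z u \<in> borel_measurable M" for u unfolding Z_def[abs_def] emp_sample by measurable
        show "continuous_on UNIV (\<lambda>u. Z u \<omega>)" if "\<omega> \<in> space M" for \<omega>
        proof -
          have "1-lipschitz_on UNIV (\<lambda>u. f u (\<theta> \<tau> \<omega>))" for \<tau>
            using f_lip \<theta>_space[OF that] by (intro lipschitz_onI) (auto simp: dist_norm)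
          then have "continuous_on UNIV (\<lambda>u. f u (\<theta> \<tau> \<omega>))" for \<tau> by (rule lipschitz_on_continuous_on)
          moreover have "1-lipschitz_on UNIV (\<lambda>u. (\<integral>y. f u y \<partial>P))"
          proof (rule lipschitz_onI)
            fix u u'
            have "(\<integral>y. f u y \<partial>P) - (\<integral>y. f u' y \<partial>P) = (\<integral>y. f u y - f u' y \<partial>P)" using fi by simp
            also have "\<bar>\<dots>\<bar> \<le> (\<integral>y. norm (u - u') \<partial>P)" by (rule integral_abs_le) (use fi f_lip in auto)
            finally show "dist (\<integral>y. f u y \<partial>P) (\<integral>y. f u' y \<partial>P) \<le> 1 * dist u u'" by (simp add: prob_Theta dist_norm)
          qed simp
          then have "continuous_on UNIV (\<lambda>u. (\<integral>y. f u y \<partial>P))" by (rule lipschitz_on_continuous_on)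
          ultimately show ?thesis unfolding Z_def emp_sample by (intro continuous_intros)
        qed
        show "M.prob {\<omega>\<in>space M. \<bar>Z u \<omega> - Z u' \<omega>\<bar> > l * norm (u - u')} \<le> B / l ^ (4 * CARD('n))" if l: "l > 0" for u u' :: "real^'n" and l
        proof -
          have "M.prob {\<omega>\<in>space M. \<bar>Z u \<omega> - Z u' \<omega>\<bar> > l * norm (u - u')}
            = M.prob {\<omega>\<in>space M. sqrt (real t) * \<bar>emp t (sample \<theta> t \<omega>) (\<lambda>y. f u y - f u' y) - (\<integral>y. f u y - f u' y \<partial>P)\<bar> > l * norm (u - u')}"
            unfolding diff by (simp add: abs_mult)
          also have "\<dots> \<le> (2 * fact (2 * n) * 2 ^ (2 * n)) / l ^ (2 * (2 * n))"
            using l elim by (intro emp_deviation) (auto intro: f_lip)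
          finally show ?thesis by (simp add: B_def n_def)
        qed
      qed (auto simp: n_def intro!: that)
      have "\<omega> \<in> E" if \<omega>: "\<omega> \<in> space M" and u: "\<And>i. \<bar>u $ i\<bar> \<le> real K"
        and big: "\<bar>(emp t (sample \<theta> t \<omega>) (top_bid v (bs + \<epsilon> t *\<^sub>R u)) - emp t (sample \<theta> t \<omega>) (top_bid v bs))
         - (mean_bid (bs + \<epsilon> t *\<^sub>R u) - mean_bid bs)\<bar> > a * (\<epsilon> t)\<^sup>2" for \<omega> u
      proof (rule ccontr)
        assume "\<omega> \<notin> E"
        then have "\<bar>Z u \<omega> - Z 0 \<omega>\<bar> \<le> 4 * L t * real (Suc K)" using \<omega> u by (intro E(3)) (auto intro: order_trans[OF u])
        also have "\<dots> = a * (sqrt (real t) * \<epsilon> t) / C" using C by (simp add: L_def field_simps del: of_nat_Suc)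
        finally have le: "\<bar>Z u \<omega> - Z 0 \<omega>\<bar> \<le> a * (sqrt (real t) * \<epsilon> t) / C" .
        have "Z u \<omega> - Z 0 \<omega> = sqrt (real t) / (\<epsilon> t * C) * ((emp t (sample \<theta> t \<omega>) (top_bid v (bs + \<epsilon> t *\<^sub>R u)) - emp t (sample \<theta> t \<omega>) (top_bid v bs))
         - (mean_bid (bs + \<epsilon> t *\<^sub>R u) - mean_bid bs))"
          unfolding Z_def f_def mean_bid_def emp_def
          by (simp add: sum_divide_distrib[symmetric] diff_divide_distrib right_diff_distrib mult_ac)
        moreover have c0: "sqrt (real t) / (\<epsilon> t * C) > 0" using e C elim by simp
        ultimately have "sqrt (real t) / (\<epsilon> t * C) * (a * (\<epsilon> t)\<^sup>2) < \<bar>Z u \<omega> - Z 0 \<omega>\<bar>"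
          using mult_strict_left_mono[OF big c0] abs_of_pos[OF c0] by (simp only: abs_mult)
        moreover have "sqrt (real t) / (\<epsilon> t * C) * (a * (\<epsilon> t)\<^sup>2) = a * (sqrt (real t) * \<epsilon> t) / C"
          using e C by (simp add: field_simps power2_eq_square)
        ultimately show False using le by simp
      qed
      then show ?case using E(1,2) by blast
    qed
  qed
qed

lemma typical_samples:
  "outer_vanishing M (\<lambda>t \<omega>. \<not> typical_sample v bs P mean_bid K j (\<epsilon> t) t (sample \<theta> t \<omega>))"
proof -
  define a where "a = 1 / real (Suc j)"
  have a: "a > 0" by (simp add: a_def)
  define q where "q t y = (if clear_win v bs (K * \<epsilon> t) y then 0 else 1 :: real)" for t y
  have [measurable]: "q t \<in> borel_measurable \<Theta>" for t unfolding q_def[abs_def] by measurable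
  have o1: "outer_vanishing M (\<lambda>t \<omega>. emp t (sample \<theta> t \<omega>) (q t) > a)"
  proof (rule outer_vanishing_mono)
    show "outer_vanishing M (\<lambda>t \<omega>. \<bar>emp t (sample \<theta> t \<omega>) (q t) - (\<integral>x. q t x \<partial>P)\<bar> > a / 2)"
      using a by (intro law_of_large_numbers[where c=1]) (auto simp: q_def)
    obtain \<delta> where \<delta>: "\<delta> > 0" "measure P {x\<in>space \<Theta>. \<not> clear_win v bs \<delta> x} < a / 2"
      using near_ties_rare[of "a/2"] a by auto
    have "(\<lambda>t. K * \<epsilon> t) \<longlonglongrightarrow> 0" using tendsto_mult_right_zero[OF eps_zero] by simp
    then have "eventually (\<lambda>t. K * \<epsilon> t < \<delta>) sequentially" using \<delta>(1) by (rule order_tendstoD)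
    then show "\<forall>\<^sub>F t in sequentially. \<forall>\<omega>\<in>space M. emp t (sample \<theta> t \<omega>) (q t) > a \<longrightarrow> \<bar>emp t (sample \<theta> t \<omega>) (q t) - (\<integral>x. q t x \<partial>P)\<bar> > a / 2"
    proof eventually_elim
      case (elim t)
      have "(\<integral>x. q t x \<partial>P) \<le> (\<integral>x. indicator {x\<in>space \<Theta>. \<not> clear_win v bs \<delta> x} x \<partial>P)"
      proof (rule integral_mono)
        fix x assume "x \<in> space P"
        then show "q t x \<le> indicator {x\<in>space \<Theta>. \<not> clear_win v bs \<delta> x} x"
          using clear_win_mono[of v bs \<delta> x "K * \<epsilon> t"] elim by (auto simp: q_def indicator_def)
      qed (auto intro!: integrable_bounded[where K=1] simp: q_def)
      also have "\<dots> = measure P {x\<in>space \<Theta>. \<not> clear_win v bs \<delta> x}" by simp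
      finally have "(\<integral>x. q t x \<partial>P) < a / 2" using \<delta>(2) by simp
      then show ?case by (intro ballI impI) linarith
    qed
  qed
  have o2: "outer_vanishing M (\<lambda>t \<omega>. \<exists>i\<in>UNIV. \<bar>emp t (sample \<theta> t \<omega>) (\<lambda>y. win y $ i) - (\<integral>y. win y $ i \<partial>P)\<bar> > a)"
    by (intro outer_vanishing_bex law_of_large_numbers[where c=C] a C) (auto intro: win_abs)
  have o3: "outer_vanishing M (\<lambda>t \<omega>. \<exists>i\<in>UNIV. \<exists>k\<in>UNIV. \<bar>emp t (sample \<theta> t \<omega>) (\<lambda>y. win y $ i * win y $ k) - (\<integral>y. win y $ i * win y $ k \<partial>P)\<bar> > a)"
    by (intro outer_vanishing_bex law_of_large_numbers[where c="C * C"] a mult_pos_pos C) (auto intro: win_mult_abs)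
  have q: "q t = (\<lambda>y. if clear_win v bs (K * \<epsilon> t) y then 0 else 1)" for t by (simp add: q_def[abs_def])
  show ?thesis
    by (rule outer_vanishing_mono[OF outer_vanishing_disj[OF uniform_deviation[OF a, of K] outer_vanishing_disj[OF o1 outer_vanishing_disj[OF o2 o3]]]])
      (auto simp: typical_sample_def a_def q not_le intro!: always_eventually)
qed

end

section \<open>The observed objective\<close>

lemma emp_mono:
  assumes "\<And>\<tau>. \<tau> < t \<Longrightarrow> f (x \<tau>) \<le> g (x \<tau>)"
  shows "emp t x f \<le> (emp t x g :: real)"
  unfolding emp_def real_scaleR_def using assms by (intro mult_left_mono sum_mono) auto

lemma emp_const: "t > 0 \<Longrightarrow> emp t x (\<lambda>_. c) = (c::real)"
  by (simp add: emp_def)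

lemma emp_abs_le:
  assumes "t > 0" "\<And>\<tau>. \<tau> < t \<Longrightarrow> \<bar>f (x \<tau>)\<bar> \<le> (c::real)"
  shows "\<bar>emp t x f\<bar> \<le> c"
proof -
  have "emp t x f \<le> emp t x (\<lambda>_. c)" "emp t x (\<lambda>_. - c) \<le> emp t x f"
    using assms(2) by (auto intro!: emp_mono simp: abs_le_iff minus_le_iff)
  then show ?thesis using assms(1) by (simp add: emp_const abs_le_iff)
qed

context market begin

lemma barrier_emp:
  assumes t: "t > 0" and x: "\<And>\<tau>. \<tau> < t \<Longrightarrow> x \<tau> \<in> space \<Theta>"
  shows "barrier (\<lambda>\<beta>. emp t x (top_bid v \<beta>)) b C b0"
proof
  fix a c :: "real^'n" and r :: real assume r: "0 \<le> r" "r \<le> 1"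
  have "emp t x (top_bid v ((1 - r) *\<^sub>R a + r *\<^sub>R c)) \<le> emp t x (\<lambda>y. (1 - r) * top_bid v a y + r * top_bid v c y)"
    by (intro emp_mono top_bid_convex r)
  also have "\<dots> = (1 - r) * emp t x (top_bid v a) + r * emp t x (top_bid v c)"
    by (simp add: emp_def sum.distrib sum_distrib_left[symmetric] add_divide_distrib)
  finally show "emp t x (top_bid v ((1 - r) *\<^sub>R a + r *\<^sub>R c)) \<le> (1 - r) * emp t x (top_bid v a) + r * emp t x (top_bid v c)" .
next
  fix a c :: "real^'n"
  have "emp t x (top_bid v a) - emp t x (top_bid v c) = emp t x (\<lambda>y. top_bid v a y - top_bid v c y)"
    by (simp add: emp_def sum_subtractf diff_divide_distrib)
  also have "\<bar>\<dots>\<bar> \<le> C * norm (a - c)" by (intro emp_abs_le t top_bid_lip x)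
  finally show "\<bar>emp t x (top_bid v a) - emp t x (top_bid v c)\<bar> \<le> C * norm (a - c)" .
next
  fix \<beta> :: "real^'n" assume "\<And>i. 0 \<le> \<beta> $ i"
  then have "emp t x (\<lambda>_. 0) \<le> emp t x (top_bid v \<beta>)"
    by (intro emp_mono top_bid_nonneg v_nonneg x)
  then show "0 \<le> emp t x (top_bid v \<beta>)" by (simp add: emp_def)
next
  have "emp t x (top_bid v (\<chi> i. 1)) \<le> emp t x (\<lambda>_. C)"
    by (intro emp_mono top_bid_le v_nonneg v_le x) auto
  then show "emp t x (top_bid v (\<chi> i. 1)) \<le> C" using t by (simp add: emp_const)
qed (use C b0 in auto)

lemma Ht_obj_eq:
  assumes "t > 0" shows "Ht_obj v b t x = log_obj (\<lambda>\<beta>. emp t x (top_bid v \<beta>)) b"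
  using assms by (auto simp: fun_eq_iff Ht_obj_def log_obj_def F_obj_top_bid emp_def sum_subtractf right_diff_distrib)

lemma beta_gamma_arg_min:
  assumes "t > 0" "\<And>\<tau>. \<tau> < t \<Longrightarrow> x \<tau> \<in> space \<Theta>"
  shows "is_arg_min (Ht_obj v b t x) (\<lambda>\<beta>. \<beta> \<in> pacing_box) (beta_gamma v b t x)"
  unfolding beta_gamma_def Ht_obj_eq[OF assms(1)] by (rule barrier.arg_min_on_is_arg_min[OF barrier_emp[of t x, OF assms]])

lemma Ht_growth:
  assumes "t > 0" "\<And>\<tau>. \<tau> < t \<Longrightarrow> x \<tau> \<in> space \<Theta>" "y \<in> pacing_box"
  shows "Ht_obj v b t x (beta_gamma v b t x) + b0 / 4 * (norm (y - beta_gamma v b t x))\<^sup>2 \<le> Ht_obj v b t x y"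
  using barrier.quadratic_growth[OF barrier_emp[of t x, OF assms(1,2)] _ assms(3)] beta_gamma_arg_min[of t x, OF assms(1,2)]
  unfolding Ht_obj_eq[OF assms(1)] by blast

end

section \<open>Resampling along a typical sequence of samples\<close>

lemma boot_fluct_inner: "c \<bullet> boot_fluct t x g w = boot_fluct t x (\<lambda>y. c \<bullet> g y) w"
  by (simp add: boot_fluct_def emp_boot_def emp_def inner_diff_right inner_sum_right inner_scaleR_right)

lemma boot_fluct_nth: "boot_fluct t x g w $ i = boot_fluct t x (\<lambda>y. (g y :: real^'n) $ i) w"
  by (simp add: boot_fluct_def emp_boot_def emp_def sum_component)

lemma boot_fluct_diff:
  "boot_fluct t x (\<lambda>y. f y - g y) w = boot_fluct t x f w - (boot_fluct t x g w :: 'b::real_vector)"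
  by (simp add: boot_fluct_def emp_boot_def emp_def sum_subtractf scaleR_diff_right algebra_simps)

lemma boot_fluct_scale: "boot_fluct t x (\<lambda>y. c * f y) w = c * (boot_fluct t x f w :: real)"
  by (simp add: boot_fluct_def emp_boot_def emp_def sum_distrib_left algebra_simps)

text \<open>The weights sum to \<open>t\<close>. Hence the barrier does not fluctuate, and neither does any part of a subgradient
  that is the same for all items.\<close>

lemma boot_fluct_const:
  assumes "t > 0" "w \<in> set_pmf (boot_weights t)"
  shows "boot_fluct t x (\<lambda>_. c) w = (0 :: 'b::real_vector)"
proof -
  have "(\<Sum>\<tau><t. real (w \<tau>) *\<^sub>R c) = real t *\<^sub>R c"
    using sum_boot_weights[OF assms(2)] by (simp flip: scaleR_left.sum)
  then show ?thesis by (simp add: boot_fluct_def emp_boot_def emp_def sum_constant_scaleR)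
qed

lemma nu_obj_eq:
  assumes t: "t > 0" and w: "w \<in> set_pmf (boot_weights t)"
  shows "nu_obj v b \<epsilon> t x w \<beta> = Ht_obj v b t x \<beta> + \<epsilon> * boot_fluct t x (top_bid v \<beta>) w"
proof -
  define c where "c = (\<Sum>i\<in>UNIV. b $ i * ln (\<beta> $ i))"
  have "boot_fluct t x (\<lambda>y. F_obj v b y \<beta>) w = boot_fluct t x (top_bid v \<beta>) w - boot_fluct t x (\<lambda>_. c) w"
    unfolding F_obj_top_bid c_def[symmetric] by (rule boot_fluct_diff)
  then have eq: "boot_fluct t x (top_bid v \<beta>) w = boot_fluct t x (\<lambda>y. F_obj v b y \<beta>) w"
    by (simp add: boot_fluct_const[OF t w])
  define F where "F \<tau> = F_obj v b (x \<tau>) \<beta>" for \<tau>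
  have "(\<Sum>\<tau><t. (1 + \<epsilon> * sqrt (real t) * (real (w \<tau>) - 1)) * F \<tau>)
      = (\<Sum>\<tau><t. F \<tau>) + \<epsilon> * sqrt (real t) * ((\<Sum>\<tau><t. real (w \<tau>) * F \<tau>) - (\<Sum>\<tau><t. F \<tau>))"
    by (simp add: algebra_simps sum.distrib sum_subtractf sum_distrib_left)
  then show ?thesis unfolding eq
    by (simp add: nu_obj_def Ht_obj_def boot_fluct_def emp_boot_def emp_def F_def add_divide_distrib diff_divide_distrib[symmetric])
qed

text \<open>A deterministic sequence of samples, of sizes \<open>T k\<close> and at scales \<open>e k\<close>, each property of
  \<open>typical_sample\<close> holding eventually. Only the weights are random from here on.\<close>

locale typical_sequence = smooth_market \<Theta> s v b C
  for \<Theta> :: "'a measure" and s :: "'a \<Rightarrow> real" and v :: "'n::finite \<Rightarrow> 'a \<Rightarrow> real" and b :: "real^'n" and C :: real +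
  fixes T :: "nat \<Rightarrow> nat" and x :: "nat \<Rightarrow> nat \<Rightarrow> 'a" and e :: "nat \<Rightarrow> real" and N :: "(real^'n) measure"
  assumes T_pos: "\<And>k. T k > 0" and T_lim: "filterlim T at_top sequentially"
    and x_space: "\<And>k \<tau>. \<tau> < T k \<Longrightarrow> x k \<tau> \<in> space \<Theta>"
    and e_pos: "\<And>k. e k > 0" and e_zero: "e \<longlonglongrightarrow> 0"
    and typical: "\<And>K j. \<forall>\<^sub>F k in sequentially. typical_sample v bs P mean_bid K j (e k) (T k) (x k)"
    and gaussian: "multivariate_normal 0 (grad_cov \<Theta> s v b) N"
begin

abbreviation "Ht k \<equiv> Ht_obj v b (T k) (x k)"
abbreviation "bg k \<equiv> beta_gamma v b (T k) (x k)"
abbreviation "W k \<equiv> boot_weights (T k)"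
abbreviation "\<Gamma> k \<equiv> boot_fluct (T k) (x k) win"

definition rare :: "(nat \<Rightarrow> (nat \<Rightarrow> nat) \<Rightarrow> bool) \<Rightarrow> bool" where
  "rare Q \<longleftrightarrow> (\<lambda>k. measure_pmf.prob (W k) {w. Q k w}) \<longlonglongrightarrow> 0"

lemma rare_mono:
  assumes "rare Q" "\<forall>\<^sub>F k in sequentially. \<forall>w\<in>set_pmf (W k). Q' k w \<longrightarrow> Q k w"
  shows "rare Q'"
  unfolding rare_def
proof (rule tendsto_sandwich[OF _ _ tendsto_const assms(1)[unfolded rare_def]])
  show "\<forall>\<^sub>F k in sequentially. measure_pmf.prob (W k) {w. Q' k w} \<le> measure_pmf.prob (W k) {w. Q k w}"
    using assms(2)
  proof eventually_elim
    case (elim k)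
    then show ?case by (intro measure_pmf.finite_measure_mono_AE AE_pmfI) auto
  qed
qed auto

lemma rare_disj:
  assumes "rare Q" "rare Q'" shows "rare (\<lambda>k w. Q k w \<or> Q' k w)"
  unfolding rare_def
proof (rule tendsto_sandwich[of "\<lambda>_. 0"])
  show "(\<lambda>k. measure_pmf.prob (W k) {w. Q k w} + measure_pmf.prob (W k) {w. Q' k w}) \<longlonglongrightarrow> 0"
    using tendsto_add[OF assms[unfolded rare_def]] by simp
  have "measure_pmf.prob (W k) {w. Q k w \<or> Q' k w} \<le> measure_pmf.prob (W k) {w. Q k w} + measure_pmf.prob (W k) {w. Q' k w}" for k
    unfolding Collect_disj_eq by (rule measure_Un_le) auto
  then show "\<forall>\<^sub>F k in sequentially. measure_pmf.prob (W k) {w. Q k w \<or> Q' k w} \<le> measure_pmf.prob (W k) {w. Q k w} + measure_pmf.prob (W k) {w. Q' k w}"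
    by (intro always_eventually allI)
qed auto

lemma rare_bex:
  assumes "finite I" "\<And>i. i \<in> I \<Longrightarrow> rare (Q i)" shows "rare (\<lambda>k w. \<exists>i\<in>I. Q i k w)"
  using assms by (induction I rule: finite_induct) (auto simp: rare_def[of "\<lambda>_ _. False"] intro: rare_disj)

lemma rare_bounded:
  assumes "\<forall>\<^sub>F k in sequentially. measure_pmf.prob (W k) {w. Q k w} \<le> p k" "p \<longlonglongrightarrow> 0"
  shows "rare Q"
  unfolding rare_def by (rule tendsto_sandwich[OF _ assms(1) tendsto_const assms(2)]) auto

text \<open>Events such as \<open>norm (\<Gamma> k w) > L\<close> do not become rare for fixed \<open>L\<close>; their probability is only small
  uniformly in \<open>k\<close> for large \<open>L\<close>. This is how they are disposed of.\<close>

lemma rare_if_tight: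
  assumes "\<And>r. r > 0 \<Longrightarrow> \<exists>Q'. rare Q' \<and> (\<exists>R. (\<forall>\<^sub>F k in sequentially. measure_pmf.prob (W k) {w. R k w} \<le> r) \<and>
      (\<forall>\<^sub>F k in sequentially. \<forall>w\<in>set_pmf (W k). Q k w \<longrightarrow> Q' k w \<or> R k w))"
  shows "rare Q"
  unfolding rare_def
proof (rule LIMSEQ_I)
  fix r :: real assume r: "r > 0"
  obtain Q' R where Q': "rare Q'" and R: "\<forall>\<^sub>F k in sequentially. measure_pmf.prob (W k) {w. R k w} \<le> r / 3"
    and sub: "\<forall>\<^sub>F k in sequentially. \<forall>w\<in>set_pmf (W k). Q k w \<longrightarrow> Q' k w \<or> R k w"
    using assms[of "r/3"] r by auto
  have "\<forall>\<^sub>F k in sequentially. measure_pmf.prob (W k) {w. Q' k w} < r / 3"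
    using Q' r unfolding rare_def by (intro order_tendstoD(2)) auto
  then have "\<forall>\<^sub>F k in sequentially. norm (measure_pmf.prob (W k) {w. Q k w} - 0) < r"
    using R sub
  proof eventually_elim
    case (elim k)
    have "measure_pmf.prob (W k) {w. Q k w} \<le> measure_pmf.prob (W k) ({w. Q' k w} \<union> {w. R k w})"
      using elim(3) by (intro measure_pmf.finite_measure_mono_AE AE_pmfI) auto
    also have "\<dots> \<le> measure_pmf.prob (W k) {w. Q' k w} + measure_pmf.prob (W k) {w. R k w}"
      by (rule measure_Un_le) auto
    also have "\<dots> < r" using elim(1,2) r by linarith
    finally show ?case by simp
  qed
  then show "\<exists>no. \<forall>k\<ge>no. norm (measure_pmf.prob (W k) {w. Q k w} - 0) < r" by (simp add: eventually_sequentially)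
qed

lemma bg_arg_min: "is_arg_min (Ht k) (\<lambda>\<beta>. \<beta> \<in> pacing_box) (bg k)"
  by (rule beta_gamma_arg_min[of "T k" "x k", OF T_pos x_space])

lemma bg_box: "bg k \<in> pacing_box" and bg_le: "y \<in> pacing_box \<Longrightarrow> Ht k (bg k) \<le> Ht k y"
  using bg_arg_min by (auto simp: is_arg_min_linorder)

lemma bg_growth: "y \<in> pacing_box \<Longrightarrow> Ht k (bg k) + b0 / 4 * (norm (y - bg k))\<^sup>2 \<le> Ht k y"
  by (rule Ht_growth[of "T k" "x k", OF T_pos x_space])

lemma Ht_H_diff: "Ht k y - Ht k z - (H y - H z) =
   (emp (T k) (x k) (top_bid v y) - emp (T k) (x k) (top_bid v z)) - (mean_bid y - mean_bid z)"
  unfolding Ht_obj_eq[OF T_pos] H_obj_eq log_obj_def by simp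

lemma typicalD:
  assumes "typical_sample v bs P mean_bid K j (e k) (T k) (x k)" "\<And>i. \<bar>u $ i\<bar> \<le> real K"
  shows "\<bar>Ht k (bs + e k *\<^sub>R u) - Ht k bs - (H (bs + e k *\<^sub>R u) - H bs)\<bar> \<le> (e k)\<^sup>2 / Suc j"
  using assms unfolding Ht_H_diff typical_sample_def by blast

text \<open>The observed objective is convex and at \<open>bg k\<close> does not exceed its value at \<open>bs\<close>. If \<open>bg k\<close> were farther
  away than \<open>q * e k\<close>, the same would hold where the segment between them crosses the sphere of this
  radius; but there \<open>H\<close> has grown by \<open>b0 / 4 * (q * e k)\<^sup>2\<close>, which exceeds the deviation allowed in a typical
  sample.\<close>

lemma bg_consistent:
  assumes \<kappa>: "\<kappa> > 0"
  shows "\<forall>\<^sub>F k in sequentially. norm (bg k - bs) \<le> \<kappa> * e k"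
proof -
  define q where "q = min \<kappa> 1"
  have q: "q > 0" "q \<le> 1" "q \<le> \<kappa>" using \<kappa> by (auto simp: q_def)
  \<comment> \<open>\<open>q \<le> 1\<close>, so that a typical sample is needed for \<open>K = 1\<close> only\<close>
  obtain j :: nat where j: "1 / Suc j < b0 / 4 * q\<^sup>2"
    using nat_approx_posE[of "b0 / 4 * q\<^sup>2"] b0(1) q(1) by auto
  from typical[of 1 j] show ?thesis
  proof eventually_elim
    case (elim k)
    have ek: "e k > 0" by (rule e_pos)
    show ?case
    proof (rule ccontr)
      assume "\<not> norm (bg k - bs) \<le> \<kappa> * e k"
      moreover have "q * e k \<le> \<kappa> * e k" using q ek by (intro mult_right_mono) auto
      ultimately have far: "q * e k < norm (bg k - bs)" by simp
      define D where "D = bg k - bs"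
      have D: "norm D > 0" using far q ek unfolding D_def by (meson le_less_trans less_imp_le mult_nonneg_nonneg)
      define r where "r = q * e k / norm D"
      have r: "0 < r" "r < 1" using far D q ek by (auto simp: r_def D_def[symmetric])
      define u where "u = (q / norm D) *\<^sub>R D"
      have y: "(1 - r) *\<^sub>R bs + r *\<^sub>R bg k = bs + e k *\<^sub>R u"
        by (simp add: r_def u_def D_def[symmetric] algebra_simps) (simp add: D_def algebra_simps)
      have nu: "norm u = q" using D q by (simp add: u_def)
      have orth: "bs \<in> pos_orthant" "bg k \<in> pos_orthant" using bs_box bg_box[of k] by (auto simp: pacing_box_def pos_orthant_def)
      have "Ht k (bs + e k *\<^sub>R u) \<le> (1 - r) * Ht k bs + r * Ht k (bg k)"
        unfolding Ht_obj_eq[OF T_pos] y[symmetric]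
        by (rule barrier.log_obj_convex[OF barrier_emp[of "T k" "x k", OF T_pos x_space] orth]) (use r in auto)
      also have "\<dots> \<le> (1 - r) * Ht k bs + r * Ht k bs"
        using bg_le[OF bs_box, of k] r by (intro add_left_mono mult_left_mono) auto
      also have "\<dots> = Ht k bs" by (simp add: algebra_simps)
      finally have le: "Ht k (bs + e k *\<^sub>R u) \<le> Ht k bs" .
      have "bs + e k *\<^sub>R u \<in> pacing_box"
      proof -
        have "convex (pacing_box :: (real^'n) set)"
        proof -
          have "pacing_box = (\<Inter>i. {\<beta> :: real^'n. 0 < axis i 1 \<bullet> \<beta>} \<inter> {\<beta>. axis i 1 \<bullet> \<beta> \<le> 1})"
            by (auto simp: pacing_box_def inner_axis')
          also have "convex \<dots>" by (intro convex_INT convex_Int convex_halfspace_gt convex_halfspace_le)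
          finally show ?thesis .
        qed
        from convexD[OF this bs_box bg_box[of k], of "1 - r" r] show ?thesis using r by (simp add: y)
      qed
      from H_growth[OF this] have "b0 / 4 * (e k)\<^sup>2 * q\<^sup>2 \<le> H (bs + e k *\<^sub>R u) - H bs"
        using ek nu by (simp add: power_mult_distrib)
      moreover have "\<bar>Ht k (bs + e k *\<^sub>R u) - Ht k bs - (H (bs + e k *\<^sub>R u) - H bs)\<bar> \<le> (e k)\<^sup>2 / Suc j"
        by (rule typicalD[OF elim]) (use component_le_norm_cart[of u] nu q in \<open>auto intro: order_trans\<close>)
      ultimately have "b0 / 4 * (e k)\<^sup>2 * q\<^sup>2 \<le> (e k)\<^sup>2 / Suc j" using le by linarith
      then have "(e k)\<^sup>2 * (b0 / 4 * q\<^sup>2) \<le> (e k)\<^sup>2 * (1 / Suc j)" by (simp add: mult_ac)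
      then have "b0 / 4 * q\<^sup>2 \<le> 1 / Suc j" using ek by (subst (asm) mult_le_cancel_left_pos) auto
      then show False using j by simp
    qed
  qed
qed

lemma local_quadratic:
  assumes a: "a > 0" and K: "K \<ge> 0"
  shows "\<forall>\<^sub>F k in sequentially. \<forall>u. norm u \<le> K \<longrightarrow>
     \<bar>Ht k (bs + e k *\<^sub>R u) - Ht k bs - (e k)\<^sup>2 * (1/2 * (u \<bullet> (A *v u)))\<bar> \<le> a * (e k)\<^sup>2"
proof -
  define a' where "a' = a / (2 * (K\<^sup>2 + 1))"
  have K1: "K\<^sup>2 + 1 > 0" by (intro add_nonneg_pos) auto
  have a': "a' > 0" using a K1 by (simp add: a'_def)
  have a'K: "a' * K\<^sup>2 \<le> a / 2"
  proof -
    have "a' * K\<^sup>2 \<le> a' * (K\<^sup>2 + 1)" using a' by simp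
    also have "\<dots> = a / 2"
    proof -
      have "a / (2 * X) * X = a / 2" if "X > 0" for X :: real using that by simp
      from this[OF K1] show ?thesis unfolding a'_def .
    qed
    finally show ?thesis .
  qed
  obtain d where d: "d > 0" "\<And>h. norm h < d \<Longrightarrow> \<bar>H (bs + h) - H bs - 1/2 * (h \<bullet> (A *v h))\<bar> \<le> a' * (norm h)\<^sup>2"
    using H_taylor[OF a'] by metis
  obtain j :: nat where j: "1 / Suc j < a / 2" using nat_approx_posE[of "a / 2"] a by auto
  have "(\<lambda>k. K * e k) \<longlonglongrightarrow> 0" using tendsto_mult_right_zero[OF e_zero] by simp
  then have "\<forall>\<^sub>F k in sequentially. K * e k < d" using d(1) by (rule order_tendstoD)
  with typical[of "nat \<lceil>K\<rceil>" j] show ?thesis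
  proof eventually_elim
    case (elim k)
    show ?case
    proof (intro allI impI)
      fix u :: "real^'n" assume u: "norm u \<le> K"
      have ek: "e k > 0" by (rule e_pos)
      have "\<bar>u $ i\<bar> \<le> real (nat \<lceil>K\<rceil>)" for i using component_le_norm_cart[of u i] u K by linarith
      then have 1: "\<bar>Ht k (bs + e k *\<^sub>R u) - Ht k bs - (H (bs + e k *\<^sub>R u) - H bs)\<bar> \<le> (e k)\<^sup>2 / Suc j"
        by (rule typicalD[OF elim(1)])
      have nh: "norm (e k *\<^sub>R u) = e k * norm u" using ek by simp
      have "e k * norm u \<le> e k * K" using ek u by (intro mult_left_mono) auto
      then have "norm (e k *\<^sub>R u) < d" unfolding nh using elim(2) by (simp add: mult.commute)
      from d(2)[OF this] have "\<bar>H (bs + e k *\<^sub>R u) - H bs - (e k)\<^sup>2 * (1/2 * (u \<bullet> (A *v u)))\<bar> \<le> a' * (e k * norm u)\<^sup>2"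
        using ek by (simp add: matrix_vector_mult_scaleR power2_eq_square mult.assoc)
      also have "a' * (e k * norm u)\<^sup>2 \<le> a' * (e k * K)\<^sup>2"
        using ek u a' by (intro mult_left_mono power_mono) auto
      also have "\<dots> = (a' * K\<^sup>2) * (e k)\<^sup>2" by (simp add: power_mult_distrib)
      also have "\<dots> \<le> a / 2 * (e k)\<^sup>2" by (intro mult_right_mono a'K) auto
      finally have 2: "\<bar>H (bs + e k *\<^sub>R u) - H bs - (e k)\<^sup>2 * (1/2 * (u \<bullet> (A *v u)))\<bar> \<le> a / 2 * (e k)\<^sup>2" .
      have "(e k)\<^sup>2 * (1 / Suc j) \<le> (e k)\<^sup>2 * (a / 2)" using j by (intro mult_left_mono) auto
      then have "(e k)\<^sup>2 / Suc j \<le> a / 2 * (e k)\<^sup>2" by (simp add: mult.commute)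
      with 1 2 show "\<bar>Ht k (bs + e k *\<^sub>R u) - Ht k bs - (e k)\<^sup>2 * (1/2 * (u \<bullet> (A *v u)))\<bar> \<le> a * (e k)\<^sup>2"
        by linarith
    qed
  qed
qed

text \<open>At scale \<open>e k\<close> the only constraints of the box that remain visible are those active at \<open>bs\<close>.\<close>

lemma cone_feasible:
  assumes K: "K \<ge> 0"
  shows "\<forall>\<^sub>F k in sequentially. \<forall>u. norm u \<le> K \<longrightarrow> u \<in> limit_cone \<Theta> s v b \<longrightarrow> bs + e k *\<^sub>R u \<in> pacing_box"
proof -
  define r where "r = Min (range (\<lambda>i. if bs $ i = 1 then bs $ i else min (bs $ i) (1 - bs $ i)))"
  have "0 < (if bs $ i = 1 then bs $ i else min (bs $ i) (1 - bs $ i))" for i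
    using bs(1)[of i] bs(2)[of i] by (auto simp: min_def)
  then have r0: "r > 0" unfolding r_def by (subst Min_gr_iff) (fastforce simp del: min_less_iff_conj)+
  have r: "r \<le> (if bs $ i = 1 then bs $ i else min (bs $ i) (1 - bs $ i))" for i unfolding r_def by (rule Min_le) auto
  have "(\<lambda>k. K * e k) \<longlonglongrightarrow> 0" using tendsto_mult_right_zero[OF e_zero] by simp
  then have "\<forall>\<^sub>F k in sequentially. K * e k < r" using r0 by (rule order_tendstoD)
  then show ?thesis
  proof eventually_elim
    case (elim k)
    show ?case
    proof (intro allI impI)
      fix u assume u: "norm u \<le> K" and c: "u \<in> limit_cone \<Theta> s v b"
      have ek: "e k > 0" by (rule e_pos)
      have "0 < bs $ i + e k * u $ i \<and> bs $ i + e k * u $ i \<le> 1" for i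
      proof -
        have "\<bar>e k * u $ i\<bar> \<le> e k * K"
          using component_le_norm_cart[of u i] u ek unfolding abs_mult by (intro mult_mono) auto
        then have s: "\<bar>e k * u $ i\<bar> < r" using elim by (simp add: mult.commute)
        show ?thesis
        proof (cases "bs $ i = 1")
          case True
          then have "u $ i \<le> 0" using c by (simp add: limit_cone_iff)
          then have "e k * u $ i \<le> 0" using ek by (simp add: mult_le_0_iff)
          then show ?thesis using s r[of i] True by auto
        next
          case False
          then show ?thesis using s r[of i] by auto
        qed
      qed
      then show "bs + e k *\<^sub>R u \<in> pacing_box" by (simp add: pacing_box_def)
    qed
  qed
qed

lemma feasible_cone:
  assumes "\<And>i. (bs + e k *\<^sub>R u) $ i \<le> 1"
  shows "u \<in> limit_cone \<Theta> s v b"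
  unfolding limit_cone_iff
proof (intro allI impI)
  fix i assume "bs $ i = 1"
  then have "e k * u $ i \<le> 0" using assms[of i] by simp
  then show "u $ i \<le> 0" using e_pos[of k] by (simp add: mult_le_0_iff)
qed

subsection \<open>The conditional central limit theorem\<close>

lemma win_emp_bound: "emp (T k) (x k) (\<lambda>y. (win y $ i)\<^sup>2) \<le> C\<^sup>2"
proof -
  have "emp (T k) (x k) (\<lambda>y. (win y $ i)\<^sup>2) \<le> emp (T k) (x k) (\<lambda>_. C\<^sup>2)"
  proof (intro emp_mono)
    fix \<tau> assume "\<tau> < T k"
    from win_abs[OF x_space[OF this]] show "(win (x k \<tau>) $ i)\<^sup>2 \<le> C\<^sup>2"
      using C by (simp add: abs_le_square_iff[symmetric])
  qed
  then show ?thesis using T_pos by (simp add: emp_const)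
qed

text \<open>Chebyshev's inequality in each coordinate, with the bound \<open>C\<close> for the valuations.\<close>

lemma \<Gamma>_tight:
  assumes r: "r > 0"
  obtains L where "L > 0" "\<And>k. measure_pmf.prob (W k) {w. norm (\<Gamma> k w) > L} \<le> r"
proof -
  define n where "n = real CARD('n)"
  have n: "n > 0" by (simp add: n_def)
  define l where "l = sqrt (n * C\<^sup>2 / r)"
  have l: "l > 0" "l\<^sup>2 = n * C\<^sup>2 / r" using n C r by (auto simp: l_def)
  show thesis
  proof (rule that[of "n * l"])
    show "n * l > 0" using n l by simp
    fix k
    have "measure_pmf.prob (W k) {w. norm (\<Gamma> k w) > n * l} \<le> measure_pmf.prob (W k) (\<Union>i\<in>UNIV. {w. \<bar>boot_fluct (T k) (x k) (\<lambda>y. win y $ i) w\<bar> > l})"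
    proof (intro measure_pmf.finite_measure_mono subsetI)
      fix w assume "w \<in> {w. norm (\<Gamma> k w) > n * l}"
      then have "\<not> (\<forall>i. \<bar>\<Gamma> k w $ i\<bar> \<le> l)" using norm_le_card[of "\<Gamma> k w" l] by (auto simp: n_def)
      then show "w \<in> (\<Union>i\<in>UNIV. {w. \<bar>boot_fluct (T k) (x k) (\<lambda>y. win y $ i) w\<bar> > l})"
        by (auto simp: boot_fluct_nth not_le)
    qed simp
    also have "\<dots> \<le> (\<Sum>i\<in>UNIV. measure_pmf.prob (W k) {w. \<bar>boot_fluct (T k) (x k) (\<lambda>y. win y $ i) w\<bar> > l})"
      by (rule measure_pmf.finite_measure_subadditive_finite) auto
    also have "\<dots> \<le> (\<Sum>i\<in>(UNIV::'n set). C\<^sup>2 / l\<^sup>2)"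
    proof (rule sum_mono)
      fix i
      have "measure_pmf.prob (W k) {w. \<bar>boot_fluct (T k) (x k) (\<lambda>y. win y $ i) w\<bar> > l} \<le> emp (T k) (x k) (\<lambda>y. (win y $ i)\<^sup>2) / l\<^sup>2"
        by (rule boot_fluct_chebyshev[OF T_pos l(1)])
      also have "\<dots> \<le> C\<^sup>2 / l\<^sup>2" by (intro divide_right_mono win_emp_bound) simp
      finally show "measure_pmf.prob (W k) {w. \<bar>boot_fluct (T k) (x k) (\<lambda>y. win y $ i) w\<bar> > l} \<le> C\<^sup>2 / l\<^sup>2" .
    qed
    also have "\<dots> = r" using l C n r by (simp add: n_def)
    finally show "measure_pmf.prob (W k) {w. norm (\<Gamma> k w) > n * l} \<le> r" .
  qed
qed

lemma emp_win_lim: "(\<lambda>k. emp (T k) (x k) (\<lambda>y. win y $ i)) \<longlonglongrightarrow> (\<integral>y. win y $ i \<partial>P)"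
  and emp_win_mult_lim: "(\<lambda>k. emp (T k) (x k) (\<lambda>y. win y $ i * win y $ j)) \<longlonglongrightarrow> (\<integral>y. win y $ i * win y $ j \<partial>P)"
proof -
  have *: "f \<longlonglongrightarrow> l" if "\<And>j::nat. \<forall>\<^sub>F k in sequentially. \<bar>f k - l\<bar> \<le> 1 / Suc j" for f and l :: real
  proof (rule tendstoI)
    fix r :: real assume "r > 0"
    then obtain j :: nat where j: "1 / Suc j < r" using nat_approx_posE by metis
    from that[of j] show "\<forall>\<^sub>F k in sequentially. dist (f k) l < r"
      by eventually_elim (use j in \<open>auto simp: dist_real_def\<close>)
  qed
  show "(\<lambda>k. emp (T k) (x k) (\<lambda>y. win y $ i)) \<longlonglongrightarrow> (\<integral>y. win y $ i \<partial>P)"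
    by (rule *, rule eventually_mono[OF typical[of 0]]) (auto simp: typical_sample_def)
  show "(\<lambda>k. emp (T k) (x k) (\<lambda>y. win y $ i * win y $ j)) \<longlonglongrightarrow> (\<integral>y. win y $ i * win y $ j \<partial>P)"
    by (rule *, rule eventually_mono[OF typical[of 0]]) (auto simp: typical_sample_def)
qed

lemma emp_var_lim:
  "(\<lambda>k. emp (T k) (x k) (\<lambda>y. (c \<bullet> win y)\<^sup>2) - (emp (T k) (x k) (\<lambda>y. c \<bullet> win y))\<^sup>2) \<longlonglongrightarrow> c \<bullet> (S *v c)"
proof -
  have 1: "emp (T k) (x k) (\<lambda>y. (c \<bullet> win y)\<^sup>2) = (\<Sum>i\<in>UNIV. \<Sum>j\<in>UNIV. c $ i * (c $ j * emp (T k) (x k) (\<lambda>y. win y $ i * win y $ j)))" for k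
  proof -
    have "(\<Sum>\<tau><T k. (c \<bullet> win (x k \<tau>))\<^sup>2) = (\<Sum>\<tau><T k. \<Sum>i\<in>UNIV. \<Sum>j\<in>UNIV. c $ i * (c $ j * (win (x k \<tau>) $ i * win (x k \<tau>) $ j)))"
      by (intro sum.cong refl) (simp add: inner_vec_def power2_eq_square sum_product mult_ac)
    also have "\<dots> = (\<Sum>i\<in>UNIV. \<Sum>\<tau><T k. \<Sum>j\<in>UNIV. c $ i * (c $ j * (win (x k \<tau>) $ i * win (x k \<tau>) $ j)))" by (rule sum.swap)
    also have "\<dots> = (\<Sum>i\<in>UNIV. \<Sum>j\<in>UNIV. \<Sum>\<tau><T k. c $ i * (c $ j * (win (x k \<tau>) $ i * win (x k \<tau>) $ j)))"
      by (intro sum.cong refl sum.swap)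
    finally show ?thesis by (simp add: emp_def sum_distrib_left sum_divide_distrib)
  qed
  have 2: "emp (T k) (x k) (\<lambda>y. c \<bullet> win y) = (\<Sum>i\<in>UNIV. c $ i * emp (T k) (x k) (\<lambda>y. win y $ i))" for k
  proof -
    have "(\<Sum>\<tau><T k. c \<bullet> win (x k \<tau>)) = (\<Sum>i\<in>UNIV. \<Sum>\<tau><T k. c $ i * win (x k \<tau>) $ i)"
      unfolding inner_vec_def by (simp add: sum.swap[of _ UNIV])
    then show ?thesis by (simp add: emp_def sum_distrib_left sum_divide_distrib)
  qed
  have "c \<bullet> (S *v c) = (\<Sum>i\<in>UNIV. \<Sum>j\<in>UNIV. c $ i * (c $ j * (\<integral>y. win y $ i * win y $ j \<partial>P))) - (\<Sum>i\<in>UNIV. c $ i * (\<integral>y. win y $ i \<partial>P))\<^sup>2"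
  proof -
    have "c \<bullet> (S *v c) = (\<Sum>i\<in>UNIV. \<Sum>j\<in>UNIV. c $ i * (c $ j * S $ i $ j))"
      by (simp add: inner_vec_def matrix_vector_mult_def sum_distrib_left mult_ac)
    also have "(\<Sum>i\<in>UNIV. c $ i * (\<integral>y. win y $ i \<partial>P))\<^sup>2 = (\<Sum>i\<in>UNIV. \<Sum>j\<in>UNIV. c $ i * (c $ j * ((\<integral>x. win x $ i \<partial>P) * (\<integral>x. win x $ j \<partial>P))))"
      by (simp add: power2_eq_square sum_product mult_ac)
    ultimately show ?thesis unfolding cov_entry by (simp add: right_diff_distrib sum_subtractf)
  qed
  then show ?thesis unfolding 1 2 by (simp only:) (intro tendsto_intros emp_win_lim emp_win_mult_lim)
qed

lemma \<Gamma>_char_lim: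
  "(\<lambda>k. CLINT w|W k. iexp (c \<bullet> \<Gamma> k w)) \<longlonglongrightarrow> (CLINT z|N. iexp (c \<bullet> z))"
proof -
  define c' where "c' = norm c * (CARD('n) * C)"
  define s2 where "s2 k = emp (T k) (x k) (\<lambda>y. (c \<bullet> win y)\<^sup>2) - (emp (T k) (x k) (\<lambda>y. c \<bullet> win y))\<^sup>2" for k
  have N: "(CLINT z|N. iexp (c \<bullet> z)) = exp (- (c \<bullet> (S *v c)) / 2)"
    using char_multivariate_normal[OF gaussian cov_nonneg] by simp
  have "(\<lambda>k. complex_of_real (exp (- s2 k / 2))) \<longlonglongrightarrow> complex_of_real (exp (- (c \<bullet> (S *v c)) / 2))"
    unfolding s2_def by (intro tendsto_intros emp_var_lim) simp
  moreover have "(\<lambda>k. (CLINT w|W k. iexp (c \<bullet> \<Gamma> k w)) - exp (- s2 k / 2)) \<longlonglongrightarrow> 0"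
  proof (rule Lim_null_comparison)
    show "\<forall>\<^sub>F k in sequentially. cmod ((CLINT w|W k. iexp (c \<bullet> \<Gamma> k w)) - exp (- s2 k / 2)) \<le> ((2 * c')^3 / 6 + c'^4 / 4) / sqrt (real (T k))"
    proof (intro always_eventually allI)
      fix k
      have "\<bar>c \<bullet> win (x k \<tau>)\<bar> \<le> c'" if "\<tau> < T k" for \<tau>
      proof -
        have "\<bar>c \<bullet> win (x k \<tau>)\<bar> \<le> norm c * norm (win (x k \<tau>))" by (rule Cauchy_Schwarz_ineq2)
        also have "\<dots> \<le> c'" unfolding c'_def using win_abs[OF x_space[OF that]]
          by (intro mult_left_mono norm_le_card) auto
        finally show ?thesis .
      qed
      from boot_fluct_char_approx[where t="T k" and x="x k" and g="\<lambda>y. c \<bullet> win y" and c=c', OF T_pos this]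
      show "cmod ((CLINT w|W k. iexp (c \<bullet> \<Gamma> k w)) - exp (- s2 k / 2)) \<le> ((2 * c')^3 / 6 + c'^4 / 4) / sqrt (real (T k))"
        by (simp add: boot_fluct_inner s2_def)
    qed
    have "filterlim (\<lambda>k. sqrt (real (T k))) at_top sequentially"
      by (intro filterlim_compose[OF sqrt_at_top] filterlim_compose[OF filterlim_real_sequentially T_lim])
    then show "(\<lambda>k. ((2 * c')^3 / 6 + c'^4 / 4) / sqrt (real (T k))) \<longlonglongrightarrow> 0"
      by (intro real_tendsto_divide_at_top[OF tendsto_const])
  qed
  ultimately show ?thesis unfolding N by (rule Lim_transform)
qed

lemma distr_W_prob: "prob_space (distr (W k) borel f)"
  by (rule measure_pmf.prob_space_distr) simp

lemma N_prob: "prob_space N" and N_sets[measurable_cong]: "sets N = sets borel"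
  using gaussian by (auto simp: multivariate_normal_def)

text \<open>It suffices that the estimator is close to \<open>qp.sol (\<Gamma> k w)\<close>: as \<open>qp.sol\<close> is Lipschitz, \<open>f \<circ> qp.sol\<close> is a
  multiple of a function in \<open>BL1\<close> for every \<open>f\<close> in \<open>BL1\<close>, and the multiple does not depend on \<open>f\<close>.\<close>

lemma conditional_law_converges:
  fixes X :: "nat \<Rightarrow> (nat \<Rightarrow> nat) \<Rightarrow> real^'n"
  assumes X: "\<And>\<eta>. \<eta> > 0 \<Longrightarrow> rare (\<lambda>k w. norm (X k w - qp.sol (\<Gamma> k w)) > \<eta>)"
  shows "(\<lambda>k. SUP f\<in>BL1. \<bar>(\<integral>z. f z \<partial>distr (W k) borel (X k)) - (\<integral>z. f z \<partial>J_FPPE \<Theta> s v b N)\<bar>) \<longlonglongrightarrow> 0"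
proof (rule tendstoI)
  fix r :: real assume r: "r > 0"
  define L where "L = max 1 (2 / b0)"
  have L: "L \<ge> 1" "2 / b0 \<le> L" by (auto simp: L_def)
  have "\<forall>\<^sub>F k in sequentially. \<forall>f\<in>BL1. \<bar>(\<integral>z. f z \<partial>distr (W k) borel (\<Gamma> k)) - (\<integral>z. f z \<partial>N)\<bar> \<le> r / (4 * L)"
  proof (rule char_convergence_imp_uniform_BL)
    show "(\<lambda>k. CLINT z|distr (W k) borel (\<Gamma> k). iexp (c \<bullet> z)) \<longlonglongrightarrow> (CLINT z|N. iexp (c \<bullet> z))" for c
      using \<Gamma>_char_lim[of c] by (subst integral_distr) auto
  qed (use r L distr_W_prob N_prob N_sets in auto)
  moreover have "\<forall>\<^sub>F k in sequentially. measure_pmf.prob (W k) {w. norm (X k w - qp.sol (\<Gamma> k w)) > r / 8} < r / 16"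
    using X[of "r/8"] r unfolding rare_def by (intro order_tendstoD(2)) auto
  ultimately show "\<forall>\<^sub>F k in sequentially. dist (SUP f\<in>BL1. \<bar>(\<integral>z. f z \<partial>distr (W k) borel (X k)) - (\<integral>z. f z \<partial>J_FPPE \<Theta> s v b N)\<bar>) 0 < r"
  proof eventually_elim
    case (elim k)
    have bound: "\<bar>(\<integral>z. f z \<partial>distr (W k) borel (X k)) - (\<integral>z. f z \<partial>J_FPPE \<Theta> s v b N)\<bar> \<le> r / 2" if f: "f \<in> BL1" for f
    proof -
      have fb: "\<bar>f z\<bar> \<le> 1" and fl: "\<bar>f z - f y\<bar> \<le> norm (z - y)" for z y using f by (auto simp: BL1_def)
      have "1-lipschitz_on UNIV f" by (rule lipschitz_onI) (auto simp: dist_norm fl)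
      then have "continuous_on UNIV f" by (rule lipschitz_on_continuous_on)
      then have fm[measurable]: "f \<in> borel_measurable borel" by (rule borel_measurable_continuous_onI)
      define g where "g z = f (qp.sol z) / L" for z
      have g: "g \<in> BL1"
      proof -
        have "\<bar>g z\<bar> \<le> 1" for z
          using fb[of "qp.sol z"] L by (simp add: g_def divide_le_eq)
        moreover have "\<bar>g z - g y\<bar> \<le> norm (z - y)" for z y
        proof -
          have "\<bar>f (qp.sol z) - f (qp.sol y)\<bar> \<le> 2 / b0 * norm (z - y)"
            by (rule order_trans[OF fl qp.sol_lipschitz])
          also have "\<dots> \<le> L * norm (z - y)" by (intro mult_right_mono L) auto
          finally show ?thesis using L by (simp add: g_def diff_divide_distrib[symmetric] divide_le_eq mult.commute)
        qed
        ultimately show ?thesis by (simp add: BL1_def)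
      qed
      have [measurable]: "g \<in> borel_measurable borel" unfolding g_def[abs_def] by measurable
      have int: "integrable (W k) h" for h :: "_ \<Rightarrow> real"
        by (rule integrable_measure_pmf_finite[OF finite_boot_weights])
      have e1: "(\<integral>z. f z \<partial>distr (W k) borel (X k)) = (\<integral>w. f (X k w) \<partial>W k)" by (subst integral_distr) auto
      have e2: "(\<integral>z. f z \<partial>J_FPPE \<Theta> s v b N) = L * (\<integral>z. g z \<partial>N)"
        unfolding J_FPPE_eq using L by (subst integral_distr) (auto simp: g_def[abs_def])
      have e3: "(\<integral>w. f (qp.sol (\<Gamma> k w)) \<partial>W k) = L * (\<integral>z. g z \<partial>distr (W k) borel (\<Gamma> k))"
        using L by (subst integral_distr) (auto simp: g_def[abs_def])
      have "L * \<bar>(\<integral>z. g z \<partial>distr (W k) borel (\<Gamma> k)) - (\<integral>z. g z \<partial>N)\<bar> \<le> L * (r / (4 * L))"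
        using elim(1) g L by (intro mult_left_mono) auto
      then have b1: "\<bar>(\<integral>w. f (qp.sol (\<Gamma> k w)) \<partial>W k) - (\<integral>z. f z \<partial>J_FPPE \<Theta> s v b N)\<bar> \<le> r / 4"
        unfolding e2 e3 using L by (simp add: abs_mult flip: right_diff_distrib)
      define B where "B = {w. norm (X k w - qp.sol (\<Gamma> k w)) > r / 8}"
      have "\<bar>(\<integral>w. f (X k w) \<partial>W k) - (\<integral>w. f (qp.sol (\<Gamma> k w)) \<partial>W k)\<bar> = \<bar>\<integral>w. f (X k w) - f (qp.sol (\<Gamma> k w)) \<partial>W k\<bar>"
        using int by simp
      also have "\<dots> \<le> (\<integral>w. r / 8 + 2 * indicator B w \<partial>W k)"
      proof (rule integral_abs_le[OF int int])
        fix w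
        show "\<bar>f (X k w) - f (qp.sol (\<Gamma> k w))\<bar> \<le> r / 8 + 2 * indicator B w"
          using fl[of "X k w" "qp.sol (\<Gamma> k w)"] fb[of "X k w"] fb[of "qp.sol (\<Gamma> k w)"] r
          by (cases "w \<in> B") (auto simp: B_def)
      qed
      also have "\<dots> = r / 8 + 2 * measure_pmf.prob (W k) B"
        using int by (subst Bochner_Integration.integral_add) auto
      also have "\<dots> \<le> r / 4" using elim(2) by (simp add: B_def)
      finally show ?thesis unfolding e1 using b1 by linarith
    qed
    have ne: "(\<lambda>_. 0) \<in> (BL1 :: (real^'n \<Rightarrow> real) set)" by (simp add: BL1_def)
    have up: "(SUP f\<in>BL1. \<bar>(\<integral>z. f z \<partial>distr (W k) borel (X k)) - (\<integral>z. f z \<partial>J_FPPE \<Theta> s v b N)\<bar>) \<le> r / 2"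
      using ne bound by (intro cSUP_least) auto
    have "bdd_above ((\<lambda>f. \<bar>(\<integral>z. f z \<partial>distr (W k) borel (X k)) - (\<integral>z. f z \<partial>J_FPPE \<Theta> s v b N)\<bar>) ` BL1)"
      using bound by (intro bdd_aboveI2[where M="r/2"]) auto
    from cSUP_upper2[OF this ne, of 0]
    have "0 \<le> (SUP f\<in>BL1. \<bar>(\<integral>z. f z \<partial>distr (W k) borel (X k)) - (\<integral>z. f z \<partial>J_FPPE \<Theta> s v b N)\<bar>)" by simp
    with up r show ?case by (simp add: dist_real_def)
  qed
qed

end

context typical_sequence begin

abbreviation "fluct k \<beta> w \<equiv> boot_fluct (T k) (x k) (top_bid v \<beta>) w"

section \<open>Localization of the numerical bootstrap\<close>

lemma fluct_lipschitz:
  obtains L where "\<And>a c. \<bar>fluct k a w - fluct k c w\<bar> \<le> L * norm (a - c)" "L \<ge> 0"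
proof
  define L where "L = sqrt (real (T k)) * (1 / real (T k) * (\<Sum>\<tau><T k. real (w \<tau>) * C) + C)"
  show "L \<ge> 0" using C by (auto simp: L_def intro!: mult_nonneg_nonneg add_nonneg_nonneg divide_nonneg_nonneg sum_nonneg)
  fix a c
  have "\<bar>emp_boot (T k) (x k) w (\<lambda>y. top_bid v a y - top_bid v c y)\<bar> \<le> 1 / real (T k) * (\<Sum>\<tau><T k. real (w \<tau>) * (C * norm (a - c)))"
  proof -
    have "\<bar>\<Sum>\<tau><T k. real (w \<tau>) * (top_bid v a (x k \<tau>) - top_bid v c (x k \<tau>))\<bar> \<le> (\<Sum>\<tau><T k. real (w \<tau>) * (C * norm (a - c)))"
      by (rule order_trans[OF sum_abs], intro sum_mono) (simp add: abs_mult mult_left_mono top_bid_lip x_space)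
    then show ?thesis unfolding emp_boot_def by (simp add: abs_mult divide_right_mono)
  qed
  moreover have "\<bar>emp (T k) (x k) (\<lambda>y. top_bid v a y - top_bid v c y)\<bar> \<le> C * norm (a - c)"
    by (intro emp_abs_le T_pos top_bid_lip x_space)
  ultimately have "\<bar>emp_boot (T k) (x k) w (\<lambda>y. top_bid v a y - top_bid v c y) - emp (T k) (x k) (\<lambda>y. top_bid v a y - top_bid v c y)\<bar>
      \<le> 1 / real (T k) * (\<Sum>\<tau><T k. real (w \<tau>) * (C * norm (a - c))) + C * norm (a - c)" by linarith
  then have "\<bar>boot_fluct (T k) (x k) (\<lambda>y. top_bid v a y - top_bid v c y) w\<bar> \<le> sqrt (real (T k)) * (1 / real (T k) * (\<Sum>\<tau><T k. real (w \<tau>) * (C * norm (a - c))) + C * norm (a - c))"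
    unfolding boot_fluct_def real_scaleR_def abs_mult by (simp add: mult_left_mono)
  also have "\<dots> = L * norm (a - c)" 
  proof -
    have "(\<Sum>\<tau><T k. real (w \<tau>) * (C * norm (a - c))) = (\<Sum>\<tau><T k. real (w \<tau>) * C) * norm (a - c)"
      by (simp add: sum_distrib_right mult.assoc)
    then show ?thesis by (simp add: L_def algebra_simps)
  qed
  finally show "\<bar>fluct k a w - fluct k c w\<bar> \<le> L * norm (a - c)" by (simp add: boot_fluct_diff)
qed

lemma fluct_continuous: "continuous_on UNIV (\<lambda>\<beta>. fluct k \<beta> w)"
proof -
  obtain L where L: "\<And>a c. \<bar>fluct k a w - fluct k c w\<bar> \<le> L * norm (a - c)" "L \<ge> 0" using fluct_lipschitz by blast
  have "L-lipschitz_on UNIV (\<lambda>\<beta>. fluct k \<beta> w)" using L by (intro lipschitz_onI) (auto simp: dist_norm)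
  then show ?thesis by (rule lipschitz_on_continuous_on)
qed

lemma fluct_tail:
  assumes l: "l > 0"
  shows "measure_pmf.prob (W k) {w. \<bar>fluct k a w - fluct k c w\<bar> > l * (C * norm (a - c))} \<le> (2 * fact m * 2 ^ m) / l ^ (2 * m)"
proof -
  have "measure_pmf.prob (W k) {w. \<bar>boot_fluct (T k) (x k) (\<lambda>y. top_bid v a y - top_bid v c y) w\<bar> > l * (C * norm (a - c))} \<le> (2 * fact m * 2 ^ m) / l ^ (2 * m)"
    by (intro boot_fluct_tail T_pos l top_bid_lip x_space) (use C in auto)
  then show ?thesis by (simp add: boot_fluct_diff)
qed

text \<open>Peeling. On the shell with \<open>norm (y - bg k)\<close> of order \<open>2 ^ j * e k\<close> the objective has grown by order
  \<open>4 ^ j * (e k)\<^sup>2\<close>, while by chaining the fluctuation term \<open>e k * fluct\<close> is of order \<open>2 ^ j * (e k)\<^sup>2\<close>, so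
  overcoming the growth requires an excess of order \<open>2 ^ j\<close>. The probabilities of these excesses are
  summable over \<open>j\<close>, uniformly in \<open>k\<close>.\<close>

lemma nu_obj_localized:
  assumes r: "r > 0"
  obtains L where "L > 0" "\<And>k. measure_pmf.prob (W k) {w. \<exists>y\<in>pacing_box.
      Ht k y + e k * fluct k y w \<le> Ht k (bg k) + e k * fluct k (bg k) w \<and> norm (y - bg k) > L * e k} \<le> r"
proof -
  define n where "n = CARD('n)"
  have n: "n \<ge> 1" by (simp add: n_def Suc_le_eq)
  define B :: real where "B = 2 * fact (2 * n) * 2 ^ (2 * n)"
  have B: "B > 0" by (simp add: B_def)
  define D where "D = (3 * n) ^ (4 * n) * B * (32 * C / b0) ^ (4 * n)"
  have D: "D > 0" using B C b0 n by (simp add: D_def)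
  obtain J :: nat where J: "(1/2::real) ^ J < r / (2 * D)" using real_arch_pow_inv[of "r / (2 * D)" "1/2"] r D by auto
  define j' where "j' i = J + i" for i
  show thesis
  proof (rule that[of "2 ^ J"])
    fix k
    have ek: "e k > 0" by (rule e_pos)
    define R where "R i = 2 ^ (j' i + 1) * e k" for i
    \<comment> \<open>makes the chaining bound \<open>e k * (C * (4 * kap i * R i))\<close> equal to the growth \<open>b0 / 4 * (2 ^ j' i * e k)\<^sup>2\<close> at
       the inner boundary of the shell\<close>
    define kap where "kap i = b0 * 2 ^ j' i / (32 * C)" for i
    have "\<exists>E. measure_pmf.prob (W k) E \<le> D * (1/2) ^ j' i \<and>
       (\<forall>w y. w \<notin> E \<longrightarrow> norm (y - bg k) \<le> R i \<longrightarrow> \<bar>fluct k y w - fluct k (bg k) w\<bar> \<le> C * (4 * kap i * R i))" for i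
    proof (rule measure_pmf.chaining_maximal_inequality[where M="W k" and R="R i" and \<kappa>="kap i" and a="bg k" and B=B and Z="\<lambda>\<beta> w. fluct k \<beta> w / C"])
      show "R i > 0" "kap i > 0" using ek b0 C by (auto simp: R_def kap_def)
      show "continuous_on UNIV (\<lambda>\<beta>. fluct k \<beta> w / C)" for w by (intro continuous_intros fluct_continuous) (use C in auto)
      show "measure_pmf.prob (W k) {w\<in>space (measure_pmf (W k)). \<bar>fluct k u w / C - fluct k u' w / C\<bar> > l * norm (u - u')} \<le> B / l ^ (4 * CARD('n))" if "l > 0" for u u' :: "real^'n" and l
      proof -
        have "l * norm (u - u') < \<bar>fluct k u w / C - fluct k u' w / C\<bar> \<longleftrightarrow> \<bar>fluct k u w - fluct k u' w\<bar> > l * (C * norm (u - u'))" for w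
          using C by (simp add: diff_divide_distrib[symmetric] less_divide_eq mult_ac)
        then show ?thesis using fluct_tail[OF that, of k u u' "2 * n"] by (simp add: B_def n_def)
      qed
      fix E assume E: "measure_pmf.prob (W k) E \<le> (3 * real CARD('n)) ^ (4 * CARD('n)) * B / kap i ^ (4 * CARD('n))"
        "\<And>w u. w \<in> space (measure_pmf (W k)) - E \<Longrightarrow> (\<And>i'. \<bar>u $ i' - bg k $ i'\<bar> \<le> R i) \<Longrightarrow> \<bar>fluct k u w / C - fluct k (bg k) w / C\<bar> \<le> 4 * kap i * R i"
      show ?thesis
      proof (intro exI[of _ E] conjI allI impI)
        have "(3 * real CARD('n)) ^ (4 * CARD('n)) * B / kap i ^ (4 * CARD('n)) = D * (1 / 2 ^ j' i) ^ (4 * n)"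
          by (simp add: kap_def D_def n_def power_mult_distrib power_divide)
        also have "\<dots> \<le> D * (1 / 2 ^ j' i) ^ 1" using D n by (intro mult_left_mono power_decreasing) auto
        finally show "measure_pmf.prob (W k) E \<le> D * (1/2) ^ j' i" using E(1) by (simp add: power_one_over)
        fix w y assume w: "w \<notin> E" and y: "norm (y - bg k) \<le> R i"
        have "\<bar>fluct k y w / C - fluct k (bg k) w / C\<bar> \<le> 4 * kap i * R i"
          using w component_le_norm_cart[of "y - bg k"] y by (intro E(2)) (auto intro: order_trans)
        then show "\<bar>fluct k y w - fluct k (bg k) w\<bar> \<le> C * (4 * kap i * R i)"
          using C by (simp add: diff_divide_distrib[symmetric] divide_le_eq mult.commute)
      qed
    qed auto
    then obtain E where E: "\<And>i. measure_pmf.prob (W k) (E i) \<le> D * (1/2) ^ j' i"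
       "\<And>i w y. w \<notin> E i \<Longrightarrow> norm (y - bg k) \<le> R i \<Longrightarrow> \<bar>fluct k y w - fluct k (bg k) w\<bar> \<le> C * (4 * kap i * R i)"
      by metis
    have geo: "(\<lambda>i. D * (1/2) ^ j' i) sums (D * (1/2) ^ J * 2)"
    proof -
      have "(\<lambda>i. (D * (1/2) ^ J) * (1/2) ^ i) sums ((D * (1/2) ^ J) * (1 / (1 - 1/2)))"
        by (intro sums_mult geometric_sums) simp
      then show ?thesis by (simp add: j'_def power_add mult_ac)
    qed
    have summ: "summable (\<lambda>i. measure_pmf.prob (W k) (E i))"
      by (rule summable_comparison_test'[OF sums_summable[OF geo], of 0]) (use E(1) in auto)
    have sub: "{w. \<exists>y\<in>pacing_box. Ht k y + e k * fluct k y w \<le> Ht k (bg k) + e k * fluct k (bg k) w \<and> norm (y - bg k) > 2 ^ J * e k} \<subseteq> (\<Union>i. E i)"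
    proof (rule subsetI, rule ccontr)
      fix w assume "w \<in> {w. \<exists>y\<in>pacing_box. Ht k y + e k * fluct k y w \<le> Ht k (bg k) + e k * fluct k (bg k) w \<and> norm (y - bg k) > 2 ^ J * e k}"
        and w: "w \<notin> (\<Union>i. E i)"
      then obtain y where y: "y \<in> pacing_box" "Ht k y + e k * fluct k y w \<le> Ht k (bg k) + e k * fluct k (bg k) w" "norm (y - bg k) > 2 ^ J * e k" by auto
      define d where "d = norm (y - bg k)"
      obtain m :: nat where m: "d / e k < 2 ^ m" using real_arch_pow[of 2 "d / e k"] by auto
      define Q where "Q i \<longleftrightarrow> d \<le> R i" for i
      have "Q m"
      proof -
        have "d < 2 ^ m * e k" using m ek by (simp add: divide_less_eq)
        also have "\<dots> \<le> R m" unfolding R_def j'_def using ek by (intro mult_right_mono power_increasing) auto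
        finally show ?thesis by (simp add: Q_def)
      qed
      \<comment> \<open>the shell that contains \<open>y\<close>\<close>
      define i where "i = (LEAST i. Q i)"
      have Qi: "d \<le> R i" using LeastI[of Q m] \<open>Q m\<close> by (simp add: i_def Q_def)
      have low: "2 ^ j' i * e k < d"
      proof (cases i)
        case 0
        then show ?thesis using y(3) by (simp add: j'_def d_def)
      next
        case (Suc i')
        then have "\<not> Q i'" using not_less_Least[of i' Q] by (simp add: i_def)
        then show ?thesis using Suc by (simp add: Q_def R_def j'_def)
      qed
      have "b0 / 4 * d\<^sup>2 \<le> e k * \<bar>fluct k y w - fluct k (bg k) w\<bar>"
      proof -
        have "b0 / 4 * d\<^sup>2 \<le> e k * (fluct k (bg k) w - fluct k y w)"
          using bg_growth[OF y(1), of k] y(2) by (simp add: d_def right_diff_distrib)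
        also have "\<dots> \<le> e k * \<bar>fluct k y w - fluct k (bg k) w\<bar>" using ek by (intro mult_left_mono) auto
        finally show ?thesis .
      qed
      also have "\<dots> \<le> e k * (C * (4 * kap i * R i))"
        using E(2)[of w i y] w Qi ek by (intro mult_left_mono) (auto simp: d_def)
      also have "\<dots> = b0 / 4 * (2 ^ j' i * e k)\<^sup>2"
        using C by (simp add: kap_def R_def power2_eq_square field_simps)
      finally have "d\<^sup>2 \<le> (2 ^ j' i * e k)\<^sup>2" using b0 by simp
      moreover have "(2 ^ j' i * e k)\<^sup>2 < d\<^sup>2" using low ek by (intro power_strict_mono) auto
      ultimately show False by simp
    qed
    have "measure_pmf.prob (W k) {w. \<exists>y\<in>pacing_box. Ht k y + e k * fluct k y w \<le> Ht k (bg k) + e k * fluct k (bg k) w \<and> norm (y - bg k) > 2 ^ J * e k}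
      \<le> measure_pmf.prob (W k) (\<Union>i. E i)"
      using sub by (intro measure_pmf.finite_measure_mono) auto
    also have "\<dots> \<le> (\<Sum>i. measure_pmf.prob (W k) (E i))"
      using summ by (intro measure_pmf.finite_measure_subadditive_countably) auto
    also have "\<dots> \<le> (\<Sum>i. D * (1/2) ^ j' i)"
      using summ E(1) sums_summable[OF geo] by (intro suminf_le) auto
    also have "\<dots> = D * (1/2) ^ J * 2" using geo by (simp add: sums_iff)
    also have "\<dots> \<le> r" using J D by (simp add: field_simps)
    finally show "measure_pmf.prob (W k) {w. \<exists>y\<in>pacing_box. Ht k y + e k * fluct k y w \<le> Ht k (bg k) + e k * fluct k (bg k) w \<and> norm (y - bg k) > 2 ^ J * e k} \<le> r" .
  qed simp
qed

section \<open>Linearization of the resampled objective\<close>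

abbreviation "tie_frac k m \<equiv> emp (T k) (x k) (\<lambda>y. if clear_win v bs (real m * e k) y then 0 else 1 :: real)"

lemma tie_frac_nonneg: "tie_frac k m \<ge> 0"
  by (simp add: emp_def sum_nonneg)

lemma tie_frac_lim: "(\<lambda>k. tie_frac k m) \<longlonglongrightarrow> 0"
proof (rule tendstoI)
  fix r :: real assume "r > 0"
  then obtain j :: nat where j: "1 / Suc j < r" using nat_approx_posE by metis
  from typical[of m j] show "\<forall>\<^sub>F k in sequentially. dist (tie_frac k m) 0 < r"
    by eventually_elim (use j tie_frac_nonneg in \<open>auto simp: dist_real_def typical_sample_def\<close>)
qed

text \<open>The second moment of a bounded function that is supported on near ties.\<close>

lemma emp_sq_near_ties:
  fixes g :: "'a \<Rightarrow> real"
  assumes "\<And>\<tau>. \<tau> < T k \<Longrightarrow> clear_win v bs (real m * e k) (x k \<tau>) \<Longrightarrow> g (x k \<tau>) = 0"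
    and "\<And>\<tau>. \<tau> < T k \<Longrightarrow> \<bar>g (x k \<tau>)\<bar> \<le> K"
  shows "emp (T k) (x k) (\<lambda>y. (g y)\<^sup>2) \<le> K\<^sup>2 * tie_frac k m"
proof -
  have "emp (T k) (x k) (\<lambda>y. (g y)\<^sup>2) \<le> emp (T k) (x k) (\<lambda>y. K\<^sup>2 * (if clear_win v bs (real m * e k) y then 0 else 1 :: real))"
  proof (rule emp_mono)
    fix \<tau> assume "\<tau> < T k"
    then show "(g (x k \<tau>))\<^sup>2 \<le> K\<^sup>2 * (if clear_win v bs (real m * e k) (x k \<tau>) then 0 else 1 :: real)"
      using assms[of \<tau>] abs_le_square_iff[of "g (x k \<tau>)" K] by auto
  qed
  then show ?thesis by (simp add: emp_def sum_distrib_left sum_divide_distrib)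
qed

text \<open>The remainder \<open>f k u\<close> of the linearization vanishes on items with a clear winner, and it is Lipschitz in
  \<open>u\<close>. Its increments therefore satisfy Chebyshev's inequality with the small factor \<open>tie_frac\<close>, and
  Hoeffding's inequality with a high power but no small factor. The geometric mean of the two bounds has
  both the small factor and the power that chaining needs.\<close>

lemma fluct_linearized:
  assumes K: "K > 0" and a: "a > 0"
  shows "rare (\<lambda>k w. \<exists>u. norm u \<le> K \<and> \<bar>fluct k (bs + e k *\<^sub>R u) w - fluct k bs w - e k * (u \<bullet> \<Gamma> k w)\<bar> > a * e k)"
proof -
  define n where "n = CARD('n)"
  have n: "n \<ge> 1" by (simp add: n_def Suc_le_eq)
  \<comment> \<open>coordinates move by at most \<open>K * e k\<close>, so a margin of \<open>2 * C * K * e k\<close> protects the winner\<close>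
  define m where "m = nat \<lceil>2 * C * K\<rceil>"
  have m: "2 * C * K \<le> real m" using C K by (simp add: m_def)
  define C1 where "C1 = C + n * C"
  have C1: "C1 > 0" using C n by (simp add: C1_def add_pos_nonneg)
  define B :: real where "B = 2 * fact (4 * n - 1) * 2 ^ (4 * n - 1)"
  have B: "B \<ge> 0" by (simp add: B_def)
  define kap where "kap = a / (4 * K * C1)"
  have kap: "kap > 0" using a K C1 by (simp add: kap_def)
  define f where "f k u y = (top_bid v (bs + e k *\<^sub>R u) y - top_bid v bs y) / e k - u \<bullet> win y" for k u y
  show ?thesis
  proof (rule rare_bounded)
    show "(\<lambda>k. (3 * n) ^ (4 * n) * sqrt (tie_frac k m * B) / kap ^ (4 * n)) \<longlonglongrightarrow> 0"
    proof -
      have "(\<lambda>k. (3 * n) ^ (4 * n) * sqrt (tie_frac k m * B) / kap ^ (4 * n)) \<longlonglongrightarrow> (3 * n) ^ (4 * n) * sqrt (0 * B) / kap ^ (4 * n)"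
        using kap by (intro tendsto_intros tie_frac_lim) auto
      then show ?thesis by simp
    qed
    show "\<forall>\<^sub>F k in sequentially. measure_pmf.prob (W k) {w. \<exists>u. norm u \<le> K \<and> \<bar>fluct k (bs + e k *\<^sub>R u) w - fluct k bs w - e k * (u \<bullet> \<Gamma> k w)\<bar> > a * e k}
      \<le> (3 * n) ^ (4 * n) * sqrt (tie_frac k m * B) / kap ^ (4 * n)"
    proof (intro always_eventually allI)
      fix k
      have ek: "e k > 0" by (rule e_pos)
      have f_fluct: "boot_fluct (T k) (x k) (f k u) w = (fluct k (bs + e k *\<^sub>R u) w - fluct k bs w) / e k - u \<bullet> \<Gamma> k w" for u w
      proof -
        have "boot_fluct (T k) (x k) (f k u) w = boot_fluct (T k) (x k) (\<lambda>y. (1 / e k) * (top_bid v (bs + e k *\<^sub>R u) y - top_bid v bs y)) w - boot_fluct (T k) (x k) (\<lambda>y. u \<bullet> win y) w"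
          unfolding f_def boot_fluct_diff[symmetric] by simp
        then show ?thesis unfolding boot_fluct_scale boot_fluct_diff boot_fluct_inner by simp
      qed
      have f_lip: "\<bar>f k u y - f k u' y\<bar> \<le> C1 * norm (u - u')" if y: "y \<in> space \<Theta>" for u u' y
      proof -
        have "\<bar>top_bid v (bs + e k *\<^sub>R u) y - top_bid v (bs + e k *\<^sub>R u') y\<bar> \<le> C * norm ((bs + e k *\<^sub>R u) - (bs + e k *\<^sub>R u'))"
          by (rule top_bid_lip[OF y])
        also have "(bs + e k *\<^sub>R u) - (bs + e k *\<^sub>R u') = e k *\<^sub>R (u - u')" by (simp add: algebra_simps)
        finally have 1: "\<bar>(top_bid v (bs + e k *\<^sub>R u) y - top_bid v (bs + e k *\<^sub>R u') y) / e k\<bar> \<le> C * norm (u - u')"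
          using ek by (simp add: divide_le_eq mult_ac)
        have "\<bar>(u - u') \<bullet> win y\<bar> \<le> norm (u - u') * norm (win y)" by (rule Cauchy_Schwarz_ineq2)
        also have "\<dots> \<le> norm (u - u') * (n * C)" unfolding n_def
          by (intro mult_left_mono norm_le_card win_abs y) auto
        finally have 2: "\<bar>(u - u') \<bullet> win y\<bar> \<le> (n * C) * norm (u - u')" by (simp add: mult_ac)
        have "f k u y - f k u' y = (top_bid v (bs + e k *\<^sub>R u) y - top_bid v (bs + e k *\<^sub>R u') y) / e k - (u - u') \<bullet> win y"
          by (simp add: f_def diff_divide_distrib inner_diff_left)
        then show ?thesis using 1 2 unfolding C1_def distrib_right by linarith
      qed
      have f_zero: "f k u y = 0" if y: "y \<in> space \<Theta>" "clear_win v bs (real m * e k) y" and u: "\<And>i. \<bar>u $ i\<bar> \<le> K" for u y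
      proof -
        have "top_bid v (bs + e k *\<^sub>R u) y = (bs + e k *\<^sub>R u) \<bullet> win y"
        proof (rule top_bid_linear[OF _ _ y(2)])
          fix i
          have "2 * C * \<bar>(bs + e k *\<^sub>R u) $ i - bs $ i\<bar> = (2 * C * \<bar>u $ i\<bar>) * e k" using ek by (simp add: abs_mult)
          also have "\<dots> \<le> (2 * C * K) * e k" using C ek u by (intro mult_right_mono mult_left_mono) auto
          also have "\<dots> \<le> real m * e k" using m ek by (intro mult_right_mono) auto
          finally show "2 * C * \<bar>(bs + e k *\<^sub>R u) $ i - bs $ i\<bar> \<le> real m * e k" .
        qed (use y ek in \<open>auto intro: v_nonneg v_le\<close>)
        moreover have "top_bid v bs y = bs \<bullet> win y"
          by (rule top_bid_linear[OF _ _ y(2)]) (use y ek in \<open>auto intro: v_nonneg v_le\<close>)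
        ultimately show ?thesis using ek by (simp add: f_def inner_add_left)
      qed
      define Z where "Z u w = boot_fluct (T k) (x k) (f k u) w / C1" for u w
      obtain E where E: "measure_pmf.prob (W k) E \<le> (3 * n) ^ (4 * n) * sqrt (tie_frac k m * B) / kap ^ (4 * n)"
        "\<And>w u. w \<notin> E \<Longrightarrow> (\<And>i. \<bar>u $ i\<bar> \<le> K) \<Longrightarrow> \<bar>Z u w - Z 0 w\<bar> \<le> 4 * kap * K"
      proof (rule measure_pmf.chaining_maximal_inequality[where M="W k" and R=K and \<kappa>=kap and a=0 and B="sqrt (tie_frac k m * B)" and Z=Z])
        show "continuous_on UNIV (\<lambda>u. Z u w)" for w
        proof -
          have "continuous_on UNIV (\<lambda>u. fluct k (bs + e k *\<^sub>R u) w)"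
            by (rule continuous_on_compose2[OF fluct_continuous]) (auto intro!: continuous_intros)
          then show ?thesis unfolding Z_def f_fluct using C1 ek by (intro continuous_intros) auto
        qed
        show "measure_pmf.prob (W k) {w\<in>space (measure_pmf (W k)). \<bar>Z u w - Z u' w\<bar> > l * norm (u - u')} \<le> sqrt (tie_frac k m * B) / l ^ (4 * CARD('n))"
          if u: "\<And>i. \<bar>u $ i - 0 $ i\<bar> \<le> K" and u': "\<And>i. \<bar>u' $ i - 0 $ i\<bar> \<le> K" and l: "l > 0" for u u' l
        proof (cases "u = u'")
          case True
          then show ?thesis using l B tie_frac_nonneg by simp
        next
          case False
          then have nz: "norm (u - u') > 0" by simp
          define g where "g y = f k u y - f k u' y" for y
          define c where "c = C1 * norm (u - u')"
          have c: "c > 0" using C1 nz by (simp add: c_def)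
          define p where "p = measure_pmf.prob (W k) {w. \<bar>boot_fluct (T k) (x k) g w\<bar> > l * c}"
          have "\<bar>Z u w - Z u' w\<bar> > l * norm (u - u') \<longleftrightarrow> \<bar>boot_fluct (T k) (x k) g w\<bar> > l * c" for w
            using C1 unfolding Z_def g_def boot_fluct_diff c_def
            by (simp add: diff_divide_distrib[symmetric] less_divide_eq mult_ac)
          then have p: "measure_pmf.prob (W k) {w\<in>space (measure_pmf (W k)). \<bar>Z u w - Z u' w\<bar> > l * norm (u - u')} = p" by (simp add: p_def)
          have "p \<le> emp (T k) (x k) (\<lambda>y. (g y)\<^sup>2) / (l * c)\<^sup>2"
            unfolding p_def using l c by (intro boot_fluct_chebyshev T_pos) auto
          also have "\<dots> \<le> c\<^sup>2 * tie_frac k m / (l * c)\<^sup>2"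
            by (intro divide_right_mono emp_sq_near_ties) (use u u' x_space f_zero f_lip in \<open>auto simp: g_def c_def\<close>)
          also have "\<dots> = tie_frac k m / l\<^sup>2" using c by (simp add: power_mult_distrib)
          finally have p1: "p \<le> tie_frac k m / l\<^sup>2" .
          have p2: "p \<le> B / l ^ (2 * (4 * n - 1))"
            unfolding p_def B_def using l c by (intro boot_fluct_tail T_pos) (auto simp: g_def c_def intro!: f_lip x_space)
          have p0: "p \<ge> 0" by (simp add: p_def)
          \<comment> \<open>interpolation: the orders \<open>2\<close> and \<open>8 * n - 2\<close> have the mean \<open>4 * n\<close>\<close>
          have "p * p \<le> (tie_frac k m / l\<^sup>2) * (B / l ^ (2 * (4 * n - 1)))"
            using p0 tie_frac_nonneg[of k m] by (intro mult_mono p1 p2) auto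
          then have "p\<^sup>2 \<le> (tie_frac k m / l\<^sup>2) * (B / l ^ (2 * (4 * n - 1)))" by (simp add: power2_eq_square)
          also have "\<dots> = tie_frac k m * B / (l ^ (4 * n))\<^sup>2"
          proof -
            have "2 + 2 * (4 * n - 1) = 4 * n * 2" using n by simp
            then show ?thesis by (simp add: power_add[symmetric] power_mult[symmetric])
          qed
          finally have "sqrt (p\<^sup>2) \<le> sqrt (tie_frac k m * B / (l ^ (4 * n))\<^sup>2)" by (rule real_sqrt_le_mono)
          then show ?thesis unfolding p using p0 l by (simp add: real_sqrt_divide n_def)
        qed
        fix E assume E: "measure_pmf.prob (W k) E \<le> (3 * real CARD('n)) ^ (4 * CARD('n)) * sqrt (tie_frac k m * B) / kap ^ (4 * CARD('n))"
          "\<And>w u. w \<in> space (measure_pmf (W k)) - E \<Longrightarrow> (\<And>i. \<bar>u $ i - 0 $ i\<bar> \<le> K) \<Longrightarrow> \<bar>Z u w - Z 0 w\<bar> \<le> 4 * kap * K"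
        show thesis by (rule that[of E]) (use E in \<open>auto simp: n_def\<close>)
      qed (use K kap in auto)
      have "measure_pmf.prob (W k) {w. \<exists>u. norm u \<le> K \<and> \<bar>fluct k (bs + e k *\<^sub>R u) w - fluct k bs w - e k * (u \<bullet> \<Gamma> k w)\<bar> > a * e k} \<le> measure_pmf.prob (W k) E"
      proof (rule measure_pmf.finite_measure_mono)
        show "{w. \<exists>u. norm u \<le> K \<and> \<bar>fluct k (bs + e k *\<^sub>R u) w - fluct k bs w - e k * (u \<bullet> \<Gamma> k w)\<bar> > a * e k} \<subseteq> E"
        proof (rule subsetI, rule ccontr)
          fix w assume "w \<in> {w. \<exists>u. norm u \<le> K \<and> \<bar>fluct k (bs + e k *\<^sub>R u) w - fluct k bs w - e k * (u \<bullet> \<Gamma> k w)\<bar> > a * e k}" and w: "w \<notin> E"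
          then obtain u where u: "norm u \<le> K" and big: "\<bar>fluct k (bs + e k *\<^sub>R u) w - fluct k bs w - e k * (u \<bullet> \<Gamma> k w)\<bar> > a * e k" by auto
          have "\<bar>Z u w - Z 0 w\<bar> \<le> 4 * kap * K"
            using w component_le_norm_cart[of u] u by (intro E(2)) (auto intro: order_trans)
          also have "\<dots> = a / C1" using K by (simp add: kap_def)
          finally have "\<bar>boot_fluct (T k) (x k) (f k u) w\<bar> \<le> a"
            using C1 by (simp add: Z_def f_fluct[of 0] divide_le_cancel)
          moreover have "fluct k (bs + e k *\<^sub>R u) w - fluct k bs w - e k * (u \<bullet> \<Gamma> k w) = e k * boot_fluct (T k) (x k) (f k u) w"
            unfolding f_fluct using ek by (simp add: field_simps)
          ultimately have "\<bar>fluct k (bs + e k *\<^sub>R u) w - fluct k bs w - e k * (u \<bullet> \<Gamma> k w)\<bar> \<le> e k * a"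
            using ek by (simp add: abs_mult)
          then show False using big by (simp add: mult.commute)
        qed
      qed simp
      also note E(1)
      finally show "measure_pmf.prob (W k) {w. \<exists>u. norm u \<le> K \<and> \<bar>fluct k (bs + e k *\<^sub>R u) w - fluct k bs w - e k * (u \<bullet> \<Gamma> k w)\<bar> > a * e k}
        \<le> (3 * n) ^ (4 * n) * sqrt (tie_frac k m * B) / kap ^ (4 * n)" .
    qed
  qed
qed

end

context typical_sequence begin

section \<open>The numerical bootstrap\<close>

text \<open>Off a set of small probability, \<open>\<Gamma> k w\<close> and the rescaled estimator are bounded by a constant. On the
  ball of that radius the rescaled objective is uniformly close to \<open>quad A (\<Gamma> k w)\<close> and its feasible set is
  that of the cone, so the estimator is a near-minimizer over the cone.\<close>

theorem nu_minimizer_near_sol: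
  assumes opt: "\<And>k w. w \<in> set_pmf (W k) \<Longrightarrow>
      is_arg_min (nu_obj v b (e k) (T k) (x k) w) (\<lambda>\<beta>. \<beta> \<in> pacing_box) (\<beta> k w)"
    and \<eta>: "\<eta> > 0"
  shows "rare (\<lambda>k w. norm ((1 / e k) *\<^sub>R (\<beta> k w - bg k) - qp.sol (\<Gamma> k w)) > \<eta>)"
proof (rule rare_if_tight)
  fix r :: real assume r: "r > 0"
  obtain L1 where L1: "L1 > 0" "\<And>k. measure_pmf.prob (W k) {w. \<exists>y\<in>pacing_box.
      Ht k y + e k * fluct k y w \<le> Ht k (bg k) + e k * fluct k (bg k) w \<and> norm (y - bg k) > L1 * e k} \<le> r / 2"
    using nu_obj_localized[of "r/2"] r by auto
  obtain L2 where L2: "L2 > 0" "\<And>k. measure_pmf.prob (W k) {w. norm (\<Gamma> k w) > L2} \<le> r / 2"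
    using \<Gamma>_tight[of "r/2"] r by auto
  define K where "K = L1 + 1 + 2 / b0 * L2"
  have K: "K > 0" "L1 + 1 \<le> K" "2 / b0 * L2 \<le> K" using L1(1) L2(1) b0(1) by (auto simp: K_def add_pos_nonneg)
  \<comment> \<open>Two approximations, each of accuracy \<open>a\<close>, are applied at two points: the estimator minimizes up to
     \<open>4 * a\<close>, and \<open>4 * (4 * a) = b0 * (\<eta> / 2)\<^sup>2\<close>.\<close>
  define a where "a = b0 * \<eta>\<^sup>2 / 64"
  have a: "a > 0" using b0(1) \<eta> by (simp add: a_def)
  define \<kappa> where "\<kappa> = min 1 (\<eta> / 2)"
  have \<kappa>: "\<kappa> > 0" "\<kappa> \<le> 1" "\<kappa> \<le> \<eta> / 2" using \<eta> by (auto simp: \<kappa>_def)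
  define Q' where "Q' k w \<longleftrightarrow> (\<exists>u. norm u \<le> K \<and> \<bar>fluct k (bs + e k *\<^sub>R u) w - fluct k bs w - e k * (u \<bullet> \<Gamma> k w)\<bar> > a * e k)" for k w
  define R1 where "R1 k w \<longleftrightarrow> (\<exists>y\<in>pacing_box. Ht k y + e k * fluct k y w \<le> Ht k (bg k) + e k * fluct k (bg k) w \<and> norm (y - bg k) > L1 * e k)" for k w
  define R where "R k w \<longleftrightarrow> R1 k w \<or> norm (\<Gamma> k w) > L2" for k w
  have PR: "measure_pmf.prob (W k) {w. R k w} \<le> r" for k
  proof -
    have "measure_pmf.prob (W k) {w. R k w} \<le> measure_pmf.prob (W k) {w. R1 k w} + measure_pmf.prob (W k) {w. norm (\<Gamma> k w) > L2}"
      unfolding R_def Collect_disj_eq by (rule measure_Un_le) auto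
    then show ?thesis using L1(2)[of k] L2(2)[of k] by (simp add: R1_def)
  qed
  have key: "\<forall>\<^sub>F k in sequentially. \<forall>w\<in>set_pmf (W k). norm ((1 / e k) *\<^sub>R (\<beta> k w - bg k) - qp.sol (\<Gamma> k w)) > \<eta> \<longrightarrow> Q' k w \<or> R k w"
    using bg_consistent[OF \<kappa>(1)] local_quadratic[OF a less_imp_le[OF K(1)]] cone_feasible[OF less_imp_le[OF K(1)]]
  proof eventually_elim
    case (elim k)
    have ek: "e k > 0" by (rule e_pos)
    show ?case
    proof (intro ballI impI, rule ccontr)
      fix w assume w: "w \<in> set_pmf (W k)" and far: "\<eta> < norm ((1 / e k) *\<^sub>R (\<beta> k w - bg k) - qp.sol (\<Gamma> k w))"
        and no: "\<not> (Q' k w \<or> R k w)"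
      define \<phi> where "\<phi> = qp.sol (\<Gamma> k w)"
      define u where "u = (1 / e k) *\<^sub>R (\<beta> k w - bs)"
      have beta: "bs + e k *\<^sub>R u = \<beta> k w" using ek by (simp add: u_def)
      have min: "\<beta> k w \<in> pacing_box" "\<And>y. y \<in> pacing_box \<Longrightarrow> Ht k (\<beta> k w) + e k * fluct k (\<beta> k w) w \<le> Ht k y + e k * fluct k y w"
        using opt[OF w] by (auto simp: is_arg_min_linorder nu_obj_eq[OF T_pos w])
      have d1: "norm (\<beta> k w - bg k) \<le> L1 * e k"
        using no min(2)[OF bg_box] min(1) unfolding R_def R1_def by (metis not_le)
      have Gb: "norm (\<Gamma> k w) \<le> L2" using no by (simp add: R_def)
      have "norm (\<beta> k w - bs) \<le> norm (\<beta> k w - bg k) + norm (bg k - bs)"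
        using norm_triangle_ineq[of "\<beta> k w - bg k" "bg k - bs"] by simp
      also have "\<dots> \<le> (L1 + 1) * e k"
      proof -
        have "\<kappa> * e k \<le> 1 * e k" using \<kappa> ek by (intro mult_right_mono) auto
        then show ?thesis using d1 elim(1) by (simp add: distrib_right)
      qed
      also have "\<dots> \<le> K * e k" using K ek by (intro mult_right_mono) auto
      finally have nu: "norm u \<le> K" using ek by (simp add: u_def divide_le_eq)
      have "norm \<phi> \<le> 2 / b0 * norm (\<Gamma> k w)" unfolding \<phi>_def by (rule qp.norm_sol)
      also have "\<dots> \<le> 2 / b0 * L2" using Gb b0(1) by (intro mult_left_mono) auto
      finally have n\<phi>: "norm \<phi> \<le> K" using K by simp
      have \<phi>c: "\<phi> \<in> limit_cone \<Theta> s v b" unfolding \<phi>_def by (rule qp.sol_minimizes)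
      have uc: "u \<in> limit_cone \<Theta> s v b" using min(1) by (intro feasible_cone[of k]) (simp add: beta[simplified] pacing_box_def flip: beta)
      have ap: "\<bar>(Ht k (bs + e k *\<^sub>R z) + e k * fluct k (bs + e k *\<^sub>R z) w) - (Ht k bs + e k * fluct k bs w) - (e k)\<^sup>2 * quad A (\<Gamma> k w) z\<bar> \<le> 2 * a * (e k)\<^sup>2"
        if z: "norm z \<le> K" for z
      proof -
        have h1: "\<bar>Ht k (bs + e k *\<^sub>R z) - Ht k bs - (e k)\<^sup>2 * (1/2 * (z \<bullet> (A *v z)))\<bar> \<le> a * (e k)\<^sup>2"
          using elim(2) z by blast
        have "\<bar>fluct k (bs + e k *\<^sub>R z) w - fluct k bs w - e k * (z \<bullet> \<Gamma> k w)\<bar> \<le> a * e k"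
          using no z unfolding Q'_def by (meson not_le)
        then have "e k * \<bar>fluct k (bs + e k *\<^sub>R z) w - fluct k bs w - e k * (z \<bullet> \<Gamma> k w)\<bar> \<le> e k * (a * e k)"
          using ek by (intro mult_left_mono) auto
        moreover have eq: "e k * fluct k (bs + e k *\<^sub>R z) w - e k * fluct k bs w - (e k)\<^sup>2 * (\<Gamma> k w \<bullet> z)
            = e k * (fluct k (bs + e k *\<^sub>R z) w - fluct k bs w - e k * (z \<bullet> \<Gamma> k w))"
          by (simp add: right_diff_distrib power2_eq_square inner_commute)
        ultimately have h2: "\<bar>e k * fluct k (bs + e k *\<^sub>R z) w - e k * fluct k bs w - (e k)\<^sup>2 * (\<Gamma> k w \<bullet> z)\<bar> \<le> a * (e k)\<^sup>2"
          unfolding eq abs_mult abs_of_pos[OF ek] by (simp add: power2_eq_square mult_ac)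
        have q: "(e k)\<^sup>2 * quad A (\<Gamma> k w) z = (e k)\<^sup>2 * (\<Gamma> k w \<bullet> z) + (e k)\<^sup>2 * (1/2 * (z \<bullet> (A *v z)))"
          by (simp add: quad_def distrib_left)
        show ?thesis unfolding q using h1 h2 by linarith
      qed
      have "bs + e k *\<^sub>R \<phi> \<in> pacing_box" using elim(3) n\<phi> \<phi>c by blast
      from min(2)[OF this] ap[OF nu] ap[OF n\<phi>] have "(e k)\<^sup>2 * quad A (\<Gamma> k w) u \<le> (e k)\<^sup>2 * quad A (\<Gamma> k w) \<phi> + 4 * a * (e k)\<^sup>2"
        unfolding beta by linarith
      then have "(e k)\<^sup>2 * quad A (\<Gamma> k w) u \<le> (e k)\<^sup>2 * (quad A (\<Gamma> k w) \<phi> + 4 * a)" by (simp add: algebra_simps)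
      then have "quad A (\<Gamma> k w) u \<le> quad A (\<Gamma> k w) (qp.sol (\<Gamma> k w)) + 4 * a"
        using ek by (simp add: \<phi>_def)
      from qp.near_minimizer_close[OF uc this, of "\<eta> / 2"] have close: "norm (u - \<phi>) \<le> \<eta> / 2"
        using \<eta> by (simp add: a_def \<phi>_def power_divide)
      have "(1 / e k) *\<^sub>R (\<beta> k w - bg k) - qp.sol (\<Gamma> k w) = (u - \<phi>) - (1 / e k) *\<^sub>R (bg k - bs)"
        by (simp add: u_def \<phi>_def algebra_simps)
      then have "norm ((1 / e k) *\<^sub>R (\<beta> k w - bg k) - qp.sol (\<Gamma> k w)) \<le> norm (u - \<phi>) + norm ((1 / e k) *\<^sub>R (bg k - bs))"
        by (metis norm_triangle_ineq4)
      also have "norm ((1 / e k) *\<^sub>R (bg k - bs)) \<le> \<eta> / 2"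
      proof -
        have "norm (bg k - bs) \<le> \<eta> / 2 * e k"
          using elim(1) \<kappa>(3) ek by (intro order_trans[OF elim(1)] mult_right_mono) auto
        then show ?thesis using ek by (simp add: divide_le_eq)
      qed
      finally show False using far close by simp
    qed
  qed
  show "\<exists>Q'. rare Q' \<and> (\<exists>R. (\<forall>\<^sub>F k in sequentially. measure_pmf.prob (W k) {w. R k w} \<le> r) \<and>
      (\<forall>\<^sub>F k in sequentially. \<forall>w\<in>set_pmf (W k). norm ((1 / e k) *\<^sub>R (\<beta> k w - bg k) - qp.sol (\<Gamma> k w)) > \<eta> \<longrightarrow> Q' k w \<or> R k w))"
  proof (intro exI conjI)
    show "rare Q'" unfolding Q'_def[abs_def] by (rule fluct_linearized[OF K(1) a])
    show "\<forall>\<^sub>F k in sequentially. measure_pmf.prob (W k) {w. R k w} \<le> r" using PR by simp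
  qed (rule key)
qed

section \<open>The proximal bootstrap\<close>

text \<open>Where the winner is clear, the subgradient at \<open>bg k\<close> is \<open>win\<close> plus the gradient of the barrier, and the
  latter does not fluctuate. So the difference is supported on near ties, and Chebyshev's inequality
  applies, with the sample held fixed.\<close>

lemma G_boot_near_\<Gamma>:
  assumes D: "subgrad_selection \<Theta> v b D" and a: "a > 0"
  shows "rare (\<lambda>k w. norm (G_boot v b D (T k) (x k) w - \<Gamma> k w) > a)"
proof -
  define n where "n = real CARD('n)"
  have n: "n > 0" by (simp add: n_def)
  \<comment> \<open>points within \<open>e k\<close> of \<open>bg k\<close> are within \<open>2 * e k\<close> of \<open>bs\<close>\<close>
  define m where "m = nat \<lceil>4 * C\<rceil>"
  have m: "4 * C \<le> real m" using C by (simp add: m_def)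
  define d where "d k y = D y (bg k) + (\<chi> i. b $ i / bg k $ i)" for k y
  have bgpos: "bg k \<in> pos_orthant" for k using bg_box[of k] by (auto simp: pacing_box_def pos_orthant_def)
  have sg: "D y (bg k) \<in> subdifferential_on pos_orthant (F_obj v b y) (bg k)" if "y \<in> space \<Theta>" for y k
    using D bgpos that unfolding subgrad_selection_def by blast
  have d_bound: "\<bar>d k y $ i\<bar> \<le> C" if y: "y \<in> space \<Theta>" for k y i
  proof -
    have "d k y \<bullet> h \<le> C" if h: "norm h = 1" for h
      unfolding d_def
    proof (rule subgradient_le[OF bgpos sg[OF y], of 1])
      fix r :: real assume r: "0 < r"
      show "top_bid v (bg k + r *\<^sub>R h) y - top_bid v (bg k) y \<le> r * C"
        using top_bid_lip[OF y, of "bg k + r *\<^sub>R h" "bg k"] r h by (simp add: mult.commute)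
    qed simp
    from this[of "axis i 1"] this[of "- axis i 1"] show ?thesis by (simp add: inner_axis abs_le_iff)
  qed
  have d_eq: "d k y = win y" if y: "y \<in> space \<Theta>" and near: "norm (bg k - bs) \<le> 1 * e k" and cw: "clear_win v bs (real m * e k) y" for k y
  proof -
    have ek: "e k > 0" by (rule e_pos)
    have lin: "top_bid v z y = z \<bullet> win y" if z: "norm (z - bg k) \<le> e k" for z
    proof (rule top_bid_linear[OF _ _ cw])
      fix i
      have "\<bar>z $ i - bs $ i\<bar> \<le> norm (z - bs)" using component_le_norm_cart[of "z - bs" i] by simp
      also have "\<dots> \<le> norm (z - bg k) + norm (bg k - bs)" using norm_triangle_ineq[of "z - bg k" "bg k - bs"] by simp
      also have "\<dots> \<le> 2 * e k" using z near by simp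
      finally have "2 * C * \<bar>z $ i - bs $ i\<bar> \<le> 2 * C * (2 * e k)" using C by (intro mult_left_mono) auto
      also have "\<dots> = (4 * C) * e k" by simp
      also have "\<dots> \<le> real m * e k" using m ek by (intro mult_right_mono) auto
      finally show "2 * C * \<bar>z $ i - bs $ i\<bar> \<le> real m * e k" .
    qed (use y ek in \<open>auto intro: v_nonneg v_le\<close>)
    have "d k y \<bullet> h \<le> win y \<bullet> h" for h
      unfolding d_def
    proof (rule subgradient_le[OF bgpos sg[OF y]])
      show "e k / (norm h + 1) > 0" using ek by (simp add: add_nonneg_pos)
      fix r assume r: "0 < r" "r < e k / (norm h + 1)"
      have h1: "norm h + 1 > 0" by (simp add: add_nonneg_pos)
      have "r * norm h \<le> r * (norm h + 1)" using r by simp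
      also have "\<dots> \<le> e k" using r h1 by (simp add: less_divide_eq)
      finally have "norm ((bg k + r *\<^sub>R h) - bg k) \<le> e k" using r by simp
      from lin[OF this] lin[of "bg k"] ek show "top_bid v (bg k + r *\<^sub>R h) y - top_bid v (bg k) y \<le> r * (win y \<bullet> h)"
        by (simp add: inner_add_left inner_add_right inner_commute)
    qed
    from this[of "d k y - win y"] have "(d k y - win y) \<bullet> (d k y - win y) \<le> 0"
      by (simp add: inner_diff_left)
    then have "(d k y - win y) \<bullet> (d k y - win y) = 0" by (intro antisym) auto
    then show ?thesis by simp
  qed
  have diff: "(G_boot v b D (T k) (x k) w - \<Gamma> k w) $ i = boot_fluct (T k) (x k) (\<lambda>y. d k y $ i - win y $ i) w"
    if w: "w \<in> set_pmf (W k)" for k w i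
  proof -
    have "boot_fluct (T k) (x k) (\<lambda>y. D y (bg k)) w = boot_fluct (T k) (x k) (\<lambda>y. d k y - (\<chi> i. b $ i / bg k $ i)) w"
      by (simp add: d_def)
    also have "\<dots> = boot_fluct (T k) (x k) (d k) w"
      unfolding boot_fluct_diff boot_fluct_const[OF T_pos w] by simp
    finally have "G_boot v b D (T k) (x k) w = boot_fluct (T k) (x k) (d k) w"
      by (simp add: G_boot_def boot_fluct_def)
    then show ?thesis by (simp add: boot_fluct_nth boot_fluct_diff)
  qed
  have comp: "rare (\<lambda>k w. \<bar>boot_fluct (T k) (x k) (\<lambda>y. d k y $ i - win y $ i) w\<bar> > a / n)" for i
  proof (rule rare_bounded)
    have "(\<lambda>k. (2 * C)\<^sup>2 * tie_frac k m / (a / n)\<^sup>2) \<longlonglongrightarrow> (2 * C)\<^sup>2 * 0 / (a / n)\<^sup>2"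
      using a n by (intro tendsto_intros tie_frac_lim) auto
    then show "(\<lambda>k. (2 * C)\<^sup>2 * tie_frac k m / (a / n)\<^sup>2) \<longlonglongrightarrow> 0" by simp
    from bg_consistent[of 1]
    have "\<forall>\<^sub>F k in sequentially. norm (bg k - bs) \<le> 1 * e k" by simp
    then show "\<forall>\<^sub>F k in sequentially. measure_pmf.prob (W k) {w. \<bar>boot_fluct (T k) (x k) (\<lambda>y. d k y $ i - win y $ i) w\<bar> > a / n}
      \<le> (2 * C)\<^sup>2 * tie_frac k m / (a / n)\<^sup>2"
    proof eventually_elim
      case (elim k)
      have "measure_pmf.prob (W k) {w. \<bar>boot_fluct (T k) (x k) (\<lambda>y. d k y $ i - win y $ i) w\<bar> > a / n}
        \<le> emp (T k) (x k) (\<lambda>y. (d k y $ i - win y $ i)\<^sup>2) / (a / n)\<^sup>2"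
        using a n by (intro boot_fluct_chebyshev T_pos) auto
      also have "\<dots> \<le> (2 * C)\<^sup>2 * tie_frac k m / (a / n)\<^sup>2"
      proof (intro divide_right_mono emp_sq_near_ties)
        fix \<tau> assume \<tau>: "\<tau> < T k"
        show "\<bar>d k (x k \<tau>) $ i - win (x k \<tau>) $ i\<bar> \<le> 2 * C"
          using d_bound[OF x_space[OF \<tau>], of k i] win_abs[OF x_space[OF \<tau>], of i] by linarith
        assume "clear_win v bs (real m * e k) (x k \<tau>)"
        then show "d k (x k \<tau>) $ i - win (x k \<tau>) $ i = 0" using d_eq[OF x_space[OF \<tau>] elim] by simp
      qed simp
      finally show ?case .
    qed
  qed
  have "rare (\<lambda>k w. \<exists>i\<in>UNIV. \<bar>boot_fluct (T k) (x k) (\<lambda>y. d k y $ i - win y $ i) w\<bar> > a / n)"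
    by (intro rare_bex comp) simp
  then show ?thesis
  proof (rule rare_mono, intro always_eventually allI ballI impI)
    fix k w assume w: "w \<in> set_pmf (W k)" and far: "a < norm (G_boot v b D (T k) (x k) w - \<Gamma> k w)"
    show "\<exists>i\<in>UNIV. \<bar>boot_fluct (T k) (x k) (\<lambda>y. d k y $ i - win y $ i) w\<bar> > a / n"
    proof (rule ccontr)
      assume "\<not> ?thesis"
      then have "\<bar>(G_boot v b D (T k) (x k) w - \<Gamma> k w) $ i\<bar> \<le> a / n" for i unfolding diff[OF w] by (auto simp: not_less)
      from norm_le_card[OF this] show False using far n by (simp add: n_def)
    qed
  qed
qed

text \<open>For large \<open>k\<close> the estimated Hessian is coercive, which bounds the rescaled estimator by a multiple of
  \<open>norm (G_boot v b D (T k) (x k) w)\<close>. Then its objective is uniformly close to \<open>quad A (\<Gamma> k w)\<close>, recentred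
  from \<open>bg k\<close> to \<open>bs\<close>, and the estimator is again a near-minimizer over the cone.\<close>

theorem pr_minimizer_near_sol:
  assumes D: "subgrad_selection \<Theta> v b D"
    and Hh: "(\<lambda>k. hess_hat v b (T k) (\<delta> k) (x k)) \<longlonglongrightarrow> A"
    and opt: "\<And>k w. w \<in> set_pmf (W k) \<Longrightarrow>
      is_arg_min (pr_obj v b D (\<delta> k) (e k) (T k) (x k) w) (\<lambda>\<beta>. \<beta> \<in> closed_box) (\<beta> k w)"
    and \<eta>: "\<eta> > 0"
  shows "rare (\<lambda>k w. norm ((1 / e k) *\<^sub>R (\<beta> k w - bg k) - qp.sol (\<Gamma> k w)) > \<eta>)"
proof (rule rare_if_tight)
  fix r :: real assume r: "r > 0"
  obtain L where L: "L > 0" "\<And>k. measure_pmf.prob (W k) {w. norm (\<Gamma> k w) > L} \<le> r"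
    using \<Gamma>_tight[OF r] by auto
  define n where "n = real CARD('n)"
  have n: "n > 0" by (simp add: n_def)
  define \<Lambda> where "\<Lambda> = n * norm A"
  have \<Lambda>: "\<Lambda> \<ge> 0" using n by (simp add: \<Lambda>_def)
  define K where "K = 4 * (L + 1) / b0 + 2 / b0 * L + L + 1"
  have K: "K > 0" "4 * (L + 1) / b0 \<le> K" "2 / b0 * L + 1 \<le> K" "L \<le> K" using L(1) b0(1) by (auto simp: K_def add_pos_nonneg)
  \<comment> \<open>\<open>a * c\<close> bounds the distance of the objective from \<open>quad A (\<Gamma> k w)\<close> on the ball of radius \<open>K\<close>, if \<open>\<Gamma>\<close>, the
     Hessian and the centre are each known up to \<open>a\<close>\<close>
  define c where "c = 2 * K + K\<^sup>2 + \<Lambda> * K + \<Lambda> + 1"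
  have c: "c > 0" using K(1) \<Lambda> by (simp add: c_def add_nonneg_pos)
  define a where "a = min (min 1 (\<eta> / 2)) (min (b0 / 2) (b0 * \<eta>\<^sup>2 / (32 * c)))"
  have a: "a > 0" "a \<le> 1" "a \<le> \<eta> / 2" "a \<le> b0 / 2" "a \<le> b0 * \<eta>\<^sup>2 / (32 * c)" using \<eta> b0(1) c by (auto simp: a_def)
  have ac: "32 * (a * c) \<le> b0 * \<eta>\<^sup>2" using a(5) c by (simp add: le_divide_eq mult_ac)
  let ?G = "\<lambda>k w. G_boot v b D (T k) (x k) w" and ?H = "\<lambda>k. hess_hat v b (T k) (\<delta> k) (x k)"
  have "(\<lambda>k. n * norm (?H k - A)) \<longlonglongrightarrow> n * 0"
    using Hh by (intro tendsto_mult tendsto_const) (simp add: tendsto_norm_zero_iff LIM_zero_iff)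
  then have "\<forall>\<^sub>F k in sequentially. n * norm (?H k - A) < a" using a(1) by (intro order_tendstoD(2)) auto
  then have key: "\<forall>\<^sub>F k in sequentially. \<forall>w\<in>set_pmf (W k). norm ((1 / e k) *\<^sub>R (\<beta> k w - bg k) - qp.sol (\<Gamma> k w)) > \<eta> \<longrightarrow>
      norm (?G k w - \<Gamma> k w) > a \<or> norm (\<Gamma> k w) > L"
    using bg_consistent[OF a(1)] cone_feasible[OF less_imp_le[OF K(1)]]
  proof eventually_elim
    case (elim k)
    have ek: "e k > 0" by (rule e_pos)
    show ?case
    proof (intro ballI impI, rule ccontr)
      fix w assume w: "w \<in> set_pmf (W k)" and far: "\<eta> < norm ((1 / e k) *\<^sub>R (\<beta> k w - bg k) - qp.sol (\<Gamma> k w))"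
        and no: "\<not> (norm (?G k w - \<Gamma> k w) > a \<or> norm (\<Gamma> k w) > L)"
      define \<phi> where "\<phi> = qp.sol (\<Gamma> k w)"
      define z where "z = (1 / e k) *\<^sub>R (bg k - bs)"
      define h where "h = (1 / e k) *\<^sub>R (\<beta> k w - bg k)"
      define q where "q h = ?G k w \<bullet> h + 1/2 * (h \<bullet> (?H k *v h))" for h
      have nz: "norm z \<le> a" using elim(2) ek by (simp add: z_def divide_le_eq)
      have Gb: "norm (\<Gamma> k w) \<le> L" and Gd: "norm (?G k w - \<Gamma> k w) \<le> a" using no by auto
      have Hd: "norm ((?H k - A) *v h) \<le> a * norm h" for h
      proof -
        have "norm ((?H k - A) *v h) \<le> n * norm (?H k - A) * norm h" unfolding n_def by (rule norm_matrix_vector_le)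
        also have "\<dots> \<le> a * norm h" using elim(1) by (intro mult_right_mono) auto
        finally show ?thesis .
      qed
      have Ab: "norm (A *v h) \<le> \<Lambda> * norm h" for h unfolding \<Lambda>_def n_def by (rule norm_matrix_vector_le)
      have obj: "pr_obj v b D (\<delta> k) (e k) (T k) (x k) w (bg k + e k *\<^sub>R h) = (e k)\<^sup>2 * q h" for h
        by (simp add: pr_obj_def q_def sqnorm_def matrix_vector_mult_scaleR power2_eq_square algebra_simps)
      have beta: "bg k + e k *\<^sub>R h = \<beta> k w" using ek by (simp add: h_def)
      have box: "\<beta> k w \<in> closed_box" and min: "\<And>y. bg k + e k *\<^sub>R y \<in> closed_box \<Longrightarrow> q h \<le> q y"
      proof -
        have *: "\<beta> k w \<in> closed_box" "\<And>y. y \<in> closed_box \<Longrightarrow> pr_obj v b D (\<delta> k) (e k) (T k) (x k) w (\<beta> k w) \<le> pr_obj v b D (\<delta> k) (e k) (T k) (x k) w y"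
          using opt[OF w] by (auto simp: is_arg_min_linorder)
        show "\<beta> k w \<in> closed_box" by (rule *)
        fix y assume "bg k + e k *\<^sub>R y \<in> closed_box"
        from *(2)[OF this] show "q h \<le> q y" unfolding beta[symmetric] obj using ek by simp
      qed
      have pc: "pacing_box \<subseteq> (closed_box :: (real^'n) set)" by (auto simp: pacing_box_def closed_box_def less_imp_le)
      have "q h \<le> q 0" using bg_box[of k] pc by (intro min) auto
      then have q0: "q h \<le> 0" by (simp add: q_def)
      have nh: "norm h \<le> K"
      proof -
        have "h \<bullet> (?H k *v h) = h \<bullet> (A *v h) + h \<bullet> ((?H k - A) *v h)"
          by (simp add: matrix_vector_mult_diff_rdistrib inner_diff_right)
        moreover have "\<bar>h \<bullet> ((?H k - A) *v h)\<bar> \<le> norm h * (a * norm h)"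
          by (rule order_trans[OF Cauchy_Schwarz_ineq2 mult_left_mono[OF Hd]]) simp
        moreover have "a * (norm h)\<^sup>2 \<le> b0 / 2 * (norm h)\<^sup>2" using a by (intro mult_right_mono) auto
        ultimately have 1: "b0 / 2 * (norm h)\<^sup>2 \<le> h \<bullet> (?H k *v h)" using A_coercive[of h]
          by (simp add: power2_eq_square mult_ac)
        have "\<bar>?G k w \<bullet> h\<bar> \<le> norm (?G k w) * norm h" by (rule Cauchy_Schwarz_ineq2)
        also have "\<dots> \<le> (L + 1) * norm h"
          using Gb Gd a(2) norm_triangle_ineq[of "?G k w - \<Gamma> k w" "\<Gamma> k w"] by (intro mult_right_mono) auto
        finally have 2: "- (?G k w \<bullet> h) \<le> (L + 1) * norm h" by simp
        have "b0 / 4 * (norm h)\<^sup>2 \<le> (L + 1) * norm h" using 1 2 q0 by (simp add: q_def)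
        then have "norm h * (b0 / 4 * norm h) \<le> norm h * (L + 1)" by (simp add: power2_eq_square mult_ac)
        then have "b0 / 4 * norm h \<le> L + 1" using L(1) by (cases "h = 0") auto
        then have "norm h \<le> 4 * (L + 1) / b0" using b0(1) by (simp add: field_simps)
        then show ?thesis using K(2) by simp
      qed
      have ap: "\<bar>q y - quad A (\<Gamma> k w) (y + z)\<bar> \<le> a * c" if y: "norm y \<le> K" for y
      proof -
        have eq: "q y - quad A (\<Gamma> k w) (y + z) = (?G k w - \<Gamma> k w) \<bullet> y - \<Gamma> k w \<bullet> z + 1/2 * (y \<bullet> ((?H k - A) *v y)) - y \<bullet> (A *v z) - 1/2 * (z \<bullet> (A *v z))"
          using A_sym[of z y]
          by (simp add: q_def quad_def matrix_vector_mult_diff_rdistrib matrix_vector_right_distrib inner_add_left inner_add_right inner_diff_left inner_diff_right algebra_simps)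
        have "\<bar>(?G k w - \<Gamma> k w) \<bullet> y\<bar> \<le> a * K"
          by (rule order_trans[OF Cauchy_Schwarz_ineq2]) (intro mult_mono, use Gd y a in auto)
        moreover have "\<bar>\<Gamma> k w \<bullet> z\<bar> \<le> K * a"
          by (rule order_trans[OF Cauchy_Schwarz_ineq2]) (intro mult_mono, use Gb nz K in auto)
        moreover have "\<bar>y \<bullet> ((?H k - A) *v y)\<bar> \<le> K * (a * K)"
        proof (rule order_trans[OF Cauchy_Schwarz_ineq2], intro mult_mono)
          have "norm ((?H k - A) *v y) \<le> a * norm y" by (rule Hd)
          also have "\<dots> \<le> a * K" using y a by (intro mult_left_mono) auto
          finally show "norm ((?H k - A) *v y) \<le> a * K" .
        qed (use y K in auto)
        moreover have Az: "norm (A *v z) \<le> \<Lambda> * a" by (rule order_trans[OF Ab mult_left_mono[OF nz \<Lambda>]])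
        then have "\<bar>y \<bullet> (A *v z)\<bar> \<le> K * (\<Lambda> * a)"
          by (intro order_trans[OF Cauchy_Schwarz_ineq2] mult_mono) (use y K in auto)
        moreover have "\<bar>z \<bullet> (A *v z)\<bar> \<le> 1 * (\<Lambda> * a)"
          using nz a(2) Az by (intro order_trans[OF Cauchy_Schwarz_ineq2] mult_mono) auto
        moreover have "a * c = a * K + K * a + K * (a * K) + K * (\<Lambda> * a) + \<Lambda> * a + a" by (simp add: c_def power2_eq_square algebra_simps)
        moreover have "0 \<le> K * (a * K)" "0 \<le> \<Lambda> * a" using K a \<Lambda> by auto
        ultimately show ?thesis unfolding eq using a(1) by linarith
      qed
      have "norm \<phi> \<le> 2 / b0 * norm (\<Gamma> k w)" unfolding \<phi>_def by (rule qp.norm_sol)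
      also have "\<dots> \<le> 2 / b0 * L" using Gb b0(1) by (intro mult_left_mono) auto
      finally have n\<phi>: "norm \<phi> \<le> 2 / b0 * L" .
      have \<phi>c: "\<phi> \<in> limit_cone \<Theta> s v b" unfolding \<phi>_def by (rule qp.sol_minimizes)
      have "norm (\<phi> - z) \<le> norm \<phi> + norm z" by (rule norm_triangle_ineq4)
      then have npz: "norm (\<phi> - z) \<le> K" using n\<phi> nz a(2) K(3) by linarith
      have "bs + e k *\<^sub>R \<phi> \<in> pacing_box" using elim(3) n\<phi> K(3) \<phi>c by auto
      moreover have "bg k + e k *\<^sub>R (\<phi> - z) = bs + e k *\<^sub>R \<phi>" using ek by (simp add: z_def algebra_simps)
      ultimately have "bg k + e k *\<^sub>R (\<phi> - z) \<in> closed_box" using pc by auto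
      then have "q h \<le> q (\<phi> - z)" by (rule min)
      then have le: "quad A (\<Gamma> k w) (h + z) \<le> quad A (\<Gamma> k w) (qp.sol (\<Gamma> k w)) + 2 * (a * c)"
        using ap[OF nh] ap[OF npz] by (simp add: \<phi>_def)
      have "bs + e k *\<^sub>R (h + z) = \<beta> k w" using ek by (simp add: h_def z_def algebra_simps)
      then have hc: "h + z \<in> limit_cone \<Theta> s v b" using box by (intro feasible_cone[of k]) (simp add: closed_box_def)
      have "norm (h + z - qp.sol (\<Gamma> k w)) \<le> \<eta> / 2"
        by (rule qp.near_minimizer_close[OF hc le]) (use ac \<eta> in \<open>auto simp: power_divide\<close>)
      moreover have "norm (h - \<phi>) \<le> norm (h + z - \<phi>) + norm z"
        using norm_triangle_ineq4[of "h + z - \<phi>" z] by simp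
      ultimately show False using far nz a(3) by (simp add: h_def \<phi>_def)
    qed
  qed
  show "\<exists>Q'. rare Q' \<and> (\<exists>R. (\<forall>\<^sub>F k in sequentially. measure_pmf.prob (W k) {w. R k w} \<le> r) \<and>
      (\<forall>\<^sub>F k in sequentially. \<forall>w\<in>set_pmf (W k). norm ((1 / e k) *\<^sub>R (\<beta> k w - bg k) - qp.sol (\<Gamma> k w)) > \<eta> \<longrightarrow> Q' k w \<or> R k w))"
  proof (intro exI conjI)
    show "rare (\<lambda>k w. norm (?G k w - \<Gamma> k w) > a)" by (rule G_boot_near_\<Gamma>[OF D a(1)])
    show "\<forall>\<^sub>F k in sequentially. measure_pmf.prob (W k) {w. norm (\<Gamma> k w) > L} \<le> r" using L(2) by simp
  qed (rule key)
qed

end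

section \<open>Conditional laws given independent data\<close>

text \<open>Independence makes the joint law a product, and Fubini's theorem integrates out \<open>Y\<close> with \<open>X\<close> fixed.\<close>

lemma regular_cond_distr_of_independent:
  fixes M :: "'w measure" and N :: "'x measure" and p :: "'y pmf" and g :: "'x \<Rightarrow> 'y \<Rightarrow> real^'n"
  assumes M: "prob_space M" and X[measurable]: "X \<in> measurable M N" and Y[measurable]: "Y \<in> measurable M (count_space UNIV)"
    and Y_law: "distr M (count_space UNIV) Y = measure_pmf p"
    and indep: "prob_space.indep_set M (sets (vimage_algebra (space M) X N)) (sets (vimage_algebra (space M) Y (count_space UNIV)))"
    and g[measurable]: "case_prod g \<in> borel_measurable (N \<Otimes>\<^sub>M count_space UNIV)"
  shows "regular_cond_distr M (vimage_algebra (space M) X N) (\<lambda>\<omega>. g (X \<omega>) (Y \<omega>)) (\<lambda>\<omega>. distr (measure_pmf p) borel (g (X \<omega>)))"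
proof -
  interpret prob_space M by fact
  define F where "F = vimage_algebra (space M) X N"
  have Xs: "X \<in> space M \<rightarrow> space N" using measurable_space[OF X] by auto
  have XF[measurable]: "X \<in> measurable F N" unfolding F_def by (rule measurable_vimage_algebra1[OF Xs])
  have spF: "space F = space M" by (simp add: F_def)
  have sF: "sets F = {X -` A \<inter> space M | A. A \<in> sets N}" unfolding F_def by (rule sets_vimage_algebra2[OF Xs])
  have sub: "subalgebra M F" unfolding subalgebra_def using spF sF measurable_sets[OF X] by auto
  have gs[measurable]: "g x \<in> borel_measurable (measure_pmf p)" for x by simp
  have gm: "(\<lambda>\<omega>. g (X \<omega>) (Y \<omega>)) \<in> borel_measurable M"
  proof -
    have "(\<lambda>\<omega>. (X \<omega>, Y \<omega>)) \<in> measurable M (N \<Otimes>\<^sub>M count_space UNIV)" by measurable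
    from measurable_compose[OF this g] show ?thesis by simp
  qed
  have g'[measurable]: "case_prod g \<in> borel_measurable (N \<Otimes>\<^sub>M measure_pmf p)"
  proof -
    have eq: "sets (N \<Otimes>\<^sub>M measure_pmf p) = sets (N \<Otimes>\<^sub>M count_space UNIV)"
      by (intro sets_pair_measure_cong) auto
    show ?thesis using g by (simp add: measurable_cong_sets[OF eq refl])
  qed
  define K0 where "K0 x = distr (measure_pmf p) borel (g x)" for x
  have K0_prob: "prob_space (K0 x)" for x unfolding K0_def by (rule measure_pmf.prob_space_distr) simp
  have K0_sets: "sets (K0 x) = sets borel" for x by (simp add: K0_def)
  have K0: "K0 \<in> measurable N (prob_algebra borel)"
  proof (rule measurable_prob_algebraI)
    show "K0 \<in> measurable N (subprob_algebra borel)"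
    proof (rule measurable_subprob_algebra)
      fix A :: "(real^'n) set" assume A[measurable]: "A \<in> sets borel"
      have "emeasure (K0 x) A = (\<integral>\<^sup>+w. indicator A (g x w) \<partial>measure_pmf p)" for x
        unfolding K0_def by (subst emeasure_distr) (auto simp: nn_integral_indicator[symmetric] indicator_def intro!: nn_integral_cong simp del: nn_integral_indicator)
      moreover have "(\<lambda>x. \<integral>\<^sup>+w. indicator A (g x w) \<partial>measure_pmf p) \<in> borel_measurable N"
        by (rule measure_pmf.borel_measurable_nn_integral) measurable
      ultimately show "(\<lambda>x. emeasure (K0 x) A) \<in> borel_measurable N" by simp
    qed (auto simp: K0_sets intro: prob_space_imp_subprob_space K0_prob)
  qed (rule K0_prob)
  then have KF: "(\<lambda>\<omega>. K0 (X \<omega>)) \<in> measurable F (prob_algebra borel)" by measurable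
  have joint: "distr M (N \<Otimes>\<^sub>M count_space UNIV) (\<lambda>\<omega>. (X \<omega>, Y \<omega>)) = distr M N X \<Otimes>\<^sub>M measure_pmf p"
  proof -
    have "distr M N X \<Otimes>\<^sub>M distr M (count_space UNIV) Y = distr M (N \<Otimes>\<^sub>M count_space UNIV) (\<lambda>\<omega>. (X \<omega>, Y \<omega>))"
    proof (rule pair_measure_eqI)
      show "sigma_finite_measure (distr M N X)"
        by (intro prob_space_imp_sigma_finite prob_space_distr X)
      show "sigma_finite_measure (distr M (count_space UNIV) Y)"
        by (intro prob_space_imp_sigma_finite prob_space_distr Y)
      fix A B assume "A \<in> sets (distr M N X)" and "B \<in> sets (distr M (count_space UNIV) Y)"
      then have A[measurable]: "A \<in> sets N" and B[measurable]: "B \<in> sets (count_space UNIV)" by auto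
      have "prob ((X -` A \<inter> space M) \<inter> (Y -` B \<inter> space M)) = prob (X -` A \<inter> space M) * prob (Y -` B \<inter> space M)"
        by (rule indep_setD[OF indep]) (use A in \<open>auto intro!: in_vimage_algebra\<close>)
      moreover have "(\<lambda>\<omega>. (X \<omega>, Y \<omega>)) -` (A \<times> B) \<inter> space M = (X -` A \<inter> space M) \<inter> (Y -` B \<inter> space M)" by auto
      ultimately show "emeasure (distr M N X) A * emeasure (distr M (count_space UNIV) Y) B
          = emeasure (distr M (N \<Otimes>\<^sub>M count_space UNIV) (\<lambda>\<omega>. (X \<omega>, Y \<omega>))) (A \<times> B)"
        by (simp add: emeasure_distr emeasure_eq_measure ennreal_mult)
    qed (unfold sets_distr, intro sets_pair_measure_cong, auto)
    then show ?thesis unfolding Y_law by simp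
  qed
  interpret DX: prob_space "distr M N X" by (rule prob_space_distr) measurable
  interpret PP: pair_prob_space "distr M N X" "measure_pmf p" ..
  interpret F: sigma_finite_subalgebra M F
    by (rule finite_measure_subalgebra_is_sigma_finite) (simp add: finite_measure_subalgebra_def finite_measure_subalgebra_axioms_def sub finite_measure_axioms)
  have cond: "AE \<omega> in M. measure (K0 (X \<omega>)) A = real_cond_exp M F (\<lambda>\<omega>'. indicator A (g (X \<omega>') (Y \<omega>'))) \<omega>"
    if A[measurable]: "A \<in> sets borel" for A
  proof -
    have m0[measurable]: "(\<lambda>x. measure (K0 x) A) \<in> borel_measurable N"
    proof -
      have "(\<lambda>x. measure (K0 x) A) = (\<lambda>x. enn2real (emeasure (K0 x) A))" by (simp add: measure_def)
      also have "\<dots> \<in> borel_measurable N"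
        using measurable_emeasure_kernel[OF measurable_prob_algebraD[OF K0] A] by measurable
      finally show ?thesis .
    qed
    have mF: "(\<lambda>\<omega>. measure (K0 (X \<omega>)) A) \<in> borel_measurable F" by measurable
    have mi: "integrable M (\<lambda>\<omega>. measure (K0 (X \<omega>)) A)"
      using prob_space.prob_le_1[OF K0_prob] by (intro integrable_const_bound[where B=1]) auto
    have fi: "integrable M (\<lambda>\<omega>'. indicator A (g (X \<omega>') (Y \<omega>')) :: real)"
      using gm by (intro integrable_const_bound[where B=1]) auto
    have "AE \<omega> in M. real_cond_exp M F (\<lambda>\<omega>'. indicator A (g (X \<omega>') (Y \<omega>'))) \<omega> = measure (K0 (X \<omega>)) A"
    proof (rule F.real_cond_exp_charact[OF _ fi mi mF])
      fix A' assume "A' \<in> sets F"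
      then obtain B where B[measurable]: "B \<in> sets N" and A': "A' = X -` B \<inter> space M" using sF by auto
      define h :: "'x \<times> 'y \<Rightarrow> real" where "h z = indicator B (fst z) * indicator A (case_prod g z)" for z
      have hm[measurable]: "h \<in> borel_measurable (N \<Otimes>\<^sub>M count_space UNIV)" unfolding h_def by measurable
      have hm'[measurable]: "h \<in> borel_measurable (distr M N X \<Otimes>\<^sub>M measure_pmf p)" unfolding h_def by measurable
      have "(\<integral>\<omega>\<in>A'. indicator A (g (X \<omega>) (Y \<omega>)) \<partial>M) = (\<integral>\<omega>. h (X \<omega>, Y \<omega>) \<partial>M)"
        unfolding set_lebesgue_integral_def by (intro Bochner_Integration.integral_cong) (auto simp: A' h_def indicator_def)
      also have "\<dots> = (\<integral>z. h z \<partial>distr M (N \<Otimes>\<^sub>M count_space UNIV) (\<lambda>\<omega>. (X \<omega>, Y \<omega>)))"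
        by (subst integral_distr) auto
      also have "\<dots> = (\<integral>x. (\<integral>y. h (x, y) \<partial>measure_pmf p) \<partial>distr M N X)"
        unfolding joint by (rule PP.integral_fst'[symmetric], rule PP.P.integrable_const_bound[where B=1]) (auto simp: h_def indicator_def)
      also have "\<dots> = (\<integral>x. indicator B x * measure (K0 x) A \<partial>distr M N X)"
      proof (intro Bochner_Integration.integral_cong refl)
        fix x
        have "(\<integral>y. h (x, y) \<partial>measure_pmf p) = indicator B x * (\<integral>y. indicator A (g x y) \<partial>measure_pmf p)"
          by (simp add: h_def)
        also have "(\<integral>y. indicator A (g x y) \<partial>measure_pmf p) = (\<integral>y. indicator (g x -` A) y \<partial>measure_pmf p :: real)"
          by (intro Bochner_Integration.integral_cong) (auto simp: indicator_def)
        also have "\<dots> = measure (K0 x) A" by (simp add: K0_def measure_distr)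
        finally show "(\<integral>y. h (x, y) \<partial>measure_pmf p) = indicator B x * measure (K0 x) A" .
      qed
      also have "\<dots> = (\<integral>\<omega>. indicator B (X \<omega>) * measure (K0 (X \<omega>)) A \<partial>M)" by (subst integral_distr) auto
      also have "\<dots> = (\<integral>\<omega>\<in>A'. measure (K0 (X \<omega>)) A \<partial>M)"
        unfolding set_lebesgue_integral_def by (intro Bochner_Integration.integral_cong) (auto simp: A' indicator_def)
      finally show "(\<integral>\<omega>\<in>A'. indicator A (g (X \<omega>) (Y \<omega>)) \<partial>M) = (\<integral>\<omega>\<in>A'. measure (K0 (X \<omega>)) A \<partial>M)" .
    qed
    then show ?thesis by eventually_elim simp
  qed
  show ?thesis
    unfolding regular_cond_distr_def F_def[symmetric] K0_def[symmetric]
    using sub gm KF cond by auto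
qed

section \<open>The observed multiplier as a statistic\<close>

context market begin

text \<open>The minimizer is unique and lies in the compact box given by \<open>pop.low\<close>.\<close>

lemma beta_gamma_measurable:
  assumes t: "t > 0"
  shows "beta_gamma v b t \<in> borel_measurable (\<Pi>\<^sub>M \<tau>\<in>{..<t}. \<Theta>)"
proof (rule unique_minimizer_measurable[where f="Ht_obj v b t" and K="cbox pop.low (\<chi> i. 1)"])
  have xs: "x \<tau> \<in> space \<Theta>" if "x \<in> space (\<Pi>\<^sub>M \<tau>\<in>{..<t}. \<Theta>)" "\<tau> < t" for x \<tau>
    using that by (auto simp: space_PiM)
  show "(\<lambda>x. Ht_obj v b t x \<beta>) \<in> borel_measurable (\<Pi>\<^sub>M \<tau>\<in>{..<t}. \<Theta>)" for \<beta>
    unfolding Ht_obj_def emp_def F_obj_top_bid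
    by (intro borel_measurable_scaleR borel_measurable_const borel_measurable_sum borel_measurable_diff
        measurable_compose[OF measurable_component_singleton top_bid_measurable] v_measurable) auto
  fix x assume x: "x \<in> space (\<Pi>\<^sub>M \<tau>\<in>{..<t}. \<Theta>)"
  have bar: "barrier (\<lambda>\<beta>. emp t x (top_bid v \<beta>)) b C b0" by (rule barrier_emp[of t x, OF t xs[OF x]])
  have am: "is_arg_min (Ht_obj v b t x) (\<lambda>\<beta>. \<beta> \<in> pacing_box) (beta_gamma v b t x)"
    by (rule beta_gamma_arg_min[of t x, OF t xs[OF x]])
  have pos: "cbox pop.low (\<chi> i. 1) \<subseteq> pos_orthant" "cbox pop.low (\<chi> i. 1) \<subseteq> pacing_box"
    using pop.low(1) by (auto simp: mem_box_cart pos_orthant_def pacing_box_def) (metis less_le_trans)+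
  show "continuous_on (cbox pop.low (\<chi> i. 1)) (Ht_obj v b t x)"
    unfolding Ht_obj_eq[OF t] by (rule continuous_on_subset[OF barrier.continuous_log_obj[OF bar] pos(1)])
  show "beta_gamma v b t x \<in> cbox pop.low (\<chi> i. 1)"
    using barrier.arg_min_in_cbox[OF bar] am unfolding Ht_obj_eq[OF t] by simp
  fix \<beta> assume \<beta>: "\<beta> \<in> cbox pop.low (\<chi> i. 1)" "\<beta> \<noteq> beta_gamma v b t x"
  have "0 < b0 / 4 * (norm (\<beta> - beta_gamma v b t x))\<^sup>2" using \<beta>(2) b0 by simp
  also have "\<dots> \<le> Ht_obj v b t x \<beta> - Ht_obj v b t x (beta_gamma v b t x)"
    using Ht_growth[of t x \<beta>, OF t xs[OF x]] \<beta>(1) pos(2) by auto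
  finally show "Ht_obj v b t x (beta_gamma v b t x) < Ht_obj v b t x \<beta>" by simp
qed simp

end

section \<open>Consistency\<close>

locale bootstrapped_market = sampled_market \<Theta> s v b C M \<theta> \<epsilon>
  for \<Theta> :: "'a measure" and s :: "'a \<Rightarrow> real" and v :: "'n::finite \<Rightarrow> 'a \<Rightarrow> real" and b :: "real^'n" and C :: real
    and M :: "'w measure" and \<theta> :: "nat \<Rightarrow> 'w \<Rightarrow> 'a" and \<epsilon> :: "nat \<Rightarrow> real" +
  fixes W :: "nat \<Rightarrow> 'w \<Rightarrow> nat \<Rightarrow> nat" and N :: "(real^'n) measure"
  assumes W_measurable: "\<And>t. t > 0 \<Longrightarrow> W t \<in> measurable M (count_space UNIV)"
    and W_law: "\<And>t. t > 0 \<Longrightarrow> distr M (count_space UNIV) (W t) = measure_pmf (boot_weights t)"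
    and W_indep: "\<And>t. t > 0 \<Longrightarrow> prob_space.indep_set M
                     (sets (data_algebra M \<Theta> \<theta> t))
                     (sets (vimage_algebra (space M) (W t) (count_space UNIV)))"
    and gaussian: "multivariate_normal 0 (grad_cov \<Theta> s v b) N"
begin

lemma sample_measurable: "sample \<theta> t \<in> measurable M (\<Pi>\<^sub>M \<tau>\<in>{..<t}. \<Theta>)"
  unfolding sample_def[abs_def] by (intro measurable_restrict \<theta>_measurable)

lemma sample_space: "\<omega> \<in> space M \<Longrightarrow> sample \<theta> t \<omega> \<in> space (\<Pi>\<^sub>M \<tau>\<in>{..<t}. \<Theta>)"
  by (rule measurable_space[OF sample_measurable])

text \<open>The common frame of both parts. The properties \<open>q j\<close> are what a particular bootstrap requires of the data
  beyond a typical sample.\<close>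

lemma bootstrap_consistent:
  assumes Bm: "\<And>t. t > 0 \<Longrightarrow> case_prod (B t) \<in> borel_measurable ((\<Pi>\<^sub>M \<tau>\<in>{..<t}. \<Theta>) \<Otimes>\<^sub>M count_space UNIV)"
    and extra: "\<And>j. outer_vanishing M (\<lambda>t \<omega>. \<not> q j t (sample \<theta> t \<omega>))"
    and near: "\<And>T x e \<eta>. typical_sequence \<Theta> s v b C T x e N \<Longrightarrow> (\<And>k. x k \<in> space (\<Pi>\<^sub>M \<tau>\<in>{..<T k}. \<Theta>)) \<Longrightarrow>
        (\<And>k. e k = \<epsilon> (T k)) \<Longrightarrow> (\<And>j::nat. \<forall>\<^sub>F k in sequentially. q j (T k) (x k)) \<Longrightarrow> \<eta> > 0 \<Longrightarrow>
        typical_sequence.rare T (\<lambda>k w. norm ((1 / e k) *\<^sub>R (B (T k) (x k) w - beta_gamma v b (T k) (x k))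
            - qp.sol (boot_fluct (T k) (x k) win w)) > \<eta>)"
  shows "consistently_estimates M (data_algebra M \<Theta> \<theta>)
          (\<lambda>t \<omega>. (1 / \<epsilon> t) *\<^sub>R (B t (sample \<theta> t \<omega>) (W t \<omega>) - beta_gamma v b t (sample \<theta> t \<omega>)))
          (J_FPPE \<Theta> s v b N)"
proof -
  define g where "g t x w = (1 / \<epsilon> t) *\<^sub>R (B t x w - beta_gamma v b t x)" for t x w
  define K where "K t \<omega> = distr (measure_pmf (boot_weights t)) borel (g t (sample \<theta> t \<omega>))" for t \<omega>
  have reg: "regular_cond_distr M (data_algebra M \<Theta> \<theta> t) (\<lambda>\<omega>. g t (sample \<theta> t \<omega>) (W t \<omega>)) (K t)" if t: "t > 0" for t
    unfolding K_def[abs_def] data_algebra_def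
  proof (rule regular_cond_distr_of_independent[OF M sample_measurable W_measurable[OF t] W_law[OF t] W_indep[OF t, unfolded data_algebra_def]])
    note [measurable] = Bm[OF t] beta_gamma_measurable[OF t]
    have "(\<lambda>z. (1 / \<epsilon> t) *\<^sub>R (case_prod (B t) z - beta_gamma v b t (fst z))) \<in> borel_measurable ((\<Pi>\<^sub>M \<tau>\<in>{..<t}. \<Theta>) \<Otimes>\<^sub>M count_space UNIV)"
      by measurable
    then show "case_prod (g t) \<in> borel_measurable ((\<Pi>\<^sub>M \<tau>\<in>{..<t}. \<Theta>) \<Otimes>\<^sub>M count_space UNIV)"
      by (simp add: g_def case_prod_unfold)
  qed
  define p where "p m t \<omega> \<longleftrightarrow> typical_sample v bs P mean_bid (fst m) (snd m) (\<epsilon> t) t (sample \<theta> t \<omega>) \<and> q (snd m) t (sample \<theta> t \<omega>)"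
    for m :: "nat \<times> nat" and t \<omega>
  have "tendsto_in_prob M (\<lambda>t \<omega>. SUP f\<in>BL1. \<bar>(\<integral>x. f x \<partial>K t \<omega>) - (\<integral>x. f x \<partial>J_FPPE \<Theta> s v b N)\<bar>) 0"
  proof (rule tendsto_in_prob_by_sequences[where p=p])
    fix m
    show "outer_vanishing M (\<lambda>t \<omega>. \<not> p m t \<omega>)"
      by (rule outer_vanishing_mono[OF outer_vanishing_disj[OF typical_samples[of "fst m" "snd m"] extra[of "snd m"]]])
        (auto simp: p_def)
  next
    fix r :: "nat \<Rightarrow> nat" and \<omega> :: "nat \<Rightarrow> 'w"
    assume r: "strict_mono r" and \<omega>: "\<And>k. \<omega> k \<in> space M" and ev: "\<And>m. \<forall>\<^sub>F k in sequentially. p m (r k) (\<omega> k)"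
    \<comment> \<open>the first index is dropped because \<open>r 0\<close> may be an empty sample\<close>
    define T where "T k = r (Suc k)" for k
    define x where "x k = sample \<theta> (T k) (\<omega> (Suc k))" for k
    define e where "e k = \<epsilon> (T k)" for k
    have T_pos: "T k > 0" for k using strict_monoD[OF r, of 0 "Suc k"] by (simp add: T_def)
    have T_lim: "filterlim T at_top sequentially"
      unfolding T_def[abs_def] using filterlim_subseq[OF r] filterlim_Suc by (rule filterlim_compose)
    have ev': "\<forall>\<^sub>F k in sequentially. p m (T k) (\<omega> (Suc k))" for m
      using ev[of m] unfolding T_def by (subst eventually_sequentially_Suc)
    have xs: "x k \<in> space (\<Pi>\<^sub>M \<tau>\<in>{..<T k}. \<Theta>)" for k unfolding x_def by (rule sample_space[OF \<omega>])
    have ts: "typical_sequence \<Theta> s v b C T x e N"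
    proof
      show "e \<longlonglongrightarrow> 0" unfolding e_def[abs_def] by (rule filterlim_compose[OF eps_zero T_lim])
      show "\<forall>\<^sub>F k in sequentially. typical_sample v bs P mean_bid K' j (e k) (T k) (x k)" for K' j
        using ev'[of "(K', j)"] by eventually_elim (simp add: p_def e_def x_def)
      show "x k \<tau> \<in> space \<Theta>" if "\<tau> < T k" for k \<tau> using xs[of k] that by (auto simp: space_PiM)
    qed (use T_pos T_lim eps_pos gaussian in \<open>auto simp: e_def\<close>)
    have qs: "\<forall>\<^sub>F k in sequentially. q j (T k) (x k)" for j
      using ev'[of "(0, j)"] by eventually_elim (simp add: p_def x_def)
    interpret ts: typical_sequence \<Theta> s v b C T x e N by (rule ts)
    have "(\<lambda>k. SUP f\<in>BL1. \<bar>(\<integral>z. f z \<partial>distr (boot_weights (T k)) borel (g (T k) (x k))) - (\<integral>z. f z \<partial>J_FPPE \<Theta> s v b N)\<bar>) \<longlonglongrightarrow> 0"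
    proof (rule ts.conditional_law_converges)
      fix \<eta> :: real assume "\<eta> > 0"
      from near[OF ts xs _ qs this]
      show "ts.rare (\<lambda>k w. norm (g (T k) (x k) w - qp.sol (boot_fluct (T k) (x k) win w)) > \<eta>)"
        by (simp add: e_def g_def)
    qed
    then have "(\<lambda>k. SUP f\<in>BL1. \<bar>(\<integral>z. f z \<partial>K (r (Suc k)) (\<omega> (Suc k))) - (\<integral>z. f z \<partial>J_FPPE \<Theta> s v b N)\<bar>) \<longlonglongrightarrow> 0"
      by (simp add: K_def T_def x_def)
    then show "(\<lambda>k. SUP f\<in>BL1. \<bar>(\<integral>z. f z \<partial>K (r k) (\<omega> k)) - (\<integral>z. f z \<partial>J_FPPE \<Theta> s v b N)\<bar>) \<longlonglongrightarrow> 0"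
      by (rule LIMSEQ_imp_Suc)
  qed
  then show ?thesis
    unfolding consistently_estimates_def using reg by (intro exI[of _ K]) (auto simp: g_def)
qed

theorem numerical_bootstrap_consistent:
  assumes sel: "argmin_selection \<Theta> (\<lambda>t. nu_obj v b (\<epsilon> t) t) pacing_box B"
  shows "consistently_estimates M (data_algebra M \<Theta> \<theta>)
          (\<lambda>t \<omega>. (1 / \<epsilon> t) *\<^sub>R (B t (sample \<theta> t \<omega>) (W t \<omega>) - beta_gamma v b t (sample \<theta> t \<omega>)))
          (J_FPPE \<Theta> s v b N)"
proof (rule bootstrap_consistent[where q="\<lambda>_ _ _. True"])
  show "case_prod (B t) \<in> borel_measurable ((\<Pi>\<^sub>M \<tau>\<in>{..<t}. \<Theta>) \<Otimes>\<^sub>M count_space UNIV)" if "t > 0" for t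
    using sel that by (simp add: argmin_selection_def)
  fix T x e and \<eta> :: real
  assume ts: "typical_sequence \<Theta> s v b C T x e N" and xs: "\<And>k. x k \<in> space (\<Pi>\<^sub>M \<tau>\<in>{..<T k}. \<Theta>)"
    and e: "\<And>k. e k = \<epsilon> (T k)" and \<eta>: "\<eta> > 0"
  interpret ts: typical_sequence \<Theta> s v b C T x e N by (rule ts)
  show "ts.rare (\<lambda>k w. norm ((1 / e k) *\<^sub>R (B (T k) (x k) w - beta_gamma v b (T k) (x k)) - qp.sol (boot_fluct (T k) (x k) win w)) > \<eta>)"
  proof (rule ts.nu_minimizer_near_sol[OF _ \<eta>])
    fix k w assume "w \<in> set_pmf (boot_weights (T k))"
    then show "is_arg_min (nu_obj v b (e k) (T k) (x k) w) (\<lambda>\<beta>. \<beta> \<in> pacing_box) (B (T k) (x k) w)"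
      using sel ts.T_pos xs by (simp add: argmin_selection_def e)
  qed
qed (simp add: outer_vanishing_False)

theorem proximal_bootstrap_consistent:
  assumes D: "subgrad_selection \<Theta> v b D"
    and sel: "argmin_selection \<Theta> (\<lambda>t. pr_obj v b D (\<delta> t) (\<epsilon> t) t) closed_box B"
    and Hh: "tendsto_in_prob M (\<lambda>t \<omega>. hess_hat v b t (\<delta> t) (sample \<theta> t \<omega>)) (hess_star \<Theta> s v b)"
  shows "consistently_estimates M (data_algebra M \<Theta> \<theta>)
          (\<lambda>t \<omega>. (1 / \<epsilon> t) *\<^sub>R (B t (sample \<theta> t \<omega>) (W t \<omega>) - beta_gamma v b t (sample \<theta> t \<omega>)))
          (J_FPPE \<Theta> s v b N)"
proof (rule bootstrap_consistent[where q="\<lambda>j t x. dist (hess_hat v b t (\<delta> t) x) A \<le> 1 / Suc j"])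
  show "case_prod (B t) \<in> borel_measurable ((\<Pi>\<^sub>M \<tau>\<in>{..<t}. \<Theta>) \<Otimes>\<^sub>M count_space UNIV)" if "t > 0" for t
    using sel that by (simp add: argmin_selection_def)
  show "outer_vanishing M (\<lambda>t \<omega>. \<not> dist (hess_hat v b t (\<delta> t) (sample \<theta> t \<omega>)) A \<le> 1 / Suc j)" for j :: nat
    using Hh unfolding tendsto_in_prob_iff_outer_vanishing by (simp add: not_le del: of_nat_Suc)
  fix T x e and \<eta> :: real
  assume ts: "typical_sequence \<Theta> s v b C T x e N" and xs: "\<And>k. x k \<in> space (\<Pi>\<^sub>M \<tau>\<in>{..<T k}. \<Theta>)"
    and e: "\<And>k. e k = \<epsilon> (T k)" and \<eta>: "\<eta> > 0"
    and q: "\<And>j::nat. \<forall>\<^sub>F k in sequentially. dist (hess_hat v b (T k) (\<delta> (T k)) (x k)) A \<le> 1 / Suc j"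
  interpret ts: typical_sequence \<Theta> s v b C T x e N by (rule ts)
  have lim: "(\<lambda>k. hess_hat v b (T k) (\<delta> (T k)) (x k)) \<longlonglongrightarrow> A"
  proof (rule tendstoI)
    fix r :: real assume "r > 0"
    then obtain j :: nat where j: "1 / Suc j < r" using nat_approx_posE by metis
    from q[of j] show "\<forall>\<^sub>F k in sequentially. dist (hess_hat v b (T k) (\<delta> (T k)) (x k)) A < r"
      by eventually_elim (use j in linarith)
  qed
  show "ts.rare (\<lambda>k w. norm ((1 / e k) *\<^sub>R (B (T k) (x k) w - beta_gamma v b (T k) (x k)) - qp.sol (boot_fluct (T k) (x k) win w)) > \<eta>)"
  proof (rule ts.pr_minimizer_near_sol[OF D lim _ \<eta>])
    fix k w assume "w \<in> set_pmf (boot_weights (T k))"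
    then show "is_arg_min (pr_obj v b D (\<delta> (T k)) (e k) (T k) (x k) w) (\<lambda>\<beta>. \<beta> \<in> closed_box) (B (T k) (x k) w)"
      using sel ts.T_pos xs by (simp add: argmin_selection_def e)
  qed
qed

end

theorem theorem3:
  fixes \<Theta> :: "'a measure" and s :: "'a \<Rightarrow> real"
    and v :: "'n::finite \<Rightarrow> 'a \<Rightarrow> real" and b :: "real^'n"
    and M :: "'w measure" and \<theta> :: "nat \<Rightarrow> 'w \<Rightarrow> 'a" and W :: "nat \<Rightarrow> 'w \<Rightarrow> nat \<Rightarrow> nat"
    and \<epsilon> :: "nat \<Rightarrow> real" and N :: "(real^'n) measure"
  assumes budgets: "\<And>i. b $ i > 0"
    and v_nonneg: "\<And>i x. x \<in> space \<Theta> \<Longrightarrow> v i x \<ge> 0"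
    and v_integrable: "\<And>i. integrable \<Theta> (v i)"
    and v_bounded: "\<exists>C. \<forall>i. \<forall>x\<in>space \<Theta>. v i x \<le> C"
    and s_nonneg: "\<And>x. x \<in> space \<Theta> \<Longrightarrow> s x \<ge> 0"
    and s_bounded: "\<exists>C. \<forall>x\<in>space \<Theta>. s x \<le> C"
    and s_integrable: "integrable \<Theta> s"
    and s_total: "(\<integral>x. s x \<partial>\<Theta>) = 1"
    and M: "prob_space M"
    and iid_indep: "prob_space.indep_vars M (\<lambda>_. \<Theta>) \<theta> UNIV"
    and iid_density: "\<And>\<tau>. distributed M \<Theta> (\<theta> \<tau>) (\<lambda>x. ennreal (s x))"
    and W_measurable: "\<And>t. t > 0 \<Longrightarrow> W t \<in> measurable M (count_space UNIV)"
    and W_law: "\<And>t. t > 0 \<Longrightarrow> distr M (count_space UNIV) (W t) = measure_pmf (boot_weights t)"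
    and W_indep: "\<And>t. t > 0 \<Longrightarrow> prob_space.indep_set M
                     (sets (data_algebra M \<Theta> \<theta> t))
                     (sets (vimage_algebra (space M) (W t) (count_space UNIV)))"
    and H_smooth: "\<exists>U. open U \<and> beta_star \<Theta> s v b \<in> U \<and> twice_cont_diff_on (H_obj \<Theta> s v b) U"
    and gaussian: "multivariate_normal 0 (grad_cov \<Theta> s v b) N"
    and exhaust: "I_gt \<Theta> s v b = {}"
    and eps_pos: "\<And>t. \<epsilon> t > 0"
    and eps_zero: "\<epsilon> \<longlonglongrightarrow> 0"
    and eps_slow: "filterlim (\<lambda>t. sqrt (real t) * \<epsilon> t) at_top sequentially"
  shows
    "(\<forall>beta_nu.
        argmin_selection \<Theta> (\<lambda>t. nu_obj v b (\<epsilon> t) t) pacing_box beta_nu \<longrightarrow>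
        consistently_estimates M (data_algebra M \<Theta> \<theta>)
          (\<lambda>t \<omega>. (1 / \<epsilon> t) *\<^sub>R
             (beta_nu t (sample \<theta> t \<omega>) (W t \<omega>) - beta_gamma v b t (sample \<theta> t \<omega>)))
          (J_FPPE \<Theta> s v b N))
     \<and>
     (\<forall>D \<eta> beta_pr.
        subgrad_selection \<Theta> v b D \<longrightarrow>
        (\<forall>t. \<eta> t > 0) \<longrightarrow>
        argmin_selection \<Theta> (\<lambda>t. pr_obj v b D (\<eta> t) (\<epsilon> t) t) closed_box beta_pr \<longrightarrow>
        tendsto_in_prob M (\<lambda>t \<omega>. hess_hat v b t (\<eta> t) (sample \<theta> t \<omega>)) (hess_star \<Theta> s v b) \<longrightarrow>
        consistently_estimates M (data_algebra M \<Theta> \<theta>)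
          (\<lambda>t \<omega>. (1 / \<epsilon> t) *\<^sub>R
             (beta_pr t (sample \<theta> t \<omega>) (W t \<omega>) - beta_gamma v b t (sample \<theta> t \<omega>)))
          (J_FPPE \<Theta> s v b N))"
proof -
  obtain C0 where C0: "\<And>i x. x \<in> space \<Theta> \<Longrightarrow> v i x \<le> C0" using v_bounded by blast
  define C where "C = max 1 C0"
  have [measurable]: "\<theta> 0 \<in> measurable M \<Theta>"
    using iid_density[of 0] by (simp add: distributed_def)
  have s_prob: "prob_space (density \<Theta> (\<lambda>x. ennreal (s x)))"
    using prob_space.prob_space_distr[OF M, of "\<theta> 0" \<Theta>] distributed_distr_eq_density[OF iid_density[of 0]] by simp
  interpret bootstrapped_market \<Theta> s v b C M \<theta> \<epsilon> W N
  proof (intro bootstrapped_market.intro sampled_market.intro smooth_market.intro)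
    show "market \<Theta> s v b C"
      using budgets v_nonneg v_integrable s_nonneg s_integrable s_prob C0
      by (intro market.intro) (auto simp: C_def le_max_iff_disj)
    show "smooth_market_axioms \<Theta> s v b" using H_smooth exhaust by (simp add: smooth_market_axioms_def)
    show "sampled_market_axioms \<Theta> s M \<theta> \<epsilon>"
      using M iid_indep iid_density eps_pos eps_zero eps_slow by (simp add: sampled_market_axioms_def)
    show "bootstrapped_market_axioms \<Theta> s v b M \<theta> W N"
      using W_measurable W_law W_indep gaussian by (simp add: bootstrapped_market_axioms_def)
  qed
  show ?thesis
  proof (intro conjI allI impI)
    fix beta_nu
    assume "argmin_selection \<Theta> (\<lambda>t. nu_obj v b (\<epsilon> t) t) pacing_box beta_nu"
    then show "consistently_estimates M (data_algebra M \<Theta> \<theta>)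
          (\<lambda>t \<omega>. (1 / \<epsilon> t) *\<^sub>R
             (beta_nu t (sample \<theta> t \<omega>) (W t \<omega>) - beta_gamma v b t (sample \<theta> t \<omega>)))
          (J_FPPE \<Theta> s v b N)"
      by (rule numerical_bootstrap_consistent)
  next
    fix D and \<eta> :: "nat \<Rightarrow> real" and beta_pr
    assume "subgrad_selection \<Theta> v b D"
      and "argmin_selection \<Theta> (\<lambda>t. pr_obj v b D (\<eta> t) (\<epsilon> t) t) closed_box beta_pr"
      and "tendsto_in_prob M (\<lambda>t \<omega>. hess_hat v b t (\<eta> t) (sample \<theta> t \<omega>)) (hess_star \<Theta> s v b)"
    then show "consistently_estimates M (data_algebra M \<Theta> \<theta>)
          (\<lambda>t \<omega>. (1 / \<epsilon> t) *\<^sub>R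
             (beta_pr t (sample \<theta> t \<omega>) (W t \<omega>) - beta_gamma v b t (sample \<theta> t \<omega>)))
          (J_FPPE \<Theta> s v b N)"
      by (rule proximal_bootstrap_consistent)
  qed
qed

end
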